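(* Assume that $\mathcal{D}(A)\subset\mathcal{D}(Q^{-1/2})$, $|(-A)^{1/2}Q^{1/2}|_{\mathcal{L}_2(H)}<\infty$ and $|Q^{-1/2}(-A)^{-1}|_{\mathcal{L}(H)}<\infty$. Assume that $F\colon H\to H$ is Fréchet differentiable and that there exist $L_F,L>0$ such that $|F(u)-F(v)|\le L_F|u-v|$ for $u,v\in H$, $|F(u)|_{\dot H^1}\le L(1+|u|_{\dot H^1})$ for $u\in\dot H^1$, and $|F'(u)v|_{\dot H^2}\le L(1+|u|_{\dot H^2}^2)|v|_{\dot H^2}$ for $u,v\in\dot H^2$. Then the family $\{X_y^{\varepsilon,n}\}_{\varepsilon>0}$ of solutions of the spectral Galerkin equation satisfies a uniform large deviations principle on $C([0,T];H_n)$ with rate $1/\varepsilon^2$ and good rate function $I_{0,T}^{n,y}$, i.e.: (i) (compact level sets) for any $T>0$, $n\in\mathbb{N}^+$ and $y\in H_n$, the level set $K_{0,T}^{n,y}(\alpha):=\{z\in C([0,T];H_n): I_{0,T}^{n,y}(z)\le\alpha\}$ is compact for every $\alpha\ge 0$; (ii) (uniform lower bound) for any $T>0$, $n\in\mathbb{N}^+$, $\alpha\ge0$, $\delta>0$, $\gamma>0$ and $K>0$, there exists $\varepsilon_0>0$ such that for any $y\in H_n$ with $|y|\le K$ and any $z\in K_{0,T}^{n,y}(\alpha)$, $$\mathbb{P}\big(|X_y^{\varepsilon,n}-z|_{C([0,T];H)}<\delta\big)\ge\exp\Big(-\frac{I_{0,T}^{n,y}(z)+\gamma}{\varepsilon^2}\Big),\quad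 0<\varepsilon\le\varepsilon_0;$$ (iii) (uniform upper bound) for any $T>0$, $n\in\mathbb{N}^+$, $\alpha\ge0$, $\delta>0$, $\gamma>0$ and $K>0$, there exists $\varepsilon_0>0$ such that for any $y\in H_n$ with $|y|\le K$, $$\mathbb{P}\big(\rho^{C([0,T];H)}(X_y^{\varepsilon,n},K_{0,T}^{n,y}(\alpha))\ge\delta\big)\le\exp\Big(-\frac{\alpha-\gamma}{\varepsilon^2}\Big),\quad 0<\varepsilon\le\varepsilon_0,$$ where $\rho^{C([0,T];H)}(z,U):=\inf_{z'\in U}|z-z'|_{C([0,T];H)}$.
   Context: $H:=L^2((0,1);\mathbb{R})$ with inner product $\langle\cdot,\cdot\rangle$ and norm $|\cdot|$; $\mathcal{L}(H)$ and $\mathcal{L}_2(H)$ are the bounded and the Hilbert–Schmidt operators on $H$. $A$ is the Dirichlet Laplacian on $(0,1)$, $\mathcal{D}(A)=H_0^1\cap H^2$; $e_i(\xi)=\sqrt2\sin(i\pi\xi)$ is an orthonormal basis of $H$ with $-Ae_i=\lambda_ie_i$, $\lambda_i=\pi^2i^2$. For $\gamma\in\mathbb{R}$, $\dot H^\gamma:=\mathcal{D}((-A)^{\gamma/2})$ with norm $|u|_{\dot H^\gamma}=|(-A)^{\gamma/2}u|$. $Q$ is a self-adjoint, positive definite bounded linear operator on $H$ with $Qe_i=q_ie_i$, $q_i>0$; $Q^{-1/2}\colon Q^{1/2}(H)\to H$ is the inverse of $Q^{1/2}$ and $\mathcal{D}(Q^{-1/2})=Q^{1/2}(H)$. $W(t)=\sum_i\beta_i(t)e_i$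 is a cylindrical Wiener process on a filtered probability space $(\Omega,\mathcal{F},\mathbb{P};\{\mathcal F_t\}_{t\ge 0})$ satisfying the usual conditions, with $\beta_i$ independent standard real Brownian motions. For $n\in\mathbb{N}^+$: $H_n:=\mathrm{span}\{e_1,\dots,e_n\}$, $P_n$ is the orthogonal projection of $H$ onto $H_n$, $A_n:=P_nA$ (on $H_n$), $E_n(t):=e^{tA_n}$, $F_n:=P_nF$, $Q_n^{1/2}:=P_nQ^{1/2}$, $W_n:=P_nW$. For $y\in H_n$ and $\varepsilon>0$, $X_y^{\varepsilon,n}$ is the unique ($H_n$-valued, continuous) mild solution of $$dX_y^{\varepsilon,n}(t)=\big(A_nX_y^{\varepsilon,n}(t)+F_n(X_y^{\varepsilon,n}(t))\big)dt+\varepsilon Q_n^{1/2}dW_n(t),\ t>0,\quad X_y^{\varepsilon,n}(0)=y.$$ For $\psi\in L^2(0,T;H_n)$, $z_{0,y}^{n,\psi}\in C([0,T];H_n)$ is the unique mild solution of $\frac{dz}{dt}=A_nz+F_n(z)+Q_n^{1/2}\psi$ on $(0,T]$, $z(0)=y$. The rate function is $$I_{0,T}^{n,y}(z)=\tfrac12\inf\{|\psi|_{L^2(0,T;H)}^2:\psi\in L^2(0,T;H_n),\ z_{0,y}^{n,\psi}=z\},\quad z\in C([0,T];H_n),$$ with $\inf\emptyset=+\infty$. *)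

theory Defs
  imports "HOL-Probability.Probability"
begin

section \<open>The space \<open>H = L\<^sup>2((0,1))\<close>\<close>

text \<open>Elements of the type \<open>L2\<close> are the classes, modulo equality almost everywhere, of the
  real Lebesgue measurable square integrable functions on \<open>(0,1)\<close>.\<close>

definition unit_leb :: "real measure" where
  "unit_leb = lebesgue_on {0<..<1}"

definition sq_int :: "(real \<Rightarrow> real) \<Rightarrow> bool" where
  "sq_int f \<longleftrightarrow> f \<in> borel_measurable unit_leb \<and> integrable unit_leb (\<lambda>x. (f x)\<^sup>2)"

definition L2_rel :: "(real \<Rightarrow> real) \<Rightarrow> (real \<Rightarrow> real) \<Rightarrow> bool" where
  "L2_rel f g \<longleftrightarrow> sq_int f \<and> sq_int g \<and> (AE x in unit_leb. f x = g x)"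

lemma sq_int_zero [simp]: "sq_int (\<lambda>_. 0)"
  by (simp add: sq_int_def)

lemma sq_int_prod:
  assumes "sq_int f" "sq_int g"
  shows "integrable unit_leb (\<lambda>x. f x * g x)"
proof (rule Bochner_Integration.integrable_bound)
  show "integrable unit_leb (\<lambda>x. (f x)\<^sup>2 + (g x)\<^sup>2)"
    using assms by (simp add: sq_int_def)
  show "(\<lambda>x. f x * g x) \<in> borel_measurable unit_leb"
    using assms by (auto simp: sq_int_def)
  have "\<bar>a * b\<bar> \<le> a\<^sup>2 + b\<^sup>2" for a b :: real
  proof -
    have "0 \<le> (\<bar>a\<bar> - \<bar>b\<bar>)\<^sup>2" by simp
    then have "2 * \<bar>a * b\<bar> \<le> a\<^sup>2 + b\<^sup>2"
      by (simp add: power2_diff abs_mult)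
    then show ?thesis by simp
  qed
  then show "AE x in unit_leb. norm (f x * g x) \<le> norm ((f x)\<^sup>2 + (g x)\<^sup>2)"
    by simp
qed

lemma sq_int_add:
  assumes "sq_int f" "sq_int g"
  shows "sq_int (\<lambda>x. f x + g x)"
  using assms sq_int_prod[OF assms]
  by (auto simp: sq_int_def power2_sum mult.assoc)

lemma sq_int_scale:
  assumes "sq_int f"
  shows "sq_int (\<lambda>x. c * f x)"
  using assms by (auto simp: sq_int_def power_mult_distrib)

lemma sq_int_uminus:
  assumes "sq_int f"
  shows "sq_int (\<lambda>x. - f x)"
  using sq_int_scale[OF assms, of "-1"] by simp

lemma sq_int_diff:
  assumes "sq_int f" "sq_int g"
  shows "sq_int (\<lambda>x. f x - g x)"
  using sq_int_add[OF assms(1) sq_int_uminus[OF assms(2)]] by simp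

quotient_type L2 = "real \<Rightarrow> real" / partial: L2_rel
proof (rule part_equivpI)
  show "\<exists>f. L2_rel f f"
    by (rule exI[of _ "\<lambda>_. 0"]) (simp add: L2_rel_def)
  show "symp L2_rel"
    by (auto simp: symp_def L2_rel_def)
  show "transp L2_rel"
    unfolding transp_def L2_rel_def by auto
qed

instantiation L2 :: real_vector
begin

lift_definition zero_L2 :: L2 is "\<lambda>_. 0"
  by (simp add: L2_rel_def)

lift_definition plus_L2 :: "L2 \<Rightarrow> L2 \<Rightarrow> L2" is "\<lambda>f g x. f x + g x"
  unfolding L2_rel_def by (auto intro: sq_int_add)

lift_definition uminus_L2 :: "L2 \<Rightarrow> L2" is "\<lambda>f x. - f x"
  unfolding L2_rel_def by (auto intro: sq_int_uminus)

lift_definition minus_L2 :: "L2 \<Rightarrow> L2 \<Rightarrow> L2" is "\<lambda>f g x. f x - g x"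
  unfolding L2_rel_def by (auto intro: sq_int_diff)

lift_definition scaleR_L2 :: "real \<Rightarrow> L2 \<Rightarrow> L2" is "\<lambda>c f x. c * f x"
  unfolding L2_rel_def by (auto intro: sq_int_scale)

instance
proof
  fix u v w :: L2 and a b :: real
  show "u + v + w = u + (v + w)"
    by transfer (auto simp: L2_rel_def add.assoc intro!: sq_int_add)
  show "u + v = v + u"
    by transfer (auto simp: L2_rel_def add.commute intro!: sq_int_add)
  show "0 + u = u"
    by transfer (auto simp: L2_rel_def)
  show "- u + u = 0"
    by transfer (auto simp: L2_rel_def)
  show "u - v = u + - v"
    by transfer (auto simp: L2_rel_def intro: sq_int_diff)
  show "a *\<^sub>R (u + v) = a *\<^sub>R u + a *\<^sub>R v"
    by transfer (auto simp: L2_rel_def distrib_left intro!: sq_int_add sq_int_scale)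
  show "(a + b) *\<^sub>R u = a *\<^sub>R u + b *\<^sub>R u"
    by transfer (auto simp: L2_rel_def distrib_right intro!: sq_int_add sq_int_scale)
  show "a *\<^sub>R b *\<^sub>R u = (a * b) *\<^sub>R u"
    by transfer (auto simp: L2_rel_def mult.assoc intro!: sq_int_scale)
  show "1 *\<^sub>R u = u"
    by transfer (auto simp: L2_rel_def)
qed

end

instantiation L2 :: real_inner
begin

lift_definition inner_L2 :: "L2 \<Rightarrow> L2 \<Rightarrow> real" is "\<lambda>f g. \<integral>x. f x * g x \<partial>unit_leb"
  unfolding L2_rel_def by (rule integral_cong_AE) (auto simp: sq_int_def)

definition norm_L2 :: "L2 \<Rightarrow> real" where
  "norm_L2 u = sqrt (inner u u)"

definition dist_L2 :: "L2 \<Rightarrow> L2 \<Rightarrow> real" where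
  "dist_L2 u v = norm (u - v)"

definition sgn_L2 :: "L2 \<Rightarrow> L2" where
  "sgn_L2 u = u /\<^sub>R norm u"

definition uniformity_L2 :: "(L2 \<times> L2) filter" where
  "uniformity_L2 = (INF e\<in>{0<..}. principal {(x, y). dist x y < e})"

definition open_L2 :: "L2 set \<Rightarrow> bool" where
  "open_L2 U \<longleftrightarrow> (\<forall>x\<in>U. \<forall>\<^sub>F (x', y) in uniformity. x' = x \<longrightarrow> y \<in> U)"

instance
proof
  fix u v w :: L2 and a :: real and U :: "L2 set"
  show "dist u v = norm (u - v)" by (rule dist_L2_def)
  show "sgn u = u /\<^sub>R norm u" by (rule sgn_L2_def)
  show "uniformity = (INF e\<in>{0<..}. principal {(x, y). dist x (y::L2) < e})"
    by (rule uniformity_L2_def)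
  show "open U \<longleftrightarrow> (\<forall>x\<in>U. \<forall>\<^sub>F (x', y) in uniformity. x' = x \<longrightarrow> y \<in> U)"
    by (rule open_L2_def)
  show "inner u v = inner v u"
    by transfer (simp add: mult.commute)
  show "inner (u + v) w = inner u w + inner v w"
  proof transfer
    fix f g h assume "L2_rel f f" "L2_rel g g" "L2_rel h h"
    then have "integrable unit_leb (\<lambda>x. f x * h x)" "integrable unit_leb (\<lambda>x. g x * h x)"
      by (auto simp: L2_rel_def intro: sq_int_prod)
    then show "(\<integral>x. (f x + g x) * h x \<partial>unit_leb) =
        (\<integral>x. f x * h x \<partial>unit_leb) + (\<integral>x. g x * h x \<partial>unit_leb)"
      by (simp add: distrib_right)
  qed
  show "inner (a *\<^sub>R u) v = a * inner u v"
    by transfer (simp add: mult.assoc)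
  show "0 \<le> inner u u"
    by transfer simp
  show "inner u u = 0 \<longleftrightarrow> u = 0"
  proof transfer
    fix f assume "L2_rel f f"
    then have f: "sq_int f" by (simp add: L2_rel_def)
    then have "(\<integral>x. (f x)\<^sup>2 \<partial>unit_leb) = 0 \<longleftrightarrow> (AE x in unit_leb. (f x)\<^sup>2 = 0)"
      by (intro integral_nonneg_eq_0_iff_AE) (auto simp: sq_int_def)
    then show "(\<integral>x. f x * f x \<partial>unit_leb) = 0 \<longleftrightarrow> L2_rel f (\<lambda>_. 0)"
      using f by (simp add: L2_rel_def power2_eq_square)
  qed
  show "norm u = sqrt (inner u u)" by (rule norm_L2_def)
qed

end

text \<open>The class in \<open>L2\<close> of a square integrable function.\<close>

text \<open>The class in \<open>L2\<close> of a square integrable function.\<close>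

definition L2_class :: "(real \<Rightarrow> real) \<Rightarrow> L2" where
  "L2_class f = abs_L2 f"

lemma L2_class_eq_iff:
  assumes "sq_int f" "sq_int g"
  shows "L2_class f = L2_class g \<longleftrightarrow> (AE x in unit_leb. f x = g x)"
  unfolding L2_class_def
  using Quotient3_rel[OF Quotient3_L2, of f g] assms
  by (auto simp: L2_rel_def)

lemma inner_L2_class:
  assumes "sq_int f" "sq_int g"
  shows "inner (L2_class f) (L2_class g) = (\<integral>x. f x * g x \<partial>unit_leb)"
  unfolding L2_class_def using assms
  by (intro inner_L2.abs_eq) (auto simp: L2_rel_def eq_onp_def)

lemma scaleR_L2_class:
  assumes "sq_int f"
  shows "c *\<^sub>R L2_class f = L2_class (\<lambda>x. c * f x)"
  unfolding L2_class_def using assms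
  by (intro scaleR_L2.abs_eq) (auto simp: L2_rel_def eq_onp_def)

lemma sq_int_continuous:
  assumes "continuous_on {0..1} f"
  shows "sq_int f"
proof -
  have m: "f \<in> borel_measurable (lebesgue_on {0..1})"
    using assms by (intro continuous_imp_measurable_on_sets_lebesgue) auto
  have c2: "continuous_on {0..1} (\<lambda>x. (f x)\<^sup>2)"
    using assms by (intro continuous_intros)
  have "(\<lambda>x. (f x)\<^sup>2) absolutely_integrable_on {0..1}"
    using absolutely_integrable_continuous[of 0 1 "\<lambda>x. (f x)\<^sup>2"] c2 by (simp add: cbox_interval)
  then have "(\<lambda>x. (f x)\<^sup>2) absolutely_integrable_on {0<..<1}"
    by (rule set_integrable_subset) auto
  then have "integrable unit_leb (\<lambda>x. (f x)\<^sup>2)"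
    unfolding unit_leb_def set_integrable_def by (subst integrable_restrict_space) auto
  moreover have "f \<in> borel_measurable unit_leb"
    unfolding unit_leb_def by (rule measurable_restrict_mono[OF m]) auto
  ultimately show ?thesis by (simp add: sq_int_def)
qed

section \<open>The Dirichlet Laplacian\<close>

definition sin_basis :: "nat \<Rightarrow> L2" where
  "sin_basis i = L2_class (\<lambda>x. sqrt 2 * sin (real i * pi * x))"

definition lam :: "nat \<Rightarrow> real" where
  "lam i = pi\<^sup>2 * (real i)\<^sup>2"

text \<open>\<open>H1_deriv f g\<close>: \<open>f\<close> is the absolutely continuous representative on \<open>[0,1]\<close> of an element of the
  Sobolev space \<open>H\<^sup>1(0,1)\<close>, and \<open>g \<in> L\<^sup>2(0,1)\<close> is its weak derivative.\<close>

definition H1_deriv :: "(real \<Rightarrow> real) \<Rightarrow> (real \<Rightarrow> real) \<Rightarrow> bool" where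
  "H1_deriv f g \<longleftrightarrow> sq_int g \<and> (\<forall>x\<in>{0..1}. (g has_integral (f x - f 0)) {0..x})"

text \<open>\<open>u \<in> H\<^sup>1\<^sub>0 \<inter> H\<^sup>2\<close> with second weak derivative \<open>w\<close>; in one dimension \<open>H\<^sup>1\<^sub>0\<close> consists of the
  elements of \<open>H\<^sup>1\<close> whose continuous representative vanishes at both end points.\<close>

definition laplacian_graph :: "L2 \<Rightarrow> L2 \<Rightarrow> bool" where
  "laplacian_graph u w \<longleftrightarrow>
     (\<exists>f g h. u = L2_class f \<and> w = L2_class h \<and> H1_deriv f g \<and> H1_deriv g h \<and> f 0 = 0 \<and> f 1 = 0)"

text \<open>\<open>lap\<close> is the operator \<open>A\<close> with domain \<open>dom_A\<close>, and \<open>neg_A_inv\<close> is \<open>(-A)\<^sup>-\<^sup>1\<close>.\<close>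

definition dom_A :: "L2 set" where
  "dom_A = {u. \<exists>w. laplacian_graph u w}"

definition lap :: "L2 \<Rightarrow> L2" where
  "lap u = (THE w. laplacian_graph u w)"

definition neg_A_inv :: "L2 \<Rightarrow> L2" where
  "neg_A_inv = the_inv_into dom_A (\<lambda>u. - lap u)"

lemma H1_deriv_continuous:
  assumes "H1_deriv f g"
  shows "continuous_on {0..1} f"
proof -
  have hi: "(g has_integral (f x - f 0)) {0..x}" if "x \<in> {0..1}" for x
    using assms that by (auto simp: H1_deriv_def)
  have "g integrable_on {0..1}"
    using hi[of 1] by auto
  then have "continuous_on {0..1} (\<lambda>x. f 0 + integral {0..x} g)"
    by (intro continuous_intros indefinite_integral_continuous_1)
  moreover have "f 0 + integral {0..x} g = f x" if "x \<in> {0..1}" for x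
    using integral_unique[OF hi[OF that]] by simp
  ultimately show ?thesis
    using continuous_on_cong[of "{0..1}" "{0..1}" "\<lambda>x. f 0 + integral {0..x} g" f] by blast
qed

lemma AE_eq_continuous:
  assumes f: "continuous_on {0..1} f" and f': "continuous_on {0..1} f'"
    and ae: "AE x in unit_leb. f x = (f' x :: real)" and x: "x \<in> {0..1}"
  shows "f x = f' x"
proof -
  have "closed {x \<in> {0..1}. f x - f' x = 0}"
    using continuous_closed_preimage_constant[of "{0..1}" "\<lambda>x. f x - f' x" 0] f f'
    by (auto intro!: continuous_intros)
  moreover have "AE x \<in> {0<..<1} in lebesgue. x \<in> {x \<in> {0..1}. f x - f' x = 0}"
    using ae unfolding unit_leb_def by (subst (asm) AE_restrict_space_iff) (auto elim!: eventually_mono)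
  ultimately have *: "x \<in> {0<..<1} \<Longrightarrow> f x - f' x = 0" for x
    using mem_closed_if_AE_lebesgue_open[of "{0<..<1}" "{x \<in> {0..1}. f x - f' x = 0}" x] by auto
  have "f x - f' x = 0"
    by (rule continuous_constant_on_closure[of "{0<..<1}" "\<lambda>x. f x - f' x" 0])
      (use f f' * x in \<open>auto intro!: continuous_intros\<close>)
  then show ?thesis by simp
qed

lemma zero_primitive_imp_AE_zero:
  assumes d: "sq_int d" and z: "\<And>x. x \<in> {0..1} \<Longrightarrow> (d has_integral 0) {0..x}"
  shows "AE x in unit_leb. d x = 0"
proof -
  have int0: "integral K d = 0" if "K \<subseteq> {0..1}" "\<exists>a b. K = cbox a b" for K
  proof (cases "K = {}")
    case False
    from that obtain a b where K: "K = {a..b}" by auto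
    with False that have ab: "0 \<le> a" "a \<le> b" "b \<le> 1" by auto
    have "integral {0..a} d + integral {a..b} d = integral {0..b} d"
      using ab z[of b] by (intro Henstock_Kurzweil_Integration.integral_combine) auto
    then show ?thesis
      using integral_unique[OF z[of a]] integral_unique[OF z[of b]] ab K by simp
  qed simp
  have "((\<lambda>x. norm (d x)) has_integral 0) (cbox 0 1)"
    unfolding has_integral
  proof (intro allI impI)
    fix e :: real assume e: "e > 0"
    have di: "d integrable_on cbox 0 1"
      using z[of 1] by auto
    obtain \<gamma> where \<gamma>: "gauge \<gamma>"
      "\<And>p. p tagged_partial_division_of (cbox 0 1) \<Longrightarrow> \<gamma> fine p \<Longrightarrow>
         (\<Sum>(x,k)\<in>p. norm (measure lborel k *\<^sub>R d x - integral k d)) < e"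
      by (rule Henstock_lemma[OF di e]) (rule that)
    have fine: "norm ((\<Sum>(x,k)\<in>p. measure lborel k *\<^sub>R norm (d x)) - 0) < e"
      if p: "p tagged_division_of cbox 0 1" "\<gamma> fine p" for p
    proof -
      have K: "integral k d = 0" if "(x, k) \<in> p" for x k
        using tagged_division_ofD(3,4)[OF p(1) that] by (intro int0) auto
      have "(case z of (x, k) \<Rightarrow> measure lborel k *\<^sub>R norm (d x)) =
          (case z of (x, k) \<Rightarrow> norm (measure lborel k *\<^sub>R d x - integral k d))" if "z \<in> p" for z
      proof (cases z)
        case (Pair x k)
        then show ?thesis using K[of x k] that by (simp add: abs_mult)
      qed
      then have "(\<Sum>(x,k)\<in>p. measure lborel k *\<^sub>R norm (d x)) =
          (\<Sum>(x,k)\<in>p. norm (measure lborel k *\<^sub>R d x - integral k d))"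
        by (rule sum.cong[OF refl])
      moreover have "\<dots> < e"
        using p by (intro \<gamma>(2)) (simp_all add: tagged_division_of_def)
      moreover have "0 \<le> (\<Sum>(x,k)\<in>p. norm (measure lborel k *\<^sub>R d x - integral k d))"
        by (intro sum_nonneg) auto
      ultimately show ?thesis by simp
    qed
    show "\<exists>\<gamma>. gauge \<gamma> \<and> (\<forall>p. p tagged_division_of cbox 0 1 \<and> \<gamma> fine p \<longrightarrow>
        norm ((\<Sum>(x,k)\<in>p. measure lborel k *\<^sub>R norm (d x)) - 0) < e)"
      by (rule exI[of _ \<gamma>], intro conjI allI impI) (rule \<gamma>(1), elim conjE, rule fine)
  qed
  then have hi: "((\<lambda>x. norm (d x)) has_integral 0) {0<..<1}"
    using has_integral_Icc_iff_Ioo[of "\<lambda>x. norm (d x)" 0 0 1] by simp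
  have "integrable unit_leb (\<lambda>x. d x * 1)"
    using d by (rule sq_int_prod) (simp add: sq_int_continuous)
  then have i: "integrable unit_leb (\<lambda>x. norm (d x))"
    by simp
  then have "(\<integral>x. norm (d x) \<partial>unit_leb) = 0"
    using lebesgue_integral_eq_integral[of "{0<..<1}" "\<lambda>x. norm (d x)"] integral_unique[OF hi]
    by (simp add: unit_leb_def)
  then show ?thesis
    using integral_nonneg_eq_0_iff_AE[OF i] by simp
qed

lemma H1_deriv_unique:
  assumes "H1_deriv f g" "H1_deriv f' g'" and "\<And>x. x \<in> {0..1} \<Longrightarrow> f x = f' x"
  shows "AE x in unit_leb. g x = g' x"
proof -
  have "AE x in unit_leb. g x - g' x = 0"
  proof (rule zero_primitive_imp_AE_zero)
    show "sq_int (\<lambda>x. g x - g' x)"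
      using assms by (auto simp: H1_deriv_def intro: sq_int_diff)
    fix x :: real assume x: "x \<in> {0..1}"
    have "((\<lambda>x. g x - g' x) has_integral ((f x - f 0) - (f' x - f' 0))) {0..x}"
      using assms(1,2) x by (intro has_integral_diff) (auto simp: H1_deriv_def)
    then show "((\<lambda>x. g x - g' x) has_integral 0) {0..x}"
      using assms(3)[OF x] assms(3)[of 0] by simp
  qed
  then show ?thesis by simp
qed

lemma laplacian_graph_unique:
  assumes "laplacian_graph u w" "laplacian_graph u w'"
  shows "w = w'"
proof -
  obtain f g h where 1: "u = L2_class f" "w = L2_class h" "H1_deriv f g" "H1_deriv g h"
    using assms(1) by (auto simp: laplacian_graph_def)
  obtain f' g' h' where 2: "u = L2_class f'" "w' = L2_class h'" "H1_deriv f' g'" "H1_deriv g' h'"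
    using assms(2) by (auto simp: laplacian_graph_def)
  note cf = H1_deriv_continuous[OF 1(3)] H1_deriv_continuous[OF 2(3)]
  note cg = H1_deriv_continuous[OF 1(4)] H1_deriv_continuous[OF 2(4)]
  have "AE x in unit_leb. f x = f' x"
    using 1(1) 2(1) L2_class_eq_iff[OF cf[THEN sq_int_continuous]] by simp
  then have "f x = f' x" if "x \<in> {0..1}" for x
    using AE_eq_continuous[OF cf] that by blast
  from H1_deriv_unique[OF 1(3) 2(3) this] have "g x = g' x" if "x \<in> {0..1}" for x
    using AE_eq_continuous[OF cg] that by blast
  from H1_deriv_unique[OF 1(4) 2(4) this] show ?thesis
    using 1 2 L2_class_eq_iff[of h h'] by (auto simp: H1_deriv_def)
qed

lemma lap_eq:
  assumes "laplacian_graph u w"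
  shows "lap u = w"
  unfolding lap_def by (rule the_equality[where P = "laplacian_graph u", OF assms])
    (rule laplacian_graph_unique[OF _ assms])

lemma H1_deriv_C1:
  assumes "continuous_on {0..1} g" and "\<And>x. (f has_real_derivative g x) (at x)"
  shows "H1_deriv f g"
  unfolding H1_deriv_def
proof (intro conjI ballI)
  show "sq_int g"
    using assms(1) by (rule sq_int_continuous)
  fix x :: real assume "x \<in> {0..1}"
  moreover have "(f has_vector_derivative g t) (at t within {0..x})" for t
    using has_field_derivative_at_within[OF assms(2)]
    by (simp add: has_real_derivative_iff_has_vector_derivative)
  ultimately show "(g has_integral (f x - f 0)) {0..x}"
    by (intro fundamental_theorem_of_calculus) auto
qed

lemma lap_sin_basis:
  "sin_basis i \<in> dom_A" "lap (sin_basis i) = - lam i *\<^sub>R sin_basis i"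
proof -
  let ?f = "\<lambda>x. sqrt 2 * sin (real i * pi * x)"
  let ?g = "\<lambda>x. sqrt 2 * (real i * pi) * cos (real i * pi * x)"
  let ?h = "\<lambda>x. - lam i * ?f x"
  have "(?f has_real_derivative ?g x) (at x)" for x
    by (auto intro!: derivative_eq_intros)
  then have "H1_deriv ?f ?g"
    by (intro H1_deriv_C1 continuous_intros)
  moreover have "(?g has_real_derivative ?h x) (at x)" for x
    by (auto intro!: derivative_eq_intros simp: lam_def power2_eq_square)
  then have "H1_deriv ?g ?h"
    by (intro H1_deriv_C1 continuous_intros)
  moreover have "sq_int ?f"
    by (rule sq_int_continuous) (intro continuous_intros)
  then have "L2_class ?h = - lam i *\<^sub>R sin_basis i"
    unfolding sin_basis_def by (subst scaleR_L2_class) auto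
  moreover have "?f 0 = 0" "?f 1 = 0"
    by (simp_all add: sin_npi)
  ultimately have "laplacian_graph (sin_basis i) (- lam i *\<^sub>R sin_basis i)"
    unfolding laplacian_graph_def by (intro exI[of _ ?f] exI[of _ ?g] exI[of _ ?h]) (simp add: sin_basis_def)
  then show "sin_basis i \<in> dom_A" "lap (sin_basis i) = - lam i *\<^sub>R sin_basis i"
    by (auto simp: dom_A_def lap_eq)
qed

lemma inner_sin_basis:
  assumes "i \<ge> 1" "j \<ge> 1"
  shows "inner (sin_basis i) (sin_basis j) = (if i = j then 1 else 0)"
proof -
  let ?f = "\<lambda>i x. sqrt 2 * sin (real i * pi * x)"
  have sq: "sq_int (?f i)" for i
    by (rule sq_int_continuous) (intro continuous_intros)
  have prod: "?f i x * ?f j x = cos ((real i - real j) * pi * x) - cos ((real i + real j) * pi * x)" for x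
    by (simp add: cos_diff cos_add algebra_simps)
  have C: "((\<lambda>x. cos (of_int k * pi * x)) has_integral (if k = 0 then 1 else 0)) {0..1::real}" for k :: int
  proof (cases "k = 0")
    case False
    have "((\<lambda>x. cos (of_int k * pi * x)) has_integral
        (sin (of_int k * pi * 1) / (of_int k * pi) - sin (of_int k * pi * 0) / (of_int k * pi))) {0..1::real}"
      by (rule fundamental_theorem_of_calculus)
        (use False in \<open>auto intro!: derivative_eq_intros
          simp: has_real_derivative_iff_has_vector_derivative[symmetric]\<close>)
    then show ?thesis using False by (simp add: sin_int_times_real mult.commute)
  qed (use has_integral_const_real[of "1::real" 0 1] in auto)
  have "((\<lambda>x. ?f i x * ?f j x) has_integral ((if i = j then 1 else 0) - 0)) {0..1}"
    unfolding prod
    using has_integral_diff[OF C[of "int i - int j"] C[of "int i + int j"]] assms by simp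
  then have "((\<lambda>x. ?f i x * ?f j x) has_integral (if i = j then 1 else 0)) {0<..<1}"
    using has_integral_Icc_iff_Ioo[of "\<lambda>x. ?f i x * ?f j x"] by simp
  then show ?thesis
    using lebesgue_integral_eq_integral[of "{0<..<1}" "\<lambda>x. ?f i x * ?f j x"] sq_int_prod[OF sq sq, of i j]
    by (simp add: sin_basis_def inner_L2_class sq unit_leb_def integral_unique)
qed

text \<open>\<open>dotH \<gamma> = D((-A)\<^bsup>\<gamma>/2\<^esup>)\<close>, for \<open>\<gamma> \<ge> 0\<close>, and \<open>neg_A_pow s = (-A)\<^sup>s\<close>, through the
  eigenbasis, which is numbered from 1.\<close>

definition dotH :: "real \<Rightarrow> L2 set" where
  "dotH \<gamma> = {u. summable (\<lambda>i. lam (Suc i) powr \<gamma> * (inner u (sin_basis (Suc i)))\<^sup>2)}"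

definition neg_A_pow :: "real \<Rightarrow> L2 \<Rightarrow> L2" where
  "neg_A_pow s u = (\<Sum>i. (lam (Suc i) powr s * inner u (sin_basis (Suc i))) *\<^sub>R sin_basis (Suc i))"

definition dotH_norm :: "real \<Rightarrow> L2 \<Rightarrow> real" where
  "dotH_norm \<gamma> u = norm (neg_A_pow (\<gamma> / 2) u)"

section \<open>Operators\<close>

definition hilbert_schmidt :: "(L2 \<Rightarrow> L2) \<Rightarrow> bool" where
  "hilbert_schmidt S \<longleftrightarrow> bounded_linear S \<and> summable (\<lambda>i. (norm (S (sin_basis (Suc i))))\<^sup>2)"

definition self_adjoint :: "(L2 \<Rightarrow> L2) \<Rightarrow> bool" where
  "self_adjoint S \<longleftrightarrow> (\<forall>u v. inner (S u) v = inner u (S v))"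

text \<open>\<open>R = Q\<^bsup>1/2\<^esup>\<close>, the (unique) bounded nonnegative self-adjoint square root of \<open>Q\<close>\<close>

definition is_sqrt_op :: "(L2 \<Rightarrow> L2) \<Rightarrow> (L2 \<Rightarrow> L2) \<Rightarrow> bool" where
  "is_sqrt_op R Q \<longleftrightarrow> bounded_linear R \<and> self_adjoint R \<and> (\<forall>u. 0 \<le> inner (R u) u) \<and>
     (\<forall>u. R (R u) = Q u)"

section \<open>Spectral Galerkin objects\<close>

definition H_n :: "nat \<Rightarrow> L2 set" where
  "H_n n = span (sin_basis ` {1..n})"

definition P_n :: "nat \<Rightarrow> L2 \<Rightarrow> L2" where
  "P_n n u = (\<Sum>i=1..n. inner u (sin_basis i) *\<^sub>R sin_basis i)"

lemma P_n_in_H_n: "P_n n u \<in> H_n n"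
  unfolding P_n_def H_n_def by (intro span_sum span_scale span_base) auto

lemma P_n_orthogonal:
  assumes "v \<in> H_n n"
  shows "inner (u - P_n n u) v = 0"
  using assms unfolding H_n_def
proof (induction rule: span_induct_alt)
  case (step c x y)
  then obtain j where j: "j \<in> {1..n}" "x = sin_basis j" by auto
  have "inner (P_n n u) x = (\<Sum>i=1..n. if i = j then inner u (sin_basis i) else 0)"
    unfolding P_n_def inner_sum_left j(2) using j(1)
    by (intro sum.cong) (auto simp: inner_sin_basis)
  also have "\<dots> = inner u x"
    using j by simp
  finally show ?case
    using step.IH by (simp add: inner_add_right inner_diff_left)
qed simp

definition A_n :: "nat \<Rightarrow> L2 \<Rightarrow> L2" where
  "A_n n u = P_n n (lap u)"

text \<open>\<open>E_n n t = e\<^bsup>tA\<^sub>n\<^esup>\<close> on \<open>H_n n\<close>, by the exponential series\<close>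

definition E_n :: "nat \<Rightarrow> real \<Rightarrow> L2 \<Rightarrow> L2" where
  "E_n n t u = (\<Sum>k. (t ^ k / fact k) *\<^sub>R (A_n n ^^ k) u)"

section \<open>The driving noise and the stochastic equation\<close>

definition usual_filtration :: "'w measure \<Rightarrow> (real \<Rightarrow> 'w measure) \<Rightarrow> bool" where
  "usual_filtration M Fil \<longleftrightarrow>
     (\<forall>t\<ge>0. subalgebra M (Fil t)) \<and>
     (\<forall>s t. 0 \<le> s \<and> s \<le> t \<longrightarrow> sets (Fil s) \<subseteq> sets (Fil t)) \<and>
     (\<forall>t\<ge>0. sets (Fil t) = (\<Inter>s\<in>{t<..}. sets (Fil s))) \<and>
     (\<forall>N\<in>null_sets M. \<forall>B\<subseteq>N. B \<in> sets (Fil 0))"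

definition brownian_motion :: "'w measure \<Rightarrow> (real \<Rightarrow> 'w measure) \<Rightarrow> (real \<Rightarrow> 'w \<Rightarrow> real) \<Rightarrow> bool" where
  "brownian_motion M Fil b \<longleftrightarrow>
     (\<forall>t\<ge>0. b t \<in> borel_measurable (Fil t)) \<and>
     (AE \<omega> in M. b 0 \<omega> = 0) \<and>
     (AE \<omega> in M. continuous_on {0..} (\<lambda>t. b t \<omega>)) \<and>
     (\<forall>s t. 0 \<le> s \<and> s < t \<longrightarrow>
        distributed M lborel (\<lambda>\<omega>. b t \<omega> - b s \<omega>) (\<lambda>x. ennreal (normal_density 0 (sqrt (t - s)) x)) \<and>
        prob_space.indep_set M (sets (Fil s))
          (sets (vimage_algebra (space M) (\<lambda>\<omega>. b t \<omega> - b s \<omega>) borel)))"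

text \<open>The cylindrical process \<open>W = \<Sum>\<^sub>i \<beta>\<^sub>i e\<^sub>i\<close> is represented by the sequence \<open>(\<beta>\<^sub>i)\<^sub>i\<^sub>\<ge>\<^sub>1\<close> of its
  coordinates, which are independent as processes.\<close>

definition cylindrical_wiener ::
  "'w measure \<Rightarrow> (real \<Rightarrow> 'w measure) \<Rightarrow> (nat \<Rightarrow> real \<Rightarrow> 'w \<Rightarrow> real) \<Rightarrow> bool" where
  "cylindrical_wiener M Fil \<beta> \<longleftrightarrow>
     (\<forall>i\<ge>1. brownian_motion M Fil (\<beta> i)) \<and>
     prob_space.indep_vars M (\<lambda>_. \<Pi>\<^sub>M t\<in>{0..}. borel) (\<lambda>i \<omega>. \<lambda>t\<in>{0..}. \<beta> i t \<omega>) {1..}"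

definition W_n :: "nat \<Rightarrow> (nat \<Rightarrow> real \<Rightarrow> 'w \<Rightarrow> real) \<Rightarrow> real \<Rightarrow> 'w \<Rightarrow> L2" where
  "W_n n \<beta> t \<omega> = (\<Sum>i=1..n. \<beta> i t \<omega> *\<^sub>R sin_basis i)"

text \<open>Operator-valued step functions \<open>\<Sum>\<^sub>j 1\<^bsub>(p\<^sub>j, p\<^sub>j\<^sub>+\<^sub>1]\<^esub> B\<^sub>j\<close> and their integrals against a process \<open>W\<close>\<close>

definition step_op :: "nat \<Rightarrow> (nat \<Rightarrow> real) \<Rightarrow> (nat \<Rightarrow> L2 \<Rightarrow> L2) \<Rightarrow> real \<Rightarrow> L2 \<Rightarrow> L2" where
  "step_op m p B s u = (\<Sum>j<m. indicator {p j<..p (Suc j)} s *\<^sub>R B j u)"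

definition step_integral ::
  "nat \<Rightarrow> (nat \<Rightarrow> real) \<Rightarrow> (nat \<Rightarrow> L2 \<Rightarrow> L2) \<Rightarrow> (real \<Rightarrow> 'w \<Rightarrow> L2) \<Rightarrow> 'w \<Rightarrow> L2" where
  "step_integral m p B W \<omega> = (\<Sum>j<m. B j (W (p (Suc j)) \<omega> - W (p j) \<omega>))"

text \<open>\<open>J = \<integral>\<^sub>0\<^sup>t \<Phi>(s) dW\<^sub>n(s)\<close> for deterministic \<open>\<Phi>\<close>: the \<open>L\<^sup>2(\<Omega>;H)\<close>-limit of the integrals of step functions
  converging to \<open>\<Phi>\<close> in \<open>L\<^sup>2(0,t; L\<^sub>2(H\<^sub>n,H))\<close> (Ito isometry). It determines \<open>J\<close> almost surely.\<close>

definition wiener_integral ::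
  "'w measure \<Rightarrow> nat \<Rightarrow> (nat \<Rightarrow> real \<Rightarrow> 'w \<Rightarrow> real) \<Rightarrow> real \<Rightarrow> (real \<Rightarrow> L2 \<Rightarrow> L2) \<Rightarrow> ('w \<Rightarrow> L2) \<Rightarrow> bool" where
  "wiener_integral M n \<beta> t \<Phi> J \<longleftrightarrow> J \<in> borel_measurable M \<and>
     (\<exists>(m :: nat \<Rightarrow> nat) p B.
        (\<forall>k. p k 0 = 0 \<and> p k (m k) = t \<and> mono_on {..m k} (p k) \<and> (\<forall>j. bounded_linear (B k j))) \<and>
        (\<lambda>k. \<integral>\<^sup>+ s\<in>{0..t}. ennreal (\<Sum>i=1..n.
            (norm (\<Phi> s (sin_basis i) - step_op (m k) (p k) (B k) s (sin_basis i)))\<^sup>2) \<partial>lborel)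
          \<longlonglongrightarrow> 0 \<and>
        (\<lambda>k. \<integral>\<^sup>+ \<omega>. ennreal ((norm (J \<omega> - step_integral (m k) (p k) (B k) (W_n n \<beta>) \<omega>))\<^sup>2) \<partial>M)
          \<longlonglongrightarrow> 0)"

text \<open>Mild solution of
  \<open>dX = (A\<^sub>n X + F\<^sub>n(X)) dt + \<epsilon> Q\<^sub>n\<^bsup>1/2\<^esup> dW\<^sub>n\<close>, \<open>X(0) = y\<close>; the argument \<open>R\<close> stands for \<open>Q\<^bsup>1/2\<^esup>\<close>.\<close>

definition mild_solution ::
  "'w measure \<Rightarrow> (real \<Rightarrow> 'w measure) \<Rightarrow> (nat \<Rightarrow> real \<Rightarrow> 'w \<Rightarrow> real) \<Rightarrow> (L2 \<Rightarrow> L2) \<Rightarrow> (L2 \<Rightarrow> L2) \<Rightarrow>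
   real \<Rightarrow> nat \<Rightarrow> L2 \<Rightarrow> (real \<Rightarrow> 'w \<Rightarrow> L2) \<Rightarrow> bool" where
  "mild_solution M Fil \<beta> F R \<epsilon> n y X \<longleftrightarrow>
     (\<forall>t\<ge>0. X t \<in> borel_measurable (Fil t)) \<and>
     (\<forall>t\<ge>0. \<forall>\<omega>\<in>space M. X t \<omega> \<in> H_n n) \<and>
     (\<forall>\<omega>\<in>space M. continuous_on {0..} (\<lambda>t. X t \<omega>)) \<and>
     (\<forall>t\<ge>0. \<exists>J. wiener_integral M n \<beta> t (\<lambda>s u. E_n n (t - s) (P_n n (R u))) J \<and>
        (AE \<omega> in M. ((\<lambda>s. E_n n (t - s) (P_n n (F (X s \<omega>)))) has_integral
            (X t \<omega> - E_n n t y - \<epsilon> *\<^sub>R J \<omega>)) {0..t}))"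

section \<open>Path spaces and the rate function\<close>

definition C_Hn :: "real \<Rightarrow> nat \<Rightarrow> (real \<Rightarrow> L2) metric" where
  "C_Hn T n = cfunspace (top_of_set {0..T}) (submetric euclidean_metric (H_n n))"

definition C_H :: "real \<Rightarrow> (real \<Rightarrow> L2) metric" where
  "C_H T = cfunspace (top_of_set {0..T}) euclidean_metric"

definition dist_C_set :: "real \<Rightarrow> (real \<Rightarrow> L2) \<Rightarrow> (real \<Rightarrow> L2) set \<Rightarrow> real" where
  "dist_C_set T z U = (INF z'\<in>U. mdist (C_H T) z z')"

definition path_on :: "real \<Rightarrow> (real \<Rightarrow> 'w \<Rightarrow> L2) \<Rightarrow> 'w \<Rightarrow> real \<Rightarrow> L2" where
  "path_on T X \<omega> = (\<lambda>t\<in>{0..T}. X t \<omega>)"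

definition L2_Hn :: "real \<Rightarrow> nat \<Rightarrow> (real \<Rightarrow> L2) set" where
  "L2_Hn T n = {\<psi>. \<psi> \<in> borel_measurable (lebesgue_on {0..T}) \<and> (\<forall>t\<in>{0..T}. \<psi> t \<in> H_n n) \<and>
     (\<integral>\<^sup>+ t. ennreal ((norm (\<psi> t))\<^sup>2) \<partial>lebesgue_on {0..T}) < \<infinity>}"

text \<open>\<open>z\<close> is the mild solution on \<open>[0,T]\<close> of \<open>dz/dt = A\<^sub>n z + F\<^sub>n(z) + Q\<^sub>n\<^bsup>1/2\<^esup> \<psi>\<close>, \<open>z(0) = y\<close>; again
  \<open>R\<close> stands for \<open>Q\<^bsup>1/2\<^esup>\<close>.\<close>

definition skeleton_solution ::
  "(L2 \<Rightarrow> L2) \<Rightarrow> (L2 \<Rightarrow> L2) \<Rightarrow> real \<Rightarrow> nat \<Rightarrow> L2 \<Rightarrow> (real \<Rightarrow> L2) \<Rightarrow> (real \<Rightarrow> L2) \<Rightarrow> bool" where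
  "skeleton_solution F R T n y \<psi> z \<longleftrightarrow> z \<in> mspace (C_Hn T n) \<and>
     (\<forall>t\<in>{0..T}. ((\<lambda>s. E_n n (t - s) (P_n n (F (z s)) + P_n n (R (\<psi> s)))) has_integral
        (z t - E_n n t y)) {0..t})"

definition rate_fun :: "(L2 \<Rightarrow> L2) \<Rightarrow> (L2 \<Rightarrow> L2) \<Rightarrow> real \<Rightarrow> nat \<Rightarrow> L2 \<Rightarrow> (real \<Rightarrow> L2) \<Rightarrow> ennreal" where
  "rate_fun F R T n y z =
     (INF \<psi>\<in>{\<psi> \<in> L2_Hn T n. skeleton_solution F R T n y \<psi> z}.
        \<integral>\<^sup>+ t. ennreal ((norm (\<psi> t))\<^sup>2) \<partial>lebesgue_on {0..T}) / 2"

definition level_set ::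
  "(L2 \<Rightarrow> L2) \<Rightarrow> (L2 \<Rightarrow> L2) \<Rightarrow> real \<Rightarrow> nat \<Rightarrow> L2 \<Rightarrow> real \<Rightarrow> (real \<Rightarrow> L2) set" where
  "level_set F R T n y \<alpha> = {z \<in> mspace (C_Hn T n). rate_fun F R T n y z \<le> ennreal \<alpha>}"

end

theory Submission
  imports Defs "HOL-Complex_Analysis.Great_Picard"
begin

text \<open>The noise is additive, so the solution is a pathwise function of the driving path. In coordinates, and after
  integrating by parts, both the mild stochastic equation and the controlled equation read
  \<open>x = y + \<integral> (A\<^sub>n x + F\<^sub>n(x)) ds + w\<close>, with \<open>w = \<epsilon> Q\<^sub>n\<^bsup>1/2\<^esup> W\<^sub>n\<close> and
  \<open>w = Q\<^sub>n\<^bsup>1/2\<^esup> \<integral> \<psi>\<close> respectively. By Gronwall's inequality \<open>x\<close> depends on \<open>w\<close> in a Lipschitz way for the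
  uniform norm, with a constant independent of \<open>y\<close>. Everything is thereby reduced to Schilder's theorem for
  finitely many independent Brownian motions, uniformly over controls of bounded energy, and to the compactness
  of the set of primitives of such controls.

  Schilder's bounds are obtained on a time grid that is fixed before \<open>\<epsilon> \<rightarrow> 0\<close>. The oscillation between grid points is
  controlled by the maximal inequality, at an exponential rate that grows with the number of grid points. The grid
  increments are independent Gaussians: shifting a Gaussian gives the lower bound, exponential moments of their squares
  the upper one.\<close>

section \<open>Coordinates and the semigroup\<close>

text \<open>The sine basis diagonalises both A and Q^(1/2), so that in coordinates only F couples
  the equations. The obstacle is the stochastic convolution: it is given only as a mean-square limit
  along arbitrary step functions, one time at a time, and not along paths. Integration by parts
  supplies the candidate w_i(t) - lam_i int_0^t exp(-lam_i (t - s)) w_i(s) ds, which is continuous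
  in the path for the uniform norm; an isometry compares the step integrals with Riemann-Stieltjes
  sums, and these converge to the candidate along almost every path.

  On a fixed grid every prefactor is independent of \<epsilon>, so that \<gamma>/\<epsilon>^2
  absorbs it. The upper bound needs no covering argument: the polygon through the grid values of the
  scaled path is itself the primitive of a control, and its energy is a quadratic form in Gaussian
  increments. The infimum in the rate function is not known to be attained at the outset; controls
  of nearly minimal energy are used, and the excess goes into \<gamma> or vanishes in the
  limit.\<close>

abbreviation coord :: "nat \<Rightarrow> L2 \<Rightarrow> real" where
  "coord i u \<equiv> inner u (sin_basis i)"

lemma P_n_of_H_n:
  assumes "u \<in> H_n n"
  shows "P_n n u = u"
proof -
  have "u - P_n n u \<in> H_n n"
    using assms P_n_in_H_n unfolding H_n_def by (intro span_diff) auto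
  then have "inner (u - P_n n u) (u - P_n n u) = 0" by (rule P_n_orthogonal)
  then show ?thesis by simp
qed

lemma H_n_expansion:
  assumes "u \<in> H_n n"
  shows "(\<Sum>i=1..n. coord i u *\<^sub>R sin_basis i) = u"
  using P_n_of_H_n[OF assms] by (simp add: P_n_def)

lemma coord_sum:
  assumes "i \<in> {1..n}"
  shows "coord i (\<Sum>j=1..n. c j *\<^sub>R sin_basis j) = c i"
proof -
  have "coord i (\<Sum>j=1..n. c j *\<^sub>R sin_basis j) = (\<Sum>j=1..n. if j = i then c j else 0)"
    unfolding inner_sum_left inner_scaleR_left
    by (intro sum.cong refl) (use assms in \<open>auto simp: inner_sin_basis\<close>)
  then show ?thesis using assms by simp
qed

lemma sum_in_H_n: "(\<Sum>j=1..n. c j *\<^sub>R sin_basis j) \<in> H_n n"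
  unfolding H_n_def by (intro span_sum span_scale span_base) auto

lemma coord_P_n:
  assumes "i \<in> {1..n}"
  shows "coord i (P_n n u) = coord i u"
  unfolding P_n_def using coord_sum[OF assms, of "\<lambda>j. coord j u"] by simp

lemma norm_sin_basis:
  assumes "i \<ge> 1"
  shows "norm (sin_basis i) = 1"
  using inner_sin_basis[OF assms assms] by (simp add: norm_eq_sqrt_inner)

lemma abs_coord_le:
  assumes "i \<ge> 1"
  shows "\<bar>coord i u\<bar> \<le> norm u"
  using Cauchy_Schwarz_ineq2[of u "sin_basis i"] norm_sin_basis[OF assms] by simp

lemma norm_H_n_sq:
  assumes "u \<in> H_n n"
  shows "(norm u)\<^sup>2 = (\<Sum>i=1..n. (coord i u)\<^sup>2)"
proof -
  have "(norm u)\<^sup>2 = inner u (\<Sum>i=1..n. coord i u *\<^sub>R sin_basis i)"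
    using H_n_expansion[OF assms] by (simp add: power2_norm_eq_inner)
  then show ?thesis by (simp add: inner_sum_right power2_eq_square)
qed

lemma norm_H_n_le:
  assumes "u \<in> H_n n"
  shows "norm u \<le> (\<Sum>i=1..n. \<bar>coord i u\<bar>)"
proof -
  have "norm u = norm (\<Sum>i=1..n. coord i u *\<^sub>R sin_basis i)"
    using H_n_expansion[OF assms] by simp
  also have "\<dots> \<le> (\<Sum>i=1..n. norm (coord i u *\<^sub>R sin_basis i))"
    by (rule norm_sum)
  also have "\<dots> = (\<Sum>i=1..n. \<bar>coord i u\<bar>)"
    by (intro sum.cong) (auto simp: norm_sin_basis)
  finally show ?thesis .
qed

section \<open>The Laplacian, its semigroup and the square root of Q on the sine basis\<close>

lemma L2_class_add:
  assumes "sq_int f" "sq_int g"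
  shows "L2_class f + L2_class g = L2_class (\<lambda>x. f x + g x)"
  unfolding L2_class_def using assms
  by (intro plus_L2.abs_eq) (auto simp: L2_rel_def eq_onp_def)

lemma H1_deriv_add:
  assumes "H1_deriv f g" "H1_deriv f' g'"
  shows "H1_deriv (\<lambda>x. f x + f' x) (\<lambda>x. g x + g' x)"
  unfolding H1_deriv_def
proof (intro conjI ballI)
  show "sq_int (\<lambda>x. g x + g' x)" using assms by (auto simp: H1_deriv_def intro: sq_int_add)
  fix x :: real assume x: "x \<in> {0..1}"
  have "((\<lambda>x. g x + g' x) has_integral ((f x - f 0) + (f' x - f' 0))) {0..x}"
    using assms x by (intro has_integral_add) (auto simp: H1_deriv_def)
  then show "((\<lambda>x. g x + g' x) has_integral f x + f' x - (f 0 + f' 0)) {0..x}"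
    by (simp add: algebra_simps)
qed

lemma H1_deriv_scale:
  assumes "H1_deriv f g"
  shows "H1_deriv (\<lambda>x. c * f x) (\<lambda>x. c * g x)"
  using assms by (auto simp: H1_deriv_def right_diff_distrib[symmetric]
    intro: sq_int_scale has_integral_mult_right)

lemma laplacian_graph_add:
  assumes "laplacian_graph u w" "laplacian_graph u' w'"
  shows "laplacian_graph (u + u') (w + w')"
proof -
  obtain f g h where 1: "u = L2_class f" "w = L2_class h" "H1_deriv f g" "H1_deriv g h" "f 0 = 0" "f 1 = 0"
    using assms(1) by (auto simp: laplacian_graph_def)
  obtain f' g' h' where 2: "u' = L2_class f'" "w' = L2_class h'" "H1_deriv f' g'" "H1_deriv g' h'" "f' 0 = 0" "f' 1 = 0"
    using assms(2) by (auto simp: laplacian_graph_def)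
  have "sq_int f" "sq_int f'"
    using 1 2 H1_deriv_continuous sq_int_continuous by blast+
  moreover have "sq_int h" "sq_int h'" using 1 2 by (auto simp: H1_deriv_def)
  ultimately show ?thesis
    unfolding laplacian_graph_def
    by (intro exI[of _ "\<lambda>x. f x + f' x"] exI[of _ "\<lambda>x. g x + g' x"] exI[of _ "\<lambda>x. h x + h' x"])
      (use 1 2 in \<open>auto simp: L2_class_add intro: H1_deriv_add\<close>)
qed

lemma laplacian_graph_scale:
  assumes "laplacian_graph u w"
  shows "laplacian_graph (c *\<^sub>R u) (c *\<^sub>R w)"
proof -
  obtain f g h where 1: "u = L2_class f" "w = L2_class h" "H1_deriv f g" "H1_deriv g h" "f 0 = 0" "f 1 = 0"
    using assms(1) by (auto simp: laplacian_graph_def)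
  have "sq_int f" "sq_int h"
    using 1 H1_deriv_continuous sq_int_continuous by (blast, auto simp: H1_deriv_def)
  then show ?thesis
    unfolding laplacian_graph_def
    by (intro exI[of _ "\<lambda>x. c * f x"] exI[of _ "\<lambda>x. c * g x"] exI[of _ "\<lambda>x. c * h x"])
      (use 1 in \<open>auto simp: scaleR_L2_class intro: H1_deriv_scale\<close>)
qed

lemma laplacian_graph_sin_basis: "laplacian_graph (sin_basis i) (- lam i *\<^sub>R sin_basis i)"
  using lap_sin_basis[of i] lap_eq unfolding dom_A_def by fastforce

text \<open>\<open>lap\<close> is a definite description, so linearity is established for its graph;
  the values of \<open>lap\<close> on \<open>H_n n\<close> then follow by
  \<open>lap_eq\<close>.\<close>

lemma laplacian_graph_sum:
  assumes "finite I"
  shows "laplacian_graph (\<Sum>i\<in>I. c i *\<^sub>R sin_basis i) (\<Sum>i\<in>I. (- lam i * c i) *\<^sub>R sin_basis i)"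
  using assms
proof (induction I rule: finite_induct)
  case empty
  show ?case
    using laplacian_graph_scale[OF laplacian_graph_sin_basis, of 0 0] by simp
next
  case (insert i I)
  then show ?case
    using laplacian_graph_add[OF laplacian_graph_scale[OF laplacian_graph_sin_basis[of i], of "c i"] insert.IH]
    by (simp add: mult.commute)
qed

lemma A_n_expansion:
  assumes "u \<in> H_n n"
  shows "A_n n u = (\<Sum>i=1..n. (- lam i * coord i u) *\<^sub>R sin_basis i)"
proof -
  have "lap u = (\<Sum>i=1..n. (- lam i * coord i u) *\<^sub>R sin_basis i)"
    using lap_eq[OF laplacian_graph_sum[of "{1..n}" "\<lambda>i. coord i u"]] H_n_expansion[OF assms] by simp
  then show ?thesis
    by (metis A_n_def P_n_of_H_n sum_in_H_n)
qed

lemma A_n_power_expansion: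
  assumes "u \<in> H_n n"
  shows "(A_n n ^^ k) u = (\<Sum>i=1..n. ((- lam i) ^ k * coord i u) *\<^sub>R sin_basis i)"
proof (induction k)
  case 0
  then show ?case using H_n_expansion[OF assms] by simp
next
  case (Suc k)
  have "(A_n n ^^ Suc k) u = A_n n (\<Sum>i=1..n. ((- lam i) ^ k * coord i u) *\<^sub>R sin_basis i)"
    by (simp add: Suc)
  also have "\<dots> = (\<Sum>i=1..n. ((- lam i) ^ Suc k * coord i u) *\<^sub>R sin_basis i)"
    unfolding A_n_expansion[OF sum_in_H_n]
    by (intro sum.cong refl) (simp only: coord_sum power_Suc mult.assoc)
  finally show ?case .
qed

lemma E_n_expansion:
  assumes "u \<in> H_n n"
  shows "E_n n t u = (\<Sum>i=1..n. (exp (- lam i * t) * coord i u) *\<^sub>R sin_basis i)"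
proof -
  have "(\<lambda>k. \<Sum>i=1..n. ((t * - lam i) ^ k / fact k) *\<^sub>R (coord i u *\<^sub>R sin_basis i)) sums
        (\<Sum>i=1..n. exp (t * - lam i) *\<^sub>R (coord i u *\<^sub>R sin_basis i))"
  proof (intro sums_sum bounded_linear.sums[OF bounded_linear_scaleR_left])
    fix i
    show "(\<lambda>k. (t * - lam i) ^ k / fact k) sums exp (t * - lam i)"
      using exp_converges[of "t * - lam i"] by (simp add: divide_inverse mult.commute)
  qed
  moreover have "(\<Sum>i=1..n. ((t * - lam i) ^ k / fact k) *\<^sub>R (coord i u *\<^sub>R sin_basis i))
      = (t ^ k / fact k) *\<^sub>R (A_n n ^^ k) u" for k
    unfolding A_n_power_expansion[OF assms] scaleR_sum_right
    by (intro sum.cong refl) (simp add: power_mult_distrib[of t, symmetric])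
  ultimately show ?thesis
    unfolding E_n_def by (simp add: sums_iff mult.commute)
qed

lemma E_n_in_H_n: "u \<in> H_n n \<Longrightarrow> E_n n t u \<in> H_n n"
  by (simp only: E_n_expansion sum_in_H_n)

lemma coord_E_n:
  assumes "u \<in> H_n n" "i \<in> {1..n}"
  shows "coord i (E_n n t u) = exp (- lam i * t) * coord i u"
  unfolding E_n_expansion[OF assms(1)] by (rule coord_sum[OF assms(2)])

text \<open>The factorisation (R + sqrt a)(R - sqrt a) e = 0 makes \<open>v\<close> an eigenvector
  of \<open>R\<close> for - sqrt a unless it vanishes, and a nonnegative operator has no negative
  eigenvalue.\<close>

lemma sqrt_op_eigenvector:
  assumes R: "is_sqrt_op R Q" and Q: "Q e = a *\<^sub>R e" and a: "a > 0"
  shows "R e = sqrt a *\<^sub>R e"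
proof -
  interpret R: bounded_linear R using R by (simp add: is_sqrt_op_def)
  define v where "v = R e - sqrt a *\<^sub>R e"
  have "R v = Q e - sqrt a *\<^sub>R R e"
    using R by (simp add: v_def R.diff R.scaleR is_sqrt_op_def)
  also have "\<dots> = - sqrt a *\<^sub>R v"
    using a by (simp add: v_def Q scaleR_diff_right)
  finally have "inner (R v) v = - sqrt a * (norm v)\<^sup>2"
    by (simp add: power2_norm_eq_inner)
  moreover have "0 \<le> inner (R v) v" using R by (simp add: is_sqrt_op_def)
  ultimately have "sqrt a * (norm v)\<^sup>2 \<le> 0" by simp
  then have "(norm v)\<^sup>2 \<le> 0" using a by (simp add: mult_le_0_iff)
  then show ?thesis by (simp add: v_def)
qed

text \<open>Self-adjointness moves \<open>R\<close> to the basis vector, so the formula holds for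
  every \<open>u\<close> in H and not only on the span of the basis.\<close>

lemma coord_sqrt_op:
  assumes R: "is_sqrt_op R Q" and Q: "Q (sin_basis i) = a *\<^sub>R sin_basis i" and a: "a > 0"
  shows "coord i (R u) = sqrt a * coord i u"
proof -
  have "coord i (R u) = inner u (R (sin_basis i))"
    using R by (simp add: is_sqrt_op_def self_adjoint_def)
  then show ?thesis using sqrt_op_eigenvector[OF R Q a] by simp
qed

section \<open>The forced equation\<close>

text \<open>The right-hand side of the assumption, damped by exp(-K t), has a nonpositive derivative
  by that same assumption, so it stays below its initial value \<open>a\<close>.\<close>

lemma gronwall:
  fixes D :: "real \<Rightarrow> real"
  assumes D: "continuous_on {0..T} D" and K: "K \<ge> 0"
    and le: "\<And>t. t \<in> {0..T} \<Longrightarrow> D t \<le> a + K * integral {0..t} D"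
    and t: "t \<in> {0..T}"
  shows "D t \<le> a * exp (K * t)"
proof -
  let ?G = "\<lambda>t. exp (- K * t) * (a + K * integral {0..t} D)"
  let ?G' = "\<lambda>t. exp (- K * t) * K * (D t - (a + K * integral {0..t} D))"
  have D': "continuous_on {0..t} D" using D t by (auto intro: continuous_on_subset)
  have der: "(?G has_real_derivative ?G' s) (at s within {0..t})" if "s \<in> {0..t}" for s
    by (rule derivative_eq_intros integral_has_real_derivative[OF D' that] refl)+
      (simp add: algebra_simps)
  have "\<exists>s\<in>{0..t}. ?G t - ?G 0 = (\<lambda>h. h * ?G' s) (t - 0)"
    by (rule mvt_very_simple) (use der t in \<open>auto simp: has_field_derivative_def mult_commute_abs\<close>)
  then obtain s where s: "s \<in> {0..t}" "?G t - ?G 0 = t * ?G' s" by auto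
  have "?G' s \<le> 0"
    using le[of s] s t K by (intro mult_nonneg_nonpos mult_nonneg_nonneg) auto
  then have "?G t \<le> a" using s t mult_nonneg_nonpos[of t "?G' s"] by simp
  then have "exp (K * t) * ?G t \<le> exp (K * t) * a" by (intro mult_left_mono) auto
  then have "a + K * integral {0..t} D \<le> a * exp (K * t)"
    by (simp add: mult.assoc[symmetric] exp_add[symmetric] mult.commute)
  then show ?thesis using le[OF t] by simp
qed

text \<open>The forcing \<open>w\<close> is merely continuous, but \<open>x - w\<close> is
  differentiable: both sides say that it solves u' = - l u + (f - l w) with u(0) = y, and the
  integrating factor exp(l s) leads from one to the other.\<close>

lemma mild_iff_integral_equation:
  fixes x w f :: "real \<Rightarrow> real"
  assumes x: "continuous_on {0..T} x" and w: "continuous_on {0..T} w" and f: "continuous_on {0..T} f"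
  shows "(\<forall>t\<in>{0..T}. x t = y + integral {0..t} (\<lambda>s. - l * x s + f s) + w t) \<longleftrightarrow>
    (\<forall>t\<in>{0..T}. x t - w t = exp (- l * t) * (y + integral {0..t} (\<lambda>s. exp (l * s) * (f s - l * w s))))"
proof
  assume A: "\<forall>t\<in>{0..T}. x t = y + integral {0..t} (\<lambda>s. - l * x s + f s) + w t"
  show "\<forall>t\<in>{0..T}. x t - w t = exp (- l * t) * (y + integral {0..t} (\<lambda>s. exp (l * s) * (f s - l * w s)))"
  proof
    fix t assume t: "t \<in> {0..T}"
    let ?g = "\<lambda>t. y + integral {0..t} (\<lambda>s. - l * x s + f s)"
    have c: "continuous_on {0..t} (\<lambda>s. - l * x s + f s)"
      using x f t by (auto intro!: continuous_intros intro: continuous_on_subset)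
    have "((\<lambda>s. exp (l * s) * ?g s) has_real_derivative exp (l * s) * (f s - l * w s)) (at s within {0..t})"
      if s: "s \<in> {0..t}" for s
    proof -
      have "x s = ?g s + w s" using A s t by auto
      then have "exp (l * s) * (f s - l * w s) = exp (l * s) * l * ?g s + exp (l * s) * (- l * x s + f s)"
        by (simp add: algebra_simps)
      show ?thesis
        by (rule derivative_eq_intros integral_has_real_derivative[OF c s] refl)+
          (use \<open>exp (l * s) * (f s - l * w s) = _\<close> in \<open>simp add: algebra_simps\<close>)
    qed
    then have "((\<lambda>s. exp (l * s) * (f s - l * w s)) has_integral
        exp (l * t) * ?g t - exp (l * 0) * ?g 0) {0..t}"
      using t by (intro fundamental_theorem_of_calculus)
        (auto simp: has_real_derivative_iff_has_vector_derivative[symmetric])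
    then have "integral {0..t} (\<lambda>s. exp (l * s) * (f s - l * w s)) = exp (l * t) * ?g t - y"
      by (simp add: integral_unique)
    then show "x t - w t = exp (- l * t) * (y + integral {0..t} (\<lambda>s. exp (l * s) * (f s - l * w s)))"
      using A t by (simp add: exp_minus)
  qed
next
  let ?J = "\<lambda>t. y + integral {0..t} (\<lambda>s. exp (l * s) * (f s - l * w s))"
  assume A: "\<forall>t\<in>{0..T}. x t - w t = exp (- l * t) * ?J t"
  show "\<forall>t\<in>{0..T}. x t = y + integral {0..t} (\<lambda>s. - l * x s + f s) + w t"
  proof
    fix t assume t: "t \<in> {0..T}"
    have c: "continuous_on {0..t} (\<lambda>s. exp (l * s) * (f s - l * w s))"
      using w f t by (auto intro!: continuous_intros intro: continuous_on_subset)
    have "((\<lambda>s. exp (- l * s) * ?J s) has_real_derivative - l * x s + f s) (at s within {0..t})"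
      if s: "s \<in> {0..t}" for s
    proof -
      have "x s = exp (- l * s) * ?J s + w s" using A s t by (auto simp: algebra_simps)
      then have "- l * x s + f s = - l * exp (- l * s) * ?J s + exp (- l * s) * (exp (l * s) * (f s - l * w s))"
        by (simp add: algebra_simps exp_minus)
      show ?thesis
        by (rule derivative_eq_intros integral_has_real_derivative[OF c s] refl)+
          (use \<open>- l * x s + f s = _\<close> in \<open>simp add: algebra_simps\<close>)
    qed
    then have "((\<lambda>s. - l * x s + f s) has_integral
        exp (- l * t) * ?J t - exp (- l * 0) * ?J 0) {0..t}"
      using t by (intro fundamental_theorem_of_calculus)
        (auto simp: has_real_derivative_iff_has_vector_derivative[symmetric])
    then have "integral {0..t} (\<lambda>s. - l * x s + f s) = exp (- l * t) * ?J t - y"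
      by (simp add: integral_unique)
    then show "x t = y + integral {0..t} (\<lambda>s. - l * x s + f s) + w t"
      using A t by (auto simp: algebra_simps)
  qed
qed

lemma abs_exp_diff_le:
  fixes l :: real
  assumes "0 \<le> a" "a \<le> s" "s \<le> T"
  shows "\<bar>exp (l * s) - exp (l * a)\<bar> \<le> \<bar>l\<bar> * exp (\<bar>l\<bar> * T) * (s - a)"
proof -
  have "norm (exp (l * s) - exp (l * a)) \<le> \<bar>l\<bar> * exp (\<bar>l\<bar> * T) * norm (s - a)"
  proof (rule field_differentiable_bound[of "{0..T}" _ "\<lambda>u. l * exp (l * u)"])
    fix u assume "u \<in> {0..T}"
    show "((\<lambda>u. exp (l * u)) has_field_derivative l * exp (l * u)) (at u within {0..T})"
      by (auto intro!: derivative_eq_intros)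
    have "l * u \<le> \<bar>l\<bar> * T" using \<open>u \<in> {0..T}\<close> by (intro mult_mono) auto
    then show "norm (l * exp (l * u)) \<le> \<bar>l\<bar> * exp (\<bar>l\<bar> * T)"
      by (simp add: abs_mult mult_left_mono)
  qed (use assms in auto)
  then show ?thesis using assms by simp
qed

text \<open>Integration by parts for an integrable density: the defect of the identity is additive and, on \<open>[a,b]\<close>, of size
  \<open>O((b - a) \<integral>\<^sub>a\<^sup>b \<bar>\<phi>\<bar>) = o(b - a)\<close>, hence constant.\<close>

lemma integral_exp_mult_parts:
  fixes \<phi> :: "real \<Rightarrow> real"
  assumes \<phi>: "\<phi> absolutely_integrable_on {0..T}" and t: "t \<in> {0..T}"
  defines "w \<equiv> \<lambda>t. integral {0..t} \<phi>"
  shows "integral {0..t} (\<lambda>s. exp (l * s) * \<phi> s) = exp (l * t) * w t - l * integral {0..t} (\<lambda>s. exp (l * s) * w s)"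
proof -
  define C where "C = \<bar>l\<bar> * exp (\<bar>l\<bar> * T)"
  have C0: "C \<ge> 0" by (simp add: C_def)
  define D where "D = (\<lambda>t. integral {0..t} (\<lambda>s. exp (l * s) * \<phi> s) -
    (exp (l * t) * w t - l * integral {0..t} (\<lambda>s. exp (l * s) * w s)))"
  define V where "V = (\<lambda>t. integral {0..t} (\<lambda>s. \<bar>\<phi> s\<bar>))"
  have i1: "\<phi> integrable_on {a..b}" if "0 \<le> a" "b \<le> T" for a b
    by (rule integrable_on_subinterval[OF set_lebesgue_integral_eq_integral(1)[OF \<phi>]]) (use that in auto)
  have i2: "(\<lambda>s. \<bar>\<phi> s\<bar>) integrable_on {a..b}" if "0 \<le> a" "b \<le> T" for a b
  proof (rule integrable_on_subinterval)
    show "(\<lambda>s. \<bar>\<phi> s\<bar>) integrable_on {0..T}"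
      using \<phi> by (simp add: absolutely_integrable_on_def)
  qed (use that in auto)
  have "(\<lambda>s. exp (l * s) * \<phi> s) absolutely_integrable_on {0..T}"
    by (rule absolutely_integrable_bounded_measurable_product_real[OF _ _ _ \<phi>])
      (auto intro!: compact_imp_bounded compact_continuous_image continuous_intros
        continuous_imp_measurable_on_sets_lebesgue)
  from set_lebesgue_integral_eq_integral(1)[OF this]
  have i3: "(\<lambda>s. exp (l * s) * \<phi> s) integrable_on {a..b}" if "0 \<le> a" "b \<le> T" for a b
    by (rule integrable_on_subinterval) (use that in auto)
  have cw: "continuous_on {0..T} w" and cV: "continuous_on {0..T} V"
    unfolding w_def V_def using i1[of 0 T] i2[of 0 T] by (auto intro!: indefinite_integral_continuous_1)
  have i4: "(\<lambda>s. exp (l * s) * w s) integrable_on {a..b}" if "0 \<le> a" "b \<le> T" for a b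
    using cw that by (intro integrable_continuous_real continuous_intros) (auto intro: continuous_on_subset)
  have split: "integral {0..b} g = integral {0..a} g + integral {a..b} g"
    if "0 \<le> a" "a \<le> b" "g integrable_on {0..b}" for a b and g :: "real \<Rightarrow> real"
    using that by (intro Henstock_Kurzweil_Integration.integral_combine[symmetric]) auto
  have inc: "\<bar>D b - D a\<bar> \<le> 2 * C * (b - a) * (V b - V a)" if ab: "0 \<le> a" "a \<le> b" "b \<le> T" for a b
  proof -
    have wV: "\<bar>w b - w s\<bar> \<le> V b - V a" if s: "s \<in> {a..b}" for s
    proof -
      have "w b - w s = integral {s..b} \<phi>"
        using split[of s b \<phi>] i1[of 0 b] s ab by (simp add: w_def)
      also have "\<bar>\<dots>\<bar> \<le> integral {s..b} (\<lambda>s. \<bar>\<phi> s\<bar>)"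
        using integral_norm_bound_integral[of \<phi> "{s..b}" "\<lambda>s. \<bar>\<phi> s\<bar>"] i1[of s b] i2[of s b] s ab by simp
      also have "\<dots> \<le> integral {a..b} (\<lambda>s. \<bar>\<phi> s\<bar>)"
        using s ab i2 by (intro integral_subset_le) auto
      also have "\<dots> = V b - V a"
        using split[of a b "\<lambda>s. \<bar>\<phi> s\<bar>"] i2[of 0 b] ab by (simp add: V_def)
      finally show ?thesis .
    qed
    have e1: "integral {a..b} (\<lambda>s. l * exp (l * s)) = exp (l * b) - exp (l * a)"
    proof (rule integral_unique, rule fundamental_theorem_of_calculus[OF ab(2)])
      fix s show "((\<lambda>s. exp (l * s)) has_vector_derivative l * exp (l * s)) (at s within {a..b})"
        by (auto intro!: derivative_eq_intros simp: has_real_derivative_iff_has_vector_derivative[symmetric])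
    qed
    have e1i: "(\<lambda>s. l * exp (l * s)) integrable_on {a..b}"
      by (intro integrable_continuous_real continuous_intros)
    have A: "integral {a..b} (\<lambda>s. (exp (l * s) - exp (l * a)) * \<phi> s)
        = integral {a..b} (\<lambda>s. exp (l * s) * \<phi> s) - exp (l * a) * (w b - w a)"
      using split[of a b \<phi>] i1[of 0 b] i1[of a b] i3[of a b] ab
      by (simp add: w_def left_diff_distrib Henstock_Kurzweil_Integration.integral_diff)
    have iA: "(\<lambda>s. (exp (l * s) - exp (l * a)) * \<phi> s) integrable_on {a..b}"
      using integrable_diff[OF i3[of a b] integrable_on_cmult_left[OF i1[of a b], of "exp (l * a)"]] ab
      by (simp add: left_diff_distrib)
    have B: "integral {a..b} (\<lambda>s. l * exp (l * s) * (w b - w s))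
        = (exp (l * b) - exp (l * a)) * w b - l * integral {a..b} (\<lambda>s. exp (l * s) * w s)"
      using Henstock_Kurzweil_Integration.integral_diff[OF integrable_on_mult_left[OF e1i, of "w b"]
          integrable_on_cmult_left[OF i4[of a b], of l]] ab e1
      by (simp add: right_diff_distrib mult.assoc)
    have iB: "(\<lambda>s. l * exp (l * s) * (w b - w s)) integrable_on {a..b}"
      using cw ab by (intro integrable_continuous_real continuous_intros) (auto intro: continuous_on_subset)
    \<comment> \<open>The boundary terms are regrouped so that each remaining integrand carries a
      factor that vanishes with the length of the interval: the increment of the exponential against
      \<open>\<phi>\<close>, and the increment of \<open>w\<close> against the derivative of the
      exponential.\<close>
    have "D b - D a = integral {a..b} (\<lambda>s. (exp (l * s) - exp (l * a)) * \<phi> s)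
        - (exp (l * b) * w b - exp (l * a) * w a - exp (l * a) * (w b - w a)
            - l * integral {a..b} (\<lambda>s. exp (l * s) * w s))"
      unfolding A D_def using split[of a b "\<lambda>s. exp (l * s) * \<phi> s"] split[of a b "\<lambda>s. exp (l * s) * w s"]
        i3[of 0 b] i4[of 0 b] ab by (simp add: algebra_simps)
    also have "\<dots> = integral {a..b} (\<lambda>s. (exp (l * s) - exp (l * a)) * \<phi> s)
        - integral {a..b} (\<lambda>s. l * exp (l * s) * (w b - w s))"
      unfolding B by (simp add: algebra_simps)
    finally have D: "D b - D a = integral {a..b} (\<lambda>s. (exp (l * s) - exp (l * a)) * \<phi> s)
        - integral {a..b} (\<lambda>s. l * exp (l * s) * (w b - w s))" .
    have "\<bar>integral {a..b} (\<lambda>s. (exp (l * s) - exp (l * a)) * \<phi> s)\<bar>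
        \<le> integral {a..b} (\<lambda>s. C * (b - a) * \<bar>\<phi> s\<bar>)"
    proof -
      have "norm ((exp (l * s) - exp (l * a)) * \<phi> s) \<le> C * (b - a) * \<bar>\<phi> s\<bar>" if s: "s \<in> {a..b}" for s
      proof -
        have "\<bar>exp (l * s) - exp (l * a)\<bar> \<le> C * (s - a)"
          using abs_exp_diff_le[of a s T l] s ab by (simp add: C_def)
        also have "\<dots> \<le> C * (b - a)" using s C0 by (intro mult_left_mono) auto
        finally show ?thesis by (simp add: abs_mult mult_right_mono)
      qed
      then show ?thesis
        using integral_norm_bound_integral[OF iA integrable_on_cmult_left[OF i2[of a b], of "C * (b - a)"]] ab
        by simp
    qed
    also have "\<dots> = C * (b - a) * (V b - V a)"
      using split[of a b "\<lambda>s. \<bar>\<phi> s\<bar>"] i2[of 0 b] ab by (simp add: V_def)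
    finally have 1: "\<bar>integral {a..b} (\<lambda>s. (exp (l * s) - exp (l * a)) * \<phi> s)\<bar> \<le> C * (b - a) * (V b - V a)" .
    have "\<bar>integral {a..b} (\<lambda>s. l * exp (l * s) * (w b - w s))\<bar>
        \<le> integral {a..b} (\<lambda>s. C * (V b - V a))"
    proof -
      have "norm (l * exp (l * s) * (w b - w s)) \<le> C * (V b - V a)" if s: "s \<in> {a..b}" for s
      proof -
        have "l * s \<le> \<bar>l\<bar> * T" using s ab by (intro mult_mono) auto
        then have "\<bar>l * exp (l * s)\<bar> \<le> C" by (simp add: C_def abs_mult mult_left_mono)
        then show ?thesis using wV[OF s] C0 by (auto simp: abs_mult intro!: mult_mono)
      qed
      then show ?thesis
        using integral_norm_bound_integral[OF iB integrable_const_ivl[of "C * (V b - V a)" a b]] by simp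
    qed
    also have "\<dots> = C * (b - a) * (V b - V a)" using ab by simp
    finally show ?thesis using 1 unfolding D by simp
  qed
  have sym: "\<bar>D b - D a\<bar> \<le> 2 * C * \<bar>b - a\<bar> * \<bar>V b - V a\<bar>" if "a \<in> {0..T}" "b \<in> {0..T}" for a b
  proof (cases "a \<le> b")
    case True
    then have "\<bar>D b - D a\<bar> \<le> 2 * C * (b - a) * (V b - V a)" using inc[of a b] that by auto
    also have "\<dots> \<le> 2 * C * (b - a) * \<bar>V b - V a\<bar>" using C0 True by (intro mult_left_mono) auto
    finally show ?thesis using True by simp
  next
    case False
    then have "\<bar>D a - D b\<bar> \<le> 2 * C * (a - b) * (V a - V b)" using inc[of b a] that by auto
    also have "\<dots> \<le> 2 * C * (a - b) * \<bar>V a - V b\<bar>" using C0 False by (intro mult_left_mono) auto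
    finally show ?thesis using False by (simp add: abs_minus_commute)
  qed
  have "(D has_field_derivative 0) (at a within {0..T})" if a: "a \<in> {0..T}" for a
    unfolding has_field_derivative_iff
  proof (rule Lim_null_comparison)
    show "\<forall>\<^sub>F b in at a within {0..T}. norm ((D b - D a) / (b - a)) \<le> 2 * C * \<bar>V b - V a\<bar>"
      unfolding eventually_at_filter
    proof (intro always_eventually allI impI)
      fix b assume "b \<noteq> a" "b \<in> {0..T}"
      then show "norm ((D b - D a) / (b - a)) \<le> 2 * C * \<bar>V b - V a\<bar>"
        using sym[OF a, of b] by (simp add: divide_le_eq mult_ac)
    qed
    have "(V \<longlongrightarrow> V a) (at a within {0..T})" using cV a by (auto simp: continuous_on_def)
    then have "((\<lambda>b. 2 * C * \<bar>V b - V a\<bar>) \<longlongrightarrow> 2 * C * \<bar>V a - V a\<bar>) (at a within {0..T})"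
      by (intro tendsto_intros)
    then show "((\<lambda>b. 2 * C * \<bar>V b - V a\<bar>) \<longlongrightarrow> 0) (at a within {0..T})" by simp
  qed
  then obtain c where "\<And>a. a \<in> {0..T} \<Longrightarrow> D a = c"
    using has_field_derivative_zero_constant[of "{0..T}" D] by auto
  then have "D t = D 0" using t by auto
  then show ?thesis by (simp add: D_def w_def)
qed

section \<open>Stability and solvability of the forced equation\<close>

definition drift :: "(L2 \<Rightarrow> L2) \<Rightarrow> nat \<Rightarrow> L2 \<Rightarrow> real" where
  "drift F i u = - lam i * coord i u + coord i (F u)"

text \<open>\<open>x = y + \<integral> (A\<^sub>n x + F\<^sub>n(x)) ds + w\<close> in coordinates.\<close>

definition forced_solution ::
  "(L2 \<Rightarrow> L2) \<Rightarrow> real \<Rightarrow> nat \<Rightarrow> L2 \<Rightarrow> (nat \<Rightarrow> real \<Rightarrow> real) \<Rightarrow> (real \<Rightarrow> L2) \<Rightarrow> bool" where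
  "forced_solution F T n y w x \<longleftrightarrow> continuous_on {0..T} x \<and> (\<forall>t\<in>{0..T}. x t \<in> H_n n) \<and>
     (\<forall>t\<in>{0..T}. \<forall>i\<in>{1..n}.
        coord i (x t) = coord i y + integral {0..t} (\<lambda>s. drift F i (x s)) + w i t)"

lemma lam_nonneg: "lam i \<ge> 0"
  by (simp add: lam_def)

text \<open>The sum of all eigenvalues is taken so that one constant serves every
  coordinate.\<close>

lemma drift_lipschitz:
  assumes F: "LF-lipschitz_on UNIV F" and i: "i \<in> {1..n}"
  shows "\<bar>drift F i u - drift F i v\<bar> \<le> ((\<Sum>j=1..n. lam j) + LF) * norm (u - v)"
proof -
  have "\<bar>coord i (u - v)\<bar> \<le> norm (u - v)" "\<bar>coord i (F u - F v)\<bar> \<le> norm (F u - F v)"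
    using i by (auto intro!: abs_coord_le)
  moreover have "norm (F u - F v) \<le> LF * norm (u - v)"
    using lipschitz_onD[OF F] by (simp add: dist_norm)
  moreover have "lam i * \<bar>coord i (u - v)\<bar> \<le> (\<Sum>j=1..n. lam j) * norm (u - v)"
    using calculation(1) i by (intro mult_mono member_le_sum sum_nonneg) (auto simp: lam_nonneg)
  moreover have "\<bar>drift F i u - drift F i v\<bar> \<le> lam i * \<bar>coord i (u - v)\<bar> + \<bar>coord i (F u - F v)\<bar>"
  proof -
    have "drift F i u - drift F i v = - lam i * coord i (u - v) + coord i (F u - F v)"
      by (simp add: drift_def inner_diff_left algebra_simps)
    then show ?thesis
      using abs_triangle_ineq[of "- lam i * coord i (u - v)"] by (simp add: abs_mult lam_nonneg)
  qed
  ultimately show ?thesis by (simp add: algebra_simps)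
qed

lemma continuous_on_drift:
  assumes F: "LF-lipschitz_on UNIV F" and x: "continuous_on S x"
  shows "continuous_on S (\<lambda>s. drift F i (x s))"
proof -
  have "continuous_on S (\<lambda>s. F (x s))"
    using continuous_on_compose2[OF lipschitz_on_continuous_on[OF F] x] by simp
  then show ?thesis unfolding drift_def by (intro continuous_intros x)
qed

text \<open>Gronwall's inequality for the sum of the absolute coordinates of the difference. The
  initial values cancel, which keeps \<open>y\<close> out of the constant and makes all later bounds
  uniform in it.\<close>

lemma forced_solution_stable:
  assumes F: "LF-lipschitz_on UNIV F"
    and x: "forced_solution F T n y w x" and x': "forced_solution F T n y w' x'"
    and r: "\<And>i t. i \<in> {1..n} \<Longrightarrow> t \<in> {0..T} \<Longrightarrow> \<bar>w i t - w' i t\<bar> \<le> r" and t: "t \<in> {0..T}"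
  shows "norm (x t - x' t) \<le> n * r * exp (n * ((\<Sum>j=1..n. lam j) + LF) * T)"
proof -
  let ?L = "(\<Sum>j=1..n. lam j) + LF"
  have L: "?L \<ge> 0" using lipschitz_on_nonneg[OF F] by (simp add: sum_nonneg lam_nonneg)
  let ?D = "\<lambda>t. \<Sum>i=1..n. \<bar>coord i (x t - x' t)\<bar>"
  have cx: "continuous_on {0..T} x" "continuous_on {0..T} x'"
    using x x' by (auto simp: forced_solution_def)
  have D: "continuous_on {0..T} ?D" by (intro continuous_intros cx)
  have nD: "norm (x s - x' s) \<le> ?D s" if "s \<in> {0..T}" for s
    using that x x' by (intro norm_H_n_le) (auto simp: forced_solution_def H_n_def intro: span_diff)
  have le: "?D s \<le> n * r + (n * ?L) * integral {0..s} ?D" if s: "s \<in> {0..T}" for s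
  proof -
    have sub: "continuous_on {0..s} x" "continuous_on {0..s} x'" "continuous_on {0..s} ?D"
      using cx D s by (auto intro: continuous_on_subset)
    note di = continuous_on_drift[OF F sub(1)] continuous_on_drift[OF F sub(2)]
    have "\<bar>coord i (x s - x' s)\<bar> \<le> r + ?L * integral {0..s} ?D" if i: "i \<in> {1..n}" for i
    proof -
      have "coord i (x s - x' s) = integral {0..s} (\<lambda>u. drift F i (x u) - drift F i (x' u)) + (w i s - w' i s)"
        using x x' i s di
        by (subst Henstock_Kurzweil_Integration.integral_diff)
          (auto simp: forced_solution_def inner_diff_left intro!: integrable_continuous_real)
      moreover have "\<bar>integral {0..s} (\<lambda>u. drift F i (x u) - drift F i (x' u))\<bar> \<le> integral {0..s} (\<lambda>u. ?L * ?D u)"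
      proof -
        have "norm (drift F i (x u) - drift F i (x' u)) \<le> ?L * ?D u" if "u \<in> {0..s}" for u
        proof -
          have "norm (drift F i (x u) - drift F i (x' u)) \<le> ?L * norm (x u - x' u)"
            using drift_lipschitz[OF F i] by simp
          also have "\<dots> \<le> ?L * ?D u" using nD that s L by (intro mult_left_mono) auto
          finally show ?thesis .
        qed
        then show ?thesis
          using integral_norm_bound_integral[of "\<lambda>u. drift F i (x u) - drift F i (x' u)" "{0..s}" "\<lambda>u. ?L * ?D u"]
            di sub by (simp add: integrable_continuous_real continuous_intros)
      qed
      ultimately show ?thesis using r[OF i s] by simp
    qed
    then have "?D s \<le> (\<Sum>i=1..n. r + ?L * integral {0..s} ?D)" by (intro sum_mono)
    then show ?thesis by (simp add: algebra_simps)
  qed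
  have "?D t \<le> n * r * exp (n * ?L * t)"
    by (rule gronwall[OF D _ le t]) (use L in auto)
  also have "\<dots> \<le> n * r * exp (n * ?L * T)"
  \<comment> \<open>For \<open>n = 0\<close> nothing prevents \<open>r\<close> from being negative,
    but then both sides vanish; for positive \<open>n\<close> it bounds an absolute value.\<close>
  proof (cases "n = 0")
    case False
    then have "r \<ge> 0" using r[of 1 t] t by force
    then show ?thesis using L t by (intro mult_left_mono) (auto intro: mult_left_mono)
  qed simp
  finally show ?thesis using nD[OF t] by simp
qed

text \<open>Picard iteration in the weighted coordinates \<open>v(t,i) = e\<^bsup>-Kt\<^esup> x\<^sub>i(t)\<close>, where for large \<open>K\<close> the integral operator
  contracts on all of \<open>[0,T]\<close>. The index \<open>i\<close> is interpolated to a real variable by tent functions, since the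
  library shows completeness of \<open>'a \<Rightarrow>\<^sub>C 'b\<close> only for metric \<open>'a\<close>.\<close>

lemma forced_solution_exists:
  assumes F: "LF-lipschitz_on UNIV F" and T: "T > 0"
    and w: "\<And>i. i \<in> {1..n} \<Longrightarrow> continuous_on {0..T} (w i)"
  shows "\<exists>x. forced_solution F T n y w x"
proof -
  let ?L = "(\<Sum>j=1..n. lam j) + LF"
  have L: "?L \<ge> 0" using lipschitz_on_nonneg[OF F] by (simp add: sum_nonneg lam_nonneg)
  \<comment> \<open>Integration against exp(K s) gains a factor 1 / K. One factor \<open>n\<close>
    comes from the coordinates summed in \<open>X\<close>, the other from the tents summed in
    \<open>\<Phi>\<close>; the 2 gives the contraction constant 1/2, and the summand 1 keeps
    \<open>K\<close> positive.\<close>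
  define K where "K = 2 * (n * (n * ?L)) + 1"
  have K: "K > 0" "n * (n * ?L) \<le> K / 2" using L by (auto simp: K_def intro: add_nonneg_pos)
  define X where "X = (\<lambda>(v :: (real \<times> real) \<Rightarrow>\<^sub>C real) s.
    \<Sum>j=1..n. (exp (K * s) * apply_bcontfun v (s, real j)) *\<^sub>R sin_basis j)"
  define G where "G = (\<lambda>v i t. exp (- K * t) * (coord i y + integral {0..t} (\<lambda>s. drift F i (X v s)) + w i t))"
  \<comment> \<open>Clamping the time to [0,T] makes \<open>\<Phi>\<close> continuous and bounded on
    the whole plane.\<close>
  define c where "c = (\<lambda>t. max 0 (min T t))"
  define h where "h = (\<lambda>i r. max 0 (1 - \<bar>r - real i\<bar>))"
  define \<Phi> where "\<Phi> = (\<lambda>v p. \<Sum>i=1..n. h i (snd p) * G v i (c (fst p)))"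
  have h: "0 \<le> h i r" "h i r \<le> 1" for i r by (auto simp: h_def)
  \<comment> \<open>At an integer only the tent centred there is nonzero, so that the fixed point,
    read at integers, satisfies the original system.\<close>
  have hj: "h i (real j) = (if i = j then 1 else 0)" for i j
    by (cases "i \<le> j") (auto simp: h_def not_le)
  have cT: "c t \<in> {0..T}" for t using T by (auto simp: c_def)
  have cX: "continuous_on S (X v)" for S v
    unfolding X_def
    by (intro continuous_intros continuous_on_compose2[OF continuous_on_apply_bcontfun[of UNIV v]]) auto
  have cG: "continuous_on {0..T} (G v i)" if "i \<in> {1..n}" for v i
    unfolding G_def
    by (intro continuous_intros indefinite_integral_continuous_1 w[OF that] integrable_continuous_real
      continuous_on_drift[OF F cX])
  have \<Phi>: "\<Phi> v \<in> bcontfun" for v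
  proof -
    have "\<exists>b. \<forall>t\<in>{0..T}. norm (G v i t) \<le> b" if i: "i \<in> {1..n}" for i
      using compact_imp_bounded[OF compact_continuous_image[OF cG[OF i] compact_Icc]]
      by (auto simp: bounded_iff)
    then obtain b where b: "\<And>i t. i \<in> {1..n} \<Longrightarrow> t \<in> {0..T} \<Longrightarrow> norm (G v i t) \<le> b i" by metis
    have "continuous_on UNIV (\<lambda>p :: real \<times> real. G v i (c (fst p)))" if "i \<in> {1..n}" for i
      by (rule continuous_on_compose2[OF cG[OF that]]) (use cT in \<open>auto simp: c_def intro!: continuous_intros\<close>)
    then have "continuous_on UNIV (\<Phi> v)"
      unfolding \<Phi>_def h_def by (intro continuous_intros) auto
    moreover have "norm (\<Phi> v p) \<le> (\<Sum>i=1..n. b i)" for p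
      unfolding \<Phi>_def
    proof (rule sum_norm_le)
      fix i assume i: "i \<in> {1..n}"
      have "norm (h i (snd p) * G v i (c (fst p))) \<le> 1 * b i"
        unfolding norm_mult using h b[OF i cT] by (intro mult_mono) auto
      then show "norm (h i (snd p) * G v i (c (fst p))) \<le> b i" by simp
    qed
    ultimately show ?thesis by (rule bcontfun_normI)
  qed
  have lip: "dist (Bcontfun (\<Phi> v)) (Bcontfun (\<Phi> v')) \<le> 1/2 * dist v v'" for v v'
  proof (rule dist_bound)
    fix p :: "real \<times> real"
    define t where "t = c (fst p)"
    have t: "0 \<le> t" using cT[of "fst p"] by (auto simp: t_def)
    \<comment> \<open>The factor \<open>n\<close> pays for bounding each of the \<open>n\<close>
      tents by 1.\<close>
    have G: "n * \<bar>G v i t - G v' i t\<bar> \<le> 1/2 * dist v v'" if i: "i \<in> {1..n}" for i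
    proof -
      let ?d = "\<lambda>s. drift F i (X v s) - drift F i (X v' s)"
      let ?e = "\<lambda>s. K / 2 * dist v v' * exp (K * s)"
      have le: "norm (n * ?d s) \<le> ?e s" for s
      proof -
        have "X v s - X v' s = (\<Sum>j=1..n. (exp (K * s) * (apply_bcontfun v (s, real j) - apply_bcontfun v' (s, real j))) *\<^sub>R sin_basis j)"
          unfolding X_def sum_subtractf[symmetric] by (intro sum.cong) (auto simp: algebra_simps)
        also have "norm \<dots> \<le> (\<Sum>j=1..n. exp (K * s) * dist v v')"
          using dist_bounded[of v _ v']
          by (intro sum_norm_le) (auto simp: norm_sin_basis abs_mult dist_real_def)
        finally have 1: "norm (X v s - X v' s) \<le> n * exp (K * s) * dist v v'" by simp
        have "norm (n * ?d s) = n * norm (?d s)" by (simp add: abs_mult)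
        also have "\<dots> \<le> n * (?L * norm (X v s - X v' s))"
          using drift_lipschitz[OF F i] by (intro mult_left_mono) auto
        also have "\<dots> \<le> n * (?L * (n * exp (K * s) * dist v v'))" using 1 L by (intro mult_left_mono) auto
        also have "\<dots> = n * (n * ?L) * (dist v v' * exp (K * s))" by simp
        also have "\<dots> \<le> K / 2 * (dist v v' * exp (K * s))" using K by (intro mult_right_mono) auto
        finally show ?thesis by simp
      qed
      have e: "(?e has_integral 1/2 * dist v v' * exp (K * t) - 1/2 * dist v v' * exp (K * 0)) {0..t}"
        using t by (intro fundamental_theorem_of_calculus)
          (auto intro!: derivative_eq_intros simp: has_real_derivative_iff_has_vector_derivative[symmetric])
      have "\<bar>integral {0..t} (\<lambda>s. n * ?d s)\<bar> \<le> integral {0..t} ?e"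
        using le e integral_norm_bound_integral[of "\<lambda>s. n * ?d s" "{0..t}" ?e] continuous_on_drift[OF F cX]
        by (simp add: integrable_continuous_real continuous_intros has_integral_integrable)
      also have "\<dots> \<le> 1/2 * dist v v' * exp (K * t)"
        unfolding integral_unique[OF e] by simp
      finally have 2: "n * \<bar>integral {0..t} ?d\<bar> \<le> 1/2 * dist v v' * exp (K * t)" by (simp add: abs_mult)
      have "G v i t - G v' i t = exp (- K * t) * integral {0..t} ?d"
        unfolding G_def using continuous_on_drift[OF F cX]
        by (subst Henstock_Kurzweil_Integration.integral_diff) (auto simp: integrable_continuous_real algebra_simps)
      then have "n * \<bar>G v i t - G v' i t\<bar> = exp (- K * t) * (n * \<bar>integral {0..t} ?d\<bar>)"
        by (simp add: abs_mult)
      also have "\<dots> \<le> exp (- K * t) * (1/2 * dist v v' * exp (K * t))"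
        using 2 by (intro mult_left_mono) auto
      finally show ?thesis by (simp add: exp_minus field_simps)
    qed
    have "\<bar>\<Phi> v p - \<Phi> v' p\<bar> = \<bar>\<Sum>i=1..n. h i (snd p) * (G v i t - G v' i t)\<bar>"
      unfolding \<Phi>_def t_def sum_subtractf[symmetric] by (simp add: algebra_simps)
    also have "\<dots> \<le> 1/2 * dist v v'"
    proof (cases "n = 0")
      case False
      have "norm (\<Sum>i=1..n. h i (snd p) * (G v i t - G v' i t)) \<le> (\<Sum>i=1..n. 1/2 * dist v v' / n)"
      proof (rule sum_norm_le)
        fix i assume i: "i \<in> {1..n}"
        have "norm (h i (snd p) * (G v i t - G v' i t)) \<le> 1 * \<bar>G v i t - G v' i t\<bar>"
          unfolding norm_mult using h by (intro mult_mono) auto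
        also have "\<dots> \<le> 1/2 * dist v v' / n"
          using G[OF i] False by (simp add: field_simps)
        finally show "norm (h i (snd p) * (G v i t - G v' i t)) \<le> 1/2 * dist v v' / n" .
      qed
      then show ?thesis using False by simp
    qed simp
    finally show "dist (apply_bcontfun (Bcontfun (\<Phi> v)) p) (apply_bcontfun (Bcontfun (\<Phi> v')) p) \<le> 1/2 * dist v v'"
      unfolding Bcontfun_inverse[OF \<Phi>] dist_real_def .
  qed
  then obtain v where "Bcontfun (\<Phi> v) = v"
    using banach_fix_type[of "1/2" "\<lambda>v. Bcontfun (\<Phi> v)"] by auto
  then have v: "apply_bcontfun v = \<Phi> v" using Bcontfun_inverse[OF \<Phi>, of v] by simp
  have "coord i (X v t) = coord i y + integral {0..t} (\<lambda>s. drift F i (X v s)) + w i t"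
    if i: "i \<in> {1..n}" and t: "t \<in> {0..T}" for i t
  proof -
    have "coord i (X v t) = exp (K * t) * apply_bcontfun v (t, real i)"
      unfolding X_def by (rule coord_sum[OF i])
    also have "apply_bcontfun v (t, real i) = G v i t"
      using i t by (simp add: v \<Phi>_def c_def hj if_distrib[of "\<lambda>x. x * _"] cong: if_cong)
    finally show ?thesis by (simp add: G_def exp_minus)
  qed
  moreover have "X v t \<in> H_n n" for t
    unfolding X_def by (rule sum_in_H_n)
  ultimately have "forced_solution F T n y w (X v)"
    unfolding forced_solution_def using cX by blast
  then show ?thesis by blast
qed

declare One_nat_def [simp del]

section \<open>Controls in coordinates, their energy and their primitives\<close>

definition L2_density :: "real \<Rightarrow> nat \<Rightarrow> (nat \<Rightarrow> real \<Rightarrow> real) \<Rightarrow> bool" where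
  "L2_density T n \<phi> \<longleftrightarrow> (\<forall>i\<in>{1..n}. \<phi> i \<in> borel_measurable (lebesgue_on {0..T}) \<and>
     integrable (lebesgue_on {0..T}) (\<lambda>t. (\<phi> i t)\<^sup>2))"

text \<open>The squared L2 norm without the factor 1/2 of the rate function; hence the level
  \<alpha> of the rate corresponds to the bound \<open>2 * \<alpha>\<close> on energies.\<close>

definition energy :: "real \<Rightarrow> nat \<Rightarrow> (nat \<Rightarrow> real \<Rightarrow> real) \<Rightarrow> real" where
  "energy T n \<phi> = (\<Sum>i=1..n. \<integral>t. (\<phi> i t)\<^sup>2 \<partial>lebesgue_on {0..T})"

definition primitive :: "(nat \<Rightarrow> real \<Rightarrow> real) \<Rightarrow> nat \<Rightarrow> real \<Rightarrow> real" where
  "primitive \<phi> i t = integral {0..t} (\<phi> i)"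

lemma finite_measure_lebesgue_Icc: "finite_measure (lebesgue_on {a..b::real})"
  by (rule finite_measureI) (cases "a \<le> b"; simp add: emeasure_restrict_space)

lemma integrable_of_square_integrable:
  fixes f :: "'a \<Rightarrow> real"
  assumes "finite_measure M" "f \<in> borel_measurable M" "integrable M (\<lambda>x. (f x)\<^sup>2)"
  shows "integrable M f"
proof (rule Bochner_Integration.integrable_bound)
  show "integrable M (\<lambda>x. 1 + (f x)\<^sup>2)"
    using assms by (intro Bochner_Integration.integrable_add finite_measure.integrable_const) auto
  have "\<bar>a\<bar> \<le> 1 + a\<^sup>2" for a :: real
  proof -
    have "0 \<le> (\<bar>a\<bar> - 1)\<^sup>2" by simp
    also have "\<dots> = a\<^sup>2 + 1 - 2 * \<bar>a\<bar>" by (simp add: power2_diff)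
    finally show ?thesis using zero_le_power2[of a] by linarith
  qed
  note le = this
  show "AE x in M. norm (f x) \<le> norm (1 + (f x)\<^sup>2)"
    unfolding real_norm_def by (rule AE_I2, rule order_trans[OF le abs_ge_self])
qed (rule assms(2))

lemma L2_density_absolutely_integrable:
  assumes "L2_density T n \<phi>" "i \<in> {1..n}"
  shows "\<phi> i absolutely_integrable_on {0..T}"
proof -
  have "integrable (lebesgue_on {0..T}) (\<phi> i)"
    using assms by (rule_tac integrable_of_square_integrable[OF finite_measure_lebesgue_Icc]) (auto simp: L2_density_def)
  then show ?thesis
    by (simp add: integrable_restrict_space set_integrable_def)
qed

lemma continuous_on_primitive:
  assumes "L2_density T n \<phi>" "i \<in> {1..n}"
  shows "continuous_on {0..T} (primitive \<phi> i)"
  unfolding primitive_def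
  by (intro indefinite_integral_continuous_1 set_lebesgue_integral_eq_integral(1)
      L2_density_absolutely_integrable[OF assms])

lemma L2_Hn_imp_density:
  assumes "\<psi> \<in> L2_Hn T n"
  shows "L2_density T n (\<lambda>i t. coord i (\<psi> t))"
    "(\<integral>\<^sup>+ t. ennreal ((norm (\<psi> t))\<^sup>2) \<partial>lebesgue_on {0..T}) = ennreal (energy T n (\<lambda>i t. coord i (\<psi> t)))"
proof -
  let ?M = "lebesgue_on {0..T}"
  have \<psi>: "\<psi> \<in> borel_measurable ?M" "\<And>t. t \<in> {0..T} \<Longrightarrow> \<psi> t \<in> H_n n"
    "(\<integral>\<^sup>+ t. ennreal ((norm (\<psi> t))\<^sup>2) \<partial>?M) < \<infinity>"
    using assms by (auto simp: L2_Hn_def)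
  have m: "(\<lambda>t. coord i (\<psi> t)) \<in> borel_measurable ?M" for i
    by (rule measurable_compose[OF \<psi>(1)]) (intro borel_measurable_continuous_onI continuous_intros)
  have mn: "(\<lambda>t. norm (\<psi> t)) \<in> borel_measurable ?M"
    by (rule measurable_compose[OF \<psi>(1)]) (intro borel_measurable_continuous_onI continuous_intros)
  have N: "integrable ?M (\<lambda>t. (norm (\<psi> t))\<^sup>2)"
    using \<psi>(3) mn by (intro integrableI_nonneg) auto
  have sq: "integrable ?M (\<lambda>t. (coord i (\<psi> t))\<^sup>2)" if i: "i \<in> {1..n}" for i
  proof (rule Bochner_Integration.integrable_bound[OF N])
    show "AE t in ?M. norm ((coord i (\<psi> t))\<^sup>2) \<le> norm ((norm (\<psi> t))\<^sup>2)"
      using i abs_coord_le[of i] by (intro AE_I2) (auto simp: abs_le_square_iff[symmetric])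
  qed (use m in measurable)
  then show D: "L2_density T n (\<lambda>i t. coord i (\<psi> t))" using m by (simp add: L2_density_def)
  have "(\<integral>\<^sup>+ t. ennreal ((norm (\<psi> t))\<^sup>2) \<partial>?M) = ennreal (\<integral>t. (norm (\<psi> t))\<^sup>2 \<partial>?M)"
    using N by (intro nn_integral_eq_integral) auto
  also have "(\<integral>t. (norm (\<psi> t))\<^sup>2 \<partial>?M) = (\<integral>t. (\<Sum>i=1..n. (coord i (\<psi> t))\<^sup>2) \<partial>?M)"
    using \<psi>(2) by (intro Bochner_Integration.integral_cong refl norm_H_n_sq) auto
  also have "\<dots> = energy T n (\<lambda>i t. coord i (\<psi> t))"
    unfolding energy_def using sq by (intro Bochner_Integration.integral_sum) auto
  finally show "(\<integral>\<^sup>+ t. ennreal ((norm (\<psi> t))\<^sup>2) \<partial>?M) = ennreal (energy T n (\<lambda>i t. coord i (\<psi> t)))" .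
qed

text \<open>\<open>L2\<close> is not known to be second countable, so that sums of measurable \<open>L2\<close>-valued functions are not covered by
  the library; the coordinates are passed through the function type \<open>nat \<Rightarrow> real\<close> instead.\<close>

lemma density_imp_L2_Hn:
  assumes "L2_density T n \<phi>"
  shows "(\<lambda>t. \<Sum>i=1..n. \<phi> i t *\<^sub>R sin_basis i) \<in> L2_Hn T n"
proof -
  let ?M = "lebesgue_on {0..T}"
  let ?\<psi> = "\<lambda>t. \<Sum>i=1..n. \<phi> i t *\<^sub>R sin_basis i"
  let ?f = "\<lambda>t i. if i \<in> {1..n} then \<phi> i t else 0"
  have 1: "?f \<in> borel_measurable ?M"
  proof (rule measurable_coordinatewise_then_product)
    fix i show "(\<lambda>t. ?f t i) \<in> borel_measurable ?M"
      using assms by (cases "i \<in> {1..n}") (auto simp: L2_density_def)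
  qed
  have "continuous_on UNIV (\<lambda>x :: nat \<Rightarrow> real. \<Sum>i=1..n. x i *\<^sub>R sin_basis i)"
    by (intro continuous_intros continuous_on_product_coordinates)
  then have "(\<lambda>t. \<Sum>i=1..n. ?f t i *\<^sub>R sin_basis i) \<in> borel_measurable ?M"
    by (rule borel_measurable_continuous_on[OF _ 1])
  moreover have "(\<lambda>t. \<Sum>i=1..n. ?f t i *\<^sub>R sin_basis i) = ?\<psi>"
    by (intro ext sum.cong) auto
  ultimately have m: "?\<psi> \<in> borel_measurable ?M" by simp
  have nsq: "(norm (?\<psi> t))\<^sup>2 = (\<Sum>i=1..n. (\<phi> i t)\<^sup>2)" for t
    unfolding norm_H_n_sq[OF sum_in_H_n] by (intro sum.cong refl) (simp only: coord_sum)
  have "integrable ?M (\<lambda>t. \<Sum>i=1..n. (\<phi> i t)\<^sup>2)"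
    using assms by (intro Bochner_Integration.integrable_sum) (auto simp: L2_density_def)
  then have "(\<integral>\<^sup>+ t. ennreal ((norm (?\<psi> t))\<^sup>2) \<partial>?M) < \<infinity>"
    unfolding nsq by (subst nn_integral_eq_integral) (auto simp: sum_nonneg)
  then show ?thesis using m by (auto simp: L2_Hn_def sum_in_H_n)
qed

text \<open>Members of the function space are required to be bounded; on a compact interval
  continuity provides this.\<close>

lemma mspace_C_Hn:
  "z \<in> mspace (C_Hn T n) \<longleftrightarrow>
     continuous_on {0..T} z \<and> (\<forall>t\<in>{0..T}. z t \<in> H_n n) \<and> z \<in> extensional {0..T}"
  unfolding C_Hn_def
  by (subst compactin_mspace_cfunspace)
    (auto simp: mtopology_of_submetric continuous_map_in_subtopology compactin_subtopology)

lemma has_integral_coord: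
  assumes "(f has_integral I) S"
  shows "((\<lambda>s. coord i (f s)) has_integral coord i I) S"
  using has_integral_linear[OF assms bounded_linear_inner_left[of "sin_basis i"]] by (simp add: o_def)

lemma has_integral_from_coords:
  assumes "\<And>s. s \<in> S \<Longrightarrow> f s \<in> H_n n" "I \<in> H_n n"
    and "\<And>i. i \<in> {1..n} \<Longrightarrow> ((\<lambda>s. coord i (f s)) has_integral coord i I) S"
  shows "(f has_integral I) S"
proof -
  have "((\<lambda>s. \<Sum>i=1..n. coord i (f s) *\<^sub>R sin_basis i) has_integral (\<Sum>i=1..n. coord i I *\<^sub>R sin_basis i)) S"
    using assms(3) by (intro has_integral_sum has_integral_scaleR_left) auto
  then show ?thesis
    unfolding H_n_expansion[OF assms(2)]
    by (rule has_integral_eq[rotated]) (simp add: H_n_expansion assms(1))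
qed

text \<open>The mild equation \<open>x(t) = e\<^bsup>tA\<^sub>n\<^esup> y + \<integral>\<^sub>0\<^sup>t e\<^bsup>(t-s)A\<^sub>n\<^esup> F\<^sub>n(x(s)) ds + c(t)\<close>, where \<open>c\<close> is the convolution
  of the semigroup with \<open>dw\<close>, written without stochastic integrals as
  \<open>c\<^sub>i(t) = w\<^sub>i(t) - \<lambda>\<^sub>i \<integral>\<^sub>0\<^sup>t e\<^bsup>-\<lambda>\<^sub>i(t-s)\<^esup> w\<^sub>i(s) ds\<close>.\<close>

lemma forced_solution_iff_mild:
  assumes F: "LF-lipschitz_on UNIV F"
    and w: "\<And>i. i \<in> {1..n} \<Longrightarrow> continuous_on {0..T} (w i)"
    and x: "continuous_on {0..T} x" "\<And>t. t \<in> {0..T} \<Longrightarrow> x t \<in> H_n n"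
  shows "forced_solution F T n y w x \<longleftrightarrow> (\<forall>i\<in>{1..n}. \<forall>t\<in>{0..T}.
    coord i (x t) = exp (- lam i * t) * (coord i y + integral {0..t} (\<lambda>s. exp (lam i * s) * coord i (F (x s))))
      + (w i t - lam i * exp (- lam i * t) * integral {0..t} (\<lambda>s. exp (lam i * s) * w i s)))"
proof -
  have cx: "continuous_on {0..T} (\<lambda>s. coord i (x s))" for i by (intro continuous_intros x)
  have cF: "continuous_on {0..T} (\<lambda>s. coord i (F (x s)))" for i
    using continuous_on_compose2[OF lipschitz_on_continuous_on[OF F] x(1)] by (intro continuous_intros) auto
  have arith: "a - w' = e * (b + (c - l * d)) \<longleftrightarrow> a = e * (b + c) + (w' - l * e * d)"
    for a b c d e l w' :: real
    by (simp add: algebra_simps)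
  have "(\<forall>t\<in>{0..T}. coord i (x t) = coord i y + integral {0..t} (\<lambda>s. drift F i (x s)) + w i t) \<longleftrightarrow>
    (\<forall>t\<in>{0..T}. coord i (x t) = exp (- lam i * t) * (coord i y + integral {0..t} (\<lambda>s. exp (lam i * s) * coord i (F (x s))))
      + (w i t - lam i * exp (- lam i * t) * integral {0..t} (\<lambda>s. exp (lam i * s) * w i s)))"
    if i: "i \<in> {1..n}" for i
    unfolding drift_def mild_iff_integral_equation[OF cx w[OF i] cF]
  proof (intro ball_cong refl)
    fix t assume t: "t \<in> {0..T}"
    have c: "continuous_on {0..t} (\<lambda>s. coord i (F (x s)))" "continuous_on {0..t} (w i)"
      by (rule continuous_on_subset[OF cF] continuous_on_subset[OF w[OF i]], use t in simp)+
    have "integral {0..t} (\<lambda>s. exp (lam i * s) * (coord i (F (x s)) - lam i * w i s)) =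
      integral {0..t} (\<lambda>s. exp (lam i * s) * coord i (F (x s)) - lam i * (exp (lam i * s) * w i s))"
      by (simp add: algebra_simps)
    also have "\<dots> = integral {0..t} (\<lambda>s. exp (lam i * s) * coord i (F (x s)))
        - lam i * integral {0..t} (\<lambda>s. exp (lam i * s) * w i s)"
      using c by (subst Henstock_Kurzweil_Integration.integral_diff)
        (auto intro!: integrable_continuous_real continuous_intros)
    finally have E: "integral {0..t} (\<lambda>s. exp (lam i * s) * (coord i (F (x s)) - lam i * w i s)) = \<dots>" .
    show "(coord i (x t) - w i t = exp (- lam i * t) *
        (coord i y + integral {0..t} (\<lambda>s. exp (lam i * s) * (coord i (F (x s)) - lam i * w i s)))) \<longleftrightarrow>
      (coord i (x t) = exp (- lam i * t) * (coord i y + integral {0..t} (\<lambda>s. exp (lam i * s) * coord i (F (x s))))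
      + (w i t - lam i * exp (- lam i * t) * integral {0..t} (\<lambda>s. exp (lam i * s) * w i s)))"
      unfolding E arith ..
  qed
  then have "(\<forall>i\<in>{1..n}. \<forall>t\<in>{0..T}.
      coord i (x t) = coord i y + integral {0..t} (\<lambda>s. drift F i (x s)) + w i t) \<longleftrightarrow>
    (\<forall>i\<in>{1..n}. \<forall>t\<in>{0..T}.
      coord i (x t) = exp (- lam i * t) * (coord i y + integral {0..t} (\<lambda>s. exp (lam i * s) * coord i (F (x s))))
      + (w i t - lam i * exp (- lam i * t) * integral {0..t} (\<lambda>s. exp (lam i * s) * w i s)))"
    by (rule ball_cong[OF refl])
  moreover have "forced_solution F T n y w x \<longleftrightarrow> (\<forall>i\<in>{1..n}. \<forall>t\<in>{0..T}.
      coord i (x t) = coord i y + integral {0..t} (\<lambda>s. drift F i (x s)) + w i t)"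
    unfolding forced_solution_def using x by auto
  ultimately show ?thesis by (rule trans[rotated])
qed

text \<open>Each coordinate of the mild integrand splits off \<open>exp (- lam i * t)\<close>;
  integrating the control part by parts turns \<open>\<psi>\<close> into its primitive and produces
  the convolution term of \<open>forced_solution_iff_mild\<close>. As all values lie in
  \<open>H_n n\<close>, the vector integral may be tested coordinatewise.\<close>

lemma skeleton_iff_forced:
  assumes F: "LF-lipschitz_on UNIV F" and y: "y \<in> H_n n" and \<psi>: "\<psi> \<in> L2_Hn T n"
    and R: "\<And>i u. i \<in> {1..n} \<Longrightarrow> coord i (R u) = r i * coord i u"
    and z: "z \<in> mspace (C_Hn T n)"
  shows "skeleton_solution F R T n y \<psi> z \<longleftrightarrow>
    forced_solution F T n y (\<lambda>i t. r i * primitive (\<lambda>i t. coord i (\<psi> t)) i t) z"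
proof -
  define \<phi> where "\<phi> = (\<lambda>i t. coord i (\<psi> t))"
  have D: "L2_density T n \<phi>" unfolding \<phi>_def by (rule L2_Hn_imp_density[OF \<psi>])
  have zc: "continuous_on {0..T} z" and zH: "\<And>t. t \<in> {0..T} \<Longrightarrow> z t \<in> H_n n"
    using z by (auto simp: mspace_C_Hn)
  have cF: "continuous_on {0..T} (\<lambda>s. coord i (F (z s)))" for i
    using continuous_on_compose2[OF lipschitz_on_continuous_on[OF F] zc] by (intro continuous_intros) auto
  let ?f = "\<lambda>t s. E_n n (t - s) (P_n n (F (z s)) + P_n n (R (\<psi> s)))"
  have PH: "P_n n u + P_n n v \<in> H_n n" for u v
    using P_n_in_H_n unfolding H_n_def by (intro span_add) auto
  let ?I = "\<lambda>i t. exp (- lam i * t) * integral {0..t} (\<lambda>s. exp (lam i * s) * coord i (F (z s)))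
      + (r i * primitive \<phi> i t - lam i * exp (- lam i * t) * integral {0..t} (\<lambda>s. exp (lam i * s) * (r i * primitive \<phi> i s)))"
  have coord_f: "((\<lambda>s. coord i (?f t s)) has_integral ?I i t) {0..t}"
    if i: "i \<in> {1..n}" and t: "t \<in> {0..T}" for i t
  proof -
    have "coord i (?f t s) = exp (- lam i * t) *
        (exp (lam i * s) * coord i (F (z s)) + r i * (exp (lam i * s) * \<phi> i s))" for s
    proof -
      have "coord i (?f t s) = exp (- lam i * (t - s)) * (coord i (F (z s)) + r i * \<phi> i s)"
        using i by (simp only: coord_E_n[OF PH i] inner_add_left coord_P_n[OF i] R[OF i] \<phi>_def)
      also have "exp (- lam i * (t - s)) = exp (- lam i * t) * exp (lam i * s)"
        by (simp add: exp_add[symmetric] algebra_simps)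
      finally show ?thesis by (simp add: algebra_simps)
    qed
    note coord_f = this
    have 1: "((\<lambda>s. exp (lam i * s) * coord i (F (z s))) has_integral
        integral {0..t} (\<lambda>s. exp (lam i * s) * coord i (F (z s)))) {0..t}"
      using t by (intro integrable_integral integrable_continuous_real continuous_on_mult
        continuous_on_subset[OF cF]) (auto intro!: continuous_intros)
    have ai: "\<phi> i absolutely_integrable_on {0..T}"
      by (rule L2_density_absolutely_integrable[OF D i])
    have "(\<lambda>s. exp (lam i * s) * \<phi> i s) absolutely_integrable_on {0..T}"
      by (rule absolutely_integrable_bounded_measurable_product_real[OF _ _ _ ai])
        (auto intro!: compact_imp_bounded compact_continuous_image continuous_intros
          continuous_imp_measurable_on_sets_lebesgue)
    from set_lebesgue_integral_eq_integral(1)[OF this]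
    have "(\<lambda>s. exp (lam i * s) * \<phi> i s) integrable_on {0..t}"
      by (rule integrable_on_subinterval) (use t in auto)
    then have 2: "((\<lambda>s. exp (lam i * s) * \<phi> i s) has_integral
        exp (lam i * t) * primitive \<phi> i t - lam i * integral {0..t} (\<lambda>s. exp (lam i * s) * primitive \<phi> i s)) {0..t}"
      unfolding primitive_def integral_exp_mult_parts[OF ai t, symmetric] by (rule integrable_integral)
    have H: "((\<lambda>s. coord i (?f t s)) has_integral exp (- lam i * t) *
        (integral {0..t} (\<lambda>s. exp (lam i * s) * coord i (F (z s))) +
        r i * (exp (lam i * t) * primitive \<phi> i t - lam i * integral {0..t} (\<lambda>s. exp (lam i * s) * primitive \<phi> i s)))) {0..t}"
      unfolding coord_f by (intro has_integral_mult_right has_integral_add 1 2)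
    have eq: "integral {0..t} (\<lambda>s. exp (lam i * s) * (r i * primitive \<phi> i s))
        = r i * integral {0..t} (\<lambda>s. exp (lam i * s) * primitive \<phi> i s)"
      by (simp only: mult.left_commute[of _ "r i"] integral_mult_right)
    have arith: "e * (a + r' * (e' * p - l * b)) = e * a + (r' * p - l * e * (r' * b))"
      if "e * e' = 1" for a b e e' l p r' :: real
    proof -
      have "e * (a + r' * (e' * p - l * b)) = e * a + (r' * ((e * e') * p) - l * e * (r' * b))"
        by (simp add: algebra_simps)
      then show ?thesis unfolding that by simp
    qed
    have ee: "exp (- lam i * t) * exp (lam i * t) = 1" by (simp add: exp_add[symmetric])
    from H show ?thesis unfolding arith[OF ee] eq .
  qed
  have cw: "continuous_on {0..T} (\<lambda>t. r i * primitive \<phi> i t)" if "i \<in> {1..n}" for i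
    by (intro continuous_intros continuous_on_primitive[OF D that])
  have aux: "a = e * (b + c) + d \<longleftrightarrow> a - e * b = e * c + d" for a b c d e :: real
    by (auto simp: distrib_left)
  have mild: "forced_solution F T n y (\<lambda>i t. r i * primitive \<phi> i t) z \<longleftrightarrow>
      (\<forall>i\<in>{1..n}. \<forall>t\<in>{0..T}. coord i (z t) - exp (- lam i * t) * coord i y = ?I i t)"
    using forced_solution_iff_mild[OF F cw zc zH, where y = y] unfolding aux .
  have cz: "coord i (z t - E_n n t y) = coord i (z t) - exp (- lam i * t) * coord i y"
    if "i \<in> {1..n}" for i t
    unfolding inner_diff_left coord_E_n[OF y that] ..
  have eqv: "(?f t has_integral (z t - E_n n t y)) {0..t} \<longleftrightarrow>
      (\<forall>i\<in>{1..n}. coord i (z t) - exp (- lam i * t) * coord i y = ?I i t)" if t: "t \<in> {0..T}" for t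
  proof
    assume A: "(?f t has_integral (z t - E_n n t y)) {0..t}"
    show "\<forall>i\<in>{1..n}. coord i (z t) - exp (- lam i * t) * coord i y = ?I i t"
    proof
      fix i assume i: "i \<in> {1..n}"
      show "coord i (z t) - exp (- lam i * t) * coord i y = ?I i t"
        using has_integral_unique[OF has_integral_coord[OF A] coord_f[OF i t]] unfolding cz[OF i] .
    qed
  next
    assume A: "\<forall>i\<in>{1..n}. coord i (z t) - exp (- lam i * t) * coord i y = ?I i t"
    show "(?f t has_integral (z t - E_n n t y)) {0..t}"
    proof (rule has_integral_from_coords)
      show "z t - E_n n t y \<in> H_n n"
        using zH[OF t] E_n_in_H_n[OF y] unfolding H_n_def by (intro span_diff) auto
      show "((\<lambda>s. coord i (?f t s)) has_integral coord i (z t - E_n n t y)) {0..t}" if i: "i \<in> {1..n}" for i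
        using coord_f[OF i t] unfolding cz[OF i] bspec[OF A i] .
    qed (rule E_n_in_H_n[OF PH])
  qed
  have conj_ball_cong: "b \<and> (\<forall>t\<in>A. P t) \<longleftrightarrow> (\<forall>t\<in>A. Q t)"
    if "b" "\<And>t. t \<in> A \<Longrightarrow> P t \<longleftrightarrow> Q t" for b P Q and A :: "real set" using that by blast
  have swap: "(\<forall>t\<in>A. \<forall>i\<in>B. P t i) \<longleftrightarrow> (\<forall>i\<in>B. \<forall>t\<in>A. P t i)"
    for A :: "real set" and B :: "nat set" and P by blast
  have "skeleton_solution F R T n y \<psi> z \<longleftrightarrow> (\<forall>t\<in>{0..T}.
      \<forall>i\<in>{1..n}. coord i (z t) - exp (- lam i * t) * coord i y = ?I i t)"
    unfolding skeleton_solution_def by (rule conj_ball_cong[OF z eqv])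
  also have "\<dots> \<longleftrightarrow> forced_solution F T n y (\<lambda>i t. r i * primitive \<phi> i t) z"
    by (rule trans[OF swap mild[symmetric]])
  finally show ?thesis unfolding \<phi>_def .
qed

declare One_nat_def [simp]

section \<open>Paths of finite energy\<close>

text \<open>The core of the completeness of L1. The integral of the summed absolute increments is
  finite, so they are summable almost everywhere; this gives convergence without passing to a
  subsequence, and the sum, added to the first function, is an integrable majorant for dominated
  convergence.\<close>

lemma absolutely_summable_increments_AE:
  fixes f :: "nat \<Rightarrow> 'a \<Rightarrow> real"
  assumes f: "\<And>k. integrable M (f k)"
    and s: "summable (\<lambda>k. \<integral>x. \<bar>f (Suc k) x - f k x\<bar> \<partial>M)"
  shows "\<exists>G. integrable M G \<and> (AE x in M. convergent (\<lambda>k. f k x) \<and> (\<forall>k. \<bar>f k x\<bar> \<le> G x))"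
proof -
  define u where "u = (\<lambda>k x. f (Suc k) x - f k x)"
  have u: "integrable M (u k)" for k using f by (simp add: u_def)
  note [measurable] = borel_measurable_integrable[OF u]
  have "(\<integral>\<^sup>+x. (\<Sum>k. ennreal \<bar>u k x\<bar>) \<partial>M) = (\<Sum>k. \<integral>\<^sup>+x. ennreal \<bar>u k x\<bar> \<partial>M)"
    by (rule nn_integral_suminf) measurable
  also have "\<dots> = (\<Sum>k. ennreal (\<integral>x. \<bar>u k x\<bar> \<partial>M))"
    using u by (intro suminf_cong nn_integral_eq_integral) auto
  also have "\<dots> = ennreal (\<Sum>k. \<integral>x. \<bar>u k x\<bar> \<partial>M)"
    using s by (intro suminf_ennreal2) (auto simp: u_def)
  finally have "(\<integral>\<^sup>+x. (\<Sum>k. ennreal \<bar>u k x\<bar>) \<partial>M) \<noteq> \<infinity>" by simp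
  then have "AE x in M. (\<Sum>k. ennreal \<bar>u k x\<bar>) \<noteq> \<infinity>"
    by (intro nn_integral_noteq_infinite) measurable
  then have su: "AE x in M. summable (\<lambda>k. norm (u k x))"
    by eventually_elim (auto intro: summable_suminf_not_top)
  have "integrable M (\<lambda>x. \<bar>u k x\<bar>)" for k using u by simp
  then have "integrable M (\<lambda>x. \<Sum>k. \<bar>u k x\<bar>)"
    using su s by (intro integrable_suminf) (auto simp: u_def)
  then have G: "integrable M (\<lambda>x. \<bar>f 0 x\<bar> + (\<Sum>k. \<bar>u k x\<bar>))"
    using f by simp
  have "AE x in M. convergent (\<lambda>k. f k x) \<and> (\<forall>k. \<bar>f k x\<bar> \<le> \<bar>f 0 x\<bar> + (\<Sum>k. \<bar>u k x\<bar>))"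
    using su
  proof eventually_elim
    case (elim x)
    have e: "f k x = f 0 x + (\<Sum>j<k. u j x)" for k
      unfolding u_def by (subst sum_lessThan_telescope) simp
    have "(\<lambda>k. \<Sum>j<k. u j x) \<longlonglongrightarrow> (\<Sum>j. u j x)"
      using summable_norm_cancel[OF elim] by (rule summable_LIMSEQ)
    then have "(\<lambda>k. f 0 x + (\<Sum>j<k. u j x)) \<longlonglongrightarrow> f 0 x + (\<Sum>j. u j x)"
      by (intro tendsto_intros)
    then have "convergent (\<lambda>k. f k x)" unfolding e[symmetric] by (rule convergentI)
    moreover have "\<bar>f k x\<bar> \<le> \<bar>f 0 x\<bar> + (\<Sum>k. \<bar>u k x\<bar>)" for k
    proof -
      have "\<bar>\<Sum>j<k. u j x\<bar> \<le> (\<Sum>j<k. \<bar>u j x\<bar>)" by (rule sum_abs)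
      also have "\<dots> \<le> (\<Sum>k. \<bar>u k x\<bar>)" using elim by (intro sum_le_suminf) auto
      finally show ?thesis using e[of k] by linarith
    qed
    ultimately show ?case by blast
  qed
  with G show ?thesis by blast
qed

text \<open>Cauchy-Schwarz, obtained from the nonnegativity of the integral of (\<phi> - m)^2 with
  \<open>m\<close> the mean of \<phi> over the interval.\<close>

lemma integral_square_bound:
  fixes \<phi> :: "real \<Rightarrow> real"
  assumes ab: "a \<le> b" and \<phi>: "\<phi> integrable_on {a..b}" "(\<lambda>t. (\<phi> t)\<^sup>2) integrable_on {a..b}"
  shows "(integral {a..b} \<phi>)\<^sup>2 \<le> (b - a) * integral {a..b} (\<lambda>t. (\<phi> t)\<^sup>2)"
proof (cases "a = b")
  case False
  define m where "m = integral {a..b} \<phi> / (b - a)"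
  have e: "(\<lambda>t. (\<phi> t - m)\<^sup>2) = (\<lambda>t. ((\<phi> t)\<^sup>2 - 2 * m * \<phi> t) + m\<^sup>2)"
    by (auto simp: power2_eq_square algebra_simps)
  have i: "((\<lambda>t. (\<phi> t - m)\<^sup>2) has_integral
      (integral {a..b} (\<lambda>t. (\<phi> t)\<^sup>2) - 2 * m * integral {a..b} \<phi>) + (b - a) *\<^sub>R m\<^sup>2) {a..b}"
    unfolding e using \<phi> has_integral_const_real[of "m\<^sup>2" a b] ab
    by (intro has_integral_add has_integral_diff has_integral_mult_right integrable_integral) auto
  then have "0 \<le> (integral {a..b} (\<lambda>t. (\<phi> t)\<^sup>2) - 2 * m * integral {a..b} \<phi>) + (b - a) *\<^sub>R m\<^sup>2"
    by (rule has_integral_nonneg) auto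
  moreover have "integral {a..b} \<phi> = m * (b - a)" using False by (simp add: m_def)
  ultimately have "m\<^sup>2 * (b - a) \<le> integral {a..b} (\<lambda>t. (\<phi> t)\<^sup>2)"
    by (simp add: power2_eq_square algebra_simps)
  then have "(b - a) * (m\<^sup>2 * (b - a)) \<le> (b - a) * integral {a..b} (\<lambda>t. (\<phi> t)\<^sup>2)"
    using ab by (intro mult_left_mono) auto
  then show ?thesis
    unfolding \<open>integral {a..b} \<phi> = m * (b - a)\<close> by (simp add: power2_eq_square mult_ac)
qed simp

lemma lebesgue_integral_eq_HK:
  fixes f :: "real \<Rightarrow> real"
  assumes "integrable (lebesgue_on {0..T}) f"
  shows "f integrable_on {0..T}" "integral\<^sup>L (lebesgue_on {0..T}) f = integral {0..T} f"
proof -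
  show "integral\<^sup>L (lebesgue_on {0..T}) f = integral {0..T} f"
    using assms by (intro lebesgue_integral_eq_integral) auto
  have "f absolutely_integrable_on {0..T}"
    using assms by (simp add: integrable_restrict_space set_integrable_def)
  then show "f integrable_on {0..T}" by (rule set_lebesgue_integral_eq_integral(1))
qed

lemma L2_density_integrable_on:
  assumes D: "L2_density T n \<phi>" and i: "i \<in> {1..n}" and ab: "0 \<le> a" "b \<le> T"
  shows "\<phi> i integrable_on {a..b}" "(\<lambda>t. (\<phi> i t)\<^sup>2) integrable_on {a..b}"
proof -
  have 1: "\<phi> i integrable_on {0..T}"
    by (rule set_lebesgue_integral_eq_integral(1)[OF L2_density_absolutely_integrable[OF D i]])
  have 2: "(\<lambda>t. (\<phi> i t)\<^sup>2) integrable_on {0..T}"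
    using D i by (intro lebesgue_integral_eq_HK) (auto simp: L2_density_def)
  show "\<phi> i integrable_on {a..b}" "(\<lambda>t. (\<phi> i t)\<^sup>2) integrable_on {a..b}"
    using integrable_on_subinterval[OF 1, of a b] integrable_on_subinterval[OF 2, of a b] ab by auto
qed

lemma energy_eq_HK:
  assumes "L2_density T n \<phi>"
  shows "energy T n \<phi> = (\<Sum>i=1..n. integral {0..T} (\<lambda>t. (\<phi> i t)\<^sup>2))"
  unfolding energy_def using assms
  by (intro sum.cong refl lebesgue_integral_eq_HK(2)) (auto simp: L2_density_def)

lemma energy_nonneg: "energy T n \<phi> \<ge> 0"
  unfolding energy_def by (intro sum_nonneg Bochner_Integration.integral_nonneg) auto

lemma primitive_increment:
  assumes D: "L2_density T n \<phi>" and i: "i \<in> {1..n}" and st: "0 \<le> s" "s \<le> t" "t \<le> T"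
  shows "primitive \<phi> i t - primitive \<phi> i s = integral {s..t} (\<phi> i)"
  using Henstock_Kurzweil_Integration.integral_combine[of 0 s t "\<phi> i"]
    L2_density_integrable_on(1)[OF D i, of 0 t] st
  by (simp add: primitive_def)

lemma primitive_increment_square:
  assumes D: "L2_density T n \<phi>" and i: "i \<in> {1..n}" and st: "0 \<le> s" "s \<le> t" "t \<le> T"
  shows "(primitive \<phi> i t - primitive \<phi> i s)\<^sup>2 \<le> (t - s) * integral {s..t} (\<lambda>u. (\<phi> i u)\<^sup>2)"
  unfolding primitive_increment[OF assms]
  using st by (intro integral_square_bound L2_density_integrable_on[OF D i]) auto

text \<open>Primitives of bounded energy are uniformly Hoelder continuous of exponent 1/2. This
  gives equicontinuity, and later bounds the motion of a primitive inside a grid cell.\<close>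

lemma primitive_increment_energy:
  assumes D: "L2_density T n \<phi>" and i: "i \<in> {1..n}" and st: "0 \<le> s" "s \<le> t" "t \<le> T"
  shows "(primitive \<phi> i t - primitive \<phi> i s)\<^sup>2 \<le> (t - s) * energy T n \<phi>"
proof -
  have "integral {s..t} (\<lambda>u. (\<phi> i u)\<^sup>2) \<le> integral {0..T} (\<lambda>u. (\<phi> i u)\<^sup>2)"
    using st L2_density_integrable_on(2)[OF D i] by (intro integral_subset_le) auto
  also have "\<dots> \<le> energy T n \<phi>"
    unfolding energy_eq_HK[OF D]
    using i L2_density_integrable_on(2)[OF D] by (intro member_le_sum) (auto intro!: Henstock_Kurzweil_Integration.integral_nonneg)
  finally have "(t - s) * integral {s..t} (\<lambda>u. (\<phi> i u)\<^sup>2) \<le> (t - s) * energy T n \<phi>"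
    using st by (intro mult_left_mono) auto
  then show ?thesis using primitive_increment_square[OF assms] by linarith
qed

lemma L2_density_lincomb:
  assumes "L2_density T n \<phi>" "L2_density T n \<psi>"
  shows "L2_density T n (\<lambda>i t. a * \<phi> i t + b * \<psi> i t)"
  unfolding L2_density_def
proof (intro ballI conjI)
  fix i assume i: "i \<in> {1..n}"
  let ?M = "lebesgue_on {0..T}"
  have [measurable]: "\<phi> i \<in> borel_measurable ?M" "\<psi> i \<in> borel_measurable ?M"
    and int: "integrable ?M (\<lambda>t. (\<phi> i t)\<^sup>2)" "integrable ?M (\<lambda>t. (\<psi> i t)\<^sup>2)"
    using assms i by (auto simp: L2_density_def)
  show "(\<lambda>t. a * \<phi> i t + b * \<psi> i t) \<in> borel_measurable ?M" by measurable
  show "integrable ?M (\<lambda>t. (a * \<phi> i t + b * \<psi> i t)\<^sup>2)"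
  proof (rule Bochner_Integration.integrable_bound)
    show "integrable ?M (\<lambda>t. 2 * a\<^sup>2 * (\<phi> i t)\<^sup>2 + 2 * b\<^sup>2 * (\<psi> i t)\<^sup>2)" using int by auto
    have "(a * x + b * y)\<^sup>2 \<le> 2 * a\<^sup>2 * x\<^sup>2 + 2 * b\<^sup>2 * y\<^sup>2" for x y
      using zero_le_power2[of "a * x - b * y"] by (simp add: power2_eq_square algebra_simps)
    then show "AE t in ?M. norm ((a * \<phi> i t + b * \<psi> i t)\<^sup>2) \<le> norm (2 * a\<^sup>2 * (\<phi> i t)\<^sup>2 + 2 * b\<^sup>2 * (\<psi> i t)\<^sup>2)"
      by (auto intro!: AE_I2 order_trans[OF _ abs_ge_self])
  qed measurable
qed

lemma energy_parallelogram:
  assumes D: "L2_density T n \<phi>" "L2_density T n \<psi>"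
  shows "energy T n (\<lambda>i t. \<phi> i t - \<psi> i t) =
    2 * energy T n \<phi> + 2 * energy T n \<psi> - 4 * energy T n (\<lambda>i t. 1/2 * \<phi> i t + 1/2 * \<psi> i t)"
proof -
  have "(\<integral>t. (\<phi> i t - \<psi> i t)\<^sup>2 \<partial>lebesgue_on {0..T}) =
      2 * (\<integral>t. (\<phi> i t)\<^sup>2 \<partial>lebesgue_on {0..T}) + 2 * (\<integral>t. (\<psi> i t)\<^sup>2 \<partial>lebesgue_on {0..T})
      - 4 * (\<integral>t. (1/2 * \<phi> i t + 1/2 * \<psi> i t)\<^sup>2 \<partial>lebesgue_on {0..T})" if i: "i \<in> {1..n}" for i
  proof -
    have e: "(x - y)\<^sup>2 = 2 * x\<^sup>2 + 2 * y\<^sup>2 - 4 * (1/2 * x + 1/2 * y)\<^sup>2" for x y :: real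
      by (simp add: power2_eq_square field_simps)
    show ?thesis
      unfolding e using D L2_density_lincomb[OF D, of "1/2" "1/2"] i
      by (simp add: L2_density_def)
  qed
  then show ?thesis
    unfolding energy_def by (simp add: sum.distrib sum_subtractf sum_distrib_left)
qed

section \<open>Closedness and compactness of the primitives of bounded energy\<close>

lemma energy_component_le:
  assumes "i \<in> {1..n}"
  shows "(\<integral>t. (\<phi> i t)\<^sup>2 \<partial>lebesgue_on {0..T}) \<le> energy T n \<phi>"
  unfolding energy_def using assms by (intro member_le_sum) auto

text \<open>Weak lower semicontinuity without weak topologies: the densities whose primitives lie uniformly within
  \<open>1/(m+1)\<close> of \<open>h\<close> form decreasing convex sets, and by the parallelogram identity almost minimisers of the energy on
  them form a Cauchy sequence.\<close>

lemma primitive_limit: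
  assumes D: "\<And>k. L2_density T n (\<phi> k)"
    and E: "\<And>k. energy T n (\<phi> k) \<le> E k" "E \<longlonglongrightarrow> E\<^sub>0"
    and lim: "\<And>e. e > 0 \<Longrightarrow> \<exists>N. \<forall>k\<ge>N. \<forall>i\<in>{1..n}. \<forall>t\<in>{0..T}. \<bar>primitive (\<phi> k) i t - h i t\<bar> < e"
  shows "\<exists>\<psi>. L2_density T n \<psi> \<and> energy T n \<psi> \<le> E\<^sub>0 \<and> (\<forall>i\<in>{1..n}. \<forall>t\<in>{0..T}. primitive \<psi> i t = h i t)"
proof -
  let ?M = "lebesgue_on {0..T}"
  define S where "S = (\<lambda>m::nat. {\<psi>. L2_density T n \<psi> \<and>
    (\<forall>i\<in>{1..n}. \<forall>t\<in>{0..T}. \<bar>primitive \<psi> i t - h i t\<bar> \<le> 1 / (real m + 1))})"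
  \<comment> \<open>The constraint sets decrease, so their least energies increase. Each of these is
    at most \<open>E\<^sub>0\<close>, because the given densities eventually satisfy every
    constraint.\<close>
  define d where "d = (\<lambda>m. Inf (energy T n ` S m))"
  have bdd: "bdd_below (energy T n ` A)" for A by (rule bdd_belowI[of _ 0]) (auto simp: energy_nonneg)
  have ev: "\<exists>N. \<forall>k\<ge>N. \<phi> k \<in> S m" for m
  proof -
    obtain N where N: "\<forall>k\<ge>N. \<forall>i\<in>{1..n}. \<forall>t\<in>{0..T}. \<bar>primitive (\<phi> k) i t - h i t\<bar> < 1 / (real m + 1)"
      using lim[of "1 / (real m + 1)"] by auto
    have "\<forall>k\<ge>N. \<phi> k \<in> S m" unfolding S_def using D N less_imp_le by blast
    then show ?thesis by blast
  qed
  have ne: "S m \<noteq> {}" for m using ev[of m] by blast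
  have Sm: "S m' \<subseteq> S m" if "m \<le> m'" for m m'
  proof -
    have "1 / (real m' + 1) \<le> 1 / (real m + 1)" using that by (simp add: frac_le)
    then show ?thesis unfolding S_def using order_trans by blast
  qed
  have "incseq d"
    unfolding d_def by (intro monoI cInf_superset_mono image_mono Sm bdd) (use ne in auto)
  have dE: "d m \<le> E\<^sub>0" for m
  proof -
    obtain N where N: "\<forall>k\<ge>N. \<phi> k \<in> S m" using ev by blast
    have "d m \<le> E k" if "k \<ge> N" for k
      using cInf_lower[OF imageI[of "\<phi> k" "S m" "energy T n"] bdd] N that E(1)[of k]
      unfolding d_def by fastforce
    then show ?thesis by (intro LIMSEQ_le_const[OF E(2)]) blast
  qed
  obtain dl where dl: "d \<longlonglongrightarrow> dl" "\<And>m. d m \<le> dl"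
    using incseq_convergent[OF \<open>incseq d\<close>, of E\<^sub>0] dE by auto
  have dlE: "dl \<le> E\<^sub>0" by (rule LIMSEQ_le_const2[OF dl(1)]) (use dE in auto)
  \<comment> \<open>A tolerance of 4^(-k) in the energies leads to L2 distances of order 2^(-k),
    which are summable.\<close>
  have "\<exists>\<psi> m. \<psi> \<in> S m \<and> k \<le> m \<and> dl - (1/4)^k \<le> d m \<and> energy T n \<psi> \<le> dl + (1/4)^k" for k :: nat
  proof -
    have "\<forall>\<^sub>F m in sequentially. dl - (1/4)^k < d m"
      using order_tendstoD(1)[OF dl(1), of "dl - (1/4)^k"] by simp
    then obtain m where m: "k \<le> m" "dl - (1/4)^k < d m"
      using eventually_conj[OF _ eventually_ge_at_top[of k]] eventually_happens[of _ sequentially]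
      by (metis (mono_tags, lifting) eventually_at_top_linorder nle_le)
    have "\<exists>a\<in>energy T n ` S m. a < d m + (1/4)^k"
      using cInf_lessD[of "energy T n ` S m" "d m + (1/4)^k"] ne unfolding d_def by auto
    then obtain \<psi> where "\<psi> \<in> S m" "energy T n \<psi> < d m + (1/4)^k" by auto
    then show ?thesis using m dl(2)[of m] by (intro exI[of _ \<psi>] exI[of _ m]) auto
  qed
  then obtain g m where g: "\<And>k. g k \<in> S (m k)" "\<And>k. k \<le> m k" "\<And>k::nat. dl - (1/4)^k \<le> d (m k)"
    "\<And>k. energy T n (g k) \<le> dl + (1/4)^k" by metis
  have gD: "L2_density T n (g k)" for k using g(1)[of k] by (simp add: S_def)
  \<comment> \<open>By convexity the midpoint of two near minimisers lies in the larger of their two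
    sets, so its energy is at least dl - 4^(-k). The parallelogram identity then leaves 2 + 2 + 4 =
    8 times 4^(-k).\<close>
  have diff: "energy T n (\<lambda>i t. g (Suc k) i t - g k i t) \<le> 8 * (1/4)^k" for k
  proof -
    let ?a = "\<lambda>i t. 1/2 * g (Suc k) i t + 1/2 * g k i t"
    let ?m = "min (m k) (m (Suc k))"
    have S: "g k \<in> S ?m" "g (Suc k) \<in> S ?m" using g(1) Sm by (meson min.cobounded1 min.cobounded2 subsetD)+
    have aD: "L2_density T n ?a" by (rule L2_density_lincomb[OF gD gD])
    have "\<bar>primitive ?a i t - h i t\<bar> \<le> 1 / (real ?m + 1)" if i: "i \<in> {1..n}" and t: "t \<in> {0..T}" for i t
    proof -
      have "primitive ?a i t = 1/2 * primitive (g (Suc k)) i t + 1/2 * primitive (g k) i t"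
        unfolding primitive_def
        using L2_density_integrable_on(1)[OF gD i, of 0 t] t
        by (subst Henstock_Kurzweil_Integration.integral_add) (auto intro!: integrable_on_cmult_left)
      moreover have "\<bar>primitive (g k) i t - h i t\<bar> \<le> 1 / (real ?m + 1)"
        "\<bar>primitive (g (Suc k)) i t - h i t\<bar> \<le> 1 / (real ?m + 1)"
        using S i t unfolding S_def by blast+
      ultimately show ?thesis by linarith
    qed
    then have "?a \<in> S ?m" using aD unfolding S_def by blast
    then have "d ?m \<le> energy T n ?a" unfolding d_def by (intro cInf_lower bdd imageI)
    moreover have "dl - (1/4)^k \<le> d ?m"
    proof -
      have "(1/4)^Suc k \<le> (1/4 :: real)^k" by (intro power_decreasing) auto
      then have "dl - (1/4)^k \<le> d (m (Suc k))" using g(3)[of "Suc k"] by linarith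
      then show ?thesis using g(3)[of k] by (simp add: min_def)
    qed
    moreover have "(1/4)^Suc k \<le> (1/4 :: real)^k" by (intro power_decreasing) auto
    ultimately show ?thesis
      using g(4)[of k] g(4)[of "Suc k"] energy_parallelogram[OF gD gD, of "Suc k" k] by linarith
  qed
  have exG: "\<exists>G. integrable ?M G \<and> (AE t in ?M. convergent (\<lambda>k. g k i t) \<and> (\<forall>k. \<bar>g k i t\<bar> \<le> G t))"
    if i: "i \<in> {1..n}" for i
  proof (rule absolutely_summable_increments_AE)
    fix k
    show "integrable ?M (g k i)"
      using gD[of k] i by (rule_tac integrable_of_square_integrable[OF finite_measure_lebesgue_Icc]) (auto simp: L2_density_def)
  next
    let ?u = "\<lambda>k t. g (Suc k) i t - g k i t"
    have uD: "L2_density T n (\<lambda>i t. g (Suc k) i t - g k i t)" for k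
      using L2_density_lincomb[OF gD gD, of 1 "Suc k" "-1" k] by simp
    have u: "integrable ?M (?u k)" "integrable ?M (\<lambda>t. (?u k t)\<^sup>2)" for k
      using uD[of k] i integrable_of_square_integrable[OF finite_measure_lebesgue_Icc, of "?u k"]
      by (auto simp: L2_density_def)
    have le: "(\<integral>t. \<bar>?u k t\<bar> \<partial>?M) \<le> (8 + measure ?M (space ?M)) * (1/2)^k" for k
    proof -
      interpret finite_measure ?M by (rule finite_measure_lebesgue_Icc)
      \<comment> \<open>Young's inequality with weights that balance a squared norm of order 4^(-k)
        and the constant term, both contributing order 2^(-k).\<close>
      have "\<bar>x\<bar> \<le> 2^k * x\<^sup>2 + (1/2)^k" for x :: real
      proof -
        have "0 \<le> (1/2)^k * (2^k * \<bar>x\<bar> - 1)\<^sup>2" by simp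
        also have "\<dots> = 2^k * x\<^sup>2 - 2 * \<bar>x\<bar> + (1/2)^k"
          by (simp add: power2_eq_square algebra_simps power_one_over)
        finally show ?thesis by (smt (verit) zero_le_power abs_ge_zero)
      qed
      then have "(\<integral>t. \<bar>?u k t\<bar> \<partial>?M) \<le> (\<integral>t. 2^k * (?u k t)\<^sup>2 + (1/2)^k \<partial>?M)"
        using u[of k] by (intro integral_mono) auto
      also have "\<dots> = 2^k * (\<integral>t. (?u k t)\<^sup>2 \<partial>?M) + (1/2)^k * measure ?M (space ?M)"
        using u[of k] by simp
      also have "\<dots> \<le> 2^k * (8 * (1/4)^k) + (1/2)^k * measure ?M (space ?M)"
        using energy_component_le[OF i, where T = T and \<phi> = "\<lambda>i t. g (Suc k) i t - g k i t"] diff[of k]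
        by (intro add_right_mono mult_left_mono) auto
      also have "(2::real)^k * (8 * (1/4)^k) = 8 * (2 * (1/4))^k" by (simp only: power_mult_distrib mult_ac)
      finally show ?thesis by (simp add: algebra_simps)
    qed
    show "summable (\<lambda>k. \<integral>t. \<bar>?u k t\<bar> \<partial>?M)"
    proof (rule summable_comparison_test'[where N = 0])
      show "summable (\<lambda>k. (8 + measure ?M (space ?M)) * (1/2)^k)"
        by (intro summable_mult summable_geometric) simp
      show "norm (\<integral>t. \<bar>?u k t\<bar> \<partial>?M) \<le> (8 + measure ?M (space ?M)) * (1/2)^k" for k
        using le[of k] by (simp only: real_norm_def abs_of_nonneg Bochner_Integration.integral_nonneg abs_ge_zero)
    qed
  qed
  define G where "G = (\<lambda>i. SOME G. integrable ?M G \<and>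
    (AE t in ?M. convergent (\<lambda>k. g k i t) \<and> (\<forall>k. \<bar>g k i t\<bar> \<le> G t)))"
  have G: "integrable ?M (G i)" "AE t in ?M. convergent (\<lambda>k. g k i t) \<and> (\<forall>k. \<bar>g k i t\<bar> \<le> G i t)"
    if "i \<in> {1..n}" for i
    using someI_ex[OF exG[OF that]] unfolding G_def by (rule conjunct1, rule conjunct2)
  define \<psi> where "\<psi> = (\<lambda>i t. lim (\<lambda>k. g k i t))"
  have gm: "g k i \<in> borel_measurable ?M" if "i \<in> {1..n}" for k i using gD[of k] that by (auto simp: L2_density_def)
  have \<psi>m: "\<psi> i \<in> borel_measurable ?M" if "i \<in> {1..n}" for i
    unfolding \<psi>_def using gm[OF that] by measurable
  have conv: "AE t in ?M. \<forall>i\<in>{1..n}. (\<lambda>k. g k i t) \<longlonglongrightarrow> \<psi> i t \<and> (\<forall>k. \<bar>g k i t\<bar> \<le> G i t)"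
    using G(2) by (subst AE_ball_countable) (auto simp: \<psi>_def convergent_LIMSEQ_iff elim!: eventually_mono)
  \<comment> \<open>Fatou's lemma, the energy of \<open>g k\<close> being at most dl +
    4^(-k).\<close>
  have nn: "(\<integral>\<^sup>+t. ennreal (\<Sum>i=1..n. (\<psi> i t)\<^sup>2) \<partial>?M) \<le> ennreal dl"
  proof -
    have "(\<integral>\<^sup>+t. ennreal (\<Sum>i=1..n. (\<psi> i t)\<^sup>2) \<partial>?M) = (\<integral>\<^sup>+t. liminf (\<lambda>k. ennreal (\<Sum>i=1..n. (g k i t)\<^sup>2)) \<partial>?M)"
    proof (intro nn_integral_cong_AE, use conv in eventually_elim)
      case (elim t)
      then have "(\<lambda>k. ennreal (\<Sum>i=1..n. (g k i t)\<^sup>2)) \<longlonglongrightarrow> ennreal (\<Sum>i=1..n. (\<psi> i t)\<^sup>2)"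
        by (intro tendsto_ennrealI tendsto_intros) auto
      then show ?case by (simp add: lim_imp_Liminf)
    qed
    also have "\<dots> \<le> liminf (\<lambda>k. \<integral>\<^sup>+t. ennreal (\<Sum>i=1..n. (g k i t)\<^sup>2) \<partial>?M)"
    proof (rule nn_integral_liminf)
      fix k show "(\<lambda>t. ennreal (\<Sum>i=1..n. (g k i t)\<^sup>2)) \<in> borel_measurable ?M"
        using gm by (intro measurable_compose[OF _ measurable_ennreal] borel_measurable_sum borel_measurable_power) auto
    qed
    also have "\<dots> \<le> liminf (\<lambda>k. ennreal (dl + (1/4)^k))"
    proof (intro Liminf_mono always_eventually allI)
      fix k
      have "(\<integral>\<^sup>+t. ennreal (\<Sum>i=1..n. (g k i t)\<^sup>2) \<partial>?M) = ennreal (\<integral>t. (\<Sum>i=1..n. (g k i t)\<^sup>2) \<partial>?M)"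
        using gD[of k] by (intro nn_integral_eq_integral Bochner_Integration.integrable_sum)
          (auto simp: L2_density_def sum_nonneg)
      also have "(\<integral>t. (\<Sum>i=1..n. (g k i t)\<^sup>2) \<partial>?M) = energy T n (g k)"
        unfolding energy_def using gD[of k] by (intro Bochner_Integration.integral_sum) (auto simp: L2_density_def)
      finally show "(\<integral>\<^sup>+t. ennreal (\<Sum>i=1..n. (g k i t)\<^sup>2) \<partial>?M) \<le> ennreal (dl + (1/4)^k)"
        using g(4)[of k] by (simp add: ennreal_leI)
    qed
    also have "\<dots> = ennreal dl"
    proof (rule lim_imp_Liminf)
      have "(\<lambda>k. dl + (1/4)^k) \<longlonglongrightarrow> dl + 0" by (intro tendsto_intros LIMSEQ_realpow_zero) auto
      then show "(\<lambda>k. ennreal (dl + (1/4)^k)) \<longlonglongrightarrow> ennreal dl" by (intro tendsto_ennrealI) auto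
    qed simp
    finally show ?thesis .
  qed
  have sumint: "integrable ?M (\<lambda>t. \<Sum>i=1..n. (\<psi> i t)\<^sup>2)"
  proof (rule integrableI_nonneg)
    show "(\<lambda>t. \<Sum>i=1..n. (\<psi> i t)\<^sup>2) \<in> borel_measurable ?M"
      using \<psi>m by (intro borel_measurable_sum borel_measurable_power) auto
    show "(\<integral>\<^sup>+t. ennreal (\<Sum>i=1..n. (\<psi> i t)\<^sup>2) \<partial>?M) < \<infinity>"
      using le_less_trans[OF nn ennreal_less_top] by simp
  qed (simp add: sum_nonneg)
  have \<psi>D: "L2_density T n \<psi>"
    unfolding L2_density_def
  proof (intro ballI conjI \<psi>m)
    fix i assume i: "i \<in> {1..n}"
    show "integrable ?M (\<lambda>t. (\<psi> i t)\<^sup>2)"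
    proof (rule Bochner_Integration.integrable_bound[OF sumint])
      show "(\<lambda>t. (\<psi> i t)\<^sup>2) \<in> borel_measurable ?M" using \<psi>m[OF i] by measurable
      show "AE t in ?M. norm ((\<psi> i t)\<^sup>2) \<le> norm (\<Sum>i=1..n. (\<psi> i t)\<^sup>2)"
      proof (rule AE_I2)
        fix t
        have "(\<psi> i t)\<^sup>2 \<le> (\<Sum>i=1..n. (\<psi> i t)\<^sup>2)" using i by (intro member_le_sum) auto
        then show "norm ((\<psi> i t)\<^sup>2) \<le> norm (\<Sum>i=1..n. (\<psi> i t)\<^sup>2)"
          unfolding real_norm_def abs_power2 by (rule order_trans[OF _ abs_ge_self])
      qed
    qed
  qed
  have dl0: "dl \<ge> 0"
  proof -
    have "0 \<le> d 0" unfolding d_def using ne by (intro cInf_greatest) (auto simp: energy_nonneg)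
    then show ?thesis using dl(2)[of 0] by linarith
  qed
  have "energy T n \<psi> = (\<integral>t. (\<Sum>i=1..n. (\<psi> i t)\<^sup>2) \<partial>?M)"
    unfolding energy_def using \<psi>D by (intro Bochner_Integration.integral_sum[symmetric]) (auto simp: L2_density_def)
  also have "ennreal \<dots> = (\<integral>\<^sup>+t. ennreal (\<Sum>i=1..n. (\<psi> i t)\<^sup>2) \<partial>?M)"
    using sumint by (intro nn_integral_eq_integral[symmetric]) (auto simp: sum_nonneg)
  finally have "ennreal (energy T n \<psi>) \<le> ennreal dl" using nn by (simp only:)
  then have "energy T n \<psi> \<le> dl" using dl0 by (simp only: ennreal_le_iff)
  moreover have "primitive \<psi> i t = h i t" if i: "i \<in> {1..n}" and t: "t \<in> {0..T}" for i t
  proof -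
    \<comment> \<open>Written as Lebesgue integrals over the fixed interval [0,T], the primitives at
      \<open>t\<close> pass to the limit by dominated convergence.\<close>
    have prim: "primitive \<theta> i t = (\<integral>s. indicator {0..t} s * \<theta> i s \<partial>?M)" if "L2_density T n \<theta>" for \<theta>
    proof -
      have ai: "(\<lambda>s. indicator {0..t} s *\<^sub>R \<theta> i s) absolutely_integrable_on {0..T}"
        using set_integrable_subset[OF L2_density_absolutely_integrable[OF that i], of "{0..t}"] t
        by (simp add: set_integrable_def Int_absorb1 indicator_inter_arith[symmetric] mult.assoc[symmetric]
            Int_commute[of "{0..T}"])
      then have "integrable ?M (\<lambda>s. indicator {0..t} s * \<theta> i s)"
        by (simp add: integrable_restrict_space set_integrable_def)
      then have "(\<integral>s. indicator {0..t} s * \<theta> i s \<partial>?M) = integral {0..T} (\<lambda>s. indicator {0..t} s * \<theta> i s)"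
        by (rule lebesgue_integral_eq_HK(2))
      also have "\<dots> = integral {0..T} (\<lambda>s. if s \<in> {0..t} then \<theta> i s else 0)"
        by (intro arg_cong[where f = "integral {0..T}"]) (auto simp: indicator_def)
      also have "\<dots> = primitive \<theta> i t"
        unfolding primitive_def using t by (subst integral_restrict_Int) (auto simp: Int_absorb2 Int_absorb1)
      finally show ?thesis by simp
    qed
    have "(\<lambda>k. \<integral>s. indicator {0..t} s * g k i s \<partial>?M) \<longlonglongrightarrow> (\<integral>s. indicator {0..t} s * \<psi> i s \<partial>?M)"
    proof (rule integral_dominated_convergence[where w = "G i"])
      have [measurable]: "{0..t} \<inter> {0..T} \<in> sets ?M" by (simp add: sets_restrict_space_iff)
      have ind: "(\<lambda>s. indicator {0..t} s :: real) \<in> borel_measurable ?M"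
        by (intro measurable_restrict_space1 borel_measurable_indicator) simp
      show "(\<lambda>s. indicator {0..t} s * \<psi> i s) \<in> borel_measurable ?M"
        by (intro borel_measurable_times ind \<psi>m i)
      show "(\<lambda>s. indicator {0..t} s * g k i s) \<in> borel_measurable ?M" for k
        by (intro borel_measurable_times ind gm i)
      show "AE s in ?M. (\<lambda>k. indicator {0..t} s * g k i s) \<longlonglongrightarrow> indicator {0..t} s * \<psi> i s"
        using conv by eventually_elim (use i in \<open>auto intro!: tendsto_intros\<close>)
      show "AE s in ?M. norm (indicator {0..t} s * g k i s) \<le> G i s" for k
        using conv
      proof eventually_elim
        case (elim s)
        then have "\<bar>g k i s\<bar> \<le> G i s" using i by blast
        then show ?case by (auto simp: indicator_def split: if_splits)
      qed
    qed (rule G(1)[OF i])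
    then have 1: "(\<lambda>k. primitive (g k) i t) \<longlonglongrightarrow> primitive \<psi> i t"
      using prim gD \<psi>D by simp
    have "(\<lambda>k. primitive (g k) i t) \<longlonglongrightarrow> h i t"
    proof (rule LIM_zero_cancel, rule Lim_null_comparison)
      show "\<forall>\<^sub>F k in sequentially. norm (primitive (g k) i t - h i t) \<le> 1 / (real k + 1)"
      proof (intro always_eventually allI)
        fix k
        have "\<bar>primitive (g k) i t - h i t\<bar> \<le> 1 / (real (m k) + 1)"
          using g(1)[of k] i t unfolding S_def by blast
        also have "\<dots> \<le> 1 / (real k + 1)" using g(2)[of k] by (simp add: frac_le)
        finally show "norm (primitive (g k) i t - h i t) \<le> 1 / (real k + 1)" by simp
      qed
      show "(\<lambda>k. 1 / (real k + 1)) \<longlonglongrightarrow> 0" using LIMSEQ_inverse_real_of_nat by (simp add: divide_inverse add.commute)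
    qed
    with 1 show ?thesis by (rule LIMSEQ_unique)
  qed
  ultimately show ?thesis using \<psi>D dlE by (intro exI[of _ \<psi>]) auto
qed

text \<open>Arzela-Ascoli with the uniform Hoelder bound. The index joins the time as second
  component of a point in one compact set, so that a single subsequence serves all coordinates at
  once.\<close>

lemma primitive_compactness:
  assumes T: "T > 0" and D: "\<And>k. L2_density T n (\<phi> k)" and B: "\<And>k. energy T n (\<phi> k) \<le> B"
  shows "\<exists>h r. strict_mono (r :: nat \<Rightarrow> nat) \<and>
    (\<forall>e>0. \<exists>N. \<forall>k\<ge>N. \<forall>i\<in>{1..n}. \<forall>t\<in>{0..T}. \<bar>primitive (\<phi> (r k)) i t - h i t\<bar> < e)"
proof -
  define f where "f = (\<lambda>k (p :: real \<times> real). primitive (\<phi> k) (nat \<lfloor>snd p\<rfloor>) (fst p))"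
  let ?S = "{0..T} \<times> real ` {1..n}"
  have B0: "B \<ge> 0" using energy_nonneg[of T n "\<phi> 0"] B[of 0] by linarith
  have inc: "\<bar>primitive (\<phi> k) i t - primitive (\<phi> k) i s\<bar> \<le> sqrt (\<bar>t - s\<bar> * B)"
    if "i \<in> {1..n}" "s \<in> {0..T}" "t \<in> {0..T}" for k i s t
  proof -
    have *: "\<bar>primitive (\<phi> k) i t - primitive (\<phi> k) i s\<bar> \<le> sqrt (\<bar>t - s\<bar> * B)"
      if "i \<in> {1..n}" "s \<le> t" "0 \<le> s" "t \<le> T" for s t
    proof -
      have "(primitive (\<phi> k) i t - primitive (\<phi> k) i s)\<^sup>2 \<le> (t - s) * energy T n (\<phi> k)"
        using primitive_increment_energy[OF D] that by blast
      also have "\<dots> \<le> \<bar>t - s\<bar> * B" using B[of k] that by (intro mult_mono) (auto simp: energy_nonneg)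
      finally show ?thesis by (intro real_le_rsqrt) simp
    qed
    show ?thesis
      using *[of s t] *[of t s] that by (cases "s \<le> t") (auto simp: abs_minus_commute)
  qed
  obtain h r where r: "strict_mono (r :: nat \<Rightarrow> nat)"
    and h: "\<And>e. 0 < e \<Longrightarrow> \<exists>N. \<forall>k x. k \<ge> N \<and> x \<in> ?S \<longrightarrow> norm (f (r k) x - h x) < e"
  proof (rule Arzela_Ascoli[of ?S f "sqrt (T * B)"])
    show "compact ?S" by (intro compact_Times compact_Icc finite_imp_compact) auto
    show "norm (f k x) \<le> sqrt (T * B)" if x: "x \<in> ?S" for k x
    proof -
      have "norm (f k x) \<le> sqrt (\<bar>fst x - 0\<bar> * B)"
        using inc[of "nat \<lfloor>snd x\<rfloor>" 0 "fst x" k] x T by (auto simp: f_def primitive_def)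
      also have "\<dots> \<le> sqrt (T * B)" using x B0 by (intro real_sqrt_le_mono mult_right_mono) auto
      finally show ?thesis .
    qed
    show "\<exists>d>0. \<forall>k y. y \<in> ?S \<and> norm (x - y) < d \<longrightarrow> norm (f k x - f k y) < e" if x: "x \<in> ?S" and e: "0 < e" for x e
    \<comment> \<open>Distance below 1 forces equal indices. The other entry inverts the modulus of
      continuity; \<open>B + 1\<close> is used because \<open>B\<close> may vanish.\<close>
    proof (intro exI[of _ "min 1 (e\<^sup>2 / (B + 1))"] conjI allI impI)
      show "0 < min 1 (e\<^sup>2 / (B + 1))" using e B0 by simp
      fix k y assume y: "y \<in> ?S \<and> norm (x - y) < min 1 (e\<^sup>2 / (B + 1))"
      obtain t i where x': "x = (t, real i)" "t \<in> {0..T}" "i \<in> {1..n}" using x by auto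
      obtain s j where y': "y = (s, real j)" "s \<in> {0..T}" "j \<in> {1..n}" using y by auto
      have le: "\<bar>t - s\<bar> \<le> norm (x - y)" "\<bar>real i - real j\<bar> \<le> norm (x - y)"
        using norm_fst_le[of "t - s" "real i - real j"] norm_snd_le[of "real i - real j" "t - s"]
        by (auto simp: x' y')
      then have "\<bar>real i - real j\<bar> < 1" using y by linarith
      then have [simp]: "i = j" by linarith
      have "\<bar>t - s\<bar> < e\<^sup>2 / (B + 1)" using le y by linarith
      then have "\<bar>t - s\<bar> * (B + 1) < e\<^sup>2" using B0 by (simp add: pos_less_divide_eq)
      then have "\<bar>t - s\<bar> * B < e\<^sup>2" by (simp add: algebra_simps)
      then have "sqrt (\<bar>t - s\<bar> * B) < e" using e by (simp add: real_less_lsqrt B0)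
      then show "norm (f k x - f k y) < e"
        using inc[of i s t k] x' y' by (auto simp: f_def)
    qed
  qed auto
  have "\<exists>N. \<forall>k\<ge>N. \<forall>i\<in>{1..n}. \<forall>t\<in>{0..T}. \<bar>primitive (\<phi> (r k)) i t - h (t, real i)\<bar> < e" if e: "e > 0" for e
  proof -
    obtain N where N: "\<And>k x. k \<ge> N \<Longrightarrow> x \<in> ?S \<Longrightarrow> norm (f (r k) x - h x) < e" using h[OF e] by blast
    have "\<bar>primitive (\<phi> (r k)) i t - h (t, real i)\<bar> < e" if "k \<ge> N" "i \<in> {1..n}" "t \<in> {0..T}" for k i t
      using N[of k "(t, real i)"] that by (auto simp: f_def)
    then show ?thesis by blast
  qed
  then show ?thesis using r by (intro exI[of _ "\<lambda>i t. h (t, real i)"] exI[of _ r]) blast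
qed

section \<open>Gaussian increments and Brownian motion\<close>

lemma (in prob_space) nn_integral_indep_mult:
  fixes G H :: "'a \<Rightarrow> ennreal"
  assumes "indep_var borel G borel H"
  shows "(\<integral>\<^sup>+\<omega>. G \<omega> * H \<omega> \<partial>M) = (\<integral>\<^sup>+\<omega>. G \<omega> \<partial>M) * (\<integral>\<^sup>+\<omega>. H \<omega> \<partial>M)"
proof -
  have "case_bool (borel :: ennreal measure) borel = (\<lambda>_. borel)"
    by (auto simp: fun_eq_iff split: bool.split)
  then have "indep_vars (\<lambda>_. borel) (case_bool G H) UNIV"
    using assms by (simp add: indep_var_def)
  from indep_vars_nn_integral[OF _ this] show ?thesis
    by (simp add: UNIV_bool mult.commute)
qed

text \<open>The sigma-algebra generated by \<open>G\<close> lies in \<open>N\<close>, and that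
  generated by \<open>f (D \<omega>)\<close> in the one generated by \<open>D\<close>; independence
  passes to smaller families.\<close>

lemma (in prob_space) indep_var_subalgebra:
  assumes ind: "indep_set (sets N) (sets (vimage_algebra (space M) D borel))"
    and sub: "subalgebra M N" and G: "G \<in> measurable N S"
    and D: "D \<in> borel_measurable M" and f: "f \<in> measurable borel S'"
  shows "indep_var S G S' (\<lambda>\<omega>. f (D \<omega>))"
  unfolding indep_var_eq
proof (intro conjI)
  show "random_variable S G" by (rule measurable_from_subalg[OF sub G])
  show "random_variable S' (\<lambda>\<omega>. f (D \<omega>))" by (rule measurable_compose[OF D f])
  have sp: "space N = space M" using sub by (simp add: subalgebra_def)
  have "sigma_sets (space M) {G -` A \<inter> space M |A. A \<in> sets S} \<subseteq> sets N"
    unfolding sp[symmetric] using G by (intro sets.sigma_sets_subset) (auto intro: measurable_sets)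
  moreover have "sigma_sets (space M) {(\<lambda>\<omega>. f (D \<omega>)) -` A \<inter> space M |A. A \<in> sets S'}
      \<subseteq> sets (vimage_algebra (space M) D borel)"
  proof -
    have "{(\<lambda>\<omega>. f (D \<omega>)) -` A \<inter> space M |A. A \<in> sets S'} \<subseteq> sets (vimage_algebra (space M) D borel)"
    proof safe
      fix A assume "A \<in> sets S'"
      then have "f -` A \<in> sets borel" using measurable_sets[OF f] by simp
      from in_vimage_algebra[OF this, of D "space M"]
      show "(\<lambda>\<omega>. f (D \<omega>)) -` A \<inter> space M \<in> sets (vimage_algebra (space M) D borel)"
        by (simp add: vimage_def)
    qed
    from sets.sigma_sets_subset[OF this] show ?thesis by simp
  qed
  ultimately show "indep_set (sigma_sets (space M) {G -` A \<inter> space M |A. A \<in> sets S})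
      (sigma_sets (space M) {(\<lambda>\<omega>. f (D \<omega>)) -` A \<inter> space M |A. A \<in> sets S'})"
    using ind unfolding indep_set_def
    by (elim indep_sets_mono_sets) (auto split: bool.split)
qed

text \<open>Completing the square: an exponential tilt moves the mean and costs a constant factor,
  which is the moment generating function.\<close>

lemma normal_density_shift:
  assumes "\<sigma> > 0"
  shows "normal_density 0 \<sigma> x * exp (\<theta> * x) = exp (\<theta>\<^sup>2 * \<sigma>\<^sup>2 / 2) * normal_density (\<theta> * \<sigma>\<^sup>2) \<sigma> x"
proof -
  have "- x\<^sup>2 / (2 * \<sigma>\<^sup>2) + \<theta> * x = \<theta>\<^sup>2 * \<sigma>\<^sup>2 / 2 + - (x - \<theta> * \<sigma>\<^sup>2)\<^sup>2 / (2 * \<sigma>\<^sup>2)"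
    using assms by (simp add: field_simps power2_eq_square)
  then have "exp (- x\<^sup>2 / (2 * \<sigma>\<^sup>2)) * exp (\<theta> * x) =
      exp (\<theta>\<^sup>2 * \<sigma>\<^sup>2 / 2) * exp (- (x - \<theta> * \<sigma>\<^sup>2)\<^sup>2 / (2 * \<sigma>\<^sup>2))"
    unfolding exp_add[symmetric] by simp
  then show ?thesis unfolding normal_density_def by (simp add: mult.assoc mult.left_commute)
qed

text \<open>A quadratic tilt only changes the variance, to \<sigma>^2 / (1 - \<theta>); for this to
  be positive \<theta> must stay below 1.\<close>

lemma normal_density_rescale:
  assumes "\<sigma> > 0" "\<theta> < 1"
  shows "normal_density 0 \<sigma> x * exp (\<theta> * (x\<^sup>2 / (2 * \<sigma>\<^sup>2))) =
    1 / sqrt (1 - \<theta>) * normal_density 0 (\<sigma> / sqrt (1 - \<theta>)) x"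
proof -
  have "exp (- x\<^sup>2 / (2 * \<sigma>\<^sup>2)) * exp (\<theta> * (x\<^sup>2 / (2 * \<sigma>\<^sup>2))) = exp (- x\<^sup>2 * (1 - \<theta>) / (2 * \<sigma>\<^sup>2))"
    unfolding exp_add[symmetric] by (simp add: right_diff_distrib diff_divide_distrib)
  moreover have "2 * (\<sigma> / sqrt (1 - \<theta>))\<^sup>2 = 2 * \<sigma>\<^sup>2 / (1 - \<theta>)"
    using assms by (simp add: power_divide)
  moreover have "1 / sqrt (2 * pi * \<sigma>\<^sup>2) = 1 / sqrt (1 - \<theta>) * (1 / sqrt (2 * pi * (\<sigma> / sqrt (1 - \<theta>))\<^sup>2))"
    using assms by (simp add: power_divide real_sqrt_divide real_sqrt_mult)
  ultimately show ?thesis unfolding normal_density_def by (simp add: mult.assoc)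
qed

lemma nn_integral_normal_density:
  assumes "\<sigma> > 0"
  shows "(\<integral>\<^sup>+x. ennreal (normal_density \<mu> \<sigma> x) \<partial>lborel) = 1"
  using assms by (subst nn_integral_eq_integral) auto

context prob_space
begin

lemma normal_exp_moment:
  assumes D: "distributed M lborel D (\<lambda>x. ennreal (normal_density 0 \<sigma> x))" and \<sigma>: "\<sigma> > 0"
  shows "(\<integral>\<^sup>+\<omega>. ennreal (exp (\<theta> * D \<omega>)) \<partial>M) = ennreal (exp (\<theta>\<^sup>2 * \<sigma>\<^sup>2 / 2))"
proof -
  have "(\<integral>\<^sup>+\<omega>. ennreal (exp (\<theta> * D \<omega>)) \<partial>M) =
      (\<integral>\<^sup>+x. ennreal (normal_density 0 \<sigma> x) * ennreal (exp (\<theta> * x)) \<partial>lborel)"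
    by (rule distributed_nn_integral[OF D, symmetric]) measurable
  also have "\<dots> = (\<integral>\<^sup>+x. ennreal (exp (\<theta>\<^sup>2 * \<sigma>\<^sup>2 / 2)) * ennreal (normal_density (\<theta> * \<sigma>\<^sup>2) \<sigma> x) \<partial>lborel)"
    by (intro nn_integral_cong) (simp add: ennreal_mult[symmetric] normal_density_shift[OF \<sigma>])
  also have "\<dots> = ennreal (exp (\<theta>\<^sup>2 * \<sigma>\<^sup>2 / 2))"
    by (subst nn_integral_cmult) (auto simp: nn_integral_normal_density[OF \<sigma>])
  finally show ?thesis .
qed

lemma normal_square_exp_moment:
  assumes D: "distributed M lborel D (\<lambda>x. ennreal (normal_density 0 \<sigma> x))" and \<sigma>: "\<sigma> > 0" and \<theta>: "\<theta> < 1"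
  shows "(\<integral>\<^sup>+\<omega>. ennreal (exp (\<theta> * ((D \<omega>)\<^sup>2 / (2 * \<sigma>\<^sup>2)))) \<partial>M) = ennreal (1 / sqrt (1 - \<theta>))"
proof -
  have s: "\<sigma> / sqrt (1 - \<theta>) > 0" using \<sigma> \<theta> by simp
  have "(\<integral>\<^sup>+\<omega>. ennreal (exp (\<theta> * ((D \<omega>)\<^sup>2 / (2 * \<sigma>\<^sup>2)))) \<partial>M) =
      (\<integral>\<^sup>+x. ennreal (normal_density 0 \<sigma> x) * ennreal (exp (\<theta> * (x\<^sup>2 / (2 * \<sigma>\<^sup>2)))) \<partial>lborel)"
    by (rule distributed_nn_integral[OF D, symmetric]) measurable
  also have "\<dots> = (\<integral>\<^sup>+x. ennreal (1 / sqrt (1 - \<theta>)) * ennreal (normal_density 0 (\<sigma> / sqrt (1 - \<theta>)) x) \<partial>lborel)"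
    using \<theta> by (intro nn_integral_cong) (simp only: ennreal_mult[symmetric] normal_density_rescale[OF \<sigma> \<theta>]
      normal_density_nonneg exp_ge_zero zero_le_divide_1_iff real_sqrt_ge_zero diff_ge_0_iff_ge less_imp_le)
  also have "\<dots> = ennreal (1 / sqrt (1 - \<theta>))"
    by (subst nn_integral_cmult) (auto simp: nn_integral_normal_density[OF s])
  finally show ?thesis .
qed

lemma normal_uminus:
  assumes D: "distributed M lborel D (\<lambda>x. ennreal (normal_density 0 \<sigma> x))" and \<sigma>: "\<sigma> > 0"
  shows "distributed M lborel (\<lambda>\<omega>. - D \<omega>) (\<lambda>x. ennreal (normal_density 0 \<sigma> x))"
  using normal_density_affine[OF D \<sigma>, of "-1" 0] by simp

lemma normal_tail:
  assumes D: "distributed M lborel D (\<lambda>x. ennreal (normal_density 0 \<sigma> x))" and \<sigma>: "\<sigma> > 0" and r: "r \<ge> 0"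
  shows "prob {\<omega>\<in>space M. D \<omega> \<ge> r} \<le> exp (- r\<^sup>2 / (2 * \<sigma>\<^sup>2))"
proof -
  have [measurable]: "D \<in> borel_measurable M" using distributed_measurable[OF D] by simp
  \<comment> \<open>Chernoff's bound; this parameter minimises \<theta>^2 \<sigma>^2 / 2 - \<theta>
    r.\<close>
  define \<theta> where "\<theta> = r / \<sigma>\<^sup>2"
  have \<theta>: "\<theta> \<ge> 0" using r by (simp add: \<theta>_def)
  have "ennreal (exp (\<theta> * r)) * emeasure M {\<omega>\<in>space M. D \<omega> \<ge> r} =
      (\<integral>\<^sup>+\<omega>. ennreal (exp (\<theta> * r)) * indicator {\<omega>\<in>space M. D \<omega> \<ge> r} \<omega> \<partial>M)"
    by (subst nn_integral_cmult_indicator) auto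
  also have "\<dots> \<le> (\<integral>\<^sup>+\<omega>. ennreal (exp (\<theta> * D \<omega>)) \<partial>M)"
    using \<theta> by (intro nn_integral_mono) (auto simp: indicator_def intro!: mult_left_mono)
  also have "\<dots> = ennreal (exp (\<theta>\<^sup>2 * \<sigma>\<^sup>2 / 2))" by (rule normal_exp_moment[OF D \<sigma>])
  finally have "exp (\<theta> * r) * prob {\<omega>\<in>space M. D \<omega> \<ge> r} \<le> exp (\<theta>\<^sup>2 * \<sigma>\<^sup>2 / 2)"
    by (simp add: emeasure_eq_measure ennreal_mult[symmetric])
  then have "prob {\<omega>\<in>space M. D \<omega> \<ge> r} \<le> exp (\<theta>\<^sup>2 * \<sigma>\<^sup>2 / 2) / exp (\<theta> * r)"
    by (simp add: pos_le_divide_eq mult.commute)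
  also have "\<dots> = exp (\<theta>\<^sup>2 * \<sigma>\<^sup>2 / 2 - \<theta> * r)" by (simp add: exp_diff)
  also have "\<theta>\<^sup>2 * \<sigma>\<^sup>2 / 2 - \<theta> * r = - r\<^sup>2 / (2 * \<sigma>\<^sup>2)"
    using \<sigma> by (simp add: \<theta>_def field_simps power2_eq_square)
  finally show ?thesis .
qed

lemma normal_abs_tail:
  assumes D: "distributed M lborel D (\<lambda>x. ennreal (normal_density 0 \<sigma> x))" and \<sigma>: "\<sigma> > 0" and r: "r \<ge> 0"
  shows "prob {\<omega>\<in>space M. \<bar>D \<omega>\<bar> \<ge> r} \<le> 2 * exp (- r\<^sup>2 / (2 * \<sigma>\<^sup>2))"
proof -
  have [measurable]: "D \<in> borel_measurable M" using distributed_measurable[OF D] by simp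
  have "prob {\<omega>\<in>space M. \<bar>D \<omega>\<bar> \<ge> r} \<le> prob ({\<omega>\<in>space M. D \<omega> \<ge> r} \<union> {\<omega>\<in>space M. - D \<omega> \<ge> r})"
    by (intro finite_measure_mono) auto
  also have "\<dots> \<le> prob {\<omega>\<in>space M. D \<omega> \<ge> r} + prob {\<omega>\<in>space M. - D \<omega> \<ge> r}"
    by (intro measure_Un_le) auto
  also have "\<dots> \<le> 2 * exp (- r\<^sup>2 / (2 * \<sigma>\<^sup>2))"
    using normal_tail[OF D \<sigma> r] normal_tail[OF normal_uminus[OF D \<sigma>] \<sigma> r] by simp
  finally show ?thesis .
qed

text \<open>\<open>D\<close> and its negative have the same law, and the two events together cover
  the space.\<close>

lemma normal_nonneg_half:
  assumes D: "distributed M lborel D (\<lambda>x. ennreal (normal_density 0 \<sigma> x))" and \<sigma>: "\<sigma> > 0"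
  shows "prob {\<omega>\<in>space M. D \<omega> \<ge> 0} \<ge> 1/2"
proof -
  note D' = normal_uminus[OF D \<sigma>]
  have [measurable]: "D \<in> borel_measurable M" using distributed_measurable[OF D] by simp
  have "emeasure M (D -` {0..} \<inter> space M) = emeasure M ((\<lambda>\<omega>. - D \<omega>) -` {0..} \<inter> space M)"
    using distributed_emeasure[OF D, of "{0..}"] distributed_emeasure[OF D', of "{0..}"] by simp
  then have "prob {\<omega>\<in>space M. D \<omega> \<ge> 0} = prob {\<omega>\<in>space M. - D \<omega> \<ge> 0}"
    by (simp add: measure_def vimage_def Int_def conj_commute)
  moreover have "1 \<le> prob {\<omega>\<in>space M. D \<omega> \<ge> 0} + prob {\<omega>\<in>space M. - D \<omega> \<ge> 0}"
  proof -
    have "1 = prob ({\<omega>\<in>space M. D \<omega> \<ge> 0} \<union> {\<omega>\<in>space M. - D \<omega> \<ge> 0})"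
      unfolding prob_space[symmetric] by (intro arg_cong[where f = prob]) auto
    also have "\<dots> \<le> prob {\<omega>\<in>space M. D \<omega> \<ge> 0} + prob {\<omega>\<in>space M. - D \<omega> \<ge> 0}"
      by (intro measure_Un_le) auto
    finally show ?thesis .
  qed
  ultimately show ?thesis by linarith
qed

text \<open>Shifting a symmetric interval by \<open>d\<close> multiplies its Gaussian mass by at least \<open>e\<^bsup>-d\<^sup>2/2\<sigma>\<^sup>2\<^esup>\<close>, because the
  remaining factor \<open>e\<^bsup>-xd/\<sigma>\<^sup>2\<^esup>\<close> symmetrises to \<open>cosh \<ge> 1\<close>. This replaces the Girsanov transform in the lower bound.\<close>

lemma normal_shifted_interval:
  assumes D: "distributed M lborel D (\<lambda>x. ennreal (normal_density 0 \<sigma> x))" and \<sigma>: "\<sigma> > 0"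
  shows "exp (- d\<^sup>2 / (2 * \<sigma>\<^sup>2)) * prob {\<omega>\<in>space M. \<bar>D \<omega>\<bar> < r} \<le> prob {\<omega>\<in>space M. \<bar>D \<omega> - d\<bar> < r}"
proof -
  let ?n = "normal_density 0 \<sigma>" and ?J = "{-r<..<r}"
  have int: "integrable lborel (\<lambda>x. ?n (x + c) * indicator ?J x)"
    "integrable lborel (\<lambda>x. ?n (c - x) * indicator ?J x)" for c
  proof -
    have "integrable lborel (\<lambda>x. ?n (c + 1 * x))" "integrable lborel (\<lambda>x. ?n (c + (-1) * x))"
      using \<sigma> by (intro lborel_integrable_real_affine; simp)+
    then show "integrable lborel (\<lambda>x. ?n (x + c) * indicator ?J x)"
      "integrable lborel (\<lambda>x. ?n (c - x) * indicator ?J x)"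
      by (auto intro!: integrable_real_mult_indicator simp: add.commute)
  qed
  have P: "prob {\<omega>\<in>space M. \<bar>D \<omega> - c\<bar> < r} = (\<integral>x. ?n (x + c) * indicator ?J x \<partial>lborel)" for c
  proof -
    have "prob {\<omega>\<in>space M. \<bar>D \<omega> - c\<bar> < r} = (\<integral>\<omega>. indicator {c - r<..<c + r} (D \<omega>) \<partial>M)"
    proof -
      have [measurable]: "D \<in> borel_measurable M" using distributed_measurable[OF D] by simp
      have "(\<integral>\<omega>. (indicator {c - r<..<c + r} (D \<omega>) :: real) \<partial>M) = (\<integral>\<omega>. indicator {\<omega>\<in>space M. \<bar>D \<omega> - c\<bar> < r} \<omega> \<partial>M)"
        by (intro Bochner_Integration.integral_cong) (auto simp: indicator_def abs_less_iff)
      then show ?thesis by simp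
    qed
    also have "\<dots> = (\<integral>x. ?n x * indicator {c - r<..<c + r} x \<partial>lborel)"
      by (rule distributed_integral[OF D, symmetric]) (auto simp: normal_density_nonneg)
    also have "\<dots> = (\<integral>x. ?n (c + 1 * x) * indicator {c - r<..<c + r} (c + 1 * x) \<partial>lborel)"
      by (subst lborel_integral_real_affine[where c = 1 and t = c]) auto
    also have "\<dots> = (\<integral>x. ?n (x + c) * indicator ?J x \<partial>lborel)"
      by (intro Bochner_Integration.integral_cong) (auto simp: indicator_def add.commute)
    finally show ?thesis .
  qed
  \<comment> \<open>Reflecting the symmetric window writes the shifted mass as the mean of two
    integrals, so that the pointwise bound \<open>pt\<close> on the mean of the two densities can be
    integrated.\<close>
  have refl: "(\<integral>x. ?n (x + d) * indicator ?J x \<partial>lborel) = (\<integral>x. ?n (d - x) * indicator ?J x \<partial>lborel)"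
    by (subst lborel_integral_real_affine[where c = "-1" and t = 0])
      (auto intro!: Bochner_Integration.integral_cong simp: indicator_def)
  have pt: "exp (- d\<^sup>2 / (2 * \<sigma>\<^sup>2)) * ?n x \<le> 1/2 * ?n (x + d) + 1/2 * ?n (d - x)" for x
  proof -
    let ?a = "exp (- d\<^sup>2 / (2 * \<sigma>\<^sup>2)) * ?n x"
    have 1: "?n (x + d) = ?a * exp (- (x * d) / \<sigma>\<^sup>2)" "?n (d - x) = ?a * exp (x * d / \<sigma>\<^sup>2)"
      unfolding normal_density_def using \<sigma>
      by (auto simp: exp_add[symmetric] mult.assoc mult.left_commute[of "exp _" "1 / _"] field_simps power2_eq_square
          intro!: arg_cong[where f = exp])
    have "1 \<le> cosh (x * d / \<sigma>\<^sup>2)" by (rule cosh_real_ge_1)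
    then have "1 \<le> 1/2 * exp (- (x * d) / \<sigma>\<^sup>2) + 1/2 * exp (x * d / \<sigma>\<^sup>2)"
      by (simp add: cosh_def)
    then have "?a * 1 \<le> ?a * (1/2 * exp (- (x * d) / \<sigma>\<^sup>2) + 1/2 * exp (x * d / \<sigma>\<^sup>2))"
      by (intro mult_left_mono) auto
    then show ?thesis unfolding 1 by (simp add: algebra_simps)
  qed
  have "exp (- d\<^sup>2 / (2 * \<sigma>\<^sup>2)) * (\<integral>x. ?n (x + 0) * indicator ?J x \<partial>lborel)
      = (\<integral>x. exp (- d\<^sup>2 / (2 * \<sigma>\<^sup>2)) * (?n (x + 0) * indicator ?J x) \<partial>lborel)" by simp
  also have "\<dots> \<le> (\<integral>x. 1/2 * (?n (x + d) * indicator ?J x) + 1/2 * (?n (d - x) * indicator ?J x) \<partial>lborel)"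
  proof (rule integral_mono)
    show "integrable lborel (\<lambda>x. exp (- d\<^sup>2 / (2 * \<sigma>\<^sup>2)) * (?n (x + 0) * indicator ?J x))"
      by (intro integrable_mult_right int)
    show "integrable lborel (\<lambda>x. 1/2 * (?n (x + d) * indicator ?J x) + 1/2 * (?n (d - x) * indicator ?J x))"
      by (intro Bochner_Integration.integrable_add integrable_mult_right int)
    show "exp (- d\<^sup>2 / (2 * \<sigma>\<^sup>2)) * (?n (x + 0) * indicator ?J x)
        \<le> 1/2 * (?n (x + d) * indicator ?J x) + 1/2 * (?n (d - x) * indicator ?J x)" for x
      using pt[of x] by (auto simp: indicator_def)
  qed
  also have "\<dots> = 1/2 * (\<integral>x. ?n (x + d) * indicator ?J x \<partial>lborel) + 1/2 * (\<integral>x. ?n (d - x) * indicator ?J x \<partial>lborel)"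
    using int by (subst Bochner_Integration.integral_add) (auto simp del: integral_mult_right_zero intro!: integrable_mult_right)
  also have "\<dots> = (\<integral>x. ?n (x + d) * indicator ?J x \<partial>lborel)" unfolding refl by simp
  finally show ?thesis using P[of d] P[of 0] by simp
qed

end

section \<open>Maximal inequalities for Brownian motion\<close>

lemma brownian_motion_uminus:
  assumes "prob_space M" "usual_filtration M Fil" and b: "brownian_motion M Fil b"
  shows "brownian_motion M Fil (\<lambda>t \<omega>. - b t \<omega>)"
  unfolding brownian_motion_def
proof (intro conjI allI impI)
  interpret prob_space M by fact
  show "(\<lambda>\<omega>. - b t \<omega>) \<in> borel_measurable (Fil t)" if "0 \<le> t" for t
    using b that by (auto simp: brownian_motion_def)
  show "AE \<omega> in M. - b 0 \<omega> = 0" using b by (auto simp: brownian_motion_def)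
  show "AE \<omega> in M. continuous_on {0..} (\<lambda>t. - b t \<omega>)"
    using b by (auto simp: brownian_motion_def intro: continuous_on_minus elim: eventually_mono)
  fix s t :: real assume st: "0 \<le> s \<and> s < t"
  let ?D = "\<lambda>\<omega>. b t \<omega> - b s \<omega>"
  have e: "(\<lambda>\<omega>. - b t \<omega> - - b s \<omega>) = (\<lambda>\<omega>. - ?D \<omega>)" by auto
  have D: "distributed M lborel ?D (\<lambda>x. ennreal (normal_density 0 (sqrt (t - s)) x))"
    and ind: "indep_set (sets (Fil s)) (sets (vimage_algebra (space M) ?D borel))"
    using b st by (auto simp: brownian_motion_def)
  show "distributed M lborel (\<lambda>\<omega>. - b t \<omega> - - b s \<omega>) (\<lambda>x. ennreal (normal_density 0 (sqrt (t - s)) x))"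
    unfolding e using st by (intro normal_uminus[OF D]) auto
  have "sets (vimage_algebra (space M) (\<lambda>\<omega>. - ?D \<omega>) borel) \<subseteq> sets (vimage_algebra (space M) ?D borel)"
  proof
    fix A assume "A \<in> sets (vimage_algebra (space M) (\<lambda>\<omega>. - ?D \<omega>) borel)"
    then obtain B where B: "B \<in> sets borel" "A = (\<lambda>\<omega>. - ?D \<omega>) -` B \<inter> space M"
      by (auto simp: sets_vimage_algebra2)
    have "uminus -` B \<inter> space borel \<in> sets (borel :: real measure)"
      using B(1) by (intro measurable_sets[of uminus borel borel]) auto
    from in_vimage_algebra[of "uminus -` B" borel ?D "space M"] this
    show "A \<in> sets (vimage_algebra (space M) ?D borel)"
      by (simp add: B(2) vimage_def)
  qed
  then show "indep_set (sets (Fil s)) (sets (vimage_algebra (space M) (\<lambda>\<omega>. - b t \<omega> - - b s \<omega>) borel))"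
    unfolding e using ind unfolding indep_set_def by (elim indep_sets_mono_sets) (auto split: bool.split)
qed

locale wiener_setting = prob_space M for M :: "'w measure" +
  fixes Fil :: "real \<Rightarrow> 'w measure" and \<beta> :: "nat \<Rightarrow> real \<Rightarrow> 'w \<Rightarrow> real"
  assumes filtration: "usual_filtration M Fil" and wiener: "cylindrical_wiener M Fil \<beta>"
begin

lemma subalgebra_Fil: "t \<ge> 0 \<Longrightarrow> subalgebra M (Fil t)"
  using filtration[unfolded usual_filtration_def, THEN conjunct1] by blast

lemma sets_Fil_mono: "0 \<le> s \<Longrightarrow> s \<le> t \<Longrightarrow> sets (Fil s) \<subseteq> sets (Fil t)"
  using filtration[unfolded usual_filtration_def, THEN conjunct2, THEN conjunct1] by blast

lemma Fil_mono:
  assumes "0 \<le> s" "s \<le> t" "f \<in> measurable (Fil s) N"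
  shows "f \<in> measurable (Fil t) N"
proof -
  have "sets (Fil s) \<subseteq> sets (Fil t)" using assms(1,2) by (rule sets_Fil_mono)
  moreover have "space (Fil s) = space (Fil t)"
    using subalgebra_Fil[of s] subalgebra_Fil[of t] assms by (auto simp: subalgebra_def)
  ultimately show ?thesis using assms(3) by (auto simp: measurable_def)
qed

lemma brownian_\<beta>: "i \<ge> 1 \<Longrightarrow> brownian_motion M Fil (\<beta> i)"
  using wiener by (auto simp: cylindrical_wiener_def)

context
  fixes b assumes b: "brownian_motion M Fil b"
begin

lemma brownian_measurable_Fil: "t \<ge> 0 \<Longrightarrow> b t \<in> borel_measurable (Fil t)"
  using b by (auto simp: brownian_motion_def)

lemma brownian_measurable: "t \<ge> 0 \<Longrightarrow> b t \<in> borel_measurable M"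
  using brownian_measurable_Fil subalgebra_Fil measurable_from_subalg by blast

lemma brownian_increment_distr:
  "0 \<le> s \<Longrightarrow> s < t \<Longrightarrow> distributed M lborel (\<lambda>\<omega>. b t \<omega> - b s \<omega>) (\<lambda>x. ennreal (normal_density 0 (sqrt (t - s)) x))"
  using b by (auto simp: brownian_motion_def)

lemma brownian_increment_indep:
  assumes "0 \<le> s" "s < t" "G \<in> measurable (Fil s) S" "f \<in> measurable borel S'"
  shows "indep_var S G S' (\<lambda>\<omega>. f (b t \<omega> - b s \<omega>))"
proof (rule indep_var_subalgebra[OF _ subalgebra_Fil])
  show "indep_set (sets (Fil s)) (sets (vimage_algebra (space M) (\<lambda>\<omega>. b t \<omega> - b s \<omega>) borel))"
    using b assms by (auto simp: brownian_motion_def)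
  show "(\<lambda>\<omega>. b t \<omega> - b s \<omega>) \<in> borel_measurable M"
    using assms by (intro borel_measurable_diff brownian_measurable) auto
qed (use assms in auto)

text \<open>Levy's maximal inequality on a finite grid, by decomposing according to the first passage time.\<close>

lemma brownian_grid_maximal:
  fixes p :: "nat \<Rightarrow> real"
  assumes p: "p 0 = a" "\<And>k. k < m \<Longrightarrow> p k < p m" "\<And>j k. j \<le> k \<Longrightarrow> k \<le> m \<Longrightarrow> p j \<le> p k"
    and a: "0 \<le> a" "a < p m" and r: "r \<ge> 0"
  shows "prob {\<omega>\<in>space M. \<exists>k\<le>m. b (p k) \<omega> - b a \<omega> \<ge> r} \<le> 2 * exp (- r\<^sup>2 / (2 * (p m - a)))"
proof -
  define S where "S = (\<lambda>k \<omega>. b (p k) \<omega> - b a \<omega>)"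
  have ap: "a \<le> p k" if "k \<le> m" for k using p(3)[OF le0 that] p(1) by simp
  have SF: "S k \<in> borel_measurable (Fil (p j))" if "k \<le> j" "j \<le> m" for k j
    unfolding S_def using ap[of k] p(3)[of k j] ap[of j] that a
    by (intro borel_measurable_diff Fil_mono[OF _ _ brownian_measurable_Fil]) auto
  have SM [measurable]: "S k \<in> borel_measurable M" if "k \<le> m" for k
    unfolding S_def using ap[of k] that a by (intro borel_measurable_diff brownian_measurable) auto
  define A where "A = (\<lambda>k. {\<omega>\<in>space M. (\<forall>j<k. S j \<omega> < r) \<and> S k \<omega> \<ge> r})"
  have spF: "space (Fil (p k)) = space M" if "k \<le> m" for k
    using subalgebra_Fil[of "p k"] ap[OF that] a by (simp add: subalgebra_def)
  have AF: "A k \<in> sets (Fil (p k))" if k: "k \<le> m" for k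
  proof -
    have m: "S j \<in> borel_measurable (Fil (p k))" if "j \<le> k" for j using SF[OF that k] .
    have "{\<omega>\<in>space (Fil (p k)). S j \<omega> < r} \<in> sets (Fil (p k))" if "j \<in> {..<k}" for j
      using that by (intro borel_measurable_less m borel_measurable_const) auto
    moreover have "{\<omega>\<in>space (Fil (p k)). r \<le> S k \<omega>} \<in> sets (Fil (p k))"
      by (intro borel_measurable_le m borel_measurable_const) auto
    ultimately have *: "{\<omega>\<in>space (Fil (p k)). (\<forall>j\<in>{..<k}. S j \<omega> < r) \<and> S k \<omega> \<ge> r} \<in> sets (Fil (p k))"
      by (intro sets.sets_Collect_conj sets.sets_Collect_finite_All) auto
    have "A k = {\<omega>\<in>space (Fil (p k)). (\<forall>j\<in>{..<k}. S j \<omega> < r) \<and> S k \<omega> \<ge> r}"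
      unfolding A_def spF[OF k] by blast
    then show ?thesis using * by (simp only:)
  qed
  have AM: "A k \<in> sets M" if "k \<le> m" for k
  proof -
    have "0 \<le> p k" using ap[OF that] a by linarith
    from subalgebra_Fil[OF this] AF[OF that] show ?thesis unfolding subalgebra_def by blast
  qed
  have "A j \<inter> A k = {}" if "j < k" for j k
  proof -
    have "S j \<omega> < r" if "\<omega> \<in> A k" for \<omega> using that \<open>j < k\<close> unfolding A_def by blast
    moreover have "r \<le> S j \<omega>" if "\<omega> \<in> A j" for \<omega> using that unfolding A_def by blast
    ultimately show ?thesis by (meson disjoint_iff not_le)
  qed
  then have disj: "disjoint_family_on A {..m}"
    unfolding disjoint_family_on_def by (metis Int_commute linorder_neqE_nat)
  have un: "{\<omega>\<in>space M. \<exists>k\<le>m. b (p k) \<omega> - b a \<omega> \<ge> r} = (\<Union>k\<in>{..m}. A k)"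
  proof (intro equalityI subsetI)
    fix \<omega> assume "\<omega> \<in> {\<omega>\<in>space M. \<exists>k\<le>m. b (p k) \<omega> - b a \<omega> \<ge> r}"
    then obtain k where k: "\<omega> \<in> space M" "k \<le> m" "S k \<omega> \<ge> r" by (auto simp: S_def)
    define k0 where "k0 = (LEAST k. S k \<omega> \<ge> r)"
    have "S k0 \<omega> \<ge> r" "k0 \<le> k" unfolding k0_def using k(3) by (rule LeastI, rule Least_le)
    moreover have "S j \<omega> < r" if "j < k0" for j using not_less_Least[of j "\<lambda>k. S k \<omega> \<ge> r"] that unfolding k0_def by auto
    ultimately show "\<omega> \<in> (\<Union>k\<in>{..m}. A k)" using k by (auto simp: A_def intro!: bexI[of _ k0])
  qed (auto simp: A_def S_def)
  let ?C = "\<lambda>k. {\<omega>\<in>space M. b (p m) \<omega> - b (p k) \<omega> \<ge> 0}"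
  have CM: "?C k \<in> sets M" if "k \<le> m" for k
  proof -
    have [measurable]: "b (p m) \<in> borel_measurable M" "b (p k) \<in> borel_measurable M"
      using ap[OF that] ap[of m] a by (auto intro: brownian_measurable)
    show ?thesis by measurable
  qed
  \<comment> \<open>After the first passage the remaining increment is independent of the past and
    nonnegative with probability at least 1/2, in which case the end value is still at least
    \<open>r\<close>. At the last grid point no increment remains.\<close>
  have half: "prob (A k) \<le> 2 * prob (A k \<inter> ?C k)" if k: "k \<le> m" for k
  proof (cases "k = m")
    case True
    then have "A k \<inter> ?C k = A k" by (auto simp: A_def)
    then show ?thesis by simp
  next
    case False
    then have lt: "p k < p m" using p(2) k by simp
    have ind: "indep_var borel (indicator (A k) :: _ \<Rightarrow> real) borel (\<lambda>\<omega>. (\<lambda>x. x) (b (p m) \<omega> - b (p k) \<omega>))"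
      using AF[OF k] ap[OF k] a lt by (intro brownian_increment_indep) auto
    have "prob ((indicator (A k) -` {1 :: real} \<inter> space M) \<inter> ((\<lambda>\<omega>. b (p m) \<omega> - b (p k) \<omega>) -` {0..} \<inter> space M))
       = prob (indicator (A k) -` {1 :: real} \<inter> space M) * prob ((\<lambda>\<omega>. b (p m) \<omega> - b (p k) \<omega>) -` {0..} \<inter> space M)"
      using indep_varD[OF ind, of "{1}" "{0..}"] by (simp add: Int_def vimage_def conj_ac)
    moreover have "indicator (A k) -` {1 :: real} \<inter> space M = A k" by (auto simp: A_def indicator_def)
    moreover have "(\<lambda>\<omega>. b (p m) \<omega> - b (p k) \<omega>) -` {0..} \<inter> space M = ?C k" by auto
    ultimately have eq: "prob (A k \<inter> ?C k) = prob (A k) * prob (?C k)" by simp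
    have "1/2 \<le> prob (?C k)"
      using lt ap[OF k] a by (intro normal_nonneg_half[OF brownian_increment_distr]) auto
    then have "prob (A k) * (1/2) \<le> prob (A k) * prob (?C k)" by (intro mult_left_mono) auto
    then show ?thesis using eq by simp
  qed
  have disj2: "disjoint_family_on (\<lambda>k. A k \<inter> ?C k) {..m}"
    using disj unfolding disjoint_family_on_def by blast
  have "prob (\<Union>k\<in>{..m}. A k) = (\<Sum>k\<le>m. prob (A k))"
    using AM disj by (intro finite_measure_finite_Union) auto
  also have "\<dots> \<le> (\<Sum>k\<le>m. 2 * prob (A k \<inter> ?C k))" by (intro sum_mono half) auto
  also have "\<dots> = 2 * prob (\<Union>k\<in>{..m}. A k \<inter> ?C k)"
    using AM CM disj2 by (subst finite_measure_finite_Union) (auto simp: sum_distrib_left)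
  also have "prob (\<Union>k\<in>{..m}. A k \<inter> ?C k) \<le> prob {\<omega>\<in>space M. b (p m) \<omega> - b a \<omega> \<ge> r}"
    using SM[of m] by (intro finite_measure_mono) (auto simp: A_def S_def)
  also have "\<dots> \<le> exp (- r\<^sup>2 / (2 * (sqrt (p m - a))\<^sup>2))"
    using a r by (intro normal_tail[OF brownian_increment_distr]) auto
  finally show ?thesis unfolding un using a by simp
qed

text \<open>Dyadic grids refine one another, so the grid events increase and their union inherits
  the common bound; continuity passes from dyadic times to all times. Since paths are continuous
  only almost surely, the bound is expressed through a measurable exceptional set.\<close>

lemma brownian_one_sided_maximal:
  assumes ab: "0 \<le> a" "a < c" and r: "r \<ge> 0"
  shows "\<exists>N\<in>sets M. prob N \<le> 2 * exp (- r\<^sup>2 / (2 * (c - a))) \<and>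
    (AE \<omega> in M. \<omega> \<notin> N \<longrightarrow> (\<forall>t\<in>{a..c}. b t \<omega> - b a \<omega> \<le> r))"
proof -
  define p where "p = (\<lambda>(l::nat) (k::nat). a + (c - a) * real k / 2 ^ l)"
  define U where "U = (\<lambda>l. {\<omega>\<in>space M. \<exists>k\<le>2^l. b (p l k) \<omega> - b a \<omega> \<ge> r})"
  have p0: "p l k \<ge> a" for l k using ab by (simp add: p_def)
  have pm: "p l (2^l) = c" for l by (simp add: p_def)
  have UM: "U l \<in> sets M" for l
  proof -
    have [measurable]: "b (p l k) \<in> borel_measurable M" "b a \<in> borel_measurable M" for k
      using p0[of l k] ab by (auto intro: brownian_measurable)
    show ?thesis unfolding U_def by measurable
  qed
  have PU: "prob (U l) \<le> 2 * exp (- r\<^sup>2 / (2 * (c - a)))" for l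
    unfolding U_def
  proof (subst pm[of l, symmetric], rule brownian_grid_maximal)
    show "p l 0 = a" by (simp add: p_def)
    show "p l k < p l (2^l)" if "k < 2^l" for k
    proof -
      have "real k < 2^l" using that by (metis of_nat_less_iff of_nat_numeral of_nat_power)
      then show ?thesis using ab by (simp add: p_def divide_simps)
    qed
    show "p l j \<le> p l k" if "j \<le> k" for j k
      using ab that by (simp add: p_def divide_right_mono mult_left_mono)
  qed (use ab r pm in auto)
  have inc: "incseq U"
  proof (rule incseq_SucI)
    fix l show "U l \<subseteq> U (Suc l)"
    proof
      fix \<omega> assume "\<omega> \<in> U l"
      then obtain k where k: "\<omega> \<in> space M" "k \<le> 2^l" "b (p l k) \<omega> - b a \<omega> \<ge> r" by (auto simp: U_def)
      have "p (Suc l) (2 * k) = p l k" by (simp add: p_def)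
      then show "\<omega> \<in> U (Suc l)" using k unfolding U_def by (auto intro!: exI[of _ "2 * k"])
    qed
  qed
  have "(\<lambda>l. prob (U l)) \<longlonglongrightarrow> prob (\<Union>l. U l)"
    using UM inc by (intro finite_Lim_measure_incseq) auto
  then have P: "prob (\<Union>l. U l) \<le> 2 * exp (- r\<^sup>2 / (2 * (c - a)))"
    by (rule LIMSEQ_le_const2) (use PU in auto)
  have "AE \<omega> in M. continuous_on {0..} (\<lambda>t. b t \<omega>)" using b by (auto simp: brownian_motion_def)
  then have "AE \<omega> in M. \<omega> \<notin> (\<Union>l. U l) \<longrightarrow> (\<forall>t\<in>{a..c}. b t \<omega> - b a \<omega> \<le> r)"
  proof (rule AE_mp, intro AE_I2 impI ballI)
    fix \<omega> t assume \<omega>: "\<omega> \<in> space M" "continuous_on {0..} (\<lambda>t. b t \<omega>)" "\<omega> \<notin> (\<Union>l. U l)" and t: "t \<in> {a..c}"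
    \<comment> \<open>Index of the last dyadic point of level \<open>l\<close> that is not beyond
      \<open>t\<close>.\<close>
    define k where "k = (\<lambda>l::nat. nat \<lfloor>(t - a) / (c - a) * 2^l\<rfloor>)"
    have x: "0 \<le> (t - a) / (c - a)" "(t - a) / (c - a) \<le> 1" using t ab by (auto simp: divide_simps)
    have k1: "real (k l) \<le> (t - a) / (c - a) * 2^l" "(t - a) / (c - a) * 2^l < real (k l) + 1" for l
    proof -
      have "0 \<le> (t - a) / (c - a) * 2^l" using x(1) by (intro mult_nonneg_nonneg) auto
      then have "real (k l) = of_int \<lfloor>(t - a) / (c - a) * 2^l\<rfloor>" unfolding k_def by (simp only: of_nat_nat zero_le_floor)
      then show "real (k l) \<le> (t - a) / (c - a) * 2^l" "(t - a) / (c - a) * 2^l < real (k l) + 1" by linarith+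
    qed
    have k2: "k l \<le> 2^l" for l
    proof -
      have "(t - a) / (c - a) * 2^l \<le> 1 * 2^l" using x by (intro mult_right_mono) auto
      then have "real (k l) \<le> 2^l" using k1(1)[of l] by linarith
      then show ?thesis using of_nat_le_iff[where 'a = real, of "k l" "2^l"] by simp
    qed
    have d: "\<bar>p l (k l) - t\<bar> \<le> (c - a) * (1/2)^l" for l
    proof -
      have e: "t - p l (k l) = (c - a) / 2^l * ((t - a) / (c - a) * 2^l - real (k l))"
        using ab by (simp add: p_def field_simps)
      have "\<bar>(t - a) / (c - a) * 2^l - real (k l)\<bar> \<le> 1" using k1[of l] by linarith
      then have "(c - a) / 2^l * \<bar>(t - a) / (c - a) * 2^l - real (k l)\<bar> \<le> (c - a) / 2^l * 1"
        using ab by (intro mult_left_mono) auto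
      moreover have "\<bar>(c - a) / 2^l\<bar> = (c - a) / 2^l" using ab by simp
      ultimately have "\<bar>t - p l (k l)\<bar> \<le> (c - a) / 2^l" unfolding e abs_mult by simp
      then show ?thesis by (simp only: abs_minus_commute[of t] power_inverse divide_inverse mult_1)
    qed
    have "(\<lambda>l. p l (k l)) \<longlonglongrightarrow> t"
    proof (rule LIM_zero_cancel, rule Lim_null_comparison)
      show "\<forall>\<^sub>F l in sequentially. norm (p l (k l) - t) \<le> (c - a) * (1/2)^l" using d by (intro always_eventually) simp
      show "(\<lambda>l. (c - a) * (1/2)^l) \<longlonglongrightarrow> 0" by (intro tendsto_mult_right_zero LIMSEQ_realpow_zero) auto
    qed
    moreover have "0 \<le> p l (k l)" for l using p0[of l "k l"] ab by linarith
    ultimately have "(\<lambda>l. b (p l (k l)) \<omega>) \<longlonglongrightarrow> b t \<omega>"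
      using continuous_on_tendsto_compose[OF \<omega>(2), of "\<lambda>l. p l (k l)" t sequentially] ab t by simp
    then have "(\<lambda>l. b (p l (k l)) \<omega> - b a \<omega>) \<longlonglongrightarrow> b t \<omega> - b a \<omega>" by (intro tendsto_intros)
    moreover have "b (p l (k l)) \<omega> - b a \<omega> \<le> r" for l
    proof (rule ccontr)
      assume "\<not> b (p l (k l)) \<omega> - b a \<omega> \<le> r"
      then have "\<omega> \<in> U l" using \<omega>(1) k2[of l] unfolding U_def by force
      then show False using \<omega>(3) by blast
    qed
    ultimately show "b t \<omega> - b a \<omega> \<le> r" by (intro LIMSEQ_le_const2) auto
  qed
  then show ?thesis using P UM by (intro bexI[of _ "\<Union>l. U l"]) auto
qed

end

text \<open>The one-sided bound is applied to the motion and to its negative; the two exceptional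
  sets give the factor 4.\<close>

lemma brownian_maximal:
  assumes b: "brownian_motion M Fil b" and ab: "0 \<le> a" "a < c" and r: "r \<ge> 0"
  shows "\<exists>N\<in>sets M. prob N \<le> 4 * exp (- r\<^sup>2 / (2 * (c - a))) \<and>
    (AE \<omega> in M. \<omega> \<notin> N \<longrightarrow> (\<forall>t\<in>{a..c}. \<bar>b t \<omega> - b a \<omega>\<bar> \<le> r))"
proof -
  obtain N1 where N1: "N1 \<in> sets M" "prob N1 \<le> 2 * exp (- r\<^sup>2 / (2 * (c - a)))"
    "AE \<omega> in M. \<omega> \<notin> N1 \<longrightarrow> (\<forall>t\<in>{a..c}. b t \<omega> - b a \<omega> \<le> r)"
    using brownian_one_sided_maximal[OF b ab r] by blast
  have b': "brownian_motion M Fil (\<lambda>t \<omega>. - b t \<omega>)"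
    by (rule brownian_motion_uminus[OF _ filtration b]) unfold_locales
  obtain N2 where N2: "N2 \<in> sets M" "prob N2 \<le> 2 * exp (- r\<^sup>2 / (2 * (c - a)))"
    "AE \<omega> in M. \<omega> \<notin> N2 \<longrightarrow> (\<forall>t\<in>{a..c}. - b t \<omega> - - b a \<omega> \<le> r)"
    using brownian_one_sided_maximal[OF b' ab r] by blast
  have "prob (N1 \<union> N2) \<le> 4 * exp (- r\<^sup>2 / (2 * (c - a)))"
    using measure_Un_le[OF N1(1) N2(1)] N1(2) N2(2) by simp
  moreover have "AE \<omega> in M. \<omega> \<notin> N1 \<union> N2 \<longrightarrow> (\<forall>t\<in>{a..c}. \<bar>b t \<omega> - b a \<omega>\<bar> \<le> r)"
    using N1(3) N2(3)
  proof eventually_elim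
    case (elim \<omega>)
    then show ?case by (auto simp: abs_le_iff)
  qed
  ultimately show ?thesis using N1(1) N2(1) by (intro bexI[of _ "N1 \<union> N2"]) auto
qed

end

section \<open>The stochastic convolution\<close>

context wiener_setting
begin

text \<open>The motion vanishes at time 0 only almost surely; after subtracting its initial value,
  identities between increments hold at every point of the sample space.\<close>

definition incr0 :: "nat \<Rightarrow> real \<Rightarrow> 'w \<Rightarrow> real" where
  "incr0 i t \<omega> = \<beta> i t \<omega> - \<beta> i 0 \<omega>"

lemma incr0_measurable [measurable]: "i \<ge> 1 \<Longrightarrow> t \<ge> 0 \<Longrightarrow> incr0 i t \<in> borel_measurable M"
  unfolding incr0_def by (intro borel_measurable_diff brownian_measurable[OF brownian_\<beta>]) auto

lemma increment_moments:
  assumes i: "i \<ge> 1" and st: "0 \<le> s" "s \<le> t"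
  defines "D \<equiv> \<lambda>\<omega>. \<beta> i t \<omega> - \<beta> i s \<omega>"
  shows "integrable M D" "integrable M (\<lambda>\<omega>. (D \<omega>)\<^sup>2)" "expectation D = 0" "expectation (\<lambda>\<omega>. (D \<omega>)\<^sup>2) = t - s"
proof -
  have "integrable M D \<and> integrable M (\<lambda>\<omega>. (D \<omega>)\<^sup>2) \<and> expectation D = 0 \<and> expectation (\<lambda>\<omega>. (D \<omega>)\<^sup>2) = t - s"
  proof (cases "s = t")
    case False
    define \<sigma> where "\<sigma> = sqrt (t - s)"
    have \<sigma>: "\<sigma> > 0" using False st by (simp add: \<sigma>_def)
    have dist: "distributed M lborel D (\<lambda>x. ennreal (normal_density 0 \<sigma> x))"
      unfolding D_def \<sigma>_def using brownian_increment_distr[OF brownian_\<beta>[OF i]] st False by simp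
    have E: "expectation D = 0" by (rule normal_distributed_expectation[OF \<sigma> dist])
    have "variance D = \<sigma>\<^sup>2" by (rule normal_distributed_variance[OF \<sigma> dist])
    then have V: "expectation (\<lambda>\<omega>. (D \<omega>)\<^sup>2) = t - s" using E st by (simp add: \<sigma>_def)
    \<comment> \<open>A function that is not integrable has Bochner integral 0, whereas this
      expectation equals t - s, which is not 0 here.\<close>
    have "integrable M (\<lambda>\<omega>. (D \<omega>)\<^sup>2)"
      using V False not_integrable_integral_eq[of M "\<lambda>\<omega>. (D \<omega>)\<^sup>2"] by fastforce
    moreover have "D \<in> borel_measurable M"
      using distributed_measurable[OF dist] by simp
    ultimately have "integrable M D"
      by (rule integrable_of_square_integrable[OF finite_measure_axioms, rotated])
    then show ?thesis using E V \<open>integrable M (\<lambda>\<omega>. (D \<omega>)\<^sup>2)\<close> by blast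
  qed (simp add: D_def)
  then show "integrable M D" "integrable M (\<lambda>\<omega>. (D \<omega>)\<^sup>2)" "expectation D = 0" "expectation (\<lambda>\<omega>. (D \<omega>)\<^sup>2) = t - s"
    by blast+
qed

lemma integrable_mult_of_squares:
  fixes f g :: "'w \<Rightarrow> real"
  assumes [measurable]: "f \<in> borel_measurable M" "g \<in> borel_measurable M"
    and "integrable M (\<lambda>x. (f x)\<^sup>2)" "integrable M (\<lambda>x. (g x)\<^sup>2)"
  shows "integrable M (\<lambda>x. f x * g x)"
proof (rule Bochner_Integration.integrable_bound)
  show "integrable M (\<lambda>x. (f x)\<^sup>2 + (g x)\<^sup>2)" using assms by simp
  have "\<bar>a * b\<bar> \<le> a\<^sup>2 + b\<^sup>2" for a b :: real
  proof -
    have "0 \<le> (\<bar>a\<bar> - \<bar>b\<bar>)\<^sup>2" by simp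
    then have "2 * \<bar>a * b\<bar> \<le> a\<^sup>2 + b\<^sup>2" by (simp add: power2_diff abs_mult)
    then show ?thesis by simp
  qed
  then show "AE x in M. norm (f x * g x) \<le> norm ((f x)\<^sup>2 + (g x)\<^sup>2)" by simp
qed measurable

text \<open>For equal indices by polarisation from the variances of increments; for different
  indices by independence of the two processes.\<close>

lemma incr0_covariance:
  assumes i: "i \<ge> 1" "l \<ge> 1" and st: "0 \<le> s" "0 \<le> t"
  shows "integrable M (\<lambda>\<omega>. incr0 i s \<omega> * incr0 l t \<omega>)"
    "expectation (\<lambda>\<omega>. incr0 i s \<omega> * incr0 l t \<omega>) = (if i = l then min s t else 0)"
proof -
  note m1 = increment_moments[OF i(1) order_refl st(1), folded incr0_def]
  note m2 = increment_moments[OF i(2) order_refl st(2), folded incr0_def]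
  show int: "integrable M (\<lambda>\<omega>. incr0 i s \<omega> * incr0 l t \<omega>)"
    using m1 m2 i st by (intro integrable_mult_of_squares) auto
  show "expectation (\<lambda>\<omega>. incr0 i s \<omega> * incr0 l t \<omega>) = (if i = l then min s t else 0)"
  proof (cases "i = l")
    case True
    have e: "incr0 i s \<omega> * incr0 i t \<omega> = ((incr0 i s \<omega>)\<^sup>2 + (incr0 i t \<omega>)\<^sup>2 - (\<beta> i (max s t) \<omega> - \<beta> i (min s t) \<omega>)\<^sup>2) / 2" for \<omega>
      by (cases "s \<le> t") (auto simp: incr0_def max_def min_def power2_eq_square field_simps)
    note m3 = increment_moments[OF i(1), of "min s t" "max s t"]
    have "expectation (\<lambda>\<omega>. incr0 i s \<omega> * incr0 i t \<omega>) = (s + t - (max s t - min s t)) / 2"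
      unfolding e using m1 m2 m3 st True by simp
    also have "\<dots> = min s t" by (auto simp: min_def max_def)
    finally show ?thesis using True by simp
  next
    case False
    have iv: "indep_vars (\<lambda>_. \<Pi>\<^sub>M t\<in>{0..}. borel) (\<lambda>i \<omega>. \<lambda>t\<in>{0..}. \<beta> i t \<omega>) {1..}"
      using wiener by (simp add: cylindrical_wiener_def)
    \<comment> \<open>Functionals of single paths: process \<open>i\<close> is evaluated at
      \<open>s\<close> and process \<open>l\<close> at \<open>t\<close>, each relative to time
      0.\<close>
    define Y where "Y = (\<lambda>k (x :: real \<Rightarrow> real). (if k = i then x s else x t) - x 0)"
    have "indep_vars (\<lambda>_. borel) (\<lambda>k \<omega>. Y k (\<lambda>t\<in>{0..}. \<beta> k t \<omega>)) {i, l}"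
    proof (rule indep_vars_compose2[OF indep_vars_subset[OF iv]])
      show "{i, l} \<subseteq> {1..}" using i by auto
      have c: "(\<lambda>x. x u) \<in> borel_measurable (\<Pi>\<^sub>M t\<in>{0..}. borel :: real measure)" if "u \<ge> 0" for u :: real
        using that by (intro measurable_component_singleton) auto
      show "Y k \<in> borel_measurable (\<Pi>\<^sub>M t\<in>{0..}. borel)" for k
        unfolding Y_def using st by (cases "k = i") (auto intro!: borel_measurable_diff c)
    qed
    note iv' = this
    have Yi: "(\<lambda>\<omega>. Y i (\<lambda>t\<in>{0..}. \<beta> i t \<omega>)) = incr0 i s"
      and Yl: "(\<lambda>\<omega>. Y l (\<lambda>t\<in>{0..}. \<beta> l t \<omega>)) = incr0 l t"
      using st False by (auto simp: Y_def incr0_def fun_eq_iff)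
    have "integrable M (\<lambda>\<omega>. Y k (\<lambda>t\<in>{0..}. \<beta> k t \<omega>))" if "k \<in> {i, l}" for k
      using that Yi Yl m1(1) m2(1) by auto
    from indep_vars_lebesgue_integral[OF _ iv' this]
    have "expectation (\<lambda>\<omega>. \<Prod>k\<in>{i, l}. Y k (\<lambda>t\<in>{0..}. \<beta> k t \<omega>)) = (\<Prod>k\<in>{i, l}. expectation (\<lambda>\<omega>. Y k (\<lambda>t\<in>{0..}. \<beta> k t \<omega>)))"
      by simp
    also have "\<dots> = 0" using False m1(3) by (simp add: Yi)
    also have "(\<lambda>\<omega>. \<Prod>k\<in>{i, l}. Y k (\<lambda>t\<in>{0..}. \<beta> k t \<omega>)) = (\<lambda>\<omega>. incr0 i s \<omega> * incr0 l t \<omega>)"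
      using False Yi[THEN fun_cong] Yl[THEN fun_cong] by simp
    finally show ?thesis using False by simp
  qed
qed

lemma expectation_double_sum:
  fixes F :: "'k \<Rightarrow> 'k \<Rightarrow> 'w \<Rightarrow> real"
  assumes i: "\<And>\<kappa> \<kappa>'. \<kappa> \<in> K \<Longrightarrow> \<kappa>' \<in> K \<Longrightarrow> integrable M (F \<kappa> \<kappa>')"
    and v: "\<And>\<kappa> \<kappa>'. \<kappa> \<in> K \<Longrightarrow> \<kappa>' \<in> K \<Longrightarrow> expectation (F \<kappa> \<kappa>') = G \<kappa> \<kappa>'"
  shows "expectation (\<lambda>\<omega>. \<Sum>\<kappa>\<in>K. \<Sum>\<kappa>'\<in>K. F \<kappa> \<kappa>' \<omega>) = (\<Sum>\<kappa>\<in>K. \<Sum>\<kappa>'\<in>K. G \<kappa> \<kappa>')"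
proof -
  have "expectation (\<lambda>\<omega>. \<Sum>\<kappa>\<in>K. \<Sum>\<kappa>'\<in>K. F \<kappa> \<kappa>' \<omega>) = (\<Sum>\<kappa>\<in>K. expectation (\<lambda>\<omega>. \<Sum>\<kappa>'\<in>K. F \<kappa> \<kappa>' \<omega>))"
    by (intro Bochner_Integration.integral_sum Bochner_Integration.integrable_sum i)
  also have "\<dots> = (\<Sum>\<kappa>\<in>K. \<Sum>\<kappa>'\<in>K. expectation (F \<kappa> \<kappa>'))"
    by (intro sum.cong refl Bochner_Integration.integral_sum i)
  also have "\<dots> = (\<Sum>\<kappa>\<in>K. \<Sum>\<kappa>'\<in>K. G \<kappa> \<kappa>')"
    by (intro sum.cong refl v)
  finally show ?thesis .
qed

text \<open>The intervals may overlap, so that differences of integrals over different partitions are covered.\<close>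

lemma increment_sum_isometry:
  assumes K: "finite K" and ix: "\<And>\<kappa>. \<kappa> \<in> K \<Longrightarrow> ix \<kappa> \<in> {1..n}"
    and ab: "\<And>\<kappa>. \<kappa> \<in> K \<Longrightarrow> 0 \<le> a \<kappa> \<and> a \<kappa> \<le> b \<kappa> \<and> b \<kappa> \<le> (T::real)"
  shows "(\<integral>\<^sup>+\<omega>. ennreal ((\<Sum>\<kappa>\<in>K. c \<kappa> * (\<beta> (ix \<kappa>) (b \<kappa>) \<omega> - \<beta> (ix \<kappa>) (a \<kappa>) \<omega>))\<^sup>2) \<partial>M) =
    (\<integral>\<^sup>+s\<in>{0..T}. ennreal (\<Sum>l=1..n. (\<Sum>\<kappa>\<in>K. if ix \<kappa> = l then c \<kappa> * indicator {a \<kappa><..b \<kappa>} s else 0)\<^sup>2) \<partial>lborel)"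
proof -
  let ?g = "\<lambda>\<kappa> \<omega>. \<beta> (ix \<kappa>) (b \<kappa>) \<omega> - \<beta> (ix \<kappa>) (a \<kappa>) \<omega>"
  let ?h = "\<lambda>\<kappa> l s. if ix \<kappa> = l then c \<kappa> * indicator {a \<kappa><..b \<kappa>} s else (0::real)"
  have g: "?g \<kappa> \<omega> = incr0 (ix \<kappa>) (b \<kappa>) \<omega> - incr0 (ix \<kappa>) (a \<kappa>) \<omega>" for \<kappa> \<omega> by (simp add: incr0_def)
  \<comment> \<open>The length of the overlap of the two intervals, which is the covariance of
    increments of the same motion over them.\<close>
  define J where "J = (\<lambda>\<kappa> \<kappa>'. if ix \<kappa> = ix \<kappa>' then max 0 (min (b \<kappa>) (b \<kappa>') - max (a \<kappa>) (a \<kappa>')) else 0)"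
  have E: "integrable M (\<lambda>\<omega>. ?g \<kappa> \<omega> * ?g \<kappa>' \<omega>) \<and> expectation (\<lambda>\<omega>. ?g \<kappa> \<omega> * ?g \<kappa>' \<omega>) = J \<kappa> \<kappa>'"
    if k: "\<kappa> \<in> K" "\<kappa>' \<in> K" for \<kappa> \<kappa>'
  proof -
    have k1: "ix \<kappa> \<ge> 1" "ix \<kappa>' \<ge> 1" using ix k by auto
    have A0: "0 \<le> a \<kappa>" and B0: "0 \<le> b \<kappa>" and A1: "0 \<le> a \<kappa>'" and B1: "0 \<le> b \<kappa>'"
      using ab[OF k(1)] ab[OF k(2)] by linarith+
    have k2: "0 \<le> a \<kappa>" "0 \<le> b \<kappa>" "0 \<le> a \<kappa>'" "0 \<le> b \<kappa>'" "a \<kappa> \<le> b \<kappa>" "a \<kappa>' \<le> b \<kappa>'"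
      using ab[OF k(1)] ab[OF k(2)] by linarith+
    note C = incr0_covariance[OF k1]
    have e: "?g \<kappa> \<omega> * ?g \<kappa>' \<omega> = (incr0 (ix \<kappa>) (b \<kappa>) \<omega> * incr0 (ix \<kappa>') (b \<kappa>') \<omega> - incr0 (ix \<kappa>) (b \<kappa>) \<omega> * incr0 (ix \<kappa>') (a \<kappa>') \<omega>)
       - (incr0 (ix \<kappa>) (a \<kappa>) \<omega> * incr0 (ix \<kappa>') (b \<kappa>') \<omega> - incr0 (ix \<kappa>) (a \<kappa>) \<omega> * incr0 (ix \<kappa>') (a \<kappa>') \<omega>)" for \<omega>
      unfolding g by (simp add: algebra_simps)
    have "integrable M (\<lambda>\<omega>. ?g \<kappa> \<omega> * ?g \<kappa>' \<omega>)"
      unfolding e by (intro Bochner_Integration.integrable_diff C(1) A0 B0 A1 B1)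
    moreover have "expectation (\<lambda>\<omega>. ?g \<kappa> \<omega> * ?g \<kappa>' \<omega>) = J \<kappa> \<kappa>'"
    proof -
      have "expectation (\<lambda>\<omega>. ?g \<kappa> \<omega> * ?g \<kappa>' \<omega>) = (if ix \<kappa> = ix \<kappa>' then
          (min (b \<kappa>) (b \<kappa>') - min (b \<kappa>) (a \<kappa>')) - (min (a \<kappa>) (b \<kappa>') - min (a \<kappa>) (a \<kappa>')) else 0)"
        unfolding e Bochner_Integration.integral_diff[OF Bochner_Integration.integrable_diff[OF C(1)[OF B0 B1] C(1)[OF B0 A1]]
            Bochner_Integration.integrable_diff[OF C(1)[OF A0 B1] C(1)[OF A0 A1]]]
          Bochner_Integration.integral_diff[OF C(1)[OF B0 B1] C(1)[OF B0 A1]]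
          Bochner_Integration.integral_diff[OF C(1)[OF A0 B1] C(1)[OF A0 A1]]
          C(2)[OF B0 B1] C(2)[OF B0 A1] C(2)[OF A0 B1] C(2)[OF A0 A1] by simp
      also have "\<dots> = J \<kappa> \<kappa>'" using k2 by (auto simp: J_def min_def max_def)
      finally show ?thesis .
    qed
    ultimately show ?thesis by blast
  qed
  have sq: "(\<Sum>\<kappa>\<in>K. x \<kappa>)\<^sup>2 = (\<Sum>\<kappa>\<in>K. \<Sum>\<kappa>'\<in>K. x \<kappa> * x \<kappa>')" for x :: "_ \<Rightarrow> real"
    by (simp add: power2_eq_square sum_product)
  have Lint: "integrable M (\<lambda>\<omega>. (\<Sum>\<kappa>\<in>K. c \<kappa> * ?g \<kappa> \<omega>)\<^sup>2)"
    and Lval: "expectation (\<lambda>\<omega>. (\<Sum>\<kappa>\<in>K. c \<kappa> * ?g \<kappa> \<omega>)\<^sup>2) = (\<Sum>\<kappa>\<in>K. \<Sum>\<kappa>'\<in>K. c \<kappa> * c \<kappa>' * J \<kappa> \<kappa>')"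
  proof -
    have e: "(\<Sum>\<kappa>\<in>K. c \<kappa> * ?g \<kappa> \<omega>)\<^sup>2 = (\<Sum>\<kappa>\<in>K. \<Sum>\<kappa>'\<in>K. c \<kappa> * c \<kappa>' * (?g \<kappa> \<omega> * ?g \<kappa>' \<omega>))" for \<omega>
      unfolding sq by (intro sum.cong refl) (simp only: mult_ac)
    show "integrable M (\<lambda>\<omega>. (\<Sum>\<kappa>\<in>K. c \<kappa> * ?g \<kappa> \<omega>)\<^sup>2)"
      unfolding e by (intro Bochner_Integration.integrable_sum integrable_mult_right) (use E in blast)
    have i: "integrable M (\<lambda>\<omega>. c \<kappa> * c \<kappa>' * (?g \<kappa> \<omega> * ?g \<kappa>' \<omega>))" if "\<kappa> \<in> K" "\<kappa>' \<in> K" for \<kappa> \<kappa>'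
      using E[OF that] by (intro integrable_mult_right) blast
    have v: "expectation (\<lambda>\<omega>. c \<kappa> * c \<kappa>' * (?g \<kappa> \<omega> * ?g \<kappa>' \<omega>)) = c \<kappa> * c \<kappa>' * J \<kappa> \<kappa>'"
      if k: "\<kappa> \<in> K" "\<kappa>' \<in> K" for \<kappa> \<kappa>'
      by (subst integral_mult_right_zero, rule arg_cong[OF conjunct2[OF E[OF k]]])
    show "expectation (\<lambda>\<omega>. (\<Sum>\<kappa>\<in>K. c \<kappa> * ?g \<kappa> \<omega>)\<^sup>2) = (\<Sum>\<kappa>\<in>K. \<Sum>\<kappa>'\<in>K. c \<kappa> * c \<kappa>' * J \<kappa> \<kappa>')"
      unfolding e by (rule expectation_double_sum[OF i v])
  qed
  have H: "((\<lambda>s. \<Sum>l=1..n. ?h \<kappa> l s * ?h \<kappa>' l s) has_integral c \<kappa> * c \<kappa>' * J \<kappa> \<kappa>') {0..T}"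
    if k: "\<kappa> \<in> K" "\<kappa>' \<in> K" for \<kappa> \<kappa>'
  proof -
    have e1: "(\<Sum>l=1..n. ?h \<kappa> l s * ?h \<kappa>' l s) = (if ix \<kappa> = ix \<kappa>' then
        c \<kappa> * c \<kappa>' * indicator ({a \<kappa><..b \<kappa>} \<inter> {a \<kappa>'<..b \<kappa>'}) s else 0)" for s
    proof -
      have "(\<Sum>l=1..n. ?h \<kappa> l s * ?h \<kappa>' l s) = (\<Sum>l=1..n. if l = ix \<kappa> then
          (if ix \<kappa> = ix \<kappa>' then c \<kappa> * c \<kappa>' * indicator ({a \<kappa><..b \<kappa>} \<inter> {a \<kappa>'<..b \<kappa>'}) s else 0) else 0)"
        by (intro sum.cong refl) (auto simp: indicator_def)
      also have "\<dots> = (if ix \<kappa> = ix \<kappa>' then c \<kappa> * c \<kappa>' * indicator ({a \<kappa><..b \<kappa>} \<inter> {a \<kappa>'<..b \<kappa>'}) s else 0)"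
        using ix[OF k(1)] by (subst sum.delta) auto
      finally show ?thesis .
    qed
    let ?A = "max (a \<kappa>) (a \<kappa>')" and ?B = "min (b \<kappa>) (b \<kappa>')"
    have "((\<lambda>s. if s \<in> {?A<..?B} then 1 else 0) has_integral max 0 (?B - ?A)) {0..T}"
    proof (cases "?A \<le> ?B")
      case True
      have "((\<lambda>s. 1::real) has_integral (?B - ?A)) {?A..?B}"
        using has_integral_const_real[of "1::real" ?A ?B] True by simp
      then have "((\<lambda>s. if s \<in> {?A..?B} then 1 else 0::real) has_integral (?B - ?A)) {0..T}"
        using ab[OF k(1)] ab[OF k(2)] by (subst has_integral_restrict) auto
      then have "((\<lambda>s. if s \<in> {?A<..?B} then 1 else 0::real) has_integral (?B - ?A)) {0..T}"
        by (rule has_integral_spike_finite[of "{?A}", rotated 2]) auto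
      then show ?thesis using True by simp
    next
      case False
      then have A: "{?A<..?B} = {}" by (intro greaterThanAtMost_empty) linarith
      have B: "max 0 (?B - ?A) = 0" using False by linarith
      show ?thesis unfolding A B by (simp only: empty_iff if_False has_integral_0)
    qed
    then have "((\<lambda>s. c \<kappa> * c \<kappa>' * (if s \<in> {?A<..?B} then 1 else 0)) has_integral c \<kappa> * c \<kappa>' * max 0 (?B - ?A)) {0..T}"
      by (rule has_integral_mult_right)
    moreover have "{a \<kappa><..b \<kappa>} \<inter> {a \<kappa>'<..b \<kappa>'} = {?A<..?B}" by auto
    ultimately show ?thesis unfolding e1 J_def by (auto simp: indicator_def of_bool_def)
  qed
  have Hs: "((\<lambda>s. \<Sum>l=1..n. (\<Sum>\<kappa>\<in>K. ?h \<kappa> l s)\<^sup>2) has_integral (\<Sum>\<kappa>\<in>K. \<Sum>\<kappa>'\<in>K. c \<kappa> * c \<kappa>' * J \<kappa> \<kappa>')) {0..T}"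
  proof -
    have "(\<Sum>l=1..n. (\<Sum>\<kappa>\<in>K. ?h \<kappa> l s)\<^sup>2) = (\<Sum>\<kappa>\<in>K. \<Sum>\<kappa>'\<in>K. \<Sum>l=1..n. ?h \<kappa> l s * ?h \<kappa>' l s)" for s
    proof -
      have "(\<Sum>l=1..n. (\<Sum>\<kappa>\<in>K. ?h \<kappa> l s)\<^sup>2) = (\<Sum>l=1..n. \<Sum>\<kappa>\<in>K. \<Sum>\<kappa>'\<in>K. ?h \<kappa> l s * ?h \<kappa>' l s)"
        unfolding sq ..
      also have "\<dots> = (\<Sum>\<kappa>\<in>K. \<Sum>l=1..n. \<Sum>\<kappa>'\<in>K. ?h \<kappa> l s * ?h \<kappa>' l s)" by (rule sum.swap)
      also have "\<dots> = (\<Sum>\<kappa>\<in>K. \<Sum>\<kappa>'\<in>K. \<Sum>l=1..n. ?h \<kappa> l s * ?h \<kappa>' l s)"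
        by (intro sum.cong refl sum.swap)
      finally show ?thesis .
    qed
    then show ?thesis using H K by (simp only:) (intro has_integral_sum)
  qed
  have "(\<integral>\<^sup>+s\<in>{0..T}. ennreal (\<Sum>l=1..n. (\<Sum>\<kappa>\<in>K. ?h \<kappa> l s)\<^sup>2) \<partial>lborel) = ennreal (\<Sum>\<kappa>\<in>K. \<Sum>\<kappa>'\<in>K. c \<kappa> * c \<kappa>' * J \<kappa> \<kappa>')"
    by (intro nn_integral_has_integral_lebesgue' Hs) (simp add: sum_nonneg)
  moreover have "(\<integral>\<^sup>+\<omega>. ennreal ((\<Sum>\<kappa>\<in>K. c \<kappa> * ?g \<kappa> \<omega>)\<^sup>2) \<partial>M) = ennreal (\<Sum>\<kappa>\<in>K. \<Sum>\<kappa>'\<in>K. c \<kappa> * c \<kappa>' * J \<kappa> \<kappa>')"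
    using nn_integral_eq_integral[OF Lint] Lval by simp
  ultimately show ?thesis by simp
qed

end

section \<open>Riemann-Stieltjes sums against the exponential\<close>

lemma riemann_stieltjes_exp_step:
  fixes b :: "real \<Rightarrow> real"
  assumes l: "l \<ge> 0" and uv: "0 \<le> u" "u \<le> v" and b: "continuous_on {u..v} b"
    and osc: "\<And>s. s \<in> {u..v} \<Longrightarrow> \<bar>b s - b v\<bar> \<le> e"
  shows "\<bar>exp (l * u) * (b v - b u) - (exp (l * v) * b v - exp (l * u) * b u - l * integral {u..v} (\<lambda>s. exp (l * s) * b s))\<bar>
    \<le> e * (exp (l * v) - exp (l * u))"
proof -
  have E: "((\<lambda>s. l * exp (l * s)) has_integral (exp (l * v) - exp (l * u))) {u..v}"
    using uv by (intro fundamental_theorem_of_calculus)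
      (auto intro!: derivative_eq_intros simp: has_real_derivative_iff_has_vector_derivative[symmetric])
  have I: "((\<lambda>s. exp (l * s) * b s) has_integral integral {u..v} (\<lambda>s. exp (l * s) * b s)) {u..v}"
    using b by (intro integrable_integral integrable_continuous_real continuous_intros)
  \<comment> \<open>The error of a cell is the integral of b(s) - b(v) against the increments of
    exp(l s). Bounding it by the oscillation leaves increments of the exponential, which telescope
    over the cells.\<close>
  have D: "((\<lambda>s. l * (exp (l * s) * b s) - l * exp (l * s) * b v) has_integral
      l * integral {u..v} (\<lambda>s. exp (l * s) * b s) - (exp (l * v) - exp (l * u)) * b v) {u..v}"
    by (intro has_integral_diff has_integral_mult_right has_integral_mult_left E I)
  have "norm (l * integral {u..v} (\<lambda>s. exp (l * s) * b s) - (exp (l * v) - exp (l * u)) * b v)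
      \<le> e * (exp (l * v) - exp (l * u))"
  proof -
    have le: "norm (l * (exp (l * s) * b s) - l * exp (l * s) * b v) \<le> e * (l * exp (l * s))" if s: "s \<in> {u..v}" for s
    proof -
      have "l * (exp (l * s) * b s) - l * exp (l * s) * b v = (l * exp (l * s)) * (b s - b v)" by (simp add: algebra_simps)
      then have "norm (l * (exp (l * s) * b s) - l * exp (l * s) * b v) = (l * exp (l * s)) * \<bar>b s - b v\<bar>"
        using l by (simp add: abs_mult)
      also have "\<dots> \<le> (l * exp (l * s)) * e" using osc[OF s] l by (intro mult_left_mono) auto
      finally show ?thesis by (simp add: mult.commute)
    qed
    have E': "((\<lambda>s. e * (l * exp (l * s))) has_integral e * (exp (l * v) - exp (l * u))) {u..v}"
      by (rule has_integral_mult_right[OF E])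
    show ?thesis
      using integral_norm_bound_integral[OF has_integral_integrable[OF D] has_integral_integrable[OF E'] le]
      unfolding integral_unique[OF D] integral_unique[OF E'] .
  qed
  moreover have "exp (l * u) * (b v - b u) - (exp (l * v) * b v - exp (l * u) * b u - l * integral {u..v} (\<lambda>s. exp (l * s) * b s))
      = l * integral {u..v} (\<lambda>s. exp (l * s) * b s) - (exp (l * v) - exp (l * u)) * b v"
    by (simp add: algebra_simps)
  ultimately show ?thesis by simp
qed

text \<open>Summation by parts identifies the limit of the Riemann--Stieltjes sums of \<open>\<integral>\<^sub>0\<^sup>t e\<^bsup>ls\<^esup> db(s)\<close>
  along every continuous path.\<close>

lemma riemann_stieltjes_exp_limit:
  fixes b :: "real \<Rightarrow> real" and t :: real
  assumes l: "l \<ge> 0" and t: "t > 0" and b: "continuous_on {0..t} b" "b 0 = 0"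
  shows "(\<lambda>N. \<Sum>j<Suc N. exp (l * (j * t / Suc N)) * (b (Suc j * t / Suc N) - b (j * t / Suc N)))
    \<longlonglongrightarrow> exp (l * t) * b t - l * integral {0..t} (\<lambda>s. exp (l * s) * b s)"
  unfolding LIMSEQ_iff
proof (intro allI impI)
  fix r :: real assume r: "r > 0"
  \<comment> \<open>The telescoped errors sum to e (exp(l t) - 1), which is below r / 2.\<close>
  define e where "e = r / (2 * exp (l * t))"
  have e: "e > 0" using r by (simp add: e_def)
  have "uniformly_continuous_on {0..t} b" by (rule compact_uniformly_continuous[OF b(1)]) simp
  then obtain d where d: "d > 0" "\<And>x y. x \<in> {0..t} \<Longrightarrow> y \<in> {0..t} \<Longrightarrow> dist y x < d \<Longrightarrow> dist (b y) (b x) < e"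
    using e unfolding uniformly_continuous_on_def by metis
  obtain N0 :: nat where N0: "t / d < real N0" using reals_Archimedean2 by blast
  show "\<exists>no. \<forall>N\<ge>no. norm ((\<Sum>j<Suc N. exp (l * (j * t / Suc N)) * (b (Suc j * t / Suc N) - b (j * t / Suc N)))
      - (exp (l * t) * b t - l * integral {0..t} (\<lambda>s. exp (l * s) * b s))) < r"
  proof (intro exI[of _ N0] allI impI)
    fix N assume N: "N0 \<le> N"
    define p where "p = (\<lambda>j::nat. j * t / Suc N)"
    have pm: "0 \<le> p j" "p j \<le> p (Suc j)" for j using t by (auto simp: p_def divide_right_mono)
    have pN: "p (Suc N) = t" "p 0 = 0" using t by (auto simp: p_def)
    have pt: "p j \<le> t" if "j \<le> Suc N" for j
      using that t by (simp add: p_def pos_divide_le_eq mult.commute[of t] mult_right_mono)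
    have pd: "p (Suc j) - p j < d" for j
    proof -
      have "t / d < real (Suc N)" using N0 N by simp
      then have "t < d * real (Suc N)" using d(1) by (simp add: pos_divide_less_eq mult.commute)
      then have "t / real (Suc N) < d" by (simp add: pos_divide_less_eq)
      moreover have "p (Suc j) - p j = t / real (Suc N)"
        unfolding p_def diff_divide_distrib[symmetric] by (simp add: algebra_simps)
      ultimately show ?thesis by simp
    qed
    have ind: "\<bar>(\<Sum>j<m. exp (l * p j) * (b (p (Suc j)) - b (p j)))
        - (exp (l * p m) * b (p m) - l * integral {0..p m} (\<lambda>s. exp (l * s) * b s))\<bar> \<le> e * (exp (l * p m) - 1)"
      if "m \<le> Suc N" for m
      using that
    proof (induction m)
      case 0
      then show ?case by (simp add: pN b(2))
    next
      case (Suc m)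
      have c: "continuous_on {0..p (Suc m)} b" "continuous_on {p m..p (Suc m)} b"
        using b(1) pt[OF Suc.prems] pm[of m] by (auto intro: continuous_on_subset)
      have osc: "\<bar>b s - b (p (Suc m))\<bar> \<le> e" if s: "s \<in> {p m..p (Suc m)}" for s
      proof -
        have "dist s (p (Suc m)) < d" using s pd[of m] by (auto simp: dist_real_def)
        then show ?thesis
          using d(2)[of "p (Suc m)" s] s pt[OF Suc.prems] pm[of m] by (auto simp: dist_real_def)
      qed
      have st: "\<bar>exp (l * p m) * (b (p (Suc m)) - b (p m)) - (exp (l * p (Suc m)) * b (p (Suc m)) - exp (l * p m) * b (p m)
          - l * integral {p m..p (Suc m)} (\<lambda>s. exp (l * s) * b s))\<bar> \<le> e * (exp (l * p (Suc m)) - exp (l * p m))"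
        by (rule riemann_stieltjes_exp_step[OF l pm(1) pm(2) c(2)], erule osc)
      have "integral {0..p m} (\<lambda>s. exp (l * s) * b s) + integral {p m..p (Suc m)} (\<lambda>s. exp (l * s) * b s)
          = integral {0..p (Suc m)} (\<lambda>s. exp (l * s) * b s)"
        using pm[of m] c(1)
        by (intro Henstock_Kurzweil_Integration.integral_combine integrable_continuous_real continuous_intros)
      then have I: "l * integral {0..p (Suc m)} (\<lambda>s. exp (l * s) * b s) =
          l * integral {0..p m} (\<lambda>s. exp (l * s) * b s) + l * integral {p m..p (Suc m)} (\<lambda>s. exp (l * s) * b s)"
        by (metis distrib_left)
      have IH: "\<bar>(\<Sum>j<m. exp (l * p j) * (b (p (Suc j)) - b (p j)))
        - (exp (l * p m) * b (p m) - l * integral {0..p m} (\<lambda>s. exp (l * s) * b s))\<bar> \<le> e * (exp (l * p m) - 1)"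
        using Suc by simp
      have arith: "\<bar>(x1 + y1) - (x4 - (z1 + z2))\<bar> \<le> e1"
        if "\<bar>x1 - (x2 - z1)\<bar> \<le> e2" "\<bar>y1 - (x4 - x2 - z2)\<bar> \<le> e3" "e2 + e3 = e1"
        for x1 y1 x2 x4 z1 z2 e1 e2 e3 :: real using that by linarith
      show ?case
        unfolding sum.lessThan_Suc I
      proof (rule arith[OF IH st])
        have "e * (x - 1) + e * (y - x) = e * (y - 1)" for x y by (simp add: algebra_simps)
        then show "e * (exp (l * p m) - 1) + e * (exp (l * p (Suc m)) - exp (l * p m)) = e * (exp (l * p (Suc m)) - 1)" .
      qed
    qed
    have "norm ((\<Sum>j<Suc N. exp (l * p j) * (b (p (Suc j)) - b (p j)))
      - (exp (l * t) * b t - l * integral {0..t} (\<lambda>s. exp (l * s) * b s))) \<le> e * (exp (l * t) - 1)"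
      using ind[of "Suc N"] pN by (simp del: sum.lessThan_Suc)
    also have "\<dots> \<le> e * exp (l * t)" using e by simp
    also have "\<dots> < r" using r by (simp add: e_def)
    finally show "norm ((\<Sum>j<Suc N. exp (l * (j * t / Suc N)) * (b (Suc j * t / Suc N) - b (j * t / Suc N)))
      - (exp (l * t) * b t - l * integral {0..t} (\<lambda>s. exp (l * s) * b s))) < r"
      unfolding p_def .
  qed
qed

lemma step_exp_approximation:
  fixes l s t :: real
  assumes l: "l \<ge> 0" and s: "0 < s" "s \<le> t"
  shows "\<bar>(\<Sum>j<Suc N. exp (l * (j * t / Suc N)) * indicator {j * t / Suc N<..Suc j * t / Suc N} s) - exp (l * s)\<bar>
    \<le> l * exp (l * t) * (t / Suc N)"
proof -
  have t: "t > 0" using s by linarith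
  \<comment> \<open>The cells are left-open, so the cell of \<open>s\<close> is found by a ceiling
    minus one; \<open>s > 0\<close> makes this nonnegative.\<close>
  define k where "k = nat (\<lceil>s * Suc N / t\<rceil> - 1)"
  have z: "0 < s * Suc N / t" "s * Suc N / t \<le> Suc N" using s t by (auto simp: divide_simps)
  then have c: "1 \<le> \<lceil>s * Suc N / t\<rceil>" by linarith
  then have k: "real k = of_int \<lceil>s * Suc N / t\<rceil> - 1" by (simp add: k_def)
  have k1: "real k < s * Suc N / t" "s * Suc N / t \<le> real k + 1" using k by linarith+
  have kN: "k < Suc N" using k1(1) z(2) by linarith
  have k2: "k * t / Suc N < s" "s \<le> Suc k * t / Suc N"
    using k1 t by (simp_all add: field_simps)
  have ind: "indicator {j * t / Suc N<..Suc j * t / Suc N} s = (if j = k then 1 else 0 :: real)" for j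
  proof (cases "j = k")
    case False
    have "s \<notin> {j * t / Suc N<..Suc j * t / Suc N}"
    proof (cases "j < k")
      case True
      then have "Suc j * t / Suc N \<le> k * t / Suc N" using t by (intro divide_right_mono mult_right_mono) auto
      then show ?thesis using k2 by auto
    next
      case False
      then have "Suc k * t / Suc N \<le> j * t / Suc N" using t \<open>j \<noteq> k\<close> by (intro divide_right_mono mult_right_mono) auto
      then show ?thesis using k2 by auto
    qed
    then show ?thesis using False by simp
  qed (use k2 in simp)
  have "(\<Sum>j<Suc N. exp (l * (j * t / Suc N)) * indicator {j * t / Suc N<..Suc j * t / Suc N} s)
      = (\<Sum>j<Suc N. if j = k then exp (l * (k * t / Suc N)) else 0)"
    unfolding ind by (intro sum.cong) auto
  also have "\<dots> = exp (l * (k * t / Suc N))" using kN by (subst sum.delta) auto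
  finally have "\<bar>(\<Sum>j<Suc N. exp (l * (j * t / Suc N)) * indicator {j * t / Suc N<..Suc j * t / Suc N} s) - exp (l * s)\<bar>
      = \<bar>exp (l * s) - exp (l * (k * t / Suc N))\<bar>" by (simp only: abs_minus_commute)
  also have "\<dots> \<le> \<bar>l\<bar> * exp (\<bar>l\<bar> * t) * (s - k * t / Suc N)"
    using k2 s t by (intro abs_exp_diff_le) auto
  also have "\<dots> \<le> l * exp (l * t) * (t / Suc N)"
  proof -
    have "s - k * t / Suc N \<le> Suc k * t / Suc N - k * t / Suc N" using k2 by linarith
    also have "\<dots> = t / Suc N" unfolding diff_divide_distrib[symmetric] by (simp add: algebra_simps)
    finally show ?thesis using l by (simp only: abs_of_nonneg) (intro mult_left_mono, auto)
  qed
  finally show ?thesis .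
qed

declare One_nat_def [simp del]

section \<open>Identification of the Wiener integral along paths\<close>

context wiener_setting
begin

text \<open>The left-point approximation of the convolution of exp(- lam_i (t - s)) with the motion
  \<beta>_i, on a uniform partition; \<open>Suc N\<close> cells avoid an empty partition.\<close>

definition rs_sum :: "nat \<Rightarrow> real \<Rightarrow> nat \<Rightarrow> 'w \<Rightarrow> real" where
  "rs_sum i t N \<omega> = exp (- lam i * t) *
    (\<Sum>j<Suc N. exp (lam i * (real j * t / real (Suc N))) * (\<beta> i (real (Suc j) * t / real (Suc N)) \<omega> - \<beta> i (real j * t / real (Suc N)) \<omega>))"

lemma rs_sum_measurable:
  assumes "i \<ge> 1" "t > 0"
  shows "rs_sum i t N \<in> borel_measurable M"
  unfolding rs_sum_def
  by (intro borel_measurable_times borel_measurable_const borel_measurable_sum borel_measurable_diff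
      brownian_measurable[OF brownian_\<beta>[OF assms(1)]]) (use assms in auto)

lemma rs_sum_limit:
  assumes i: "i \<ge> 1" and t: "t > 0"
  shows "AE \<omega> in M. (\<lambda>N. rs_sum i t N \<omega>) \<longlonglongrightarrow>
    \<beta> i t \<omega> - lam i * exp (- lam i * t) * integral {0..t} (\<lambda>s. exp (lam i * s) * \<beta> i s \<omega>)"
proof -
  have "AE \<omega> in M. \<beta> i 0 \<omega> = 0" "AE \<omega> in M. continuous_on {0..} (\<lambda>t. \<beta> i t \<omega>)"
    using brownian_\<beta>[OF i] by (auto simp: brownian_motion_def)
  then show ?thesis
  proof eventually_elim
    case (elim \<omega>)
    have c: "continuous_on {0..t} (\<lambda>t. \<beta> i t \<omega>)" using elim(2) by (rule continuous_on_subset) auto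
    have "(\<lambda>N. rs_sum i t N \<omega>) \<longlonglongrightarrow>
      exp (- lam i * t) * (exp (lam i * t) * \<beta> i t \<omega> - lam i * integral {0..t} (\<lambda>s. exp (lam i * s) * \<beta> i s \<omega>))"
      unfolding rs_sum_def
      by (intro tendsto_mult tendsto_const riemann_stieltjes_exp_limit lam_nonneg t c elim(1))
    moreover have "e * (e' * x - l * y) = x - l * e * y" if "e * e' = 1" for e e' l x y :: real
    proof -
      have "e * (e' * x - l * y) = (e * e') * x - l * e * y" by (simp add: algebra_simps)
      then show ?thesis by (simp add: that)
    qed
    from this[of "exp (- lam i * t)" "exp (lam i * t)"]
    have "exp (- lam i * t) * (exp (lam i * t) * x - lam i * y) = x - lam i * exp (- lam i * t) * y" for x y
      by (simp add: exp_add[symmetric])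
    ultimately show ?case by (simp only:)
  qed
qed

text \<open>The difference of a step integral and a Riemann--Stieltjes sum is again a finite sum of increments, so that its
  second moment is an integral over \<open>[0,t]\<close> of the difference of the integrands.\<close>

lemma step_integral_rs_sum_bound:
  fixes B :: "nat \<Rightarrow> L2 \<Rightarrow> L2" and p :: "nat \<Rightarrow> real"
  assumes i: "i \<in> {1..n}" and t: "t > 0"
    and p: "p 0 = 0" "p m = t" "mono_on {..m} p" and B: "\<And>j. bounded_linear (B j)"
    and R: "\<And>u. coord i (R u) = r * coord i u"
  defines "S \<equiv> \<lambda>\<omega>. coord i (step_integral m p B (W_n n \<beta>) \<omega>)"
    and "A \<equiv> \<integral>\<^sup>+s\<in>{0..t}. ennreal (\<Sum>l=1..n.
      (norm (E_n n (t - s) (P_n n (R (sin_basis l))) - step_op m p B s (sin_basis l)))\<^sup>2) \<partial>lborel"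
  shows "S \<in> borel_measurable M"
    "(\<integral>\<^sup>+\<omega>. ennreal ((S \<omega> - r * rs_sum i t N \<omega>)\<^sup>2) \<partial>M) \<le> 2 * A + ennreal (2 * (r * lam i * (t / real (Suc N)))\<^sup>2 * t)"
proof -
  let ?c = "\<lambda>l j. coord i (B j (sin_basis l))"
  have i1: "i \<ge> 1" using i by simp
  have SE: "S \<omega> = (\<Sum>l\<in>{1..n}. \<Sum>j<m. ?c l j * (\<beta> l (p (Suc j)) \<omega> - \<beta> l (p j) \<omega>))" for \<omega>
  proof -
    have "S \<omega> = (\<Sum>j<m. \<Sum>l\<in>{1..n}. ?c l j * (\<beta> l (p (Suc j)) \<omega> - \<beta> l (p j) \<omega>))"
      unfolding S_def step_integral_def inner_sum_left
    proof (intro sum.cong refl)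
      fix j
      interpret B: bounded_linear "B j" by (rule B)
      have "W_n n \<beta> (p (Suc j)) \<omega> - W_n n \<beta> (p j) \<omega> =
          (\<Sum>l=1..n. (\<beta> l (p (Suc j)) \<omega> - \<beta> l (p j) \<omega>) *\<^sub>R sin_basis l)"
        unfolding W_n_def sum_subtractf[symmetric] scaleR_left_diff_distrib ..
      then show "coord i (B j (W_n n \<beta> (p (Suc j)) \<omega> - W_n n \<beta> (p j) \<omega>)) =
          (\<Sum>l\<in>{1..n}. ?c l j * (\<beta> l (p (Suc j)) \<omega> - \<beta> l (p j) \<omega>))"
        by (simp only: B.sum B.scaleR inner_sum_left inner_scaleR_left mult.commute)
    qed
    also have "\<dots> = (\<Sum>l\<in>{1..n}. \<Sum>j<m. ?c l j * (\<beta> l (p (Suc j)) \<omega> - \<beta> l (p j) \<omega>))" by (rule sum.swap)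
    finally show ?thesis .
  qed
  have pm: "0 \<le> p j" "p j \<le> p (Suc j)" "p (Suc j) \<le> t" if "j < m" for j
    using monotone_onD[OF p(3), of 0 j] monotone_onD[OF p(3), of j "Suc j"] monotone_onD[OF p(3), of "Suc j" m]
      p(1,2) that by auto
  have pm': "0 \<le> p (Suc j)" if "j < m" for j using pm(1,2)[OF that] by linarith
  show "S \<in> borel_measurable M"
    unfolding SE
    by (intro borel_measurable_times borel_measurable_const borel_measurable_sum borel_measurable_diff
        brownian_measurable[OF brownian_\<beta>]) (use pm pm' in auto)
  \<comment> \<open>The disjoint sum merges the two families of increments: those of the step
    integral, for all coordinates, and those of the uniform partition, for coordinate
    \<open>i\<close> only.\<close>
  define K where "K = ({1..n} \<times> {..<m}) <+> {..<Suc N}"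
  define ix where "ix = case_sum (\<lambda>(l, j::nat). l) (\<lambda>j::nat. i)"
  define a where "a = case_sum (\<lambda>(l::nat, j::nat). p j) (\<lambda>j::nat. real j * t / real (Suc N))"
  define b where "b = case_sum (\<lambda>(l::nat, j::nat). p (Suc j)) (\<lambda>j::nat. real (Suc j) * t / real (Suc N))"
  define c where "c = case_sum (\<lambda>(l, j). ?c l j) (\<lambda>j::nat. - r * exp (- lam i * t) * exp (lam i * (real j * t / real (Suc N))))"
  have sumK: "(\<Sum>\<kappa>\<in>K. g \<kappa>) = (\<Sum>l\<in>{1..n}. \<Sum>j<m. g (Inl (l, j))) + (\<Sum>j<Suc N. g (Inr j))"
    for g :: "_ \<Rightarrow> real"
    unfolding K_def by (subst sum.Plus) (auto simp: sum.cartesian_product split_def simp del: sum.lessThan_Suc)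
  have Z: "S \<omega> - r * rs_sum i t N \<omega> = (\<Sum>\<kappa>\<in>K. c \<kappa> * (\<beta> (ix \<kappa>) (b \<kappa>) \<omega> - \<beta> (ix \<kappa>) (a \<kappa>) \<omega>))" for \<omega>
  proof -
    have "- (r * rs_sum i t N \<omega>) = (\<Sum>j<Suc N. c (Inr j) * (\<beta> (ix (Inr j)) (b (Inr j)) \<omega> - \<beta> (ix (Inr j)) (a (Inr j)) \<omega>))"
      unfolding rs_sum_def c_def ix_def a_def b_def sum_distrib_left sum_negf[symmetric]
      by (intro sum.cong refl) (simp add: mult.assoc)
    then show ?thesis unfolding sumK SE by (simp add: c_def ix_def a_def b_def)
  qed
  have "(\<integral>\<^sup>+\<omega>. ennreal ((S \<omega> - r * rs_sum i t N \<omega>)\<^sup>2) \<partial>M) =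
    (\<integral>\<^sup>+s\<in>{0..t}. ennreal (\<Sum>l=1..n. (\<Sum>\<kappa>\<in>K. if ix \<kappa> = l then c \<kappa> * indicator {a \<kappa><..b \<kappa>} s else 0)\<^sup>2) \<partial>lborel)"
    unfolding Z
  proof (rule increment_sum_isometry)
    show "finite K" by (simp add: K_def)
    show "ix \<kappa> \<in> {1..n}" if "\<kappa> \<in> K" for \<kappa> using that i unfolding K_def ix_def by (auto split: sum.splits)
    show "0 \<le> a \<kappa> \<and> a \<kappa> \<le> b \<kappa> \<and> b \<kappa> \<le> t" if "\<kappa> \<in> K" for \<kappa>
    proof -
      have "real j * t \<le> real (Suc j) * t \<and> real (Suc j) * t \<le> t * real (Suc N)" if "j < Suc N" for j
        using that t by (simp add: mult.commute[of t] mult_right_mono)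
      then have "0 \<le> real j * t / real (Suc N) \<and> real j * t / real (Suc N) \<le> real (Suc j) * t / real (Suc N) \<and> real (Suc j) * t / real (Suc N) \<le> t" if "j < Suc N" for j
        using that t by (simp add: divide_right_mono pos_divide_le_eq)
      then show ?thesis using that pm unfolding K_def a_def b_def by (auto split: sum.splits)
    qed
  qed
  also have "\<dots> \<le> (\<integral>\<^sup>+s. (2 * (ennreal (\<Sum>l=1..n. ((\<Sum>j<m. ?c l j * indicator {p j<..p (Suc j)} s) -
      (if l = i then r * exp (- lam i * (t - s)) else 0))\<^sup>2) * indicator {0..t} s) +
      ennreal (2 * (r * lam i * (t / real (Suc N)))\<^sup>2) * indicator {0..t} s) \<partial>lborel)"
  proof (rule nn_integral_mono_AE)
    \<comment> \<open>At time 0 no left-open cell is hit and the step function does not approximate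
      the exponential; the single point is a null set.\<close>
    have "AE s in lborel. s \<noteq> (0::real)" by (rule AE_lborel_singleton)
    then show "AE s in lborel. ennreal (\<Sum>l=1..n. (\<Sum>\<kappa>\<in>K. if ix \<kappa> = l then c \<kappa> * indicator {a \<kappa><..b \<kappa>} s else 0)\<^sup>2) * indicator {0..t} s
      \<le> 2 * (ennreal (\<Sum>l=1..n. ((\<Sum>j<m. ?c l j * indicator {p j<..p (Suc j)} s) -
      (if l = i then r * exp (- lam i * (t - s)) else 0))\<^sup>2) * indicator {0..t} s) +
      ennreal (2 * (r * lam i * (t / real (Suc N)))\<^sup>2) * indicator {0..t} s"
    proof eventually_elim
      case (elim s)
      show ?case
      proof (cases "s \<in> {0..t}")
        case True
        then have s: "0 < s" "s \<le> t" using elim by auto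
        define h where "h = (\<lambda>l. (\<Sum>j<m. ?c l j * indicator {p j<..p (Suc j)} s) -
          (if l = i then r * exp (- lam i * (t - s)) else 0))"
        define g where "g = (\<Sum>j<Suc N. exp (lam i * (real j * t / real (Suc N))) * indicator {real j * t / real (Suc N)<..real (Suc j) * t / real (Suc N)} s)"
        \<comment> \<open>The discretisation error of the exponential. It is separated from the
          distance \<open>h\<close> between the integrands by (x + y)^2 \<le> 2 x^2 + 2 y^2, the
          source of the factors 2.\<close>
        define q where "q = r * exp (- lam i * t) * (exp (lam i * s) - g)"
        have x: "(\<Sum>\<kappa>\<in>K. if ix \<kappa> = l then c \<kappa> * indicator {a \<kappa><..b \<kappa>} s else 0) = h l + (if l = i then q else 0)"
          if l: "l \<in> {1..n}" for l
        proof -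
          have "(\<Sum>l'\<in>{1..n}. \<Sum>j<m. if ix (Inl (l', j)) = l then c (Inl (l', j)) * indicator {a (Inl (l', j))<..b (Inl (l', j))} s else 0)
            = (\<Sum>l'\<in>{1..n}. if l' = l then \<Sum>j<m. ?c l j * indicator {p j<..p (Suc j)} s else 0)"
            by (intro sum.cong refl) (simp add: ix_def a_def b_def c_def)
          also have "\<dots> = (\<Sum>j<m. ?c l j * indicator {p j<..p (Suc j)} s)"
            using l by (subst sum.delta) auto
          finally have 1: "(\<Sum>l'\<in>{1..n}. \<Sum>j<m. if ix (Inl (l', j)) = l then c (Inl (l', j)) * indicator {a (Inl (l', j))<..b (Inl (l', j))} s else 0)
            = (\<Sum>j<m. ?c l j * indicator {p j<..p (Suc j)} s)" .
          have 2: "(\<Sum>j<Suc N. if ix (Inr j) = l then c (Inr j) * indicator {a (Inr j)<..b (Inr j)} s else 0)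
            = (if l = i then - r * exp (- lam i * t) * g else 0)"
          proof (cases "l = i")
            case True
            then show ?thesis unfolding g_def sum_distrib_left
              by (simp add: ix_def a_def b_def c_def mult.assoc del: sum.lessThan_Suc)
          qed (simp add: ix_def del: sum.lessThan_Suc)
          have 3: "exp (- lam i * (t - s)) = exp (- lam i * t) * exp (lam i * s)"
            by (simp add: exp_add[symmetric] algebra_simps)
          show ?thesis unfolding sumK 1 2 h_def q_def 3 by (simp add: algebra_simps)
        qed
        have "\<bar>q\<bar> \<le> \<bar>r\<bar> * exp (- lam i * t) * (lam i * exp (lam i * t) * (t / real (Suc N)))"
          unfolding q_def abs_mult using step_exp_approximation[OF lam_nonneg s, of i N]
          by (intro mult_mono) (auto simp: g_def abs_minus_commute)
        also have "\<dots> = \<bar>r * lam i * (t / real (Suc N))\<bar>"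
        proof -
          have "exp (- lam i * t) * exp (lam i * t) = 1" by (simp add: exp_add[symmetric])
          moreover have "\<bar>r\<bar> * e * (l * e' * d) = \<bar>r\<bar> * l * d * (e * e')" for e e' l d :: real
            by (simp add: mult_ac)
          ultimately show ?thesis using t lam_nonneg[of i] by (simp add: abs_mult)
        qed
        finally have q: "q\<^sup>2 \<le> (r * lam i * (t / real (Suc N)))\<^sup>2" by (simp only: abs_le_square_iff)
        have "(\<Sum>l=1..n. (h l + (if l = i then q else 0))\<^sup>2) \<le> (\<Sum>l=1..n. 2 * (h l)\<^sup>2 + (if l = i then 2 * q\<^sup>2 else 0))"
        proof (intro sum_mono)
          fix l
          have "(x + y)\<^sup>2 \<le> 2 * x\<^sup>2 + 2 * y\<^sup>2" for x y :: real
            using zero_le_power2[of "x - y"] by (simp add: power2_eq_square algebra_simps)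
          then show "(h l + (if l = i then q else 0))\<^sup>2 \<le> 2 * (h l)\<^sup>2 + (if l = i then 2 * q\<^sup>2 else 0)"
            using zero_le_power2[of "h l"] by (auto simp del: zero_le_power2)
        qed
        also have "\<dots> = 2 * (\<Sum>l=1..n. (h l)\<^sup>2) + 2 * q\<^sup>2"
          using i by (simp add: sum.distrib sum_distrib_left)
        also have "\<dots> \<le> 2 * (\<Sum>l=1..n. (h l)\<^sup>2) + 2 * (r * lam i * (t / real (Suc N)))\<^sup>2" using q by simp
        finally have "(\<Sum>l=1..n. (\<Sum>\<kappa>\<in>K. if ix \<kappa> = l then c \<kappa> * indicator {a \<kappa><..b \<kappa>} s else 0)\<^sup>2)
            \<le> 2 * (\<Sum>l=1..n. (h l)\<^sup>2) + 2 * (r * lam i * (t / real (Suc N)))\<^sup>2"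
          by (subst sum.cong[OF refl arg_cong[where f = "\<lambda>x. x\<^sup>2", OF x]])
        then have "ennreal (\<Sum>l=1..n. (\<Sum>\<kappa>\<in>K. if ix \<kappa> = l then c \<kappa> * indicator {a \<kappa><..b \<kappa>} s else 0)\<^sup>2)
          \<le> ennreal (2 * (\<Sum>l=1..n. (h l)\<^sup>2) + 2 * (r * lam i * (t / real (Suc N)))\<^sup>2)"
          by (rule ennreal_leI)
        also have "\<dots> = 2 * ennreal (\<Sum>l=1..n. (h l)\<^sup>2) + ennreal (2 * (r * lam i * (t / real (Suc N)))\<^sup>2)"
          by (subst ennreal_plus) (auto simp: sum_nonneg ennreal_mult')
        finally show ?thesis using True unfolding h_def by simp
      qed simp
    qed
  qed
  also have "\<dots> = 2 * (\<integral>\<^sup>+s. ennreal (\<Sum>l=1..n. ((\<Sum>j<m. ?c l j * indicator {p j<..p (Suc j)} s) -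
      (if l = i then r * exp (- lam i * (t - s)) else 0))\<^sup>2) * indicator {0..t} s \<partial>lborel) +
      ennreal (2 * (r * lam i * (t / real (Suc N)))\<^sup>2 * t)"
  proof -
    have m: "(\<lambda>s. ennreal (\<Sum>l=1..n. ((\<Sum>j<m. ?c l j * indicator {p j<..p (Suc j)} s) -
      (if l = i then r * exp (- lam i * (t - s)) else 0))\<^sup>2) * indicator {0..t} s) \<in> borel_measurable lborel"
    proof -
      have "(\<lambda>s. if l = i then r * exp (- lam i * (t - s)) else 0) \<in> borel_measurable lborel" for l
        by (cases "l = i") auto
      then show ?thesis by measurable
    qed
    have "ennreal (2 * (r * lam i * (t / real (Suc N)))\<^sup>2) * ennreal t = ennreal (2 * (r * lam i * (t / real (Suc N)))\<^sup>2 * t)"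
      using t by (intro ennreal_mult'[symmetric]) auto
    then show ?thesis
      using m t by (subst nn_integral_add) (auto simp: nn_integral_cmult nn_integral_cmult_indicator)
  qed
  also have "\<dots> \<le> 2 * A + ennreal (2 * (r * lam i * (t / real (Suc N)))\<^sup>2 * t)"
  proof (intro add_right_mono mult_left_mono)
    show "(\<integral>\<^sup>+s. ennreal (\<Sum>l=1..n. ((\<Sum>j<m. ?c l j * indicator {p j<..p (Suc j)} s) -
      (if l = i then r * exp (- lam i * (t - s)) else 0))\<^sup>2) * indicator {0..t} s \<partial>lborel) \<le> A"
      unfolding A_def
    proof (intro nn_integral_mono mult_right_mono ennreal_leI sum_mono)
      fix s l assume l: "l \<in> {1..n}"
      let ?d = "E_n n (t - s) (P_n n (R (sin_basis l))) - step_op m p B s (sin_basis l)"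
      have "coord i (E_n n (t - s) (P_n n (R (sin_basis l)))) = (if l = i then r * exp (- lam i * (t - s)) else 0)"
        unfolding coord_E_n[OF P_n_in_H_n i] coord_P_n[OF i] R using l i by (simp add: inner_sin_basis)
      moreover have "coord i (step_op m p B s (sin_basis l)) = (\<Sum>j<m. ?c l j * indicator {p j<..p (Suc j)} s)"
        unfolding step_op_def inner_sum_left by (simp add: mult.commute)
      ultimately have "(\<Sum>j<m. ?c l j * indicator {p j<..p (Suc j)} s) -
          (if l = i then r * exp (- lam i * (t - s)) else 0) = - coord i ?d"
        by (simp add: inner_diff_left)
      then have "((\<Sum>j<m. ?c l j * indicator {p j<..p (Suc j)} s) -
          (if l = i then r * exp (- lam i * (t - s)) else 0))\<^sup>2 = \<bar>coord i ?d\<bar>\<^sup>2" by simp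
      also have "\<dots> \<le> (norm ?d)\<^sup>2" by (intro power_mono abs_coord_le i1) auto
      finally show "((\<Sum>j<m. ?c l j * indicator {p j<..p (Suc j)} s) -
          (if l = i then r * exp (- lam i * (t - s)) else 0))\<^sup>2 \<le> (norm ?d)\<^sup>2" .
    qed auto
  qed auto
  finally show "(\<integral>\<^sup>+\<omega>. ennreal ((S \<omega> - r * rs_sum i t N \<omega>)\<^sup>2) \<partial>M) \<le> 2 * A + ennreal (2 * (r * lam i * (t / real (Suc N)))\<^sup>2 * t)" .
qed

text \<open>The step integrals converge in mean square to the coordinate of \<open>J\<close> by
  definition, and by the isometry also to \<open>r\<close> times the pathwise limit of the
  Riemann-Stieltjes sums; hence the two limits agree almost surely.\<close>

lemma wiener_integral_coord:
  assumes i: "i \<in> {1..n}" and t: "t > 0" and R: "\<And>u. coord i (R u) = r * coord i u"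
    and J: "wiener_integral M n \<beta> t (\<lambda>s u. E_n n (t - s) (P_n n (R u))) J"
  shows "AE \<omega> in M. coord i (J \<omega>) = r * (\<beta> i t \<omega> -
    lam i * exp (- lam i * t) * integral {0..t} (\<lambda>s. exp (lam i * s) * \<beta> i s \<omega>))"
proof -
  have i1: "i \<ge> 1" using i by simp
  obtain m p B where p: "\<And>k. p k 0 = 0" "\<And>k. p k (m k) = t" "\<And>k. mono_on {..m k} (p k)"
    and B: "\<And>k j. bounded_linear (B k j)"
    and A: "(\<lambda>k. \<integral>\<^sup>+ s\<in>{0..t}. ennreal (\<Sum>l=1..n.
        (norm (E_n n (t - s) (P_n n (R (sin_basis l))) - step_op (m k) (p k) (B k) s (sin_basis l)))\<^sup>2) \<partial>lborel) \<longlonglongrightarrow> 0"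
    and C: "(\<lambda>k. \<integral>\<^sup>+ \<omega>. ennreal ((norm (J \<omega> - step_integral (m k) (p k) (B k) (W_n n \<beta>) \<omega>))\<^sup>2) \<partial>M) \<longlonglongrightarrow> 0"
    and Jm: "J \<in> borel_measurable M"
    using J unfolding wiener_integral_def by blast
  define A' where "A' = (\<lambda>k. \<integral>\<^sup>+ s\<in>{0..t}. ennreal (\<Sum>l=1..n.
        (norm (E_n n (t - s) (P_n n (R (sin_basis l))) - step_op (m k) (p k) (B k) s (sin_basis l)))\<^sup>2) \<partial>lborel)"
  define C' where "C' = (\<lambda>k. \<integral>\<^sup>+ \<omega>. ennreal ((norm (J \<omega> - step_integral (m k) (p k) (B k) (W_n n \<beta>) \<omega>))\<^sup>2) \<partial>M)"
  define S where "S = (\<lambda>k \<omega>. coord i (step_integral (m k) (p k) (B k) (W_n n \<beta>) \<omega>))"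
  have Sm [measurable]: "S k \<in> borel_measurable M" for k
    unfolding S_def by (rule step_integral_rs_sum_bound(1)[OF i t p B R])
  have ZN: "(\<integral>\<^sup>+\<omega>. ennreal ((S k \<omega> - r * rs_sum i t N \<omega>)\<^sup>2) \<partial>M) \<le> 2 * A' k + ennreal (2 * (r * lam i * (t / real (Suc N)))\<^sup>2 * t)" for k N
    unfolding S_def A'_def by (rule step_integral_rs_sum_bound(2)[OF i t p B R])
  have rm [measurable]: "rs_sum i t N \<in> borel_measurable M" for N by (rule rs_sum_measurable[OF i1 t])
  have cm [measurable]: "(\<lambda>\<omega>. coord i (J \<omega>)) \<in> borel_measurable M"
    by (rule measurable_compose[OF Jm]) (intro borel_measurable_continuous_onI continuous_intros)
  \<comment> \<open>As a pointwise limit of measurable sums \<open>Y\<close> is measurable; the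
    integral along the path is identified with it only almost surely.\<close>
  define Y where "Y = (\<lambda>\<omega>. lim (\<lambda>N. rs_sum i t N \<omega>))"
  have Ym [measurable]: "Y \<in> borel_measurable M" unfolding Y_def by measurable
  have Yl: "AE \<omega> in M. (\<lambda>N. rs_sum i t N \<omega>) \<longlonglongrightarrow> Y \<omega> \<and>
      Y \<omega> = \<beta> i t \<omega> - lam i * exp (- lam i * t) * integral {0..t} (\<lambda>s. exp (lam i * s) * \<beta> i s \<omega>)"
    using rs_sum_limit[OF i1 t]
  proof eventually_elim
    case (elim \<omega>)
    from limI[OF elim] elim show ?case unfolding Y_def by simp
  qed
  \<comment> \<open>Fatou's lemma under refinement of the uniform partition removes the
    discretisation term.\<close>
  have SY: "(\<integral>\<^sup>+\<omega>. ennreal ((S k \<omega> - r * Y \<omega>)\<^sup>2) \<partial>M) \<le> 2 * A' k" for k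
  proof -
    have "(\<integral>\<^sup>+\<omega>. ennreal ((S k \<omega> - r * Y \<omega>)\<^sup>2) \<partial>M) = (\<integral>\<^sup>+\<omega>. liminf (\<lambda>N. ennreal ((S k \<omega> - r * rs_sum i t N \<omega>)\<^sup>2)) \<partial>M)"
    proof (intro nn_integral_cong_AE, use Yl in eventually_elim)
      case (elim \<omega>)
      have "(\<lambda>N. ennreal ((S k \<omega> - r * rs_sum i t N \<omega>)\<^sup>2)) \<longlonglongrightarrow> ennreal ((S k \<omega> - r * Y \<omega>)\<^sup>2)"
        using elim by (intro tendsto_ennrealI tendsto_intros) auto
      from lim_imp_Liminf[OF _ this] show ?case by simp
    qed
    also have "\<dots> \<le> liminf (\<lambda>N. \<integral>\<^sup>+\<omega>. ennreal ((S k \<omega> - r * rs_sum i t N \<omega>)\<^sup>2) \<partial>M)"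
      by (rule nn_integral_liminf) measurable
    also have "\<dots> \<le> liminf (\<lambda>N. 2 * A' k + ennreal (2 * (r * lam i * (t / real (Suc N)))\<^sup>2 * t))"
      by (intro Liminf_mono always_eventually allI ZN)
    also have "\<dots> = 2 * A' k"
    proof (rule lim_imp_Liminf)
      have "(\<lambda>N. 2 * (r * lam i * (t * inverse (real (Suc N))))\<^sup>2 * t) \<longlonglongrightarrow> 2 * (r * lam i * (t * 0))\<^sup>2 * t"
        by (intro tendsto_intros LIMSEQ_inverse_real_of_nat)
      then have "(\<lambda>N. ennreal (2 * (r * lam i * (t / real (Suc N)))\<^sup>2 * t)) \<longlonglongrightarrow> ennreal 0"
        by (intro tendsto_ennrealI) (simp add: divide_inverse)
      then have "(\<lambda>N. 2 * A' k + ennreal (2 * (r * lam i * (t / real (Suc N)))\<^sup>2 * t)) \<longlonglongrightarrow> 2 * A' k + ennreal 0"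
        by (intro tendsto_add tendsto_const)
      then show "(\<lambda>N. 2 * A' k + ennreal (2 * (r * lam i * (t / real (Suc N)))\<^sup>2 * t)) \<longlonglongrightarrow> 2 * A' k" by simp
    qed simp
    finally show ?thesis .
  qed
  have le: "(\<integral>\<^sup>+\<omega>. ennreal ((coord i (J \<omega>) - r * Y \<omega>)\<^sup>2) \<partial>M) \<le> 2 * C' k + 2 * (2 * A' k)" for k
  proof -
    have "(\<integral>\<^sup>+\<omega>. ennreal ((coord i (J \<omega>) - r * Y \<omega>)\<^sup>2) \<partial>M) \<le>
      (\<integral>\<^sup>+\<omega>. 2 * ennreal ((coord i (J \<omega>) - S k \<omega>)\<^sup>2) + 2 * ennreal ((S k \<omega> - r * Y \<omega>)\<^sup>2) \<partial>M)"
    proof (intro nn_integral_mono)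
      fix \<omega>
      have "(x - z)\<^sup>2 \<le> 2 * (x - y)\<^sup>2 + 2 * (y - z)\<^sup>2" for x y z :: real
        using zero_le_power2[of "(x - y) - (y - z)"] by (simp add: power2_eq_square algebra_simps)
      then have "ennreal ((coord i (J \<omega>) - r * Y \<omega>)\<^sup>2) \<le> ennreal (2 * (coord i (J \<omega>) - S k \<omega>)\<^sup>2 + 2 * (S k \<omega> - r * Y \<omega>)\<^sup>2)"
        by (intro ennreal_leI)
      then show "ennreal ((coord i (J \<omega>) - r * Y \<omega>)\<^sup>2) \<le> 2 * ennreal ((coord i (J \<omega>) - S k \<omega>)\<^sup>2) + 2 * ennreal ((S k \<omega> - r * Y \<omega>)\<^sup>2)"
        by (simp add: ennreal_mult')
    qed
    also have "\<dots> = 2 * (\<integral>\<^sup>+\<omega>. ennreal ((coord i (J \<omega>) - S k \<omega>)\<^sup>2) \<partial>M) + 2 * (\<integral>\<^sup>+\<omega>. ennreal ((S k \<omega> - r * Y \<omega>)\<^sup>2) \<partial>M)"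
      by (subst nn_integral_add) (auto simp: nn_integral_cmult)
    also have "\<dots> \<le> 2 * C' k + 2 * (2 * A' k)"
    proof (intro add_mono mult_left_mono SY)
      show "(\<integral>\<^sup>+\<omega>. ennreal ((coord i (J \<omega>) - S k \<omega>)\<^sup>2) \<partial>M) \<le> C' k"
        unfolding C'_def S_def inner_diff_left[symmetric]
        using abs_coord_le[OF i1] by (intro nn_integral_mono ennreal_leI) (simp only: abs_le_square_iff[symmetric] abs_norm_cancel)
    qed auto
    finally show ?thesis .
  qed
  have "(\<lambda>k. 2 * C' k + 2 * (2 * A' k)) \<longlonglongrightarrow> 2 * 0 + 2 * (2 * 0)"
    using A C unfolding A'_def[symmetric] C'_def[symmetric] by (intro tendsto_add tendsto_mult_ennreal tendsto_const) auto
  then have "(\<integral>\<^sup>+\<omega>. ennreal ((coord i (J \<omega>) - r * Y \<omega>)\<^sup>2) \<partial>M) \<le> 2 * 0 + 2 * (2 * 0)"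
    by (rule LIMSEQ_le_const) (use le in auto)
  then have "(\<integral>\<^sup>+\<omega>. ennreal ((coord i (J \<omega>) - r * Y \<omega>)\<^sup>2) \<partial>M) = 0" by simp
  then have "AE \<omega> in M. ennreal ((coord i (J \<omega>) - r * Y \<omega>)\<^sup>2) = 0"
    by (subst (asm) nn_integral_0_iff_AE) measurable
  then show ?thesis using Yl by eventually_elim (simp add: ennreal_eq_0_iff)
qed

end

declare One_nat_def [simp]

section \<open>Schilder's theorem\<close>

lemma step_function_has_integral:
  fixes v :: "nat \<Rightarrow> real"
  assumes \<tau>: "\<tau> > 0"
  defines "f \<equiv> \<lambda>t. v (nat \<lfloor>t / \<tau>\<rfloor>)"
  shows "t \<in> {real j * \<tau>..real (Suc j) * \<tau>} \<Longrightarrow> (f has_integral v j * (t - real j * \<tau>)) {real j * \<tau>..t}"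
    "(f has_integral (\<Sum>j<m. v j * \<tau>)) {0..real m * \<tau>}"
proof -
  show piece: "(f has_integral v j * (t - real j * \<tau>)) {real j * \<tau>..t}"
    if t: "t \<in> {real j * \<tau>..real (Suc j) * \<tau>}" for t j
  \<comment> \<open>At the right end of the cell the floor already selects the next value, so this
    point is removed.\<close>
  proof (rule has_integral_spike_finite[of "{real (Suc j) * \<tau>}"])
    show "((\<lambda>_. v j) has_integral v j * (t - real j * \<tau>)) {real j * \<tau>..t}"
      using has_integral_const_real[of "v j" "real j * \<tau>" t] t by (simp add: mult.commute)
    fix s assume s: "s \<in> {real j * \<tau>..t} - {real (Suc j) * \<tau>}"
    then have "real j * \<tau> \<le> s" "s < real (Suc j) * \<tau>" using t by auto
    then have "real j \<le> s / \<tau>" "s / \<tau> < real (Suc j)"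
      using \<tau> by (simp_all add: pos_le_divide_eq pos_divide_less_eq)
    then have "\<lfloor>s / \<tau>\<rfloor> = int j" by (intro floor_unique) auto
    then show "f s = v j" by (simp add: f_def)
  qed simp
  show "(f has_integral (\<Sum>j<m. v j * \<tau>)) {0..real m * \<tau>}"
  proof (induction m)
    case (Suc m)
    have "(f has_integral (\<Sum>j<m. v j * \<tau>) + v m * (real (Suc m) * \<tau> - real m * \<tau>)) {0..real (Suc m) * \<tau>}"
    proof (rule has_integral_combine)
      show "(f has_integral (\<Sum>j<m. v j * \<tau>)) {0..real m * \<tau>}" by (rule Suc)
      show "(f has_integral v m * (real (Suc m) * \<tau> - real m * \<tau>)) {real m * \<tau>..real (Suc m) * \<tau>}"
        using \<tau> by (intro piece) (auto intro: mult_right_mono)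
    qed (use \<tau> in \<open>auto intro: mult_right_mono\<close>)
    then show ?case by (simp add: algebra_simps)
  qed (simp add: has_integral_refl)
qed

text \<open>The polygon with increments \<open>D i j\<close> on the grid: its slope on a cell is
  \<open>D i j / \<tau>\<close>, so its energy is an explicit quadratic form in the increments. With
  Brownian increments for \<open>D\<close> it supplies the control of the upper bound.\<close>

lemma polygonal_primitive:
  fixes D :: "nat \<Rightarrow> nat \<Rightarrow> real"
  assumes \<tau>: "\<tau> > 0" and T: "T = real N * \<tau>"
  shows "\<exists>\<phi>. L2_density T n \<phi> \<and> energy T n \<phi> = (\<Sum>i=1..n. \<Sum>j<N. (D i j)\<^sup>2 / \<tau>) \<and>
    (\<forall>i\<in>{1..n}. \<forall>j\<le>N. primitive \<phi> i (real j * \<tau>) = (\<Sum>k<j. D i k)) \<and>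
    (\<forall>i\<in>{1..n}. \<forall>j<N. \<forall>t\<in>{real j * \<tau>..real (Suc j) * \<tau>}.
      \<bar>primitive \<phi> i t - primitive \<phi> i (real j * \<tau>)\<bar> \<le> \<bar>D i j\<bar>)"
proof -
  define \<phi> where "\<phi> = (\<lambda>i t. D i (nat \<lfloor>t / \<tau>\<rfloor>) / \<tau>)"
  let ?M = "lebesgue_on {0..T}"
  have \<phi>D: "L2_density T n \<phi>"
    unfolding L2_density_def
  proof (intro ballI conjI)
    fix i
    have "(\<lambda>t::real. \<lfloor>t / \<tau>\<rfloor>) \<in> measurable borel (count_space UNIV)" by measurable
    then have "(\<lambda>t. D i (nat \<lfloor>t / \<tau>\<rfloor>) / \<tau>) \<in> borel_measurable borel"
      by (rule measurable_compose) simp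
    then have m: "\<phi> i \<in> borel_measurable lborel" by (simp add: \<phi>_def)
    then show m': "\<phi> i \<in> borel_measurable ?M"
      by (intro measurable_restrict_space1 measurable_completion)
    show "integrable ?M (\<lambda>t. (\<phi> i t)\<^sup>2)"
    proof (rule finite_measure.integrable_const_bound[OF finite_measure_lebesgue_Icc])
      show "(\<lambda>t. (\<phi> i t)\<^sup>2) \<in> borel_measurable ?M" using m' by measurable
      \<comment> \<open>The index \<open>N\<close> is included because the floor equals
        \<open>N\<close> at \<open>t = T\<close>.\<close>
      show "AE t in ?M. norm ((\<phi> i t)\<^sup>2) \<le> (\<Sum>k\<le>N. (D i k / \<tau>)\<^sup>2)"
      proof (rule AE_I2)
        fix t assume "t \<in> space ?M"
        then have t: "0 \<le> t" "t \<le> T" by auto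
        have "t / \<tau> \<le> real N" using t T \<tau> by (simp add: pos_divide_le_eq)
        then have "\<lfloor>t / \<tau>\<rfloor> \<le> int N" by linarith
        then have "nat \<lfloor>t / \<tau>\<rfloor> \<in> {..N}" by auto
        then have "(\<phi> i t)\<^sup>2 \<le> (\<Sum>k\<le>N. (D i k / \<tau>)\<^sup>2)"
          unfolding \<phi>_def by (intro member_le_sum) auto
        then show "norm ((\<phi> i t)\<^sup>2) \<le> (\<Sum>k\<le>N. (D i k / \<tau>)\<^sup>2)" by simp
      qed
    qed
  qed
  have grid: "primitive \<phi> i (real j * \<tau>) = (\<Sum>k<j. D i k)" for i j
    unfolding primitive_def \<phi>_def
    using integral_unique[OF step_function_has_integral(2)[OF \<tau>, of "\<lambda>k. D i k / \<tau>" j]] \<tau> by (simp del: integral_divide)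
  have "integral {0..T} (\<lambda>t. (\<phi> i t)\<^sup>2) = (\<Sum>j<N. (D i j)\<^sup>2 / \<tau>)" for i
  proof -
    have "integral {0..T} (\<lambda>t. (\<phi> i t)\<^sup>2) = (\<Sum>j<N. (D i j / \<tau>)\<^sup>2 * \<tau>)"
      using integral_unique[OF step_function_has_integral(2)[OF \<tau>, of "\<lambda>k. (D i k / \<tau>)\<^sup>2" N]]
      by (simp add: \<phi>_def T)
    then show ?thesis using \<tau> by (simp add: power_divide power2_eq_square)
  qed
  then have en: "energy T n \<phi> = (\<Sum>i=1..n. \<Sum>j<N. (D i j)\<^sup>2 / \<tau>)"
    unfolding energy_eq_HK[OF \<phi>D] by simp
  have "\<bar>primitive \<phi> i t - primitive \<phi> i (real j * \<tau>)\<bar> \<le> \<bar>D i j\<bar>"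
    if i: "i \<in> {1..n}" and j: "j < N" and t: "t \<in> {real j * \<tau>..real (Suc j) * \<tau>}" for i j t
  proof -
    have "real (Suc j) * \<tau> \<le> T" unfolding T using j \<tau> by (intro mult_right_mono) auto
    then have "primitive \<phi> i t - primitive \<phi> i (real j * \<tau>) = D i j / \<tau> * (t - real j * \<tau>)"
      using primitive_increment[OF \<phi>D i, of "real j * \<tau>" t]
        integral_unique[OF step_function_has_integral(1)[OF \<tau> t, of "\<lambda>k. D i k / \<tau>"]] t \<tau>
      by (simp add: \<phi>_def del: integral_divide)
    moreover have "\<bar>D i j / \<tau> * (t - real j * \<tau>)\<bar> \<le> \<bar>D i j\<bar> / \<tau> * \<tau>"
      unfolding abs_mult using t \<tau> by (intro mult_mono) (auto simp: algebra_simps)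
    ultimately show ?thesis using \<tau> by simp
  qed
  then show ?thesis using \<phi>D en grid by (intro exI[of _ \<phi>]) blast
qed

section \<open>Independence of the increments over a grid\<close>

context wiener_setting
begin

context
  fixes p :: "nat \<Rightarrow> real" and m :: nat
  assumes p0: "0 \<le> p 0" and p_step: "\<And>j. j < m \<Longrightarrow> p j < p (Suc j)"
begin

lemma grid_mono: "j \<le> k \<Longrightarrow> k \<le> m \<Longrightarrow> p j \<le> p k"
proof (induction k)
  case (Suc k)
  then show ?case using p_step[of k] by (cases "j = Suc k") auto
qed simp

lemma grid_nonneg: "k \<le> m \<Longrightarrow> 0 \<le> p k"
  using grid_mono[of 0 k] p0 by simp

text \<open>Induction on the number of cells: the product over earlier increments is measurable at
  the last grid time, and the next increment is independent of that past.\<close>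

lemma nn_integral_increment_prod:
  fixes f :: "nat \<Rightarrow> real \<Rightarrow> ennreal"
  assumes i: "i \<ge> 1" and f: "\<And>j. f j \<in> borel_measurable borel" and k: "k \<le> m"
  shows "(\<integral>\<^sup>+\<omega>. (\<Prod>j<k. f j (\<beta> i (p (Suc j)) \<omega> - \<beta> i (p j) \<omega>)) \<partial>M) =
    (\<Prod>j<k. \<integral>\<^sup>+\<omega>. f j (\<beta> i (p (Suc j)) \<omega> - \<beta> i (p j) \<omega>) \<partial>M)"
  using k
proof (induction k)
  case 0
  then show ?case by (simp add: emeasure_space_1)
next
  case (Suc k)
  have "(\<lambda>\<omega>. \<Prod>j<k. f j (\<beta> i (p (Suc j)) \<omega> - \<beta> i (p j) \<omega>)) \<in> borel_measurable (Fil (p k))"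
  proof (intro borel_measurable_prod_ennreal measurable_compose[OF _ f] borel_measurable_diff)
    fix j assume "j \<in> {..<k}"
    then have j: "j \<le> m" "Suc j \<le> m" "j \<le> k" "Suc j \<le> k" "k \<le> m" using Suc.prems by auto
    show "\<beta> i (p (Suc j)) \<in> borel_measurable (Fil (p k))" "\<beta> i (p j) \<in> borel_measurable (Fil (p k))"
      using j grid_nonneg grid_mono
      by (auto intro!: Fil_mono[OF _ _ brownian_measurable_Fil[OF brownian_\<beta>[OF i]]])
  qed
  then have "indep_var borel (\<lambda>\<omega>. \<Prod>j<k. f j (\<beta> i (p (Suc j)) \<omega> - \<beta> i (p j) \<omega>))
      borel (\<lambda>\<omega>. f k (\<beta> i (p (Suc k)) \<omega> - \<beta> i (p k) \<omega>))"
    using Suc.prems grid_nonneg[of k] p_step[of k]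
    by (intro brownian_increment_indep[OF brownian_\<beta>[OF i]] f) auto
  from nn_integral_indep_mult[OF this] Suc show ?case by simp
qed

text \<open>Independence across coordinates comes from the independence of the processes,
  independence in time from the filtration; together they factor every product over the array of
  increments.\<close>

lemma nn_integral_increment_prod2:
  fixes f :: "nat \<Rightarrow> nat \<Rightarrow> real \<Rightarrow> ennreal"
  assumes f: "\<And>i j. f i j \<in> borel_measurable borel"
  shows "(\<integral>\<^sup>+\<omega>. (\<Prod>i\<in>{1..n}. \<Prod>j<m. f i j (\<beta> i (p (Suc j)) \<omega> - \<beta> i (p j) \<omega>)) \<partial>M) =
    (\<Prod>i\<in>{1..n}. \<Prod>j<m. \<integral>\<^sup>+\<omega>. f i j (\<beta> i (p (Suc j)) \<omega> - \<beta> i (p j) \<omega>) \<partial>M)"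
proof -
  have iv: "indep_vars (\<lambda>_. \<Pi>\<^sub>M t\<in>{0..}. borel) (\<lambda>i \<omega>. \<lambda>t\<in>{0..}. \<beta> i t \<omega>) {1..}"
    using wiener by (simp add: cylindrical_wiener_def)
  define Y where "Y = (\<lambda>i (x :: real \<Rightarrow> real). \<Prod>j<m. f i j (x (p (Suc j)) - x (p j)))"
  have "indep_vars (\<lambda>_. borel) (\<lambda>i \<omega>. Y i (\<lambda>t\<in>{0..}. \<beta> i t \<omega>)) {1..n}"
  proof (rule indep_vars_compose2[OF indep_vars_subset[OF iv]])
    have c: "(\<lambda>x. x u) \<in> borel_measurable (\<Pi>\<^sub>M t\<in>{0..}. borel :: real measure)" if "u \<ge> 0" for u :: real
      using that by (intro measurable_component_singleton) auto
    show "Y i \<in> borel_measurable (\<Pi>\<^sub>M t\<in>{0..}. borel)" for i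
      unfolding Y_def using grid_nonneg
      by (intro borel_measurable_prod_ennreal measurable_compose[OF _ f] borel_measurable_diff c) auto
  qed auto
  then have "(\<integral>\<^sup>+\<omega>. (\<Prod>i\<in>{1..n}. Y i (\<lambda>t\<in>{0..}. \<beta> i t \<omega>)) \<partial>M) =
      (\<Prod>i\<in>{1..n}. \<integral>\<^sup>+\<omega>. Y i (\<lambda>t\<in>{0..}. \<beta> i t \<omega>) \<partial>M)"
    by (intro indep_vars_nn_integral) auto
  moreover have "Y i (\<lambda>t\<in>{0..}. \<beta> i t \<omega>) = (\<Prod>j<m. f i j (\<beta> i (p (Suc j)) \<omega> - \<beta> i (p j) \<omega>))" for i \<omega>
    unfolding Y_def using grid_nonneg by (intro prod.cong refl) auto
  ultimately have "(\<integral>\<^sup>+\<omega>. (\<Prod>i\<in>{1..n}. \<Prod>j<m. f i j (\<beta> i (p (Suc j)) \<omega> - \<beta> i (p j) \<omega>)) \<partial>M) =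
      (\<Prod>i\<in>{1..n}. \<integral>\<^sup>+\<omega>. (\<Prod>j<m. f i j (\<beta> i (p (Suc j)) \<omega> - \<beta> i (p j) \<omega>)) \<partial>M)"
    by (simp only:)
  also have "\<dots> = (\<Prod>i\<in>{1..n}. \<Prod>j<m. \<integral>\<^sup>+\<omega>. f i j (\<beta> i (p (Suc j)) \<omega> - \<beta> i (p j) \<omega>) \<partial>M)"
    by (intro prod.cong refl nn_integral_increment_prod f) auto
  finally show ?thesis .
qed

end
end

section \<open>Gaussian estimates on a uniform grid\<close>

context wiener_setting
begin

definition grid_incr :: "real \<Rightarrow> nat \<Rightarrow> nat \<Rightarrow> 'w \<Rightarrow> real" where
  "grid_incr \<tau> i j \<omega> = \<beta> i (real (Suc j) * \<tau>) \<omega> - \<beta> i (real j * \<tau>) \<omega>"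

context
  fixes \<tau> :: real
  assumes \<tau>: "\<tau> > 0"
begin

lemma grid_incr_distr:
  assumes "i \<ge> 1"
  shows "distributed M lborel (grid_incr \<tau> i j) (\<lambda>x. ennreal (normal_density 0 (sqrt \<tau>) x))"
proof -
  have "real (Suc j) * \<tau> - real j * \<tau> = \<tau>" by (simp add: algebra_simps)
  then show ?thesis
    using brownian_increment_distr[OF brownian_\<beta>[OF assms], of "real j * \<tau>" "real (Suc j) * \<tau>"] \<tau>
    unfolding grid_incr_def[abs_def] by simp
qed

lemma grid_incr_measurable:
  assumes "i \<ge> 1"
  shows "grid_incr \<tau> i j \<in> borel_measurable M"
  using distributed_measurable[OF grid_incr_distr[OF assms]] by simp

lemma nn_integral_grid_prod:
  fixes f :: "nat \<Rightarrow> nat \<Rightarrow> real \<Rightarrow> ennreal"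
  assumes f: "\<And>i j. f i j \<in> borel_measurable borel"
  shows "(\<integral>\<^sup>+\<omega>. (\<Prod>i\<in>{1..n}. \<Prod>j<m. f i j (grid_incr \<tau> i j \<omega>)) \<partial>M) =
    (\<Prod>i\<in>{1..n}. \<Prod>j<m. \<integral>\<^sup>+\<omega>. f i j (grid_incr \<tau> i j \<omega>) \<partial>M)"
  unfolding grid_incr_def using \<tau>
  by (intro nn_integral_increment_prod2[of "\<lambda>j. real j * \<tau>" m f, OF _ _ f]) (auto intro: mult_strict_right_mono)

text \<open>Each window is a shifted symmetric interval. By \<open>normal_shifted_interval\<close>
  the shift costs an exponential factor, and by the smallness assumption the unshifted interval has
  probability at least 1/2. Independence multiplies the bounds; the power of 1/2 does not involve
  \<epsilon>.\<close>

lemma grid_box_lower_bound: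
  fixes d :: "nat \<Rightarrow> nat \<Rightarrow> real" and m n :: nat
  assumes \<epsilon>: "\<epsilon> > 0" and r: "r > 0" and small: "2 * exp (- (r / \<epsilon>)\<^sup>2 / (2 * \<tau>)) \<le> 1/2"
  defines "A \<equiv> {\<omega>\<in>space M. \<forall>i\<in>{1..n}. \<forall>j\<in>{..<m}. \<bar>\<epsilon> * grid_incr \<tau> i j \<omega> - d i j\<bar> < r}"
  shows "A \<in> sets M"
    "exp (- (\<Sum>i=1..n. \<Sum>j<m. (d i j)\<^sup>2 / \<tau>) / (2 * \<epsilon>\<^sup>2)) * (1/2) ^ (n * m) \<le> prob A"
proof -
  have [measurable]: "grid_incr \<tau> i j \<in> borel_measurable M" if "i \<in> {1..n}" for i j
    using that by (intro grid_incr_measurable) auto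
  show A: "A \<in> sets M"
    unfolding A_def
  proof (intro sets.sets_Collect_finite_All)
    fix i j assume i: "i \<in> {1..n}"
    show "{\<omega>\<in>space M. \<bar>\<epsilon> * grid_incr \<tau> i j \<omega> - d i j\<bar> < r} \<in> sets M"
      using grid_incr_measurable[of i j] i by measurable
  qed auto
  define f where "f = (\<lambda>i j (x::real). indicator {d i j / \<epsilon> - r / \<epsilon><..<d i j / \<epsilon> + r / \<epsilon>} x :: ennreal)"
  have f: "f i j \<in> borel_measurable borel" for i j by (simp add: f_def)
  have mem: "\<bar>\<epsilon> * x - c\<bar> < r \<longleftrightarrow> x \<in> {c / \<epsilon> - r / \<epsilon><..<c / \<epsilon> + r / \<epsilon>}"
    "\<bar>x - c / \<epsilon>\<bar> < r / \<epsilon> \<longleftrightarrow> x \<in> {c / \<epsilon> - r / \<epsilon><..<c / \<epsilon> + r / \<epsilon>}" for x c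
  proof -
    have "\<bar>\<epsilon> * x - c\<bar> = \<epsilon> * \<bar>x - c / \<epsilon>\<bar>" using \<epsilon> by (simp add: abs_mult_pos' right_diff_distrib)
    then have "\<bar>\<epsilon> * x - c\<bar> < r \<longleftrightarrow> \<bar>x - c / \<epsilon>\<bar> < r / \<epsilon>"
      using \<epsilon> by (simp add: pos_less_divide_eq mult.commute)
    moreover show "\<bar>x - c / \<epsilon>\<bar> < r / \<epsilon> \<longleftrightarrow> x \<in> {c / \<epsilon> - r / \<epsilon><..<c / \<epsilon> + r / \<epsilon>}"
      by (auto simp: abs_less_iff)
    ultimately show "\<bar>\<epsilon> * x - c\<bar> < r \<longleftrightarrow> x \<in> {c / \<epsilon> - r / \<epsilon><..<c / \<epsilon> + r / \<epsilon>}" by blast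
  qed
  have ind: "indicator A \<omega> = (\<Prod>i\<in>{1..n}. \<Prod>j<m. f i j (grid_incr \<tau> i j \<omega>))" if sp: "\<omega> \<in> space M" for \<omega>
  proof (cases "\<omega> \<in> A")
    case True
    then have "f i j (grid_incr \<tau> i j \<omega>) = 1" if "i \<in> {1..n}" "j \<in> {..<m}" for i j
      using that unfolding A_def f_def mem(1) by auto
    then show ?thesis using True by simp
  next
    case False
    then obtain i j where ij: "i \<in> {1..n}" "j \<in> {..<m}" "\<not> \<bar>\<epsilon> * grid_incr \<tau> i j \<omega> - d i j\<bar> < r"
      using sp unfolding A_def by blast
    then have "f i j (grid_incr \<tau> i j \<omega>) = 0" unfolding mem(1) f_def by simp
    then have "(\<Prod>j<m. f i j (grid_incr \<tau> i j \<omega>)) = 0" using ij(2) by (auto intro!: prod_zero)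
    then have "(\<Prod>i\<in>{1..n}. \<Prod>j<m. f i j (grid_incr \<tau> i j \<omega>)) = 0" using ij(1) by (intro prod_zero) auto
    then show ?thesis using False by simp
  qed
  have one: "ennreal (exp (- (d i j)\<^sup>2 / \<tau> / (2 * \<epsilon>\<^sup>2)) * (1/2)) \<le> (\<integral>\<^sup>+\<omega>. f i j (grid_incr \<tau> i j \<omega>) \<partial>M)"
    if i: "i \<in> {1..n}" for i j
  proof -
    have i1: "i \<ge> 1" using i by simp
    note D = grid_incr_distr[OF i1, of j]
    have [measurable]: "grid_incr \<tau> i j \<in> borel_measurable M" by (rule grid_incr_measurable[OF i1])
    have s: "sqrt \<tau> > 0" using \<tau> by simp
    have "prob {\<omega>\<in>space M. \<bar>grid_incr \<tau> i j \<omega>\<bar> \<ge> r / \<epsilon>} \<le> 1/2"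
      using normal_abs_tail[OF D s, of "r / \<epsilon>"] r \<epsilon> \<tau> small by simp
    moreover have "prob {\<omega>\<in>space M. \<bar>grid_incr \<tau> i j \<omega>\<bar> < r / \<epsilon>} = 1 - prob {\<omega>\<in>space M. \<bar>grid_incr \<tau> i j \<omega>\<bar> \<ge> r / \<epsilon>}"
    proof -
      have "{\<omega>\<in>space M. \<bar>grid_incr \<tau> i j \<omega>\<bar> < r / \<epsilon>} = space M - {\<omega>\<in>space M. \<bar>grid_incr \<tau> i j \<omega>\<bar> \<ge> r / \<epsilon>}" by auto
      then show ?thesis by (simp add: prob_compl)
    qed
    ultimately have h: "1/2 \<le> prob {\<omega>\<in>space M. \<bar>grid_incr \<tau> i j \<omega>\<bar> < r / \<epsilon>}" by linarith
    have "exp (- (d i j / \<epsilon>)\<^sup>2 / (2 * (sqrt \<tau>)\<^sup>2)) * (1/2)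
        \<le> exp (- (d i j / \<epsilon>)\<^sup>2 / (2 * (sqrt \<tau>)\<^sup>2)) * prob {\<omega>\<in>space M. \<bar>grid_incr \<tau> i j \<omega>\<bar> < r / \<epsilon>}"
      using h by (intro mult_left_mono) auto
    also have "\<dots> \<le> prob {\<omega>\<in>space M. \<bar>grid_incr \<tau> i j \<omega> - d i j / \<epsilon>\<bar> < r / \<epsilon>}"
      by (rule normal_shifted_interval[OF D s])
    also have "(- (d i j / \<epsilon>)\<^sup>2 / (2 * (sqrt \<tau>)\<^sup>2)) = - (d i j)\<^sup>2 / \<tau> / (2 * \<epsilon>\<^sup>2)"
      using \<tau> by (simp add: power_divide mult.commute)
    finally have "ennreal (exp (- (d i j)\<^sup>2 / \<tau> / (2 * \<epsilon>\<^sup>2)) * (1/2))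
        \<le> emeasure M {\<omega>\<in>space M. \<bar>grid_incr \<tau> i j \<omega> - d i j / \<epsilon>\<bar> < r / \<epsilon>}"
      by (simp add: emeasure_eq_measure ennreal_leI)
    also have "\<dots> = (\<integral>\<^sup>+\<omega>. indicator {\<omega>\<in>space M. \<bar>grid_incr \<tau> i j \<omega> - d i j / \<epsilon>\<bar> < r / \<epsilon>} \<omega> \<partial>M)"
      by (rule nn_integral_indicator[symmetric]) measurable
    also have "\<dots> = (\<integral>\<^sup>+\<omega>. f i j (grid_incr \<tau> i j \<omega>) \<partial>M)"
      unfolding f_def mem(2) by (intro nn_integral_cong) (auto simp: indicator_def)
    finally show ?thesis .
  qed
  have "exp (- (\<Sum>i=1..n. \<Sum>j<m. (d i j)\<^sup>2 / \<tau>) / (2 * \<epsilon>\<^sup>2)) * (1/2) ^ (n * m) =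
      (\<Prod>i\<in>{1..n}. \<Prod>j<m. exp (- (d i j)\<^sup>2 / \<tau> / (2 * \<epsilon>\<^sup>2)) * (1/2))"
  proof -
    have 1: "- (\<Sum>i=1..n. \<Sum>j<m. (d i j)\<^sup>2 / \<tau>) / (2 * \<epsilon>\<^sup>2) = (\<Sum>i=1..n. \<Sum>j<m. - (d i j)\<^sup>2 / \<tau> / (2 * \<epsilon>\<^sup>2))"
      by (simp add: sum_negf sum_divide_distrib)
    have 2: "(\<Prod>i\<in>{1..n}. \<Prod>j<m. F i j * (1/2)) = (\<Prod>i\<in>{1..n}. \<Prod>j<m. F i j) * (1/2) ^ (n * m)"
      for F :: "nat \<Rightarrow> nat \<Rightarrow> real"
      by (simp only: prod.distrib prod_constant card_lessThan card_atLeastAtMost diff_Suc_1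
        power_mult[symmetric] mult.commute[of m n])
    show ?thesis unfolding 1 2 by (simp only: exp_sum finite_atLeastAtMost finite_lessThan)
  qed
  then have "ennreal (exp (- (\<Sum>i=1..n. \<Sum>j<m. (d i j)\<^sup>2 / \<tau>) / (2 * \<epsilon>\<^sup>2)) * (1/2) ^ (n * m)) =
      (\<Prod>i\<in>{1..n}. \<Prod>j<m. ennreal (exp (- (d i j)\<^sup>2 / \<tau> / (2 * \<epsilon>\<^sup>2)) * (1/2)))"
    by (simp only: prod_ennreal[symmetric] prod_nonneg exp_ge_zero mult_nonneg_nonneg zero_le_divide_1_iff zero_le_numeral)
  also have "\<dots> \<le> (\<Prod>i\<in>{1..n}. \<Prod>j<m. \<integral>\<^sup>+\<omega>. f i j (grid_incr \<tau> i j \<omega>) \<partial>M)"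
    by (intro prod_mono_ennreal one)
  also have "\<dots> = (\<integral>\<^sup>+\<omega>. (\<Prod>i\<in>{1..n}. \<Prod>j<m. f i j (grid_incr \<tau> i j \<omega>)) \<partial>M)"
    by (rule nn_integral_grid_prod[OF f, symmetric])
  also have "\<dots> = (\<integral>\<^sup>+\<omega>. indicator A \<omega> \<partial>M)"
    by (intro nn_integral_cong ind[symmetric])
  also have "\<dots> = ennreal (prob A)" using A by (simp add: emeasure_eq_measure)
  finally show "exp (- (\<Sum>i=1..n. \<Sum>j<m. (d i j)\<^sup>2 / \<tau>) / (2 * \<epsilon>\<^sup>2)) * (1/2) ^ (n * m) \<le> prob A"
    by simp
qed

text \<open>The exponential Chebyshev inequality for the sum of independent squared Gaussians.
  Keeping \<theta> below 1 makes each moment finite, at the price of the rate \<theta> \<alpha>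
  instead of \<alpha>; the prefactor does not involve \<epsilon>.\<close>

lemma grid_energy_tail:
  fixes \<alpha> \<epsilon> \<theta> :: real and m n :: nat
  assumes \<epsilon>: "\<epsilon> > 0" and \<theta>: "0 \<le> \<theta>" "\<theta> < 1"
  defines "N \<equiv> {\<omega>\<in>space M. (\<Sum>i=1..n. \<Sum>j<m. (\<epsilon> * grid_incr \<tau> i j \<omega>)\<^sup>2 / \<tau>) > 2 * \<alpha>}"
  shows "N \<in> sets M" "prob N \<le> exp (- \<theta> * \<alpha> / \<epsilon>\<^sup>2) * (1 / sqrt (1 - \<theta>)) ^ (n * m)"
proof -
  have gm: "grid_incr \<tau> i j \<in> borel_measurable M" if "i \<in> {1..n}" for i j
    using that by (intro grid_incr_measurable) auto
  have "(\<lambda>\<omega>. \<Sum>i=1..n. \<Sum>j<m. (\<epsilon> * grid_incr \<tau> i j \<omega>)\<^sup>2 / \<tau>) \<in> borel_measurable M"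
    by (intro borel_measurable_sum borel_measurable_divide borel_measurable_power borel_measurable_times
      borel_measurable_const gm)
  then show N: "N \<in> sets M" unfolding N_def by measurable
  define f where "f = (\<lambda>(i::nat) (j::nat) (x::real). ennreal (exp (\<theta> * (x\<^sup>2 / (2 * (sqrt \<tau>)\<^sup>2)))))"
  have f: "f i j \<in> borel_measurable borel" for i j unfolding f_def by measurable
  have "ennreal (exp (\<theta> * \<alpha> / \<epsilon>\<^sup>2)) * emeasure M N = (\<integral>\<^sup>+\<omega>. ennreal (exp (\<theta> * \<alpha> / \<epsilon>\<^sup>2)) * indicator N \<omega> \<partial>M)"
    using N by (simp add: nn_integral_cmult_indicator)
  also have "\<dots> \<le> (\<integral>\<^sup>+\<omega>. (\<Prod>i\<in>{1..n}. \<Prod>j<m. f i j (grid_incr \<tau> i j \<omega>)) \<partial>M)"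
  proof (intro nn_integral_mono)
    fix \<omega> assume "\<omega> \<in> space M"
    have e: "(\<Prod>i\<in>{1..n}. \<Prod>j<m. f i j (grid_incr \<tau> i j \<omega>)) =
        ennreal (exp (\<theta> * (\<Sum>i=1..n. \<Sum>j<m. (grid_incr \<tau> i j \<omega>)\<^sup>2 / \<tau>) / 2))"
      unfolding f_def using \<tau>
      by (simp add: prod_ennreal prod_nonneg exp_sum[symmetric] sum_distrib_left sum_divide_distrib mult.commute)
    show "ennreal (exp (\<theta> * \<alpha> / \<epsilon>\<^sup>2)) * indicator N \<omega> \<le> (\<Prod>i\<in>{1..n}. \<Prod>j<m. f i j (grid_incr \<tau> i j \<omega>))"
    proof (cases "\<omega> \<in> N")
      case True
      have "(\<Sum>i=1..n. \<Sum>j<m. (\<epsilon> * grid_incr \<tau> i j \<omega>)\<^sup>2 / \<tau>) = \<epsilon>\<^sup>2 * (\<Sum>i=1..n. \<Sum>j<m. (grid_incr \<tau> i j \<omega>)\<^sup>2 / \<tau>)"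
        by (simp add: power_mult_distrib sum_distrib_left)
      then have "2 * \<alpha> \<le> \<epsilon>\<^sup>2 * (\<Sum>i=1..n. \<Sum>j<m. (grid_incr \<tau> i j \<omega>)\<^sup>2 / \<tau>)"
        using True unfolding N_def by simp
      then have "\<alpha> / \<epsilon>\<^sup>2 \<le> (\<Sum>i=1..n. \<Sum>j<m. (grid_incr \<tau> i j \<omega>)\<^sup>2 / \<tau>) / 2"
        using \<epsilon> by (simp add: pos_divide_le_eq mult.commute)
      then have "\<theta> * (\<alpha> / \<epsilon>\<^sup>2) \<le> \<theta> * ((\<Sum>i=1..n. \<Sum>j<m. (grid_incr \<tau> i j \<omega>)\<^sup>2 / \<tau>) / 2)"
        using \<theta> by (intro mult_left_mono)
      then show ?thesis unfolding e using True by (simp add: ennreal_leI)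
    qed simp
  qed
  also have "\<dots> = (\<Prod>i\<in>{1..n}. \<Prod>j<m. \<integral>\<^sup>+\<omega>. f i j (grid_incr \<tau> i j \<omega>) \<partial>M)"
    by (rule nn_integral_grid_prod[OF f])
  also have "\<dots> = (\<Prod>i\<in>{1..n}. \<Prod>j<m. ennreal (1 / sqrt (1 - \<theta>)))"
  proof (intro prod.cong refl)
    fix i j assume "i \<in> {1..n}"
    then have i: "i \<ge> 1" by simp
    show "(\<integral>\<^sup>+\<omega>. f i j (grid_incr \<tau> i j \<omega>) \<partial>M) = ennreal (1 / sqrt (1 - \<theta>))"
      unfolding f_def using \<tau> \<theta> by (intro normal_square_exp_moment[OF grid_incr_distr[OF i]]) auto
  qed
  also have "\<dots> = ennreal ((1 / sqrt (1 - \<theta>)) ^ (n * m))"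
    using \<theta> by (simp add: ennreal_power power_mult mult.commute[of n])
  finally have "exp (\<theta> * \<alpha> / \<epsilon>\<^sup>2) * prob N \<le> (1 / sqrt (1 - \<theta>)) ^ (n * m)"
    using \<theta> by (simp add: emeasure_eq_measure ennreal_mult[symmetric])
  then have "prob N \<le> (1 / sqrt (1 - \<theta>)) ^ (n * m) / exp (\<theta> * \<alpha> / \<epsilon>\<^sup>2)"
    by (simp only: pos_le_divide_eq exp_gt_zero mult.commute)
  then show "prob N \<le> exp (- \<theta> * \<alpha> / \<epsilon>\<^sup>2) * (1 / sqrt (1 - \<theta>)) ^ (n * m)"
    by (simp add: exp_minus divide_inverse mult.commute)
qed

text \<open>One maximal inequality for each coordinate and cell. The mesh stands in the denominator
  of the exponent, so a fine grid outweighs any prescribed rate.\<close>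

lemma grid_oscillation:
  assumes \<epsilon>: "\<epsilon> > 0" and r: "r \<ge> 0"
  shows "\<exists>N\<in>sets M. prob N \<le> 4 * real (n * m) * exp (- r\<^sup>2 / (2 * \<tau> * \<epsilon>\<^sup>2)) \<and>
    (AE \<omega> in M. \<omega> \<notin> N \<longrightarrow> (\<forall>i\<in>{1..n}. \<forall>j<m. \<forall>t\<in>{real j * \<tau>..real (Suc j) * \<tau>}.
      \<bar>\<epsilon> * \<beta> i t \<omega> - \<epsilon> * \<beta> i (real j * \<tau>) \<omega>\<bar> \<le> r))"
proof -
  have "\<exists>N\<in>sets M. prob N \<le> 4 * exp (- r\<^sup>2 / (2 * \<tau> * \<epsilon>\<^sup>2)) \<and>
    (AE \<omega> in M. \<omega> \<notin> N \<longrightarrow> (\<forall>t\<in>{real j * \<tau>..real (Suc j) * \<tau>}. \<bar>\<beta> i t \<omega> - \<beta> i (real j * \<tau>) \<omega>\<bar> \<le> r / \<epsilon>))"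
    if i: "i \<in> {1..n}" for i j
  proof -
    have i1: "i \<ge> 1" using i by simp
    have w: "real (Suc j) * \<tau> - real j * \<tau> = \<tau>" by (simp add: algebra_simps)
    have e: "- (r / \<epsilon>)\<^sup>2 / (2 * (real (Suc j) * \<tau> - real j * \<tau>)) = - r\<^sup>2 / (2 * \<tau> * \<epsilon>\<^sup>2)"
      unfolding w by (simp add: power_divide mult.commute)
    have "0 \<le> real j * \<tau>" "real j * \<tau> < real (Suc j) * \<tau>" "0 \<le> r / \<epsilon>" using \<tau> \<epsilon> r by auto
    from brownian_maximal[OF brownian_\<beta>[OF i1] this] show ?thesis unfolding e .
  qed
  then have "\<forall>i\<in>{1..n}. \<forall>j. \<exists>N. N \<in> sets M \<and> prob N \<le> 4 * exp (- r\<^sup>2 / (2 * \<tau> * \<epsilon>\<^sup>2)) \<and>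
    (AE \<omega> in M. \<omega> \<notin> N \<longrightarrow> (\<forall>t\<in>{real j * \<tau>..real (Suc j) * \<tau>}. \<bar>\<beta> i t \<omega> - \<beta> i (real j * \<tau>) \<omega>\<bar> \<le> r / \<epsilon>))"
    by blast
  then obtain N where N: "\<forall>i\<in>{1..n}. \<forall>j. N i j \<in> sets M \<and> prob (N i j) \<le> 4 * exp (- r\<^sup>2 / (2 * \<tau> * \<epsilon>\<^sup>2)) \<and>
    (AE \<omega> in M. \<omega> \<notin> N i j \<longrightarrow> (\<forall>t\<in>{real j * \<tau>..real (Suc j) * \<tau>}. \<bar>\<beta> i t \<omega> - \<beta> i (real j * \<tau>) \<omega>\<bar> \<le> r / \<epsilon>))"
    unfolding bchoice_iff choice_iff by blast
  let ?U = "\<Union>q\<in>{1..n} \<times> {..<m}. N (fst q) (snd q)"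
  have "prob ?U \<le> (\<Sum>q\<in>{1..n} \<times> {..<m}. prob (N (fst q) (snd q)))"
    using N by (intro measure_UNION_le) auto
  also have "\<dots> \<le> (\<Sum>q\<in>{1..n} \<times> {..<m}. 4 * exp (- r\<^sup>2 / (2 * \<tau> * \<epsilon>\<^sup>2)))"
    using N by (intro sum_mono) auto
  also have "\<dots> = 4 * real (n * m) * exp (- r\<^sup>2 / (2 * \<tau> * \<epsilon>\<^sup>2))" by simp
  finally have P: "prob ?U \<le> 4 * real (n * m) * exp (- r\<^sup>2 / (2 * \<tau> * \<epsilon>\<^sup>2))" .
  have "AE \<omega> in M. \<forall>i\<in>{1..n}. \<forall>j\<in>{..<m}. \<omega> \<notin> N i j \<longrightarrow>
      (\<forall>t\<in>{real j * \<tau>..real (Suc j) * \<tau>}. \<bar>\<beta> i t \<omega> - \<beta> i (real j * \<tau>) \<omega>\<bar> \<le> r / \<epsilon>)"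
    using N by (intro AE_finite_allI) auto
  then have "AE \<omega> in M. \<omega> \<notin> ?U \<longrightarrow> (\<forall>i\<in>{1..n}. \<forall>j<m. \<forall>t\<in>{real j * \<tau>..real (Suc j) * \<tau>}.
      \<bar>\<epsilon> * \<beta> i t \<omega> - \<epsilon> * \<beta> i (real j * \<tau>) \<omega>\<bar> \<le> r)"
  proof eventually_elim
    case (elim \<omega>)
    show ?case
    proof (intro impI ballI allI)
      fix i j t assume U: "\<omega> \<notin> ?U" and i: "i \<in> {1..n}" and j: "j < m" and t: "t \<in> {real j * \<tau>..real (Suc j) * \<tau>}"
      have "\<omega> \<notin> N i j" using U i j by force
      then have "\<bar>\<beta> i t \<omega> - \<beta> i (real j * \<tau>) \<omega>\<bar> \<le> r / \<epsilon>" using elim i j t by blast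
      then have "\<epsilon> * \<bar>\<beta> i t \<omega> - \<beta> i (real j * \<tau>) \<omega>\<bar> \<le> r" using \<epsilon> by (simp add: pos_le_divide_eq mult.commute)
      then show "\<bar>\<epsilon> * \<beta> i t \<omega> - \<epsilon> * \<beta> i (real j * \<tau>) \<omega>\<bar> \<le> r"
        using \<epsilon> by (simp add: right_diff_distrib[symmetric] abs_mult)
    qed
  qed
  then show ?thesis using P N by (intro bexI[of _ ?U]) (blast, auto)
qed

end
end

lemma exp_decay_bound:
  fixes a c \<eta> :: real
  assumes "a > 0" "c \<ge> 0" "\<eta> > 0"
  shows "\<exists>x\<^sub>0>0. \<forall>x\<ge>x\<^sub>0. c * exp (- a * x) \<le> \<eta>"
\<comment> \<open>From a x \<le> exp(a x) it suffices that c \<le> \<eta> a x.\<close>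
proof (intro exI[of _ "c / (a * \<eta>) + 1"] conjI allI impI)
  show "0 < c / (a * \<eta>) + 1" using assms by (intro add_nonneg_pos) auto
  fix x assume x: "c / (a * \<eta>) + 1 \<le> x"
  then have x0: "x > 0" using assms by (smt (verit) divide_nonneg_nonneg mult_nonneg_nonneg)
  have "c / (a * \<eta>) \<le> x" using x by linarith
  then have "c \<le> x * (a * \<eta>)" using assms by (simp add: pos_divide_le_eq)
  also have "\<dots> \<le> \<eta> * exp (a * x)"
  proof -
    have "a * x \<le> exp (a * x)" using exp_ge_add_one_self[of "a * x"] by linarith
    then have "\<eta> * (a * x) \<le> \<eta> * exp (a * x)" using assms by (intro mult_left_mono) auto
    then show ?thesis by (simp add: mult_ac)
  qed
  finally have "c \<le> \<eta> * exp (a * x)" .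
  then have "c * exp (- a * x) \<le> \<eta> * exp (a * x) * exp (- a * x)" by (intro mult_right_mono) auto
  also have "\<dots> = \<eta>" by (simp add: mult.assoc exp_add[symmetric])
  finally show "c * exp (- a * x) \<le> \<eta>" .
qed

text \<open>Thresholds are found for the large parameter 1 / \<epsilon>^2; this turns them into
  thresholds for \<epsilon>.\<close>

lemma inverse_square_ge:
  fixes \<epsilon> x\<^sub>0 :: real
  assumes "x\<^sub>0 > 0" "0 < \<epsilon>" "\<epsilon> \<le> 1 / sqrt x\<^sub>0"
  shows "x\<^sub>0 \<le> 1 / \<epsilon>\<^sup>2"
proof -
  have "\<epsilon>\<^sup>2 \<le> (1 / sqrt x\<^sub>0)\<^sup>2" using assms by (intro power_mono) auto
  then have "\<epsilon>\<^sup>2 \<le> 1 / x\<^sub>0" using assms by (simp add: power_divide)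
  then show ?thesis using assms by (simp add: pos_le_divide_eq mult.commute)
qed

lemma grid_cell:
  fixes \<tau> t :: real
  assumes \<tau>: "\<tau> > 0" and N: "N > 0" and t: "0 \<le> t" "t \<le> real N * \<tau>"
  shows "\<exists>j<N. t \<in> {real j * \<tau>..real (Suc j) * \<tau>}"
proof (cases "t = real N * \<tau>")
  case True
  then show ?thesis using \<tau> N by (intro exI[of _ "N - 1"]) auto
next
  case False
  define j where "j = nat \<lfloor>t / \<tau>\<rfloor>"
  have "real j = of_int \<lfloor>t / \<tau>\<rfloor>" using t \<tau> by (simp add: j_def)
  then have j: "real j \<le> t / \<tau>" "t / \<tau> < real j + 1" by linarith+
  have "t / \<tau> < real N" using t False \<tau> by (simp add: pos_divide_less_eq)
  then have "j < N" using j by linarith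
  moreover have "real j * \<tau> \<le> t" "t \<le> real (Suc j) * \<tau>"
    using j \<tau> by (simp_all add: pos_le_divide_eq pos_divide_less_eq add.commute)
  ultimately show ?thesis by auto
qed

lemma sum_integral_cells:
  fixes f :: "real \<Rightarrow> real"
  assumes \<tau>: "\<tau> > 0" and f: "f integrable_on {0..real N * \<tau>}" and m: "m \<le> N"
  shows "(\<Sum>j<m. integral {real j * \<tau>..real (Suc j) * \<tau>} f) = integral {0..real m * \<tau>} f"
  using m
proof (induction m)
  case (Suc m)
  have "f integrable_on {0..real (Suc m) * \<tau>}"
    by (rule integrable_on_subinterval[OF f]) (use Suc.prems \<tau> in auto)
  then have "integral {0..real m * \<tau>} f + integral {real m * \<tau>..real (Suc m) * \<tau>} f = integral {0..real (Suc m) * \<tau>} f"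
    using \<tau> by (intro Henstock_Kurzweil_Integration.integral_combine) (auto intro: mult_right_mono)
  then show ?case using Suc by simp
qed simp

text \<open>Cauchy-Schwarz on every cell: among paths with given grid values the polygon has the
  least energy.\<close>

lemma primitive_grid_energy:
  assumes D: "L2_density T n \<phi>" and \<tau>: "\<tau> > 0" and T: "T = real N * \<tau>"
  shows "(\<Sum>i=1..n. \<Sum>j<N. (primitive \<phi> i (real (Suc j) * \<tau>) - primitive \<phi> i (real j * \<tau>))\<^sup>2 / \<tau>) \<le> energy T n \<phi>"
  unfolding energy_eq_HK[OF D]
proof (intro sum_mono)
  fix i assume i: "i \<in> {1..n}"
  have "(primitive \<phi> i (real (Suc j) * \<tau>) - primitive \<phi> i (real j * \<tau>))\<^sup>2 / \<tau>
      \<le> integral {real j * \<tau>..real (Suc j) * \<tau>} (\<lambda>t. (\<phi> i t)\<^sup>2)" if j: "j < N" for j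
  proof -
    have "real (Suc j) * \<tau> \<le> T" unfolding T using j \<tau> by (intro mult_right_mono) auto
    moreover have "real j * \<tau> \<le> real (Suc j) * \<tau>" using \<tau> by (intro mult_right_mono) auto
    moreover have "real (Suc j) * \<tau> - real j * \<tau> = \<tau>" by (simp add: algebra_simps)
    ultimately show ?thesis
      using primitive_increment_square[OF D i, of "real j * \<tau>" "real (Suc j) * \<tau>"] \<tau>
      by (simp only: pos_divide_le_eq mult.commute) (simp add: mult.commute)
  qed
  then have "(\<Sum>j<N. (primitive \<phi> i (real (Suc j) * \<tau>) - primitive \<phi> i (real j * \<tau>))\<^sup>2 / \<tau>)
      \<le> (\<Sum>j<N. integral {real j * \<tau>..real (Suc j) * \<tau>} (\<lambda>t. (\<phi> i t)\<^sup>2))" by (intro sum_mono) auto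
  also have "\<dots> = integral {0..T} (\<lambda>t. (\<phi> i t)\<^sup>2)"
    unfolding T using L2_density_integrable_on(2)[OF D i, of 0 T] T \<tau> by (intro sum_integral_cells) auto
  finally show "(\<Sum>j<N. (primitive \<phi> i (real (Suc j) * \<tau>) - primitive \<phi> i (real j * \<tau>))\<^sup>2 / \<tau>)
      \<le> integral {0..T} (\<lambda>t. (\<phi> i t)\<^sup>2)" .
qed

section \<open>Schilder's bounds, uniformly over controls of bounded energy\<close>

context wiener_setting
begin

lemma AE_beta_zero: "AE \<omega> in M. \<forall>i\<in>{1..n}. \<beta> i 0 \<omega> = 0"
proof (rule AE_finite_allI)
  fix i assume "i \<in> {1..n}"
  then show "AE \<omega> in M. \<beta> i 0 \<omega> = 0" using brownian_\<beta>[of i] by (simp add: brownian_motion_def)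
qed simp

text \<open>The grid depends neither on \<open>\<phi>\<close> nor on \<open>\<epsilon>\<close>, whence the uniformity.\<close>

lemma schilder_lower:
  assumes T: "T > 0" and r: "r > 0" and \<gamma>: "\<gamma> > 0" and E0: "E\<^sub>0 \<ge> 0"
  shows "\<exists>\<epsilon>\<^sub>0>0. \<forall>\<phi>. L2_density T n \<phi> \<longrightarrow> energy T n \<phi> \<le> E\<^sub>0 \<longrightarrow> (\<forall>\<epsilon>. 0 < \<epsilon> \<and> \<epsilon> \<le> \<epsilon>\<^sub>0 \<longrightarrow>
    (\<exists>A\<in>sets M. exp (- ((energy T n \<phi> / 2 + \<gamma>) / \<epsilon>\<^sup>2)) \<le> prob A \<and>
      (AE \<omega> in M. \<omega> \<in> A \<longrightarrow> (\<forall>i\<in>{1..n}. \<forall>t\<in>{0..T}. \<bar>\<epsilon> * \<beta> i t \<omega> - primitive \<phi> i t\<bar> \<le> r))))"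
proof -
  \<comment> \<open>The second term makes a primitive of energy at most \<open>E\<^sub>0\<close>
    move by at most r / 4 within a cell. The third makes the exponent of an oscillation above r / 4
    at least \<open>E\<^sub>0 / 2 + 2\<close>; its surplus 2 will beat the number of cells.\<close>
  obtain N :: nat where N0: "1 + 16 * T * E\<^sub>0 / r\<^sup>2 + 32 * T * (E\<^sub>0 / 2 + 2) / r\<^sup>2 < real N"
    using reals_Archimedean2 by blast
  have pos: "0 \<le> 16 * T * E\<^sub>0 / r\<^sup>2" "0 \<le> 32 * T * (E\<^sub>0 / 2 + 2) / r\<^sup>2" using T E0 by auto
  have N: "1 \<le> real N" "16 * T * E\<^sub>0 / r\<^sup>2 \<le> real N" "32 * T * (E\<^sub>0 / 2 + 2) / r\<^sup>2 \<le> real N"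
    using N0 pos by linarith+
  then have Npos: "N > 0" by simp
  define \<tau> where "\<tau> = T / N"
  have \<tau>: "\<tau> > 0" using T Npos by (simp add: \<tau>_def)
  have TN: "T = real N * \<tau>" using Npos by (simp add: \<tau>_def)
  have osc1: "\<tau> * E\<^sub>0 \<le> (r / 4)\<^sup>2"
  proof -
    have "16 * T * E\<^sub>0 \<le> real N * r\<^sup>2" using N(2) r by (simp add: pos_divide_le_eq)
    then show ?thesis unfolding \<tau>_def using Npos by (simp add: pos_divide_le_eq power_divide mult.commute)
  qed
  have osc2: "E\<^sub>0 / 2 + 2 \<le> (r / 4)\<^sup>2 / (2 * \<tau>)"
  proof -
    have "32 * T * (E\<^sub>0 / 2 + 2) \<le> real N * r\<^sup>2" using N(3) r by (simp add: pos_divide_le_eq)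
    then show ?thesis unfolding \<tau>_def using Npos T
      by (simp add: pos_le_divide_eq power_divide) (simp add: field_simps)
  qed
  \<comment> \<open>Errors of single increments add up along the grid to at most r / 4.\<close>
  define \<rho> where "\<rho> = r / (4 * N)"
  have \<rho>: "\<rho> > 0" "real N * \<rho> = r / 4" using r Npos by (auto simp: \<rho>_def)
  define \<eta> where "\<eta> = (1/2 :: real) ^ (n * N)"
  have \<eta>: "\<eta> / 2 > 0" by (simp add: \<eta>_def)
  \<comment> \<open>Thresholds for 1 / \<epsilon>^2: \<open>x1\<close> for the smallness assumption
    on the windows, \<open>x2\<close> so that oscillation costs at most half of the probability of
    the windows, \<open>x3\<close> so that \<gamma> absorbs the remaining half of the
    prefactor.\<close>
  obtain x1 where x1: "x1 > 0" "\<And>x. x \<ge> x1 \<Longrightarrow> 2 * exp (- (\<rho>\<^sup>2 / (2 * \<tau>)) * x) \<le> 1/2"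
    using exp_decay_bound[of "\<rho>\<^sup>2 / (2 * \<tau>)" 2 "1/2"] \<rho> \<tau> by auto
  obtain x2 where x2: "x2 > 0" "\<And>x. x \<ge> x2 \<Longrightarrow> 4 * real (n * N) * exp (- 2 * x) \<le> \<eta> / 2"
    using exp_decay_bound[of 2 "4 * real (n * N)" "\<eta> / 2"] \<eta> by auto
  obtain x3 where x3: "x3 > 0" "\<And>x. x \<ge> x3 \<Longrightarrow> 1 * exp (- \<gamma> * x) \<le> \<eta> / 2"
    using exp_decay_bound[of \<gamma> 1 "\<eta> / 2"] \<eta> \<gamma> by auto
  define x\<^sub>0 where "x\<^sub>0 = max x1 (max x2 x3)"
  have x0: "x\<^sub>0 > 0" using x1(1) by (simp add: x\<^sub>0_def)
  show ?thesis
  proof (intro exI[of _ "1 / sqrt x\<^sub>0"] conjI allI impI)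
    show "0 < 1 / sqrt x\<^sub>0" using x0 by simp
    fix \<phi> \<epsilon> assume D: "L2_density T n \<phi>" and E: "energy T n \<phi> \<le> E\<^sub>0" and \<epsilon>': "0 < \<epsilon> \<and> \<epsilon> \<le> 1 / sqrt x\<^sub>0"
    then have \<epsilon>: "\<epsilon> > 0" by simp
    define x where "x = 1 / \<epsilon>\<^sup>2"
    have x: "x \<ge> x1" "x \<ge> x2" "x \<ge> x3" "x \<ge> 0"
      using inverse_square_ge[OF x0, of \<epsilon>] \<epsilon>' x0 unfolding x_def x\<^sub>0_def by auto
    define d where "d = (\<lambda>i j. primitive \<phi> i (real (Suc j) * \<tau>) - primitive \<phi> i (real j * \<tau>))"
    define A where "A = {\<omega>\<in>space M. \<forall>i\<in>{1..n}. \<forall>j\<in>{..<N}. \<bar>\<epsilon> * grid_incr \<tau> i j \<omega> - d i j\<bar> < \<rho>}"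
    have small: "2 * exp (- (\<rho> / \<epsilon>)\<^sup>2 / (2 * \<tau>)) \<le> 1/2"
    proof -
      have "- (\<rho> / \<epsilon>)\<^sup>2 / (2 * \<tau>) = - (\<rho>\<^sup>2 / (2 * \<tau>)) * x" by (simp add: x_def power_divide)
      then show ?thesis using x1(2)[OF x(1)] by (simp only:)
    qed
    note box = grid_box_lower_bound[OF \<tau> \<epsilon> \<rho>(1) small, where d = d and n = n and m = N, folded A_def]
    obtain B where B: "B \<in> sets M" "prob B \<le> 4 * real (n * N) * exp (- (r / 4)\<^sup>2 / (2 * \<tau> * \<epsilon>\<^sup>2))"
      "AE \<omega> in M. \<omega> \<notin> B \<longrightarrow> (\<forall>i\<in>{1..n}. \<forall>j<N. \<forall>t\<in>{real j * \<tau>..real (Suc j) * \<tau>}.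
        \<bar>\<epsilon> * \<beta> i t \<omega> - \<epsilon> * \<beta> i (real j * \<tau>) \<omega>\<bar> \<le> r / 4)"
      using grid_oscillation[OF \<tau> \<epsilon>, of "r / 4" n N] r by auto
    define E where "E = energy T n \<phi>"
    have E0': "E \<le> E\<^sub>0" using \<open>energy T n \<phi> \<le> E\<^sub>0\<close> by (simp add: E_def)
    have PA: "exp (- E * x / 2) * \<eta> \<le> prob A"
    proof -
      have "(\<Sum>i=1..n. \<Sum>j<N. (d i j)\<^sup>2 / \<tau>) \<le> E"
        unfolding d_def E_def by (rule primitive_grid_energy[OF D \<tau> TN])
      then have "(\<Sum>i=1..n. \<Sum>j<N. (d i j)\<^sup>2 / \<tau>) / (2 * \<epsilon>\<^sup>2) \<le> E / (2 * \<epsilon>\<^sup>2)"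
        by (intro divide_right_mono) auto
      then have "- E * x / 2 \<le> - (\<Sum>i=1..n. \<Sum>j<N. (d i j)\<^sup>2 / \<tau>) / (2 * \<epsilon>\<^sup>2)"
        by (simp add: x_def mult.commute)
      then have "exp (- E * x / 2) * \<eta> \<le> exp (- (\<Sum>i=1..n. \<Sum>j<N. (d i j)\<^sup>2 / \<tau>) / (2 * \<epsilon>\<^sup>2)) * \<eta>"
        using \<eta> by (intro mult_right_mono) auto
      then show ?thesis using box(2) unfolding \<eta>_def by linarith
    qed
    have PB: "prob B \<le> exp (- E * x / 2) * (\<eta> / 2)"
    proof -
      have e: "- (r / 4)\<^sup>2 / (2 * \<tau> * \<epsilon>\<^sup>2) = - ((r / 4)\<^sup>2 / (2 * \<tau>) * x)" by (simp add: x_def)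
      have "(E / 2 + 2) * x \<le> (r / 4)\<^sup>2 / (2 * \<tau>) * x"
        using osc2 E0' x(4) by (intro mult_right_mono) auto
      then have "exp (- (r / 4)\<^sup>2 / (2 * \<tau> * \<epsilon>\<^sup>2)) \<le> exp (- ((E / 2 + 2) * x))" unfolding e by simp
      also have "\<dots> = exp (- E * x / 2) * exp (- 2 * x)" by (simp add: exp_add[symmetric] algebra_simps)
      finally have "4 * real (n * N) * exp (- (r / 4)\<^sup>2 / (2 * \<tau> * \<epsilon>\<^sup>2))
          \<le> 4 * real (n * N) * (exp (- E * x / 2) * exp (- 2 * x))" by (intro mult_left_mono) auto
      also have "\<dots> = exp (- E * x / 2) * (4 * real (n * N) * exp (- 2 * x))" by (simp only: mult_ac)
      also have "\<dots> \<le> exp (- E * x / 2) * (\<eta> / 2)" using x2(2)[OF x(2)] by (intro mult_left_mono) auto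
      finally show ?thesis using B(2) by linarith
    qed
    have "prob A \<le> prob (A - B) + prob B"
    proof -
      have "prob A \<le> prob ((A - B) \<union> B)" using box(1) B(1) by (intro finite_measure_mono) auto
      also have "\<dots> \<le> prob (A - B) + prob B" using box(1) B(1) by (intro measure_Un_le) auto
      finally show ?thesis .
    qed
    moreover have "exp (- ((E / 2 + \<gamma>) / \<epsilon>\<^sup>2)) \<le> exp (- E * x / 2) * (\<eta> / 2)"
    proof -
      have "exp (- ((E / 2 + \<gamma>) / \<epsilon>\<^sup>2)) = exp (- E * x / 2) * exp (- \<gamma> * x)"
        by (simp add: x_def exp_add[symmetric] add_divide_distrib)
      also have "\<dots> \<le> exp (- E * x / 2) * (\<eta> / 2)" using x3(2)[OF x(3)] by (intro mult_left_mono) auto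
      finally show ?thesis .
    qed
    moreover have "exp (- E * x / 2) * \<eta> = exp (- E * x / 2) * (\<eta> / 2) + exp (- E * x / 2) * (\<eta> / 2)" by simp
    ultimately have P: "exp (- ((E / 2 + \<gamma>) / \<epsilon>\<^sup>2)) \<le> prob (A - B)" using PA PB by linarith
    have "AE \<omega> in M. \<omega> \<in> A - B \<longrightarrow> (\<forall>i\<in>{1..n}. \<forall>t\<in>{0..T}. \<bar>\<epsilon> * \<beta> i t \<omega> - primitive \<phi> i t\<bar> \<le> r)"
      using B(3) AE_beta_zero[of n]
    proof eventually_elim
      case (elim \<omega>)
      show ?case
      proof (intro impI ballI)
        fix i t assume \<omega>: "\<omega> \<in> A - B" and i: "i \<in> {1..n}" and t: "t \<in> {0..T}"
        have grid: "\<bar>\<epsilon> * \<beta> i (real j * \<tau>) \<omega> - primitive \<phi> i (real j * \<tau>)\<bar> \<le> real j * \<rho>" if "j \<le> N" for j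
          using that
        proof (induction j)
          case 0
          then show ?case using elim(2) i by (simp add: primitive_def)
        next
          case (Suc j)
          have "\<bar>\<epsilon> * grid_incr \<tau> i j \<omega> - d i j\<bar> < \<rho>" using \<omega> i Suc.prems unfolding A_def by auto
          moreover have "\<epsilon> * grid_incr \<tau> i j \<omega> = \<epsilon> * \<beta> i (real (Suc j) * \<tau>) \<omega> - \<epsilon> * \<beta> i (real j * \<tau>) \<omega>"
            unfolding grid_incr_def by (rule right_diff_distrib)
          moreover have "\<bar>\<epsilon> * \<beta> i (real j * \<tau>) \<omega> - primitive \<phi> i (real j * \<tau>)\<bar> \<le> real j * \<rho>" using Suc by simp
          moreover have "real (Suc j) * \<rho> = real j * \<rho> + \<rho>" by (simp add: algebra_simps)
          ultimately show ?case unfolding d_def by linarith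
        qed
        obtain j where j: "j < N" "t \<in> {real j * \<tau>..real (Suc j) * \<tau>}"
          using grid_cell[OF \<tau> Npos, of t] t TN by auto
        have "real j * \<rho> \<le> real N * \<rho>" using j(1) \<rho>(1) by (intro mult_right_mono) auto
        then have 1: "\<bar>\<epsilon> * \<beta> i (real j * \<tau>) \<omega> - primitive \<phi> i (real j * \<tau>)\<bar> \<le> r / 4"
          using grid[of j] j(1) \<rho>(2) by linarith
        have 2: "\<bar>\<epsilon> * \<beta> i t \<omega> - \<epsilon> * \<beta> i (real j * \<tau>) \<omega>\<bar> \<le> r / 4" using elim(1) \<omega> i j by blast
        have "(primitive \<phi> i t - primitive \<phi> i (real j * \<tau>))\<^sup>2 \<le> (t - real j * \<tau>) * energy T n \<phi>"
          using j t \<tau> by (intro primitive_increment_energy[OF D i]) auto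
        also have "\<dots> \<le> \<tau> * E\<^sub>0"
        proof (rule mult_mono)
          show "t - real j * \<tau> \<le> \<tau>" using j(2) by (simp add: algebra_simps)
        qed (use \<open>energy T n \<phi> \<le> E\<^sub>0\<close> \<tau> in \<open>auto simp: energy_nonneg\<close>)
        also have "\<dots> \<le> (r / 4)\<^sup>2" by (rule osc1)
        finally have "\<bar>primitive \<phi> i t - primitive \<phi> i (real j * \<tau>)\<bar> \<le> \<bar>r / 4\<bar>" by (simp only: abs_le_square_iff)
        then have 3: "\<bar>primitive \<phi> i t - primitive \<phi> i (real j * \<tau>)\<bar> \<le> r / 4" using r by simp
        show "\<bar>\<epsilon> * \<beta> i t \<omega> - primitive \<phi> i t\<bar> \<le> r" using 1 2 3 r by linarith
      qed
    qed
    then show "\<exists>A\<in>sets M. exp (- ((energy T n \<phi> / 2 + \<gamma>) / \<epsilon>\<^sup>2)) \<le> prob A \<and>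
      (AE \<omega> in M. \<omega> \<in> A \<longrightarrow> (\<forall>i\<in>{1..n}. \<forall>t\<in>{0..T}. \<bar>\<epsilon> * \<beta> i t \<omega> - primitive \<phi> i t\<bar> \<le> r))"
      using P box(1) B(1) unfolding E_def by (intro bexI[of _ "A - B"]) auto
  qed
qed

text \<open>The control is read off from the path itself, as the slopes of the polygon through the
  grid values of \<epsilon>\<beta>. The exceptional event collects the outcomes where this polygon
  has too much energy or the path leaves it inside a cell.\<close>

lemma schilder_upper:
  assumes T: "T > 0" and r: "r > 0" and \<gamma>: "\<gamma> > 0" and \<alpha>: "\<alpha> \<ge> 0"
  shows "\<exists>\<epsilon>\<^sub>0>0. \<forall>\<epsilon>. 0 < \<epsilon> \<and> \<epsilon> \<le> \<epsilon>\<^sub>0 \<longrightarrow>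
    (\<exists>A\<in>sets M. prob A \<le> exp (- ((\<alpha> - \<gamma>) / \<epsilon>\<^sup>2)) \<and>
      (AE \<omega> in M. \<omega> \<notin> A \<longrightarrow> (\<exists>\<phi>. L2_density T n \<phi> \<and> energy T n \<phi> \<le> 2 * \<alpha> \<and>
        (\<forall>i\<in>{1..n}. \<forall>t\<in>{0..T}. \<bar>\<epsilon> * \<beta> i t \<omega> - primitive \<phi> i t\<bar> \<le> r))))"
proof -
  \<comment> \<open>Makes the exponent of an oscillation above r / 2 at least \<alpha> + 1. Half of
    \<open>r\<close> suffices twice, since the polygon moves within a cell by no more than the
    path.\<close>
  obtain N :: nat where N0: "1 + 8 * T * (\<alpha> + 1) / r\<^sup>2 < real N"
    using reals_Archimedean2 by blast
  have "0 \<le> 8 * T * (\<alpha> + 1) / r\<^sup>2" using T \<alpha> by auto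
  then have N: "1 \<le> real N" "8 * T * (\<alpha> + 1) / r\<^sup>2 \<le> real N" using N0 by linarith+
  then have Npos: "N > 0" by simp
  define \<tau> where "\<tau> = T / N"
  have \<tau>: "\<tau> > 0" using T Npos by (simp add: \<tau>_def)
  have TN: "T = real N * \<tau>" using Npos by (simp add: \<tau>_def)
  have osc: "\<alpha> + 1 \<le> (r / 2)\<^sup>2 / (2 * \<tau>)"
  proof -
    have "8 * T * (\<alpha> + 1) \<le> real N * r\<^sup>2" using N(2) r by (simp add: pos_divide_le_eq)
    then show ?thesis unfolding \<tau>_def using Npos T
      by (simp add: pos_le_divide_eq power_divide) (simp add: field_simps)
  qed
  \<comment> \<open>The loss (1 - \<theta>) \<alpha> is at most \<gamma> / 2, which leaves the other
    half of \<gamma> for the prefactor; the cap 1/2 keeps \<theta> nonnegative.\<close>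
  define \<theta> where "\<theta> = 1 - min (1/2) (\<gamma> / (2 * (\<alpha> + 1)))"
  have \<theta>: "0 \<le> \<theta>" "\<theta> < 1" using \<gamma> \<alpha> by (auto simp: \<theta>_def min_def)
  have \<theta>\<alpha>: "\<alpha> - \<gamma> / 2 \<le> \<theta> * \<alpha>"
  proof -
    have "min (1/2) (\<gamma> / (2 * (\<alpha> + 1))) * \<alpha> \<le> \<gamma> / (2 * (\<alpha> + 1)) * (\<alpha> + 1)"
      using \<alpha> \<gamma> by (intro mult_mono) auto
    also have "\<dots> = \<gamma> / 2" using \<alpha> by (simp add: field_simps)
    finally show ?thesis by (simp add: \<theta>_def left_diff_distrib)
  qed
  define C where "C = (1 / sqrt (1 - \<theta>)) ^ (n * N)"
  have C: "C \<ge> 0" using \<theta> by (simp add: C_def)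
  \<comment> \<open>Compared with \<alpha> - \<gamma>, the exponent of the oscillation has the
    surplus 1 + \<gamma> and that of the energy the surplus \<gamma> / 2; each brings its constant
    below 1/2.\<close>
  obtain x1 where x1: "x1 > 0" "\<And>x. x \<ge> x1 \<Longrightarrow> 4 * real (n * N) * exp (- (1 + \<gamma>) * x) \<le> 1/2"
    using exp_decay_bound[of "1 + \<gamma>" "4 * real (n * N)" "1/2"] \<gamma> by auto
  obtain x2 where x2: "x2 > 0" "\<And>x. x \<ge> x2 \<Longrightarrow> C * exp (- (\<gamma> / 2) * x) \<le> 1/2"
    using exp_decay_bound[of "\<gamma> / 2" C "1/2"] \<gamma> C by auto
  define x\<^sub>0 where "x\<^sub>0 = max x1 x2"
  have x0: "x\<^sub>0 > 0" using x1(1) by (simp add: x\<^sub>0_def)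
  show ?thesis
  proof (intro exI[of _ "1 / sqrt x\<^sub>0"] conjI allI impI)
    show "0 < 1 / sqrt x\<^sub>0" using x0 by simp
    fix \<epsilon> assume \<epsilon>': "0 < \<epsilon> \<and> \<epsilon> \<le> 1 / sqrt x\<^sub>0"
    then have \<epsilon>: "\<epsilon> > 0" by simp
    define x where "x = 1 / \<epsilon>\<^sup>2"
    have x: "x \<ge> x1" "x \<ge> x2" "x \<ge> 0"
      using inverse_square_ge[OF x0, of \<epsilon>] \<epsilon>' x0 unfolding x_def x\<^sub>0_def by auto
    obtain B where B: "B \<in> sets M" "prob B \<le> 4 * real (n * N) * exp (- (r / 2)\<^sup>2 / (2 * \<tau> * \<epsilon>\<^sup>2))"
      "AE \<omega> in M. \<omega> \<notin> B \<longrightarrow> (\<forall>i\<in>{1..n}. \<forall>j<N. \<forall>t\<in>{real j * \<tau>..real (Suc j) * \<tau>}.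
        \<bar>\<epsilon> * \<beta> i t \<omega> - \<epsilon> * \<beta> i (real j * \<tau>) \<omega>\<bar> \<le> r / 2)"
      using grid_oscillation[OF \<tau> \<epsilon>, of "r / 2" n N] r by auto
    define A where "A = {\<omega>\<in>space M. (\<Sum>i=1..n. \<Sum>j<N. (\<epsilon> * grid_incr \<tau> i j \<omega>)\<^sup>2 / \<tau>) > 2 * \<alpha>}"
    note tail = grid_energy_tail[OF \<tau> \<epsilon> \<theta>, where \<alpha> = \<alpha> and n = n and m = N, folded A_def C_def]
    have PB: "prob B \<le> exp (- ((\<alpha> - \<gamma>) / \<epsilon>\<^sup>2)) * (1/2)"
    proof -
      have e: "- (r / 2)\<^sup>2 / (2 * \<tau> * \<epsilon>\<^sup>2) = - ((r / 2)\<^sup>2 / (2 * \<tau>) * x)" by (simp add: x_def)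
      have "(\<alpha> + 1) * x \<le> (r / 2)\<^sup>2 / (2 * \<tau>) * x" using osc x(3) by (intro mult_right_mono) auto
      then have "exp (- (r / 2)\<^sup>2 / (2 * \<tau> * \<epsilon>\<^sup>2)) \<le> exp (- ((\<alpha> + 1) * x))" unfolding e by simp
      also have "\<dots> = exp (- ((\<alpha> - \<gamma>) * x)) * exp (- (1 + \<gamma>) * x)" by (simp add: exp_add[symmetric] algebra_simps)
      finally have "4 * real (n * N) * exp (- (r / 2)\<^sup>2 / (2 * \<tau> * \<epsilon>\<^sup>2))
          \<le> 4 * real (n * N) * (exp (- ((\<alpha> - \<gamma>) * x)) * exp (- (1 + \<gamma>) * x))" by (intro mult_left_mono) auto
      also have "\<dots> = exp (- ((\<alpha> - \<gamma>) * x)) * (4 * real (n * N) * exp (- (1 + \<gamma>) * x))" by (simp only: mult_ac)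
      also have "\<dots> \<le> exp (- ((\<alpha> - \<gamma>) * x)) * (1/2)" using x1(2)[OF x(1)] by (intro mult_left_mono) auto
      finally show ?thesis using B(2) by (simp add: x_def)
    qed
    have PA: "prob A \<le> exp (- ((\<alpha> - \<gamma>) / \<epsilon>\<^sup>2)) * (1/2)"
    proof -
      have "(\<alpha> - \<gamma> / 2) * x \<le> \<theta> * \<alpha> * x" using \<theta>\<alpha> x(3) by (intro mult_right_mono) auto
      then have "exp (- \<theta> * \<alpha> / \<epsilon>\<^sup>2) \<le> exp (- ((\<alpha> - \<gamma> / 2) * x))" by (simp add: x_def)
      also have "\<dots> = exp (- ((\<alpha> - \<gamma>) * x)) * exp (- (\<gamma> / 2) * x)" by (simp add: exp_add[symmetric] algebra_simps)
      finally have "exp (- \<theta> * \<alpha> / \<epsilon>\<^sup>2) * C \<le> exp (- ((\<alpha> - \<gamma>) * x)) * exp (- (\<gamma> / 2) * x) * C"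
        using C by (intro mult_right_mono) auto
      also have "\<dots> = exp (- ((\<alpha> - \<gamma>) * x)) * (C * exp (- (\<gamma> / 2) * x))" by (simp only: mult_ac)
      also have "\<dots> \<le> exp (- ((\<alpha> - \<gamma>) * x)) * (1/2)" using x2(2)[OF x(2)] by (intro mult_left_mono) auto
      finally show ?thesis using tail(2) by (simp add: x_def)
    qed
    have P: "prob (A \<union> B) \<le> exp (- ((\<alpha> - \<gamma>) / \<epsilon>\<^sup>2))"
      using measure_Un_le[OF tail(1) B(1)] PA PB by linarith
    have "AE \<omega> in M. \<omega> \<notin> A \<union> B \<longrightarrow> (\<exists>\<phi>. L2_density T n \<phi> \<and> energy T n \<phi> \<le> 2 * \<alpha> \<and>
        (\<forall>i\<in>{1..n}. \<forall>t\<in>{0..T}. \<bar>\<epsilon> * \<beta> i t \<omega> - primitive \<phi> i t\<bar> \<le> r))"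
      using B(3) AE_beta_zero[of n] AE_space
    proof eventually_elim
      case (elim \<omega>)
      show ?case
      proof
        assume \<omega>: "\<omega> \<notin> A \<union> B"
        obtain \<phi> where D: "L2_density T n \<phi>"
          and E: "energy T n \<phi> = (\<Sum>i=1..n. \<Sum>j<N. (\<epsilon> * grid_incr \<tau> i j \<omega>)\<^sup>2 / \<tau>)"
          and G: "\<forall>i\<in>{1..n}. \<forall>j\<le>N. primitive \<phi> i (real j * \<tau>) = (\<Sum>k<j. \<epsilon> * grid_incr \<tau> i k \<omega>)"
          and O: "\<forall>i\<in>{1..n}. \<forall>j<N. \<forall>t\<in>{real j * \<tau>..real (Suc j) * \<tau>}.
            \<bar>primitive \<phi> i t - primitive \<phi> i (real j * \<tau>)\<bar> \<le> \<bar>\<epsilon> * grid_incr \<tau> i j \<omega>\<bar>"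
          using polygonal_primitive[OF \<tau> TN, of n "\<lambda>i j. \<epsilon> * grid_incr \<tau> i j \<omega>"] by blast
        have "energy T n \<phi> \<le> 2 * \<alpha>" unfolding E using \<omega> elim(3) unfolding A_def by auto
        moreover have "\<bar>\<epsilon> * \<beta> i t \<omega> - primitive \<phi> i t\<bar> \<le> r" if i: "i \<in> {1..n}" and t: "t \<in> {0..T}" for i t
        proof -
          obtain j where j: "j < N" "t \<in> {real j * \<tau>..real (Suc j) * \<tau>}"
            using grid_cell[OF \<tau> Npos, of t] t TN by auto
          have "(\<Sum>k<m. \<epsilon> * grid_incr \<tau> i k \<omega>) = \<epsilon> * \<beta> i (real m * \<tau>) \<omega>" for m
          proof -
            have "(\<Sum>k<m. grid_incr \<tau> i k \<omega>) = \<beta> i (real m * \<tau>) \<omega> - \<beta> i (real 0 * \<tau>) \<omega>"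
              unfolding grid_incr_def by (rule sum_lessThan_telescope)
            then show ?thesis using elim(2) i by (simp add: sum_distrib_left[symmetric])
          qed
          then have 1: "primitive \<phi> i (real j * \<tau>) = \<epsilon> * \<beta> i (real j * \<tau>) \<omega>" using G i j(1) by simp
          have osc: "\<bar>\<epsilon> * \<beta> i s \<omega> - \<epsilon> * \<beta> i (real j * \<tau>) \<omega>\<bar> \<le> r / 2" if "s \<in> {real j * \<tau>..real (Suc j) * \<tau>}" for s
            using elim(1) \<omega> i j that by blast
          have "\<bar>\<epsilon> * grid_incr \<tau> i j \<omega>\<bar> \<le> r / 2"
            using osc[of "real (Suc j) * \<tau>"] \<tau> unfolding grid_incr_def right_diff_distrib
            by (auto intro: mult_right_mono)
          then have 2: "\<bar>primitive \<phi> i t - primitive \<phi> i (real j * \<tau>)\<bar> \<le> r / 2" using O i j by fastforce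
          show ?thesis using osc[OF j(2)] 2 unfolding 1 by linarith
        qed
        ultimately show "\<exists>\<phi>. L2_density T n \<phi> \<and> energy T n \<phi> \<le> 2 * \<alpha> \<and>
          (\<forall>i\<in>{1..n}. \<forall>t\<in>{0..T}. \<bar>\<epsilon> * \<beta> i t \<omega> - primitive \<phi> i t\<bar> \<le> r)"
          using D by blast
      qed
    qed
    then show "\<exists>A\<in>sets M. prob A \<le> exp (- ((\<alpha> - \<gamma>) / \<epsilon>\<^sup>2)) \<and>
      (AE \<omega> in M. \<omega> \<notin> A \<longrightarrow> (\<exists>\<phi>. L2_density T n \<phi> \<and> energy T n \<phi> \<le> 2 * \<alpha> \<and>
        (\<forall>i\<in>{1..n}. \<forall>t\<in>{0..T}. \<bar>\<epsilon> * \<beta> i t \<omega> - primitive \<phi> i t\<bar> \<le> r)))"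
      using P tail(1) B(1) by (intro bexI[of _ "A \<union> B"]) auto
  qed
qed

end

section \<open>The large deviations principle\<close>

lemma forced_solution_cong:
  assumes x: "\<And>t. t \<in> {0..T} \<Longrightarrow> x t = x' t"
    and w: "\<And>i t. i \<in> {1..n} \<Longrightarrow> t \<in> {0..T} \<Longrightarrow> w i t = w' i t"
    and f: "forced_solution F T n y w x"
  shows "forced_solution F T n y w' x'"
  unfolding forced_solution_def
proof (intro conjI ballI)
  show "continuous_on {0..T} x'"
    using f x continuous_on_cong[of "{0..T}" "{0..T}" x x'] by (auto simp: forced_solution_def)
  show "x' t \<in> H_n n" if "t \<in> {0..T}" for t
  proof -
    have "x t \<in> H_n n" using f that unfolding forced_solution_def by blast
    then show ?thesis using x[OF that] by simp
  qed
  fix t i assume t: "t \<in> {0..T}" and i: "i \<in> {1..n}"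
  have "integral {0..t} (\<lambda>s. drift F i (x s)) = integral {0..t} (\<lambda>s. drift F i (x' s))"
    using t x by (intro Henstock_Kurzweil_Integration.integral_cong) auto
  moreover have "coord i (x t) = coord i y + integral {0..t} (\<lambda>s. drift F i (x s)) + w i t"
    using f t i unfolding forced_solution_def by blast
  ultimately show "coord i (x' t) = coord i y + integral {0..t} (\<lambda>s. drift F i (x' s)) + w' i t"
    using x[OF t] w[OF i t] by simp
qed

lemma mspace_C_H: "z \<in> mspace (C_H T) \<longleftrightarrow> continuous_on {0..T} z \<and> z \<in> extensional {0..T}"
  unfolding C_H_def by (subst compactin_mspace_cfunspace) (auto simp: compactin_subtopology)

lemma C_Hn_subset_C_H: "z \<in> mspace (C_Hn T n) \<Longrightarrow> z \<in> mspace (C_H T)"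
  by (simp add: mspace_C_Hn mspace_C_H)

lemma mdist_C_H_le:
  assumes "0 \<le> B" "\<And>t. t \<in> {0..T} \<Longrightarrow> norm (f t - g t) \<le> B"
  shows "mdist (C_H T) f g \<le> B"
  unfolding C_H_def by (rule mdist_cfunspace_le) (use assms in \<open>auto simp: dist_norm\<close>)

lemma mdist_C_Hn_le:
  assumes "0 \<le> B" "\<And>t. t \<in> {0..T} \<Longrightarrow> norm (f t - g t) \<le> B"
  shows "mdist (C_Hn T n) f g \<le> B"
  unfolding C_Hn_def by (rule mdist_cfunspace_le) (use assms in \<open>auto simp: dist_norm\<close>)

lemma mdist_C_H_le_iff:
  assumes "T > 0" "f \<in> mspace (C_H T)" "g \<in> mspace (C_H T)"
  shows "mdist (C_H T) f g \<le> a \<longleftrightarrow> (\<forall>t\<in>{0..T}. norm (f t - g t) \<le> a)"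
  using cfunspace_mdist_le[of f "top_of_set {0..T}" euclidean_metric g a] assms
  by (auto simp: C_H_def dist_norm subtopology_eq_discrete_topology_empty)

text \<open>A countable dense set, on which statements that are almost sure for each single time
  hold simultaneously. Time 0 is left out because \<open>wiener_integral_coord\<close> concerns
  positive times; continuity recovers it.\<close>

definition rat_times :: "real \<Rightarrow> real set" where
  "rat_times T = {0<..<T} \<inter> \<rat>"

lemma countable_rat_times: "countable (rat_times T)"
  unfolding rat_times_def by (intro countable_Int2 countable_rat)

lemma closure_rat_times: "T > 0 \<Longrightarrow> closure (rat_times T) = {0..T}"
  unfolding rat_times_def by (subst closure_open_Int_superset) (auto simp: Rats_closure_real)

section \<open>Level sets of the rate function\<close>

locale galerkin =
  fixes F R :: "L2 \<Rightarrow> L2" and r :: "nat \<Rightarrow> real" and LF T :: real and n :: nat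
  assumes F: "LF-lipschitz_on UNIV F" and R: "\<And>i u. i \<in> {1..n} \<Longrightarrow> coord i (R u) = r i * coord i u"
    and T: "T > 0" and r: "\<And>i. i \<in> {1..n} \<Longrightarrow> r i \<ge> 0"
begin

abbreviation "skeleton y \<phi> \<equiv> forced_solution F T n y (\<lambda>i t. r i * primitive \<phi> i t)"

text \<open>The infimum in the rate is approached rather than attained, hence the excess \<eta> in
  the energy of the control.\<close>

lemma level_set_density:
  assumes y: "y \<in> H_n n" and z: "z \<in> level_set F R T n y \<alpha>" and \<eta>: "\<eta> > 0"
  shows "\<exists>\<phi>. L2_density T n \<phi> \<and> energy T n \<phi> \<le> 2 * enn2real (rate_fun F R T n y z) + \<eta> \<and> skeleton y \<phi> z"
proof -
  have zm: "z \<in> mspace (C_Hn T n)" and "rate_fun F R T n y z \<le> ennreal \<alpha>"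
    using z by (auto simp: level_set_def)
  then have fin: "rate_fun F R T n y z < top" using ennreal_less_top le_less_trans by blast
  define I where "I = enn2real (rate_fun F R T n y z)"
  have I: "rate_fun F R T n y z = ennreal I" using fin by (simp add: I_def)
  have I0: "I \<ge> 0" by (simp add: I_def)
  define V where "V = (INF \<psi>\<in>{\<psi> \<in> L2_Hn T n. skeleton_solution F R T n y \<psi> z}.
        \<integral>\<^sup>+ t. ennreal ((norm (\<psi> t))\<^sup>2) \<partial>lebesgue_on {0..T})"
  have "V / 2 = ennreal I" using I unfolding rate_fun_def V_def .
  moreover have "V = 2 * (V / 2)"
    by (simp add: ennreal_times_divide mult.commute[of 2] ennreal_mult_divide_eq)
  ultimately have "V = 2 * ennreal I" by (simp only:)
  then have "V = ennreal (2 * I)" using I0 by (simp add: ennreal_mult')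
  also have "\<dots> < ennreal (2 * I + \<eta>)" using I0 \<eta> by (simp add: ennreal_less_iff)
  finally have "V < ennreal (2 * I + \<eta>)" .
  then obtain \<psi> where \<psi>: "\<psi> \<in> L2_Hn T n" "skeleton_solution F R T n y \<psi> z"
    "(\<integral>\<^sup>+ t. ennreal ((norm (\<psi> t))\<^sup>2) \<partial>lebesgue_on {0..T}) < ennreal (2 * I + \<eta>)"
    unfolding V_def INF_less_iff by blast
  let ?\<phi> = "\<lambda>i t. coord i (\<psi> t)"
  have "energy T n ?\<phi> \<le> 2 * I + \<eta>"
    using \<psi>(3) unfolding L2_Hn_imp_density(2)[OF \<psi>(1)]
    by (simp add: ennreal_less_iff energy_nonneg)
  moreover have "skeleton y ?\<phi> z" using \<psi>(2) skeleton_iff_forced[OF F y \<psi>(1) R zm] by blast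
  ultimately show ?thesis using L2_Hn_imp_density(1)[OF \<psi>(1)] unfolding I_def by (intro exI[of _ ?\<phi>]) blast
qed

lemma density_level_set:
  assumes y: "y \<in> H_n n" and D: "L2_density T n \<phi>" and E: "energy T n \<phi> \<le> 2 * \<alpha>"
  shows "\<exists>z\<in>level_set F R T n y \<alpha>. skeleton y \<phi> z"
proof -
  have "continuous_on {0..T} (\<lambda>t. r i * primitive \<phi> i t)" if "i \<in> {1..n}" for i
    by (intro continuous_on_mult continuous_on_const continuous_on_primitive[OF D that])
  from forced_solution_exists[OF F T, of n "\<lambda>i t. r i * primitive \<phi> i t" y, OF this]
  obtain x where x: "skeleton y \<phi> x" by blast
  \<comment> \<open>Elements of the path space are extensional on [0,T]; the equation does not see
    the restriction.\<close>
  define z where "z = restrict x {0..T}"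
  have z: "skeleton y \<phi> z" by (rule forced_solution_cong[OF _ _ x]) (auto simp: z_def)
  then have zm: "z \<in> mspace (C_Hn T n)" by (auto simp: mspace_C_Hn forced_solution_def z_def)
  define \<psi> where "\<psi> = (\<lambda>t. \<Sum>i=1..n. \<phi> i t *\<^sub>R sin_basis i)"
  have \<psi>: "\<psi> \<in> L2_Hn T n" unfolding \<psi>_def by (rule density_imp_L2_Hn[OF D])
  have c: "(\<lambda>t. coord i (\<psi> t)) = \<phi> i" if "i \<in> {1..n}" for i unfolding \<psi>_def using coord_sum[OF that] by auto
  have "skeleton y (\<lambda>i t. coord i (\<psi> t)) z"
    by (rule forced_solution_cong[OF _ _ z]) (simp_all only: primitive_def c)
  then have "skeleton_solution F R T n y \<psi> z" using skeleton_iff_forced[OF F y \<psi> R zm] by blast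
  then have "rate_fun F R T n y z \<le> (\<integral>\<^sup>+ t. ennreal ((norm (\<psi> t))\<^sup>2) \<partial>lebesgue_on {0..T}) / 2"
    unfolding rate_fun_def using \<psi> by (intro divide_right_mono_ennreal INF_lower) auto
  also have "\<dots> = ennreal (energy T n (\<lambda>i t. coord i (\<psi> t))) / 2"
    unfolding L2_Hn_imp_density(2)[OF \<psi>] ..
  also have "energy T n (\<lambda>i t. coord i (\<psi> t)) = energy T n \<phi>"
    unfolding energy_def using c by (intro sum.cong refl) (metis (no_types, lifting))
  also have "ennreal (energy T n \<phi>) / 2 = ennreal (energy T n \<phi> / 2)"
    using divide_ennreal[OF energy_nonneg, of 2 T n \<phi>] by simp
  also have "\<dots> \<le> ennreal \<alpha>" using E by (intro ennreal_leI) simp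
  finally show ?thesis using zm z by (auto simp: level_set_def)
qed

text \<open>The Lipschitz constant of the solution as a function of the unscaled driving path. The
  sum of all \<open>r i\<close> plus 1 bounds each single \<open>r i\<close>, and neither
  \<open>y\<close> nor the forcing enters.\<close>

definition stab :: real where
  "stab = n * ((\<Sum>i=1..n. r i) + 1) * exp (n * ((\<Sum>j=1..n. lam j) + LF) * T)"

lemma stab_nonneg: "stab \<ge> 0"
  unfolding stab_def by (intro mult_nonneg_nonneg add_nonneg_nonneg sum_nonneg r) auto

lemma forced_stable:
  assumes "forced_solution F T n y (\<lambda>i t. r i * w i t) x" "forced_solution F T n y (\<lambda>i t. r i * w' i t) x'"
    and \<rho>: "\<rho> \<ge> 0" "\<And>i t. i \<in> {1..n} \<Longrightarrow> t \<in> {0..T} \<Longrightarrow> \<bar>w i t - w' i t\<bar> \<le> \<rho>" and t: "t \<in> {0..T}"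
  shows "norm (x t - x' t) \<le> stab * \<rho>"
proof -
  have "norm (x t - x' t) \<le> n * (((\<Sum>i=1..n. r i) + 1) * \<rho>) * exp (n * ((\<Sum>j=1..n. lam j) + LF) * T)"
  proof (rule forced_solution_stable[OF F assms(1,2) _ t])
    fix i t assume i: "i \<in> {1..n}" and t: "t \<in> {0..T}"
    have "\<bar>r i * w i t - r i * w' i t\<bar> = r i * \<bar>w i t - w' i t\<bar>"
      using r[OF i] by (simp add: right_diff_distrib[symmetric] abs_mult)
    also have "\<dots> \<le> ((\<Sum>i=1..n. r i) + 1) * \<rho>"
    proof (rule mult_mono[OF _ \<rho>(2)[OF i t]])
      have "r i \<le> (\<Sum>i=1..n. r i)" using i r by (intro member_le_sum) auto
      then show "r i \<le> (\<Sum>i=1..n. r i) + 1" by simp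
      show "0 \<le> (\<Sum>i=1..n. r i) + 1" using r by (intro add_nonneg_nonneg sum_nonneg) auto
    qed simp
    finally show "\<bar>r i * w i t - r i * w' i t\<bar> \<le> ((\<Sum>i=1..n. r i) + 1) * \<rho>" .
  qed
  also have "\<dots> = stab * \<rho>" unfolding stab_def by (simp only: mult_ac)
  finally show ?thesis .
qed

text \<open>Along a sequence the controls are chosen with vanishing excess energy. A subsequence of
  their primitives converges uniformly, lower semicontinuity provides a limiting control of energy
  at most 2 \<alpha>, and stability carries the convergence over to the solutions.\<close>

theorem compactin_level_set:
  assumes y: "y \<in> H_n n" and \<alpha>: "\<alpha> \<ge> 0"
  shows "compactin (mtopology_of (C_Hn T n)) (level_set F R T n y \<alpha>)"
proof -
  interpret C: Metric_space "mspace (C_Hn T n)" "mdist (C_Hn T n)" by simp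
  have sub: "level_set F R T n y \<alpha> \<subseteq> mspace (C_Hn T n)" by (auto simp: level_set_def)
  have rate: "enn2real (rate_fun F R T n y z) \<le> \<alpha>" if "z \<in> level_set F R T n y \<alpha>" for z
    using that \<alpha> by (auto simp: level_set_def intro: enn2real_leI)
  show ?thesis
    unfolding mtopology_of_def C.compactin_sequentially
  proof (intro conjI allI impI sub)
    fix \<sigma> :: "nat \<Rightarrow> real \<Rightarrow> L2" assume \<sigma>: "range \<sigma> \<subseteq> level_set F R T n y \<alpha>"
    have "\<exists>\<phi>. L2_density T n \<phi> \<and> energy T n \<phi> \<le> 2 * \<alpha> + inverse (real (Suc k)) \<and> skeleton y \<phi> (\<sigma> k)" for k
    proof -
      have k: "\<sigma> k \<in> level_set F R T n y \<alpha>" using \<sigma> by auto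
      have "inverse (real (Suc k)) > 0" by simp
      from level_set_density[OF y k this] rate[OF k] show ?thesis by fastforce
    qed
    then obtain \<phi> where D: "\<And>k. L2_density T n (\<phi> k)"
      and E: "\<And>k. energy T n (\<phi> k) \<le> 2 * \<alpha> + inverse (real (Suc k))"
      and S: "\<And>k. skeleton y (\<phi> k) (\<sigma> k)" by metis
    have "inverse (real (Suc k)) \<le> 1" for k by (simp add: inverse_le_1_iff)
    then have B: "energy T n (\<phi> k) \<le> 2 * \<alpha> + 1" for k using E[of k] by (meson add_left_mono order_trans)
    obtain h \<rho> where \<rho>: "strict_mono (\<rho> :: nat \<Rightarrow> nat)"
      and h: "\<forall>e>0. \<exists>N. \<forall>k\<ge>N. \<forall>i\<in>{1..n}. \<forall>t\<in>{0..T}. \<bar>primitive (\<phi> (\<rho> k)) i t - h i t\<bar> < e"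
      using primitive_compactness[where \<phi> = \<phi> and B = "2 * \<alpha> + 1", OF T D B] by blast
    have lim: "(\<lambda>k. 2 * \<alpha> + inverse (real (Suc (\<rho> k)))) \<longlonglongrightarrow> 2 * \<alpha> + 0"
      using LIMSEQ_subseq_LIMSEQ[OF LIMSEQ_inverse_real_of_nat \<rho>]
      by (intro tendsto_add tendsto_const) (simp add: o_def)
    obtain \<psi> where \<psi>: "L2_density T n \<psi>" "energy T n \<psi> \<le> 2 * \<alpha>"
      "\<forall>i\<in>{1..n}. \<forall>t\<in>{0..T}. primitive \<psi> i t = h i t"
      using primitive_limit[where \<phi> = "\<lambda>k. \<phi> (\<rho> k)" and E = "\<lambda>k. 2 * \<alpha> + inverse (real (Suc (\<rho> k)))"
          and h = h and E\<^sub>0 = "2 * \<alpha>", OF D E] lim h by auto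
    obtain z where z: "z \<in> level_set F R T n y \<alpha>" "skeleton y \<psi> z"
      using density_level_set[OF y \<psi>(1,2)] by blast
    have "limitin C.mtopology (\<sigma> \<circ> \<rho>) z sequentially"
      unfolding C.limit_metric_sequentially
    proof (intro conjI allI impI)
      show "z \<in> mspace (C_Hn T n)" using z sub by auto
      fix e :: real assume e: "e > 0"
      define e' where "e' = e / (2 * (stab + 1))"
      have e': "e' > 0" using e stab_nonneg by (simp add: e'_def)
      have se: "stab * e' < e"
      proof -
        have "stab * e' \<le> (stab + 1) * e'" using e' by (intro mult_right_mono) auto
        also have "\<dots> = e / 2" using stab_nonneg by (simp add: e'_def field_simps)
        finally show ?thesis using e by linarith
      qed
      obtain N where N: "\<forall>k\<ge>N. \<forall>i\<in>{1..n}. \<forall>t\<in>{0..T}. \<bar>primitive (\<phi> (\<rho> k)) i t - h i t\<bar> < e'"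
        using h e' by blast
      show "\<exists>N. \<forall>k\<ge>N. (\<sigma> \<circ> \<rho>) k \<in> mspace (C_Hn T n) \<and> mdist (C_Hn T n) ((\<sigma> \<circ> \<rho>) k) z < e"
      proof (intro exI[of _ N] allI impI conjI)
        fix k assume k: "k \<ge> N"
        show "(\<sigma> \<circ> \<rho>) k \<in> mspace (C_Hn T n)" using \<sigma> sub by auto
        have "mdist (C_Hn T n) ((\<sigma> \<circ> \<rho>) k) z \<le> stab * e'"
        proof (rule mdist_C_Hn_le)
          show "0 \<le> stab * e'" using stab_nonneg e' by simp
          fix t assume t: "t \<in> {0..T}"
          have "norm (\<sigma> (\<rho> k) t - z t) \<le> stab * e'"
          proof (rule forced_stable[OF S z(2) _ _ t])
            fix i t assume "i \<in> {1..n}" "t \<in> {0..T}"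
            then show "\<bar>primitive (\<phi> (\<rho> k)) i t - primitive \<psi> i t\<bar> \<le> e'"
              using N k \<psi>(3) by (metis less_imp_le)
          qed (use e' in simp)
          then show "norm ((\<sigma> \<circ> \<rho>) k t - z t) \<le> stab * e'" by simp
        qed
        then show "mdist (C_Hn T n) ((\<sigma> \<circ> \<rho>) k) z < e" using se by linarith
      qed
    qed
    then show "\<exists>l r. l \<in> level_set F R T n y \<alpha> \<and> strict_mono r \<and> limitin C.mtopology (\<sigma> \<circ> r) l sequentially"
      using z(1) \<rho> by blast
  qed
qed

end

section \<open>Paths of the stochastic equation as forced solutions\<close>

lemma continuous_eq_on_rat_times:
  fixes f g :: "real \<Rightarrow> real"
  assumes T: "T > 0" and f: "continuous_on {0..T} f" and g: "continuous_on {0..T} g"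
    and eq: "\<And>t. t \<in> rat_times T \<Longrightarrow> f t = g t" and t: "t \<in> {0..T}"
  shows "f t = g t"
proof -
  have "f t - g t = 0"
  proof (rule continuous_constant_on_closure[of "rat_times T" "\<lambda>t. f t - g t" 0])
    show "continuous_on (closure (rat_times T)) (\<lambda>t. f t - g t)"
      unfolding closure_rat_times[OF T] by (intro continuous_intros f g)
    show "t \<in> closure (rat_times T)" unfolding closure_rat_times[OF T] by (rule t)
  qed (simp add: eq)
  then show ?thesis by simp
qed

locale galerkin_sde = wiener_setting M Fil \<beta> + galerkin F R r LF T n
  for M :: "'w measure" and Fil :: "real \<Rightarrow> 'w measure" and \<beta> :: "nat \<Rightarrow> real \<Rightarrow> 'w \<Rightarrow> real"
    and F R :: "L2 \<Rightarrow> L2" and r :: "nat \<Rightarrow> real" and LF T :: real and n :: nat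
begin

text \<open>The mild equation holds for each time outside a null set that depends on the time. The
  null sets of the rational times are united, and continuity of both sides extends the identity to
  [0,T]; this is possible because the right-hand side has been freed of the stochastic
  integral.\<close>

lemma mild_solution_forced:
  assumes y: "y \<in> H_n n" and X: "mild_solution M Fil \<beta> F R \<epsilon> n y X"
  shows "AE \<omega> in M. forced_solution F T n y (\<lambda>i t. r i * (\<epsilon> * \<beta> i t \<omega>)) (\<lambda>t. X t \<omega>)"
proof -
  have XH: "X t \<omega> \<in> H_n n" if "t \<ge> 0" "\<omega> \<in> space M" for t \<omega>
    using X that unfolding mild_solution_def by blast
  have Xc: "continuous_on {0..} (\<lambda>t. X t \<omega>)" if "\<omega> \<in> space M" for \<omega>
    using X that unfolding mild_solution_def by blast
  define V where "V = (\<lambda>\<omega> i t. exp (- lam i * t) * (coord i y + integral {0..t} (\<lambda>s. exp (lam i * s) * coord i (F (X s \<omega>))))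
      + (r i * (\<epsilon> * \<beta> i t \<omega>) - lam i * exp (- lam i * t) * integral {0..t} (\<lambda>s. exp (lam i * s) * (r i * (\<epsilon> * \<beta> i s \<omega>)))))"
  have "AE \<omega> in M. coord i (X t \<omega>) = V \<omega> i t" if i: "i \<in> {1..n}" and t: "t > 0" for i t
  proof -
    obtain J where J: "wiener_integral M n \<beta> t (\<lambda>s u. E_n n (t - s) (P_n n (R u))) J"
      "AE \<omega> in M. ((\<lambda>s. E_n n (t - s) (P_n n (F (X s \<omega>)))) has_integral (X t \<omega> - E_n n t y - \<epsilon> *\<^sub>R J \<omega>)) {0..t}"
      using X t unfolding mild_solution_def by (meson less_imp_le)
    show ?thesis
      using J(2) wiener_integral_coord[OF i t R[OF i] J(1)]
    proof eventually_elim
      case (elim \<omega>)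
      have "exp (- lam i * (t - s)) = exp (- lam i * t) * exp (lam i * s)" for s
        by (simp add: exp_add[symmetric] algebra_simps)
      then have c: "coord i (E_n n (t - s) (P_n n (F (X s \<omega>)))) = exp (- lam i * t) * (exp (lam i * s) * coord i (F (X s \<omega>)))" for s
        unfolding coord_E_n[OF P_n_in_H_n i] coord_P_n[OF i] by (simp only: mult.assoc)
      have "((\<lambda>s. exp (- lam i * t) * (exp (lam i * s) * coord i (F (X s \<omega>)))) has_integral
          coord i (X t \<omega> - E_n n t y - \<epsilon> *\<^sub>R J \<omega>)) {0..t}"
        using has_integral_coord[OF elim(1), of i] unfolding c .
      from integral_unique[OF this]
      have "exp (- lam i * t) * integral {0..t} (\<lambda>s. exp (lam i * s) * coord i (F (X s \<omega>))) =
          coord i (X t \<omega>) - exp (- lam i * t) * coord i y - \<epsilon> * coord i (J \<omega>)"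
        unfolding inner_diff_left inner_scaleR_left coord_E_n[OF y i] integral_mult_right .
      moreover have "integral {0..t} (\<lambda>s. exp (lam i * s) * (r i * (\<epsilon> * \<beta> i s \<omega>)))
          = r i * \<epsilon> * integral {0..t} (\<lambda>s. exp (lam i * s) * \<beta> i s \<omega>)"
      proof -
        have "exp (lam i * s) * (r i * (\<epsilon> * \<beta> i s \<omega>)) = r i * \<epsilon> * (exp (lam i * s) * \<beta> i s \<omega>)" for s
          by (simp only: mult_ac)
        then show ?thesis by (simp only: integral_mult_right)
      qed
      moreover have arith: "x = e * (y' + I1) + (rr * (ee * b) - l * e * (rr * ee * I2))"
        if "e * I1 = x - e * y' - ee * j" "j = rr * (b - l * e * I2)" for x e y' I1 rr ee b l I2 j :: real
        using that by (simp add: algebra_simps)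
      ultimately show ?case unfolding V_def using elim(2) by (simp only:)
    qed
  qed
  then have "AE \<omega> in M. \<forall>i\<in>{1..n}. \<forall>t\<in>rat_times T. coord i (X t \<omega>) = V \<omega> i t"
    by (intro AE_finite_allI AE_ball_countable'[OF _ countable_rat_times]) (auto simp: rat_times_def)
  moreover have "AE \<omega> in M. \<forall>i\<in>{1..n}. continuous_on {0..} (\<lambda>t. \<beta> i t \<omega>)"
  proof (rule AE_finite_allI)
    fix i assume "i \<in> {1..n}"
    then show "AE \<omega> in M. continuous_on {0..} (\<lambda>t. \<beta> i t \<omega>)" using brownian_\<beta>[of i] by (simp add: brownian_motion_def)
  qed simp
  ultimately show ?thesis using AE_space
  proof eventually_elim
    case (elim \<omega>)
    have cX: "continuous_on {0..T} (\<lambda>t. X t \<omega>)" using Xc[OF elim(3)] by (rule continuous_on_subset) auto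
    have cb: "continuous_on {0..T} (\<lambda>t. r i * (\<epsilon> * \<beta> i t \<omega>))" if "i \<in> {1..n}" for i
    proof -
      have "continuous_on {0..T} (\<lambda>t. \<beta> i t \<omega>)"
        using bspec[OF elim(2) that] by (rule continuous_on_subset) auto
      then show ?thesis by (intro continuous_intros)
    qed
    have cF: "continuous_on {0..T} (\<lambda>s. coord i (F (X s \<omega>)))" for i
      using continuous_on_compose2[OF lipschitz_on_continuous_on[OF F] cX] by (intro continuous_intros) auto
    have "coord i (X t \<omega>) = V \<omega> i t" if i: "i \<in> {1..n}" and t: "t \<in> {0..T}" for i t
    proof (rule continuous_eq_on_rat_times[OF T _ _ _ t])
      show "continuous_on {0..T} (\<lambda>t. coord i (X t \<omega>))" by (intro continuous_intros cX)
      show "continuous_on {0..T} (V \<omega> i)"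
        unfolding V_def
        by (intro continuous_on_add continuous_on_diff continuous_on_mult continuous_on_exp continuous_on_const
            continuous_on_id cb[OF i] indefinite_integral_continuous_1 integrable_continuous_real cF)
    qed (use elim(1) i in blast)
    moreover have "X t \<omega> \<in> H_n n" if "t \<in> {0..T}" for t using XH[of t \<omega>] elim(3) that by auto
    ultimately show ?case
      unfolding V_def by (subst forced_solution_iff_mild[OF F cb cX]) auto
  qed
qed

lemma mild_solution_path:
  assumes X: "mild_solution M Fil \<beta> F R \<epsilon> n y X" and \<omega>: "\<omega> \<in> space M"
  shows "path_on T X \<omega> \<in> mspace (C_H T)"
proof -
  have "continuous_on {0..} (\<lambda>t. X t \<omega>)" using X \<omega> unfolding mild_solution_def by blast
  then have "continuous_on {0..T} (\<lambda>t. X t \<omega>)" by (rule continuous_on_subset) auto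
  then have "continuous_on {0..T} (\<lambda>t\<in>{0..T}. X t \<omega>)" by (rule continuous_on_eq) simp
  then show ?thesis by (simp only: mspace_C_H path_on_def restrict_extensional simp_thms)
qed

text \<open>A lower bound for the probability of the tube requires its measurability, as the measure
  of any other set is 0. By continuity the uniform distance is a supremum over rational times, and
  the strict inequality is a countable union of non-strict ones.\<close>

lemma mild_solution_tube_measurable:
  assumes X: "mild_solution M Fil \<beta> F R \<epsilon> n y X" and z: "z \<in> mspace (C_H T)"
  shows "{\<omega>\<in>space M. mdist (C_H T) (path_on T X \<omega>) z < \<delta>} \<in> sets M"
proof -
  have le: "mdist (C_H T) (path_on T X \<omega>) z \<le> a \<longleftrightarrow> (\<forall>t\<in>rat_times T. norm (X t \<omega> - z t) \<le> a)"
    if \<omega>: "\<omega> \<in> space M" for \<omega> a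
  proof -
    have c: "continuous_on {0..T} (\<lambda>t. norm (path_on T X \<omega> t - z t))"
      using mild_solution_path[OF X \<omega>] z by (intro continuous_intros) (auto simp: mspace_C_H)
    have "(\<forall>t\<in>{0..T}. norm (path_on T X \<omega> t - z t) \<le> a) \<longleftrightarrow> (\<forall>t\<in>rat_times T. norm (path_on T X \<omega> t - z t) \<le> a)"
    proof
      assume A: "\<forall>t\<in>rat_times T. norm (path_on T X \<omega> t - z t) \<le> a"
      show "\<forall>t\<in>{0..T}. norm (path_on T X \<omega> t - z t) \<le> a"
        using continuous_le_on_closure[of "rat_times T" "\<lambda>t. norm (path_on T X \<omega> t - z t)" _ a] A c
        unfolding closure_rat_times[OF T] by blast
    qed (auto simp: rat_times_def)
    moreover have "path_on T X \<omega> t = X t \<omega>" if "t \<in> rat_times T" for t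
      using that by (simp add: path_on_def rat_times_def)
    ultimately show ?thesis
      unfolding mdist_C_H_le_iff[OF T mild_solution_path[OF X \<omega>] z] by simp
  qed
  have lt: "mdist (C_H T) (path_on T X \<omega>) z < \<delta> \<longleftrightarrow>
      (\<exists>k::nat. \<forall>t\<in>rat_times T. norm (X t \<omega> - z t) \<le> \<delta> - inverse (real (Suc k)))" if \<omega>: "\<omega> \<in> space M" for \<omega>
    unfolding le[OF \<omega>, symmetric]
  proof
    assume "mdist (C_H T) (path_on T X \<omega>) z < \<delta>"
    then obtain k :: nat where "inverse (real (Suc k)) < \<delta> - mdist (C_H T) (path_on T X \<omega>) z"
      using reals_Archimedean[of "\<delta> - mdist (C_H T) (path_on T X \<omega>) z"] by auto
    then show "\<exists>k::nat. mdist (C_H T) (path_on T X \<omega>) z \<le> \<delta> - inverse (real (Suc k))"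
      by (intro exI[of _ k]) linarith
  next
    assume "\<exists>k::nat. mdist (C_H T) (path_on T X \<omega>) z \<le> \<delta> - inverse (real (Suc k))"
    then obtain k :: nat where "mdist (C_H T) (path_on T X \<omega>) z \<le> \<delta> - inverse (real (Suc k))" by blast
    moreover have "inverse (real (Suc k)) > 0" by simp
    ultimately show "mdist (C_H T) (path_on T X \<omega>) z < \<delta>" by linarith
  qed
  have "{\<omega>\<in>space M. norm (X t \<omega> - z t) \<le> a} \<in> sets M" if t: "t \<in> rat_times T" for t a
  proof -
    have t0: "t \<ge> 0" using t by (simp add: rat_times_def)
    have "X t \<in> borel_measurable (Fil t)" using X t0 unfolding mild_solution_def by blast
    then have "X t \<in> borel_measurable M" by (rule measurable_from_subalg[OF subalgebra_Fil[OF t0]])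
    then have "(\<lambda>\<omega>. norm (X t \<omega> - z t)) \<in> borel_measurable M"
      by (rule measurable_compose) (intro borel_measurable_continuous_onI continuous_intros)
    then show ?thesis by measurable
  qed
  then have "{\<omega>\<in>space M. \<exists>k::nat. \<forall>t\<in>rat_times T. norm (X t \<omega> - z t) \<le> \<delta> - inverse (real (Suc k))} \<in> sets M"
    by (intro sets.sets_Collect_countable_Ex sets.sets_Collect_countable_All' countable_rat_times)
  moreover have "{\<omega>\<in>space M. \<exists>k::nat. \<forall>t\<in>rat_times T. norm (X t \<omega> - z t) \<le> \<delta> - inverse (real (Suc k))}
      = {\<omega>\<in>space M. mdist (C_H T) (path_on T X \<omega>) z < \<delta>}" using lt by blast
  ultimately show ?thesis by simp
qed

text \<open>Half of \<delta> turns the non-strict stability bound into a strict one;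
  \<open>stab + 1\<close> avoids division by zero.\<close>

lemma ex_tube_radius:
  assumes "\<delta> > 0"
  shows "\<exists>\<rho>>0. stab * \<rho> \<le> \<delta> / 2"
proof (intro exI[of _ "\<delta> / (2 * (stab + 1))"] conjI)
  show "0 < \<delta> / (2 * (stab + 1))" using assms stab_nonneg by simp
  have "stab * (\<delta> / (2 * (stab + 1))) \<le> (stab + 1) * (\<delta> / (2 * (stab + 1)))"
    using assms stab_nonneg by (intro mult_right_mono) auto
  also have "\<dots> = \<delta> / 2" using stab_nonneg by (simp add: field_simps)
  finally show "stab * (\<delta> / (2 * (stab + 1))) \<le> \<delta> / 2" .
qed

lemma path_close:
  assumes X: "forced_solution F T n y (\<lambda>i t. r i * (\<epsilon> * \<beta> i t \<omega>)) (\<lambda>t. X t \<omega>)" and z: "skeleton y \<phi> z"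
    and \<rho>: "\<rho> > 0" "stab * \<rho> \<le> \<delta> / 2" and \<delta>: "\<delta> > 0"
    and c: "\<forall>i\<in>{1..n}. \<forall>t\<in>{0..T}. \<bar>\<epsilon> * \<beta> i t \<omega> - primitive \<phi> i t\<bar> \<le> \<rho>"
  shows "mdist (C_H T) (path_on T X \<omega>) z < \<delta>"
proof -
  have "mdist (C_H T) (path_on T X \<omega>) z \<le> \<delta> / 2"
  proof (rule mdist_C_H_le)
    fix t assume t: "t \<in> {0..T}"
    have "norm (X t \<omega> - z t) \<le> stab * \<rho>"
      by (rule forced_stable[OF X z _ _ t]) (use c \<rho> in auto)
    then show "norm (path_on T X \<omega> t - z t) \<le> \<delta> / 2" using t \<rho>(2) by (simp add: path_on_def)
  qed (use \<delta> in simp)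
  then show ?thesis using \<delta> by linarith
qed

text \<open>\<open>schilder_lower\<close> covers all controls of energy at most 2 \<alpha> +
  \<gamma> at once. So the threshold for \<epsilon> is fixed before \<open>y\<close> and
  \<open>z\<close>, which then select a nearly optimal control.\<close>

theorem uniform_lower_bound:
  assumes \<alpha>: "\<alpha> \<ge> 0" and \<delta>: "\<delta> > 0" and \<gamma>: "\<gamma> > 0"
    and X: "\<And>\<epsilon> y. \<epsilon> > 0 \<Longrightarrow> y \<in> H_n n \<Longrightarrow> mild_solution M Fil \<beta> F R \<epsilon> n y (X \<epsilon> y)"
  shows "\<exists>\<epsilon>\<^sub>0>0. \<forall>y\<in>H_n n. \<forall>z\<in>level_set F R T n y \<alpha>. \<forall>\<epsilon>. 0 < \<epsilon> \<and> \<epsilon> \<le> \<epsilon>\<^sub>0 \<longrightarrow>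
    exp (- ((enn2real (rate_fun F R T n y z) + \<gamma>) / \<epsilon>\<^sup>2)) \<le>
      prob {\<omega>\<in>space M. mdist (C_H T) (path_on T (X \<epsilon> y) \<omega>) z < \<delta>}"
proof -
  obtain \<rho> where \<rho>: "\<rho> > 0" "stab * \<rho> \<le> \<delta> / 2" using ex_tube_radius[OF \<delta>] by blast
  \<comment> \<open>One half of \<gamma> pays for Schilder's bound, the other for the excess of the
    control, whose energy may exceed twice the rate by \<gamma>.\<close>
  have "\<gamma> / 2 > 0" "2 * \<alpha> + \<gamma> \<ge> 0" using \<gamma> \<alpha> by auto
  from schilder_lower[OF T \<rho>(1) this, of n] obtain \<epsilon>\<^sub>0 where \<epsilon>0: "\<epsilon>\<^sub>0 > 0"
    and S: "\<And>\<phi> \<epsilon>. L2_density T n \<phi> \<Longrightarrow> energy T n \<phi> \<le> 2 * \<alpha> + \<gamma> \<Longrightarrow> 0 < \<epsilon> \<and> \<epsilon> \<le> \<epsilon>\<^sub>0 \<Longrightarrow>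
      \<exists>A\<in>sets M. exp (- ((energy T n \<phi> / 2 + \<gamma> / 2) / \<epsilon>\<^sup>2)) \<le> prob A \<and>
      (AE \<omega> in M. \<omega> \<in> A \<longrightarrow> (\<forall>i\<in>{1..n}. \<forall>t\<in>{0..T}. \<bar>\<epsilon> * \<beta> i t \<omega> - primitive \<phi> i t\<bar> \<le> \<rho>))"
    by blast
  show ?thesis
  proof (intro exI[of _ \<epsilon>\<^sub>0] conjI \<epsilon>0 ballI allI impI)
    fix y z \<epsilon> assume y: "y \<in> H_n n" and z: "z \<in> level_set F R T n y \<alpha>" and \<epsilon>: "0 < \<epsilon> \<and> \<epsilon> \<le> \<epsilon>\<^sub>0"
    define I where "I = enn2real (rate_fun F R T n y z)"
    have I: "I \<le> \<alpha>" using z \<alpha> by (auto simp: I_def level_set_def intro: enn2real_leI)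
    obtain \<phi> where D: "L2_density T n \<phi>" and E: "energy T n \<phi> \<le> 2 * I + \<gamma>" and sk: "skeleton y \<phi> z"
      using level_set_density[OF y z \<gamma>] unfolding I_def by blast
    obtain A where A: "A \<in> sets M" "exp (- ((energy T n \<phi> / 2 + \<gamma> / 2) / \<epsilon>\<^sup>2)) \<le> prob A"
      "AE \<omega> in M. \<omega> \<in> A \<longrightarrow> (\<forall>i\<in>{1..n}. \<forall>t\<in>{0..T}. \<bar>\<epsilon> * \<beta> i t \<omega> - primitive \<phi> i t\<bar> \<le> \<rho>)"
      using S[OF D _ \<epsilon>] E I by force
    have Xm: "mild_solution M Fil \<beta> F R \<epsilon> n y (X \<epsilon> y)" using X y \<epsilon> by blast
    have "energy T n \<phi> / 2 + \<gamma> / 2 \<le> I + \<gamma>" using E by simp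
    then have "(energy T n \<phi> / 2 + \<gamma> / 2) / \<epsilon>\<^sup>2 \<le> (I + \<gamma>) / \<epsilon>\<^sup>2" by (intro divide_right_mono) auto
    then have "exp (- ((I + \<gamma>) / \<epsilon>\<^sup>2)) \<le> exp (- ((energy T n \<phi> / 2 + \<gamma> / 2) / \<epsilon>\<^sup>2))" by simp
    also have "\<dots> \<le> prob A" by (rule A(2))
    also have "\<dots> \<le> prob {\<omega>\<in>space M. mdist (C_H T) (path_on T (X \<epsilon> y) \<omega>) z < \<delta>}"
    proof (rule finite_measure_mono_AE)
      have "z \<in> mspace (C_H T)" using z C_Hn_subset_C_H by (auto simp: level_set_def)
      then show "{\<omega>\<in>space M. mdist (C_H T) (path_on T (X \<epsilon> y) \<omega>) z < \<delta>} \<in> sets M"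
        by (rule mild_solution_tube_measurable[OF Xm])
      show "AE \<omega> in M. \<omega> \<in> A \<longrightarrow> \<omega> \<in> {\<omega>\<in>space M. mdist (C_H T) (path_on T (X \<epsilon> y) \<omega>) z < \<delta>}"
        using A(3) mild_solution_forced[OF y Xm] AE_space
      proof eventually_elim
        case (elim \<omega>)
        show ?case
        proof
          assume "\<omega> \<in> A"
          then have "\<forall>i\<in>{1..n}. \<forall>t\<in>{0..T}. \<bar>\<epsilon> * \<beta> i t \<omega> - primitive \<phi> i t\<bar> \<le> \<rho>" using elim(1) by blast
          from path_close[where X = "X \<epsilon> y" and \<omega> = \<omega>, OF elim(2) sk \<rho> \<delta> this] elim(3)
          show "\<omega> \<in> {\<omega>\<in>space M. mdist (C_H T) (path_on T (X \<epsilon> y) \<omega>) z < \<delta>}" by blast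
        qed
      qed
    qed
    finally show "exp (- ((enn2real (rate_fun F R T n y z) + \<gamma>) / \<epsilon>\<^sup>2)) \<le>
      prob {\<omega>\<in>space M. mdist (C_H T) (path_on T (X \<epsilon> y) \<omega>) z < \<delta>}" unfolding I_def .
  qed
qed

text \<open>Outside the exceptional event of \<open>schilder_upper\<close> the driving path is close
  to the primitive of a control of energy at most 2 \<alpha>. For any initial value \<open>y\<close>
  this control drives a path of the level set, and stability keeps the solution within \<delta> of
  it.\<close>

theorem uniform_upper_bound:
  assumes \<alpha>: "\<alpha> \<ge> 0" and \<delta>: "\<delta> > 0" and \<gamma>: "\<gamma> > 0"
    and X: "\<And>\<epsilon> y. \<epsilon> > 0 \<Longrightarrow> y \<in> H_n n \<Longrightarrow> mild_solution M Fil \<beta> F R \<epsilon> n y (X \<epsilon> y)"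
  shows "\<exists>\<epsilon>\<^sub>0>0. \<forall>y\<in>H_n n. \<forall>\<epsilon>. 0 < \<epsilon> \<and> \<epsilon> \<le> \<epsilon>\<^sub>0 \<longrightarrow>
    prob {\<omega>\<in>space M. dist_C_set T (path_on T (X \<epsilon> y) \<omega>) (level_set F R T n y \<alpha>) \<ge> \<delta>} \<le> exp (- ((\<alpha> - \<gamma>) / \<epsilon>\<^sup>2))"
proof -
  obtain \<rho> where \<rho>: "\<rho> > 0" "stab * \<rho> \<le> \<delta> / 2" using ex_tube_radius[OF \<delta>] by blast
  from schilder_upper[OF T \<rho>(1) \<gamma> \<alpha>, of n] obtain \<epsilon>\<^sub>0 where \<epsilon>0: "\<epsilon>\<^sub>0 > 0"
    and S: "\<And>\<epsilon>. 0 < \<epsilon> \<and> \<epsilon> \<le> \<epsilon>\<^sub>0 \<Longrightarrow> \<exists>A\<in>sets M. prob A \<le> exp (- ((\<alpha> - \<gamma>) / \<epsilon>\<^sup>2)) \<and>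
      (AE \<omega> in M. \<omega> \<notin> A \<longrightarrow> (\<exists>\<phi>. L2_density T n \<phi> \<and> energy T n \<phi> \<le> 2 * \<alpha> \<and>
        (\<forall>i\<in>{1..n}. \<forall>t\<in>{0..T}. \<bar>\<epsilon> * \<beta> i t \<omega> - primitive \<phi> i t\<bar> \<le> \<rho>)))"
    by blast
  show ?thesis
  proof (intro exI[of _ \<epsilon>\<^sub>0] conjI \<epsilon>0 ballI allI impI)
    fix y \<epsilon> assume y: "y \<in> H_n n" and \<epsilon>: "0 < \<epsilon> \<and> \<epsilon> \<le> \<epsilon>\<^sub>0"
    obtain A where A: "A \<in> sets M" "prob A \<le> exp (- ((\<alpha> - \<gamma>) / \<epsilon>\<^sup>2))"
      "AE \<omega> in M. \<omega> \<notin> A \<longrightarrow> (\<exists>\<phi>. L2_density T n \<phi> \<and> energy T n \<phi> \<le> 2 * \<alpha> \<and>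
        (\<forall>i\<in>{1..n}. \<forall>t\<in>{0..T}. \<bar>\<epsilon> * \<beta> i t \<omega> - primitive \<phi> i t\<bar> \<le> \<rho>))"
      using S[OF \<epsilon>] by blast
    have Xm: "mild_solution M Fil \<beta> F R \<epsilon> n y (X \<epsilon> y)" using X y \<epsilon> by blast
    have "prob {\<omega>\<in>space M. dist_C_set T (path_on T (X \<epsilon> y) \<omega>) (level_set F R T n y \<alpha>) \<ge> \<delta>} \<le> prob A"
    proof (rule finite_measure_mono_AE[OF _ A(1)])
      show "AE \<omega> in M. \<omega> \<in> {\<omega>\<in>space M. dist_C_set T (path_on T (X \<epsilon> y) \<omega>) (level_set F R T n y \<alpha>) \<ge> \<delta>} \<longrightarrow> \<omega> \<in> A"
        using A(3) mild_solution_forced[OF y Xm]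
      proof eventually_elim
        case (elim \<omega>)
        show ?case
        proof (rule impI, rule ccontr)
          assume \<omega>: "\<omega> \<in> {\<omega>\<in>space M. dist_C_set T (path_on T (X \<epsilon> y) \<omega>) (level_set F R T n y \<alpha>) \<ge> \<delta>}" "\<omega> \<notin> A"
          then obtain \<phi> where D: "L2_density T n \<phi>" "energy T n \<phi> \<le> 2 * \<alpha>"
            and c: "\<forall>i\<in>{1..n}. \<forall>t\<in>{0..T}. \<bar>\<epsilon> * \<beta> i t \<omega> - primitive \<phi> i t\<bar> \<le> \<rho>" using elim(1) by blast
          obtain z where z: "z \<in> level_set F R T n y \<alpha>" "skeleton y \<phi> z"
            using density_level_set[OF y D] by blast
          have "dist_C_set T (path_on T (X \<epsilon> y) \<omega>) (level_set F R T n y \<alpha>) \<le> mdist (C_H T) (path_on T (X \<epsilon> y) \<omega>) z"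
            unfolding dist_C_set_def using z(1) by (intro cINF_lower bdd_belowI2[of _ 0]) auto
          also have "\<dots> < \<delta>" by (rule path_close[where X = "X \<epsilon> y" and \<omega> = \<omega>, OF elim(2) z(2) \<rho> \<delta> c])
          finally show False using \<omega>(1) by simp
        qed
      qed
    qed
    then show "prob {\<omega>\<in>space M. dist_C_set T (path_on T (X \<epsilon> y) \<omega>) (level_set F R T n y \<alpha>) \<ge> \<delta>} \<le> exp (- ((\<alpha> - \<gamma>) / \<epsilon>\<^sup>2))"
      using A(2) by linarith
  qed
qed

end

theorem theorem3p1:
  fixes M :: "'w measure" and Fil :: "real \<Rightarrow> 'w measure"
    and \<beta> :: "nat \<Rightarrow> real \<Rightarrow> 'w \<Rightarrow> real"
    and Q Q_half :: "L2 \<Rightarrow> L2" and q :: "nat \<Rightarrow> real"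
    and F :: "L2 \<Rightarrow> L2" and F' :: "L2 \<Rightarrow> L2 \<Rightarrow> L2" and L\<^sub>F L :: real
    and X :: "real \<Rightarrow> nat \<Rightarrow> L2 \<Rightarrow> real \<Rightarrow> 'w \<Rightarrow> L2"
  assumes "prob_space M" and "usual_filtration M Fil" and "cylindrical_wiener M Fil \<beta>"
    and "bounded_linear Q" and "self_adjoint Q" and "\<And>u. u \<noteq> 0 \<Longrightarrow> inner (Q u) u > 0"
    and "\<And>i. i \<ge> 1 \<Longrightarrow> q i > 0" and "\<And>i. i \<ge> 1 \<Longrightarrow> Q (sin_basis i) = q i *\<^sub>R sin_basis i"
    and sqrt_Q: "is_sqrt_op Q_half Q"
    and "dom_A \<subseteq> range Q_half"
    and "\<And>u. Q_half u \<in> dotH 1" and "hilbert_schmidt (\<lambda>u. neg_A_pow (1/2) (Q_half u))"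
    and "bounded_linear (\<lambda>u. inv Q_half (neg_A_inv u))"
    and "\<And>u. (F has_derivative F' u) (at u)"
    and "L\<^sub>F > 0" and "L > 0"
    and "\<And>u v. norm (F u - F v) \<le> L\<^sub>F * norm (u - v)"
    and "\<And>u. u \<in> dotH 1 \<Longrightarrow> F u \<in> dotH 1 \<and> dotH_norm 1 (F u) \<le> L * (1 + dotH_norm 1 u)"
    and "\<And>u v. u \<in> dotH 2 \<Longrightarrow> v \<in> dotH 2 \<Longrightarrow>
           F' u v \<in> dotH 2 \<and> dotH_norm 2 (F' u v) \<le> L * (1 + (dotH_norm 2 u)\<^sup>2) * dotH_norm 2 v"
    and "\<And>\<epsilon> n y. \<epsilon> > 0 \<Longrightarrow> n \<ge> 1 \<Longrightarrow> y \<in> H_n n \<Longrightarrow>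
           mild_solution M Fil \<beta> F Q_half \<epsilon> n y (X \<epsilon> n y)"
  shows
    "(\<forall>T>0. \<forall>n\<ge>1. \<forall>y\<in>H_n n. \<forall>\<alpha>\<ge>0.
        compactin (mtopology_of (C_Hn T n)) (level_set F Q_half T n y \<alpha>)) \<and>
     (\<forall>T>0. \<forall>n\<ge>1. \<forall>\<alpha>\<ge>0. \<forall>\<delta>>0. \<forall>\<gamma>>0. \<forall>K>0. \<exists>\<epsilon>\<^sub>0>0.
        \<forall>y\<in>H_n n. norm y \<le> K \<longrightarrow> (\<forall>z\<in>level_set F Q_half T n y \<alpha>. \<forall>\<epsilon>. 0 < \<epsilon> \<and> \<epsilon> \<le> \<epsilon>\<^sub>0 \<longrightarrow>
          measure M {\<omega> \<in> space M. mdist (C_H T) (path_on T (X \<epsilon> n y) \<omega>) z < \<delta>}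
            \<ge> exp (- ((enn2real (rate_fun F Q_half T n y z) + \<gamma>) / \<epsilon>\<^sup>2)))) \<and>
     (\<forall>T>0. \<forall>n\<ge>1. \<forall>\<alpha>\<ge>0. \<forall>\<delta>>0. \<forall>\<gamma>>0. \<forall>K>0. \<exists>\<epsilon>\<^sub>0>0.
        \<forall>y\<in>H_n n. norm y \<le> K \<longrightarrow> (\<forall>\<epsilon>. 0 < \<epsilon> \<and> \<epsilon> \<le> \<epsilon>\<^sub>0 \<longrightarrow>
          measure M {\<omega> \<in> space M.
              dist_C_set T (path_on T (X \<epsilon> n y) \<omega>) (level_set F Q_half T n y \<alpha>) \<ge> \<delta>}
            \<le> exp (- ((\<alpha> - \<gamma>) / \<epsilon>\<^sup>2))))"
proof -
  interpret wiener_setting M Fil \<beta>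
    by (intro wiener_setting.intro wiener_setting_axioms.intro assms(1-3))
  have F: "L\<^sub>F-lipschitz_on UNIV F"
    using assms(15,17) by (intro lipschitz_onI) (auto simp: dist_norm)
  \<comment> \<open>The defining properties of the square root force the eigenvalue
    \<open>sqrt (q i)\<close> on the sine basis.\<close>
  have R: "coord i (Q_half u) = sqrt (q i) * coord i u" if "i \<ge> 1" for i u
    using assms(7,8) that by (intro coord_sqrt_op[OF sqrt_Q]) auto
  have gal: "galerkin F Q_half (\<lambda>i. sqrt (q i)) L\<^sub>F T n" if "T > 0" for T n
    using F that by (intro galerkin.intro R) (auto intro: less_imp_le[OF assms(7)])
  have sde: "galerkin_sde M Fil \<beta> F Q_half (\<lambda>i. sqrt (q i)) L\<^sub>F T n" if "T > 0" for T n
    by (intro galerkin_sde.intro gal[OF that]) unfold_locales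
  show ?thesis
  proof (intro conjI allI impI ballI)
    fix T \<alpha> :: real and n :: nat and y assume "0 < T" "1 \<le> n" "y \<in> H_n n" "0 \<le> \<alpha>"
    then show "compactin (mtopology_of (C_Hn T n)) (level_set F Q_half T n y \<alpha>)"
      by (intro galerkin.compactin_level_set[OF gal])
  next
    fix T :: real and n :: nat and \<alpha> \<delta> \<gamma> K :: real
    assume T: "0 < T" and n: "1 \<le> n" and par: "0 \<le> \<alpha>" "0 < \<delta>" "0 < \<gamma>"
    show "\<exists>\<epsilon>\<^sub>0>0. \<forall>y\<in>H_n n. norm y \<le> K \<longrightarrow> (\<forall>z\<in>level_set F Q_half T n y \<alpha>. \<forall>\<epsilon>. 0 < \<epsilon> \<and> \<epsilon> \<le> \<epsilon>\<^sub>0 \<longrightarrow>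
        exp (- ((enn2real (rate_fun F Q_half T n y z) + \<gamma>) / \<epsilon>\<^sup>2))
          \<le> measure M {\<omega> \<in> space M. mdist (C_H T) (path_on T (X \<epsilon> n y) \<omega>) z < \<delta>})"
      using galerkin_sde.uniform_lower_bound[OF sde[OF T] par, of n "\<lambda>\<epsilon> y. X \<epsilon> n y"] assms(20) n by blast
  next
    fix T :: real and n :: nat and \<alpha> \<delta> \<gamma> K :: real
    assume T: "0 < T" and n: "1 \<le> n" and par: "0 \<le> \<alpha>" "0 < \<delta>" "0 < \<gamma>"
    show "\<exists>\<epsilon>\<^sub>0>0. \<forall>y\<in>H_n n. norm y \<le> K \<longrightarrow> (\<forall>\<epsilon>. 0 < \<epsilon> \<and> \<epsilon> \<le> \<epsilon>\<^sub>0 \<longrightarrow>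
        measure M {\<omega> \<in> space M. \<delta> \<le> dist_C_set T (path_on T (X \<epsilon> n y) \<omega>) (level_set F Q_half T n y \<alpha>)}
          \<le> exp (- ((\<alpha> - \<gamma>) / \<epsilon>\<^sup>2)))"
      using galerkin_sde.uniform_upper_bound[OF sde[OF T] par, of n "\<lambda>\<epsilon> y. X \<epsilon> n y"] assms(20) n by blast
  qed
qed

end
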